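(* Let $(\xi_j)$ be a homogeneous Markov chain with Markov operator $R$ acting on a Banach space $(B,\|\cdot\|)$ as in the context, let $f\in B$ be real valued, and let $S_n=\sum_{j=1}^n(f(\xi_j)-\mathbb E[f(\xi_j)])$. Let $\sigma^2=\lim_{n\to\infty}\frac1n\mathrm{Var}(S_n)$, assume $\sigma>0$, and put $\sigma_n=\|S_n\|_{L^2}$. Let $A_n=O(1)$ and let $B_n>0$ satisfy either $B_n=\sigma\sqrt n+O(1)$ or $B_n=\sigma_n+O(1)$. Put $F_n(x)=\mathbb P((S_n-A_n)/B_n\le x)$. Then for every $p\ge1$ there is a constant $C_p$ such that for all $n$ $$W_p(dF_n,d\Phi)\le C_pB_n^{-1}.$$ Moreover, if $(B_n)$ is monotone increasing, $B_0=0$, and $(Z_j)$ are independent centered normal random variables with $\mathrm{Var}(Z_j)=B_j^2-B_{j-1}^2$, then for all $m$ there is a constant $C$ such that for every $n$ there is a coupling of $(S_1,S_2-S_1,\dots,S_n-S_{n-1})$ with $(Z_1,\dots,Z_n)$ so that $\|S_n-\sum_{j=1}^nZ_j\|_{L^{m-1}}\le C$.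
   Context: $(\xi_j)$ is a homogeneous (not necessarily stationary) Markov chain with values in a measurable space $\mathcal X$, and $Rg(x)=\mathbb E[g(\xi_1)\mid\xi_0=x]$ is its Markov operator. It is assumed that $R$ acts continuously on a Banach space $(B,\|\cdot\|)$ of functions on $\mathcal X$ with $\|g\|\ge\sup|g|$, that for every $f\in B$ and $z\in\mathbb C$ we have $e^{zf}\in B$ and the map $z\mapsto e^{zf}$ is analytic, that $R$ is quasi-compact, and that the constant function $\mathbf 1$ is the unique eigenfunction (up to scaling) with eigenvalue of modulus $1$; namely, there are a unique stationary measure $\mu$ and constants $\delta\in(0,1)$, $C>0$ with $\|R^ng-\mu(g)\|\le C\|g\|\delta^n$ for every $g\in B$ and $n$. $\Phi$ is the standard normal distribution function and $W_p(\mu,\nu)=\inf\|X-Y\|_{L^p}$ is the $p$-Wasserstein distance, infimum over couplings of $X\sim\mu$, $Y\sim\nu$. A coupling is a realization on a common probability space preserving individual laws. *)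

theory Defs
  imports "HOL-Probability.Probability" "HOL-Library.Landau_Symbols"
begin

section \<open>Complex Banach spaces of functions\<close>

text \<open>The library only has real Banach spaces (class \<^class>\<open>banach\<close>); a complex Banach space is
  a real one together with a compatible scalar multiplication by complex numbers.\<close>

class complex_banach = banach +
  fixes scaleC :: "complex \<Rightarrow> 'a \<Rightarrow> 'a" (infixr "*\<^sub>C" 75)
  assumes scaleC_add_right: "c *\<^sub>C (x + y) = c *\<^sub>C x + c *\<^sub>C y"
    and scaleC_add_left: "(c + d) *\<^sub>C x = c *\<^sub>C x + d *\<^sub>C x"
    and scaleC_scaleC: "c *\<^sub>C d *\<^sub>C x = (c * d) *\<^sub>C x"
    and scaleC_of_real: "complex_of_real r *\<^sub>C x = r *\<^sub>R x"
    and norm_scaleC: "norm (c *\<^sub>C x) = cmod c * norm x"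

text \<open>Analyticity on the whole plane of a Banach-space valued map: around every point it is the sum
  of a norm-convergent power series.\<close>

definition analytic_map :: "(complex \<Rightarrow> 'b::complex_banach) \<Rightarrow> bool" where
  "analytic_map E \<longleftrightarrow> (\<forall>z0. \<exists>r>0. \<exists>a :: nat \<Rightarrow> 'b. \<forall>z. dist z z0 < r \<longrightarrow>
     (\<lambda>k. (z - z0) ^ k *\<^sub>C a k) sums E z)"

definition compact_operator :: "('b::complex_banach \<Rightarrow> 'b) \<Rightarrow> bool" where
  "compact_operator Q \<longleftrightarrow> bounded_linear Q \<and> (\<forall>c g. Q (c *\<^sub>C g) = c *\<^sub>C Q g) \<and>
     compact (closure (Q ` cball 0 1))"

text \<open>Quasi-compactness in the sense of Yosida and Kakutani. The threshold \<open>1\<close> is the right one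
  for operators of spectral radius \<open>1\<close>, such as the Markov operators below.\<close>

definition quasi_compact :: "('b::complex_banach \<Rightarrow> 'b) \<Rightarrow> bool" where
  "quasi_compact R \<longleftrightarrow> (\<exists>n\<ge>1. \<exists>Q. compact_operator Q \<and> onorm (\<lambda>g. (R ^^ n) g - Q g) < 1)"

text \<open>A Banach space of functions on the measurable space \<open>M\<close> is a type \<open>'b\<close> in
  \<^class>\<open>complex_banach\<close> together with an evaluation map \<open>ev\<close> that embeds it linearly and
  injectively into the complex functions on \<open>space M\<close>; the set of functions is the range of \<open>ev\<close>.
  Values of \<open>ev g\<close> outside \<open>space M\<close> are irrelevant.\<close>

locale banach_function_space =
  fixes M :: "'a measure" and ev :: "'b::complex_banach \<Rightarrow> 'a \<Rightarrow> complex"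
  assumes ev_add: "x \<in> space M \<Longrightarrow> ev (g + h) x = ev g x + ev h x"
    and ev_scaleC: "x \<in> space M \<Longrightarrow> ev (c *\<^sub>C g) x = c * ev g x"
    and ev_inject: "(\<And>x. x \<in> space M \<Longrightarrow> ev g x = ev h x) \<Longrightarrow> g = h"
    and ev_measurable: "ev g \<in> borel_measurable M"
    and norm_ge: "x \<in> space M \<Longrightarrow> cmod (ev g x) \<le> norm g"
begin

definition member :: "('a \<Rightarrow> complex) \<Rightarrow> bool" where
  "member h \<longleftrightarrow> (\<exists>g. \<forall>x\<in>space M. ev g x = h x)"

definition elem :: "('a \<Rightarrow> complex) \<Rightarrow> 'b" where
  "elem h = (THE g. \<forall>x\<in>space M. ev g x = h x)"

end


section \<open>Markov chains and Markov operators\<close>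

definition stationary :: "'a measure \<Rightarrow> ('a \<Rightarrow> 'a measure) \<Rightarrow> 'a measure \<Rightarrow> bool" where
  "stationary M K \<mu> \<longleftrightarrow> \<mu> \<in> space (prob_algebra M) \<and> \<mu> \<bind> K = \<mu>"

text \<open>Here \<open>K\<close> is the transition kernel and \<open>R\<close> the operator
  \<open>R g(x) = E[g(\<xi>\<^sub>1) | \<xi>\<^sub>0 = x]\<close>, the integral of \<open>g\<close> against \<open>K x\<close>.
  The assumption \<open>spectral_gap\<close> makes \<open>quasi_compact\<close> and \<open>unimodular_eigenvector\<close> precise.\<close>

locale markov_operator = banach_function_space M ev
  for M :: "'a measure" and ev :: "'b::complex_banach \<Rightarrow> 'a \<Rightarrow> complex" +
  fixes K :: "'a \<Rightarrow> 'a measure" and R :: "'b \<Rightarrow> 'b"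
  assumes kernel: "K \<in> M \<rightarrow>\<^sub>M prob_algebra M"
    and exp_member: "member (\<lambda>x. exp (z * ev g x))"
    and exp_analytic: "analytic_map (\<lambda>z. elem (\<lambda>x. exp (z * ev g x)))"
    and ev_R: "x \<in> space M \<Longrightarrow> ev (R g) x = (LINT y|K x. ev g y)"
    and R_bounded: "bounded_linear R"
    and quasi_compact: "quasi_compact R"
    and unimodular_eigenvector:
      "R g = l *\<^sub>C g \<Longrightarrow> cmod l = 1 \<Longrightarrow> \<exists>c. \<forall>x\<in>space M. ev g x = c"
    and spectral_gap: "\<exists>\<mu>. stationary M K \<mu> \<and> (\<forall>\<nu>. stationary M K \<nu> \<longrightarrow> \<nu> = \<mu>) \<and>
      (\<exists>\<delta> C. 0 < \<delta> \<and> \<delta> < 1 \<and> 0 < C \<and>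
        (\<forall>g n. norm ((R ^^ n) g - elem (\<lambda>_. LINT y|\<mu>. ev g y)) \<le> C * norm g * \<delta> ^ n))"

text \<open>The Markov property is stated with respect to the filtration generated by the chain;
  the initial law is arbitrary.\<close>

definition markov_chain ::
  "'w measure \<Rightarrow> 'a measure \<Rightarrow> ('a \<Rightarrow> 'a measure) \<Rightarrow> (nat \<Rightarrow> 'w \<Rightarrow> 'a) \<Rightarrow> bool" where
  "markov_chain P M K \<xi> \<longleftrightarrow> prob_space P \<and> (\<forall>n. \<xi> n \<in> P \<rightarrow>\<^sub>M M) \<and>
     (\<forall>n. \<forall>A\<in>sets M. AE \<omega> in P.
        real_cond_exp P
          (vimage_algebra (space P) (\<lambda>\<omega>. \<lambda>i\<in>{..n}. \<xi> i \<omega>) (\<Pi>\<^sub>M i\<in>{..n}. M))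
          (\<lambda>\<omega>. indicator A (\<xi> (Suc n) \<omega>)) \<omega>
        = measure (K (\<xi> n \<omega>)) A)"

definition centered_sum ::
  "'w measure \<Rightarrow> (nat \<Rightarrow> 'w \<Rightarrow> 'a) \<Rightarrow> ('a \<Rightarrow> real) \<Rightarrow> nat \<Rightarrow> 'w \<Rightarrow> real" where
  "centered_sum P \<xi> f n \<omega> = (\<Sum>j=1..n. f (\<xi> j \<omega>) - (LINT \<omega>'|P. f (\<xi> j \<omega>')))"


section \<open>Couplings and the Wasserstein distance\<close>

text \<open>A coupling of two laws is represented by the joint law it induces on the product space.\<close>

definition couplings :: "'a measure \<Rightarrow> 'b measure \<Rightarrow> ('a \<times> 'b) measure set" where
  "couplings \<mu> \<nu> = {\<gamma>. prob_space \<gamma> \<and> sets \<gamma> = sets (\<mu> \<Otimes>\<^sub>M \<nu>) \<and>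
     distr \<gamma> \<mu> fst = \<mu> \<and> distr \<gamma> \<nu> snd = \<nu>}"

definition Lp_norm :: "real \<Rightarrow> 'a measure \<Rightarrow> ('a \<Rightarrow> real) \<Rightarrow> ennreal" where
  "Lp_norm p N h = (let I = (\<integral>\<^sup>+ x. ennreal (\<bar>h x\<bar> powr p) \<partial>N)
     in if I = \<infinity> then \<infinity> else ennreal (enn2real I powr (1 / p)))"

definition wasserstein :: "real \<Rightarrow> real measure \<Rightarrow> real measure \<Rightarrow> ennreal" where
  "wasserstein p \<mu> \<nu> = (INF \<gamma>\<in>couplings \<mu> \<nu>. Lp_norm p \<gamma> (\<lambda>(x, y). x - y))"

text \<open>\<open>normal_density 0 0\<close> is the zero function, so the degenerate case is treated separately.\<close>

definition centered_normal :: "real \<Rightarrow> real measure" where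
  "centered_normal v =
     (if v = 0 then return borel 0 else density lborel (normal_density 0 (sqrt v)))"

end

theory Submission
  imports Defs "HOL-Complex_Analysis.Complex_Analysis" "HOL-Real_Asymp.Real_Asymp"
begin

text \<open>
  Since \<open>B\<close> is closed under \<open>g \<mapsto> exp (z * g)\<close>, it is an algebra, and by the closed graph theorem
  multiplication operators on it are bounded. A cone argument for the perturbed operators
  \<open>g \<mapsto> R (exp (z * f) * g)\<close> shows that the logarithm of the moment generating function of \<open>S n\<close>
  is defined, holomorphic and of size \<open>O(n)\<close> on a disk independent of \<open>n\<close>, and that the variance of
  \<open>S n\<close> is \<open>n \<sigma>\<^sup>2 + O(1)\<close>. Exponential tilting and Esseen's smoothing inequality then give
  tail asymptotics that are uniform up to deviations of order \<open>n\<close>. In terms of quantiles, the monotone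
  rearrangement \<open>Y\<close> of \<open>S n\<close> to a standard normal variable satisfies
  \<open>\<bar>S n - sqrt (Var (S n)) * Y\<bar> \<le> C (1 + (S n)\<^sup>2 / n + Y\<^sup>2)\<close>, and the right hand side has bounded
  moments of every order. Normalising by \<open>B n\<close> gives the Wasserstein bound.
  For the second claim, \<open>B n * Y\<close> is decomposed into independent normal variables with the prescribed
  variances by rotating \<open>Y\<close> successively against auxiliary independent normal variables.
\<close>


section \<open>Multiplication operators\<close>

text \<open>A Wasserstein bound for every \<open>p\<close> needs control relative to the normal
  tail: an additive Berry-Esseen error of order \<open>1/sqrt n\<close> is worthless once the tail
  is smaller than that. Tilting by \<open>u\<close> puts the point in question at the mean of the
  tilted law; there the additive error competes with a Laplace integral of order
  \<open>1/(1 + u sqrt n)\<close> (Mills ratio) and so becomes the relative error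
  \<open>exp (O(1/sqrt n + u + n u^3))\<close>. As the hazard rate of the normal law grows linearly,
  this factor amounts to a shift of the argument, and with \<open>u\<close> of order
  \<open>x/n\<close> the shift is \<open>O(1 + x^2/n)\<close> on the scale of \<open>x\<close>.

  The chain may start from any law, so the expectation at time 0 is not invariant under
  \<open>R\<close>. Ratios of consecutive generating functions replace eigenvalues and spectral
  projections: they converge geometrically, uniformly near 0, and stay near 1, so their principal
  logarithms can be summed.

  A coupling is only a joint law, so auxiliary independent normal variables are free. They remove
  atoms of \<open>S n\<close>, make small \<open>n\<close> harmless, and supply the randomness for
  splitting one normal variable into many.\<close>

theorem closed_graph_bounded_linear:
  fixes T :: "'a::banach \<Rightarrow> 'b::banach"
  assumes lin: "linear T"
    and closed: "\<And>X x y. X \<longlonglongrightarrow> x \<Longrightarrow> (\<lambda>n. T (X n)) \<longlonglongrightarrow> y \<Longrightarrow> T x = y"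
  shows "bounded_linear T"
proof -
  \<comment> \<open>By Baire's theorem the closure of one of these sublevel sets contains a ball;
    \<open>T\<close> is then bounded by \<open>k\<close> on a dense part of that ball.\<close>
  define A where "A = (\<lambda>k::nat. {x. norm (T x) \<le> real k})"
  have cover: "(\<Union>k. closure (A k)) = UNIV"
  proof -
    have "x \<in> A (nat \<lceil>norm (T x)\<rceil>)" for x
      unfolding A_def by (simp add: real_nat_ceiling_ge)
    then have "x \<in> (\<Union>k. closure (A k))" for x
      using closure_subset by blast
    then show ?thesis by blast
  qed
  have "\<exists>k. interior (closure (A k)) \<noteq> {}"
  proof (rule ccontr)
    assume "\<not> ?thesis"
    then have "Met_TC.mtopology interior_of (\<Union>(range (\<lambda>k. closure (A k)))) = ({}::'a set)"
      by (intro Met_TC.metric_Baire_category_alt) (auto simp: Met_TC.mcomplete_def Cauchy_convergent_iff convergent_def)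
    then show False using cover by simp
  qed
  then obtain k x0 \<rho> where \<rho>: "\<rho> > 0" "cball x0 \<rho> \<subseteq> closure (A k)"
    by (auto simp: mem_interior_cball)
  \<comment> \<open>Points of \<open>A k\<close> near \<open>x0 + x'\<close> and near
    \<open>x0\<close> differ by nearly \<open>x'\<close>, which moves the ball to the origin. A
    tolerance of \<open>\<rho> / 4\<close> for each leaves half of the norm as error.\<close>
  have step0: "\<exists>y. norm (x - y) \<le> norm x / 2 \<and> norm (T y) \<le> (2 * real k / \<rho>) * norm x" for x :: 'a
  proof (cases "x = 0")
    case True
    then show ?thesis using linear_0[OF lin] by (intro exI[of _ 0]) auto
  next
    case False
    define s where "s = norm x / \<rho>"
    have s: "s > 0" using False \<rho> by (simp add: s_def)
    define x' where "x' = x /\<^sub>R s"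
    have nx': "norm x' = \<rho>" using s False \<rho> by (simp add: x'_def s_def field_simps)
    have "x0 + x' \<in> closure (A k)" "x0 \<in> closure (A k)"
      using \<rho> nx' by (auto simp: dist_norm subset_iff)
    then obtain a b where a: "a \<in> A k" "dist a (x0 + x') < \<rho> / 4" and b: "b \<in> A k" "dist b x0 < \<rho> / 4"
      using \<rho>(1) unfolding closure_approachable by (metis divide_pos_pos zero_less_numeral)
    have "norm (x' - (a - b)) \<le> norm (a - (x0 + x')) + norm (b - x0)"
      using norm_triangle_ineq[of "(x0 + x') - a" "b - x0"] by (simp add: norm_minus_commute algebra_simps)
    then have 1: "norm (x' - (a - b)) \<le> \<rho> / 2" using a b by (simp add: dist_norm)
    have 2: "norm (T (a - b)) \<le> 2 * real k"
      using a b norm_triangle_ineq4[of "T a" "T b"] by (simp add: A_def linear_diff[OF lin])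
    have "x - s *\<^sub>R (a - b) = s *\<^sub>R (x' - (a - b))" using s by (simp add: x'_def algebra_simps)
    then have "norm (x - s *\<^sub>R (a - b)) \<le> s * (\<rho> / 2)" using 1 s by (simp add: mult_left_mono)
    moreover have "norm (T (s *\<^sub>R (a - b))) \<le> s * (2 * real k)"
      using 2 s by (simp add: linear_cmul[OF lin] mult_left_mono)
    ultimately show ?thesis using \<rho> by (intro exI[of _ "s *\<^sub>R (a - b)"]) (simp add: s_def field_simps)
  qed
  define K where "K = 2 * real k / \<rho>"
  have K0: "K \<ge> 0" using \<rho> by (simp add: K_def)
  obtain Y where Y: "\<And>x. norm (x - Y x) \<le> norm x / 2" "\<And>x. norm (T (Y x)) \<le> K * norm x"
    using step0 unfolding K_def by metis
  have "norm (T x) \<le> norm x * (2 * K)" for x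
  proof -
    \<comment> \<open>Remainders of the successive approximation. Each step halves the norm, so
      \<open>x\<close> is the sum of the corrections \<open>Y (r i)\<close>, and closedness of the
      graph passes \<open>T\<close> through the series.\<close>
    define r where "r = (\<lambda>n. ((\<lambda>x. x - Y x) ^^ n) x)"
    have r0: "r 0 = x" and rS: "r (Suc n) = r n - Y (r n)" for n by (auto simp: r_def)
    have rn: "norm (r n) \<le> norm x * (1/2) ^ n" for n
    proof (induction n)
      case (Suc n)
      then show ?case using Y(1)[of "r n"] by (simp add: rS)
    qed (simp add: r0)
    have r_lim: "r \<longlonglongrightarrow> 0"
      by (rule Lim_null_comparison[where g = "\<lambda>n. norm x * (1/2) ^ n"])
        (use rn in \<open>auto intro!: tendsto_eq_intros LIMSEQ_power_zero\<close>)
    have sumY: "(\<Sum>i<n. Y (r i)) = x - r n" for n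
      by (induction n) (auto simp: r0 rS)
    have bT: "norm (T (Y (r i))) \<le> K * (norm x * (1/2) ^ i)" for i
      using Y(2)[of "r i"] rn[of i] K0 by (meson mult_left_mono order_trans)
    have geo: "summable (\<lambda>i. K * (norm x * (1/2::real) ^ i))"
      by (intro summable_mult summable_geometric) auto
    have sT: "summable (\<lambda>i. T (Y (r i)))"
      by (rule summable_comparison_test'[OF geo]) (use bT in auto)
    have "(\<lambda>n. T (x - r n)) \<longlonglongrightarrow> (\<Sum>i. T (Y (r i)))"
      using summable_LIMSEQ[OF sT] by (simp add: linear_sum[OF lin, symmetric] sumY)
    moreover have "(\<lambda>n. x - r n) \<longlonglongrightarrow> x" using r_lim by (auto intro: tendsto_eq_intros)
    ultimately have Tx: "T x = (\<Sum>i. T (Y (r i)))" by (intro closed)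
    have "norm (T x) \<le> (\<Sum>i. K * (norm x * (1/2::real) ^ i))"
      unfolding Tx by (rule norm_suminf_le[OF bT geo])
    also have "\<dots> = norm x * (2 * K)"
      by (simp add: suminf_mult suminf_geometric summable_mult summable_geometric)
    finally show ?thesis .
  qed
  then show ?thesis
    by (intro bounded_linear_intro[where K="2 * K"]) (auto simp: linear_add[OF lin] linear_cmul[OF lin])
qed

section \<open>Products in the function space and multiplication by exponentials\<close>

lemma power_series_coeff_unique:
  fixes a b :: "nat \<Rightarrow> complex"
  assumes r: "r > 0"
    and a: "\<And>z. norm z < r \<Longrightarrow> (\<lambda>k. a k * z ^ k) sums f z"
    and b: "\<And>z. norm z < r \<Longrightarrow> (\<lambda>k. b k * z ^ k) sums f z"
  shows "a = b"
proof -
  have conv: "fps_conv_radius (Abs_fps c) > 0"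
    if "\<And>z. norm z < r \<Longrightarrow> (\<lambda>k. c k * z ^ k) sums f z" for c :: "nat \<Rightarrow> complex"
  proof -
    have "summable (\<lambda>k. c k * (of_real (r/2)) ^ k)"
      using that[of "of_real (r/2)"] r by (auto simp: sums_iff)
    then have "conv_radius c \<ge> norm (of_real (r/2) :: complex)" by (rule conv_radius_geI)
    then show ?thesis using r by (simp add: fps_conv_radius_def) (meson ereal_less(2) half_gt_zero less_le_trans)
  qed
  have "Abs_fps a = Abs_fps b"
  proof (rule eval_fps_eqD)
    have "eventually (\<lambda>z::complex. z \<in> ball 0 r) (nhds 0)"
      using r by (intro eventually_nhds_in_open) auto
    then show "eventually (\<lambda>z. eval_fps (Abs_fps a) z = eval_fps (Abs_fps b) z) (nhds 0)"
    proof eventually_elim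
      case (elim z)
      then show ?case using a[of z] b[of z] by (auto simp: eval_fps_def sums_iff)
    qed
  qed (use conv a b in auto)
  then show ?thesis by (simp add: fps_eq_iff fun_eq_iff)
qed

lemma scaleC_zero_left [simp]: "0 *\<^sub>C (x :: 'b::complex_banach) = 0"
  using scaleC_of_real[of 0 x] by simp

lemma scaleC_one [simp]: "1 *\<^sub>C (x :: 'b::complex_banach) = x"
  using scaleC_of_real[of 1 x] by simp

lemma scaleC_zero_right [simp]: "c *\<^sub>C (0 :: 'b::complex_banach) = 0"
  using norm_scaleC[of c 0] by simp

context banach_function_space
begin

lemma bounded_linear_ev: "x \<in> space M \<Longrightarrow> bounded_linear (\<lambda>g. ev g x)"
  using ev_scaleC[of x "complex_of_real _"]
  by (intro bounded_linear_intro[where K=1]) (auto simp: ev_add norm_ge scaleC_of_real scaleR_conv_of_real)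

lemma ev_elem: "member h \<Longrightarrow> x \<in> space M \<Longrightarrow> ev (elem h) x = h x"
proof -
  assume h: "member h" and x: "x \<in> space M"
  have "\<exists>!g. \<forall>x\<in>space M. ev g x = h x"
    using h ev_inject unfolding member_def by metis
  from theI'[OF this] x show ?thesis by (simp add: elem_def)
qed

lemma ev_diff: "x \<in> space M \<Longrightarrow> ev (g - h) x = ev g x - ev h x"
  by (intro linear_diff bounded_linear.linear bounded_linear_ev)

end

context markov_operator
begin

text \<open>The degree-two coefficient of the power series of \<open>exp (z * g)\<close> at
  \<open>z = 0\<close> is an element of the space. Evaluation at a point is bounded, hence acts term
  by term, and uniqueness of scalar power series identifies the coefficient with
  \<open>g^2 / 2\<close>.\<close>

lemma square_member: "\<exists>s. \<forall>x\<in>space M. ev s x = (ev g x)\<^sup>2"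
proof -
  obtain r a where r: "r > 0" and
    sums: "\<And>z. dist z 0 < r \<Longrightarrow> (\<lambda>k. (z - 0) ^ k *\<^sub>C a k) sums elem (\<lambda>x. exp (z * ev g x))"
    using exp_analytic[of g] unfolding analytic_map_def by (metis (no_types))
  have "ev (a 2) x = (ev g x)\<^sup>2 / 2" if x: "x \<in> space M" for x
  proof -
    have "(\<lambda>k. ev (a k) x) = (\<lambda>k. ev g x ^ k / fact k)"
    proof (rule power_series_coeff_unique[OF r])
      fix z :: complex assume "norm z < r"
      then have "(\<lambda>k. ev ((z - 0) ^ k *\<^sub>C a k) x) sums ev (elem (\<lambda>x. exp (z * ev g x))) x"
        using bounded_linear.sums[OF bounded_linear_ev[OF x]] sums by simp
      then show "(\<lambda>k. ev (a k) x * z ^ k) sums exp (z * ev g x)"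
        using x by (simp add: ev_scaleC ev_elem exp_member mult.commute)
      show "(\<lambda>k. ev g x ^ k / fact k * z ^ k) sums exp (z * ev g x)"
        using exp_converges[of "z * ev g x"]
        by (simp add: scaleR_conv_of_real field_simps power_mult_distrib)
    qed
    from fun_cong[OF this, of 2] show ?thesis by simp
  qed
  then show ?thesis by (intro exI[of _ "2 *\<^sub>C a 2"]) (auto simp: ev_scaleC field_simps)
qed

text \<open>Polarisation: \<open>2 g h = (g + h)^2 - g^2 - h^2\<close>.\<close>

lemma product_member: "member (\<lambda>x. ev g x * ev h x)"
proof -
  obtain s1 s2 s3 where s: "\<forall>x\<in>space M. ev s1 x = (ev (g + h) x)\<^sup>2"
    "\<forall>x\<in>space M. ev s2 x = (ev g x)\<^sup>2" "\<forall>x\<in>space M. ev s3 x = (ev h x)\<^sup>2"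
    using square_member by meson
  show ?thesis unfolding member_def
  proof (intro exI ballI)
    fix x assume x: "x \<in> space M"
    then show "ev ((1/2) *\<^sub>C (s1 - s2 - s3)) x = ev g x * ev h x"
      using s by (simp add: ev_scaleC ev_diff ev_add power2_eq_square algebra_simps)
  qed
qed

definition mul :: "'b \<Rightarrow> 'b \<Rightarrow> 'b" where
  "mul g h = elem (\<lambda>x. ev g x * ev h x)"

lemma ev_mul [simp]: "x \<in> space M \<Longrightarrow> ev (mul g h) x = ev g x * ev h x"
  unfolding mul_def by (rule ev_elem[OF product_member])

text \<open>Nothing relates the norm of a product to the norms of the factors directly. But norm
  limits are determined by point values, since the norm dominates the supremum, so the graph of
  \<open>mul g\<close> is closed.\<close>

lemma bounded_linear_mul: "bounded_linear (mul g)"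
proof (rule closed_graph_bounded_linear)
  show "linear (mul g)"
  proof (rule linearI)
    fix h k show "mul g (h + k) = mul g h + mul g k"
      by (rule ev_inject) (simp add: ev_add algebra_simps)
  next
    fix c h show "mul g (c *\<^sub>R h) = c *\<^sub>R mul g h"
      by (rule ev_inject) (simp add: scaleC_of_real[symmetric] ev_scaleC)
  qed
  fix X h k assume X: "X \<longlonglongrightarrow> h" "(\<lambda>n. mul g (X n)) \<longlonglongrightarrow> k"
  show "mul g h = k"
  proof (rule ev_inject)
    fix x assume x: "x \<in> space M"
    note lim = bounded_linear.tendsto[OF bounded_linear_ev[OF x]]
    have "(\<lambda>n. ev g x * ev (X n) x) \<longlonglongrightarrow> ev k x" using lim[OF X(2)] x by simp
    moreover have "(\<lambda>n. ev g x * ev (X n) x) \<longlonglongrightarrow> ev g x * ev h x"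
      using lim[OF X(1)] by (intro tendsto_intros)
    ultimately show "ev (mul g h) x = ev k x" using x LIMSEQ_unique by auto
  qed
qed

text \<open>\<open>E z\<close> is the exponential series of the bounded operator
  \<open>z * mul f\<close>. The operator series, unlike mere membership of
  \<open>exp (z * f)\<close>, shows that \<open>E z\<close> differs from the identity by
  \<open>O(norm z)\<close> in operator norm, which is the smallness that the perturbation argument
  consumes.\<close>

lemma exp_mult_operator:
  obtains C E where "C \<ge> 0"
    and "\<And>z g x. x \<in> space M \<Longrightarrow> ev (E z g) x = exp (z * ev f x) * ev g x"
    and "\<And>z g. norm z \<le> 1 \<Longrightarrow> norm (E z g - g) \<le> C * norm z * norm g"
proof -
  obtain c where c: "c > 0" "\<And>h. norm (mul f h) \<le> norm h * c"
    using bounded_linear.pos_bounded[OF bounded_linear_mul[of f]] by auto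
  define p where "p = (\<lambda>k g. (mul f ^^ k) g)"
  have ev_p: "ev (p k g) x = ev f x ^ k * ev g x" if "x \<in> space M" for k g x
    using that unfolding p_def by (induction k) auto
  have norm_p: "norm (p k g) \<le> c ^ k * norm g" for k g
  proof (induction k)
    case (Suc k)
    have "norm (p (Suc k) g) \<le> norm (p k g) * c" using c(2) by (simp add: p_def)
    also have "\<dots> \<le> (c ^ k * norm g) * c" using Suc c(1) by (intro mult_right_mono) auto
    finally show ?case by (simp add: mult_ac)
  qed (simp add: p_def)
  define t where "t = (\<lambda>z g k. (z ^ k / fact k) *\<^sub>C p k g)"
  have norm_t: "norm (t z g k) \<le> (norm g) * ((norm z * c) ^ k /\<^sub>R fact k)" for z g k
    using mult_left_mono[OF norm_p[of k g], of "norm z ^ k / fact k"]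
    by (simp add: t_def norm_scaleC norm_divide norm_power power_mult_distrib field_simps)
  have exp_sums: "(\<lambda>k. norm g * ((norm z * c) ^ k /\<^sub>R fact k)) sums (norm g * exp (norm z * c))"
    for g :: 'b and z :: complex
    by (intro sums_mult exp_converges)
  have summ: "summable (t z g)" for z g
    by (rule summable_comparison_test'[OF sums_summable[OF exp_sums]]) (rule norm_t)
  define E where "E = (\<lambda>z g. \<Sum>k. t z g k)"
  have 1: "ev (E z g) x = exp (z * ev f x) * ev g x" if x: "x \<in> space M" for z g x
  proof -
    have "(\<lambda>k. ev (t z g k) x) sums ev (E z g) x"
      unfolding E_def by (rule bounded_linear.sums[OF bounded_linear_ev[OF x] summable_sums[OF summ]])
    moreover have "(\<lambda>k. ev (t z g k) x) sums (exp (z * ev f x) * ev g x)"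
      using sums_mult2[OF exp_converges[of "z * ev f x"], of "ev g x"] x
      by (simp add: t_def ev_scaleC ev_p scaleR_conv_of_real field_simps power_mult_distrib)
    ultimately show ?thesis by (rule sums_unique2)
  qed
  have 2: "norm (E z g - g) \<le> (c * exp c) * norm z * norm g" if z: "norm z \<le> 1" for z g
  proof -
    have "E z g - g = (\<Sum>k. t z g (Suc k))"
      unfolding E_def using suminf_split_head[OF summ[of z g]] by (simp add: t_def p_def)
    moreover have "norm (\<Sum>k. t z g (Suc k)) \<le> (\<Sum>k. norm g * ((norm z * c) ^ Suc k /\<^sub>R fact (Suc k)))"
      by (intro norm_suminf_le norm_t iffD2[OF summable_Suc_iff] sums_summable[OF exp_sums])
    moreover have "(\<Sum>k. norm g * ((norm z * c) ^ Suc k /\<^sub>R fact (Suc k))) = norm g * (exp (norm z * c) - 1)"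
      using suminf_split_head[OF sums_summable[OF exp_sums[of g z]]] sums_unique[OF exp_sums[of g z]]
      by (simp add: algebra_simps)
    moreover have "exp (norm z * c) - 1 \<le> norm z * c * exp c"
    proof -
      define y where "y = norm z * c"
      have y: "0 \<le> y" "y \<le> c" using z c(1) by (auto simp: y_def mult_le_cancel_right1 zero_le_mult_iff)
      have "1 - y \<le> exp (- y)" using exp_ge_add_one_self[of "-y"] by simp
      then have "(1 - y) * exp y \<le> 1" using mult_right_mono[of "1 - y" "exp (-y)" "exp y"] by (simp add: exp_minus)
      then have "exp y - 1 \<le> y * exp y" by (simp add: algebra_simps)
      also have "\<dots> \<le> y * exp c" using y by (intro mult_left_mono) auto
      finally show ?thesis by (simp add: y_def)
    qed
    ultimately show ?thesis
      using mult_left_mono[of "exp (norm z * c) - 1" "norm z * c * exp c" "norm g"] by (simp add: mult_ac)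
  qed
  show ?thesis by (rule that[OF _ 1 2]) (use c in auto)
qed

end

section \<open>Perturbation of the leading eigenvalue\<close>

text \<open>\<open>N\<close> measures the distance to the constants in a norm for which \<open>R\<close> is a contraction.
  The cone \<open>N g \<le> \<kappa> * norm (l g)\<close> is invariant under small perturbations of \<open>R\<close>, and the normalised
  iteration contracts on it.\<close>

lemma perturbed_iteration:
  fixes R :: "'b::complex_banach \<Rightarrow> 'b" and E :: "complex \<Rightarrow> 'b \<Rightarrow> 'b"
    and mu l :: "'b \<Rightarrow> complex" and one :: 'b and N :: "'b \<Rightarrow> real"
  assumes l_add: "\<And>g h. l (g + h) = l g + l h" and l_scale: "\<And>c g. l (c *\<^sub>C g) = c * l g"
    and l_bd: "\<And>g. norm (l g) \<le> norm g" and l_one: "l one = 1"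
    and E_add: "\<And>z g h. E z (g + h) = E z g + E z h" and E_scale: "\<And>z c g. E z (c *\<^sub>C g) = c *\<^sub>C E z g"
    and pert: "\<And>z g. norm z \<le> 1 \<Longrightarrow> norm (E z g - R g) \<le> C * norm z * norm g" and C: "C \<ge> 0"
    and N_add: "\<And>g h. N (g + h) \<le> N g + N h" and N_scale: "\<And>c g. N (c *\<^sub>C g) = norm c * N g"
    and N_R: "\<And>g. N (R g) \<le> \<delta> * N g" and \<delta>: "0 < \<delta>" "\<delta> < 1"
    and N_le: "\<And>g. N g \<le> D * norm g" and N_one: "N one = 0" and D: "D \<ge> 1"
    and R_near: "\<And>g. norm (R g - g) \<le> 2 * N g"
    and norm_le: "\<And>g. norm g \<le> A * (N g + norm (l g))" and A: "A \<ge> 1"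
  obtains r \<theta> where "0 < r" "r \<le> 1" "0 \<le> \<theta>" "\<theta> < 1"
    and "\<And>z n. norm z \<le> r \<Longrightarrow> l ((E z ^^ n) one) \<noteq> 0"
    and "\<And>z n. norm z \<le> r \<Longrightarrow> norm (l ((E z ^^ Suc n) one) / l ((E z ^^ n) one) - 1) \<le> 2/5"
    and "\<And>z n. norm z \<le> r \<Longrightarrow> norm (l ((E z ^^ Suc (Suc n)) one) / l ((E z ^^ Suc n) one)
           - l ((E z ^^ Suc n) one) / l ((E z ^^ n) one)) \<le> 3 * \<theta> ^ n"
proof -
  \<comment> \<open>\<open>t\<close> is the contraction deficit of \<open>R\<close>,
    \<open>\<kappa>\<close> the aperture of the cone and \<open>\<epsilon>\<close> the admissible
    relative size of the perturbation. The values give \<open>\<delta> * \<kappa> + 2 * \<epsilon>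
    \<le> \<kappa> * (1 - 2 * \<kappa> - 2 * \<epsilon>)\<close>, which makes the cone invariant,
    and \<open>\<theta> < 1\<close>.\<close>
  define t where "t = 1 - \<delta>"
  define \<kappa> where "\<kappa> = t / 8"
  define \<epsilon> where "\<epsilon> = \<kappa> * t / 4"
  have t: "0 < t" "t < 1" using \<delta> by (auto simp: t_def)
  have \<kappa>: "0 < \<kappa>" "\<kappa> < 1/8" using t by (auto simp: \<kappa>_def)
  have \<epsilon>: "0 < \<epsilon>" "\<epsilon> \<le> \<kappa> / 4" using t \<kappa> by (auto simp: \<epsilon>_def mult_le_cancel_left1)
  define L where "L = C * D * A + 1"
  have L: "L > 0" using C D A by (simp add: L_def add_nonneg_pos)
  define r where "r = min 1 (\<epsilon> / L)"
  define \<theta> where "\<theta> = (\<delta> + \<epsilon> + 3 * \<kappa>) / (1 - 2 * \<kappa> - 2 * \<epsilon>)"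
  have r: "0 < r" "r \<le> 1" using \<epsilon> L by (auto simp: r_def)
  have den: "1 - 2 * \<kappa> - 2 * \<epsilon> \<ge> 3/5" using \<kappa> \<epsilon> by simp
  have \<theta>: "0 \<le> \<theta>" "\<theta> < 1"
  proof -
    have "3 * \<epsilon> \<le> 3 * (t / 32)" using \<epsilon> by (simp add: \<kappa>_def)
    then have "\<delta> + \<epsilon> + 3 * \<kappa> < 1 - 2 * \<kappa> - 2 * \<epsilon>" using t(1) \<epsilon> unfolding \<kappa>_def t_def by argo
    then show "\<theta> < 1" "0 \<le> \<theta>" using den \<delta> \<epsilon> \<kappa> by (auto simp: \<theta>_def)
  qed
  have N_nonneg: "N g \<ge> 0" for g using R_near[of g] norm_ge_zero[of "R g - g"] by linarith
  have l_diff: "l (g - h) = l g - l h" for g h using l_add[of "g - h" h] by simp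
  have N_uminus: "N (- g) = N g" for g
  proof -
    have "- g = (-1) *\<^sub>C g" using scaleC_of_real[of "-1" g] by simp
    then show ?thesis using N_scale[of "-1" g] by simp
  qed
  have E_diff: "E z (g - h) = E z g - E z h" for z g h using E_add[of z "g - h" h] by simp
  \<comment> \<open>By \<open>norm_le\<close> the sum \<open>N g + norm (l g)\<close> can stand for
    the norm, so the perturbation is of relative size \<open>\<epsilon>\<close> both in norm and in
    \<open>N\<close>.\<close>
  have D1: "norm (E z g - R g) \<le> \<epsilon> * (N g + norm (l g))"
    and D2: "N (E z g - R g) \<le> \<epsilon> * (N g + norm (l g))" if z: "norm z \<le> r" for z g
  proof -
    have "norm (E z g - R g) \<le> C * norm z * norm g" using z r by (intro pert) auto
    also have "\<dots> \<le> C * norm z * (A * (N g + norm (l g)))" using norm_le C by (intro mult_left_mono) auto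
    finally have *: "norm (E z g - R g) \<le> C * A * norm z * (N g + norm (l g))" by (simp add: mult_ac)
    have "norm z \<le> \<epsilon> / L" using z by (simp add: r_def)
    then have zz: "norm z * L \<le> \<epsilon>" using L by (simp add: pos_le_divide_eq)
    have "C * D * A * norm z \<le> L * norm z" by (intro mult_right_mono) (auto simp: L_def)
    then have "C * D * A * norm z \<le> \<epsilon>" using zz by (simp add: mult.commute)
    then have **: "C * D * A * norm z * (N g + norm (l g)) \<le> \<epsilon> * (N g + norm (l g))"
      using N_nonneg[of g] by (intro mult_right_mono) auto
    have "1 * (C * A * norm z * (N g + norm (l g))) \<le> D * (C * A * norm z * (N g + norm (l g)))"
      using D C A N_nonneg[of g] by (intro mult_right_mono mult_nonneg_nonneg) auto
    then show "norm (E z g - R g) \<le> \<epsilon> * (N g + norm (l g))" using * ** by (simp add: mult_ac)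
    have "N (E z g - R g) \<le> D * norm (E z g - R g)" by (rule N_le)
    also have "\<dots> \<le> D * (C * A * norm z * (N g + norm (l g)))" using * D by (intro mult_left_mono) auto
    finally show "N (E z g - R g) \<le> \<epsilon> * (N g + norm (l g))" using ** by (simp add: mult_ac)
  qed
  have NE: "N (E z g) \<le> \<delta> * N g + \<epsilon> * (N g + norm (l g))" if "norm z \<le> r" for z g
    using N_add[of "R g" "E z g - R g"] N_R[of g] D2[OF that, of g] by simp
  \<comment> \<open>\<open>l\<close> need not be invariant under \<open>R\<close>.
    \<open>R_near\<close> bounds the drift by \<open>2 * N g\<close>, which on the cone is a small
    multiple of \<open>norm (l g)\<close>.\<close>
  have lE: "norm (l (E z g) - l g) \<le> 2 * N g + \<epsilon> * (N g + norm (l g))" if "norm z \<le> r" for z g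
  proof -
    have *: "l (E z g) - l g = l (R g - g) + l (E z g - R g)" by (simp add: l_diff)
    have "norm (l (E z g) - l g) \<le> norm (R g - g) + norm (E z g - R g)"
      unfolding *
      using norm_triangle_ineq[of "l (R g - g)" "l (E z g - R g)"] l_bd[of "R g - g"] l_bd[of "E z g - R g"] by linarith
    then show ?thesis using R_near[of g] D1[OF that, of g] by linarith
  qed
  define G where "G = (\<lambda>z n. (E z ^^ n) one)"
  have G0: "G z 0 = one" and GS: "G z (Suc n) = E z (G z n)" for z n by (auto simp: G_def)
  have cone_step: "norm (l (E z g) - l g) \<le> (2 * \<kappa> + 2 * \<epsilon>) * norm (l g) \<and> l (E z g) \<noteq> 0 \<and> N (E z g) \<le> \<kappa> * norm (l (E z g))"
    if z: "norm z \<le> r" and g: "l g \<noteq> 0" "N g \<le> \<kappa> * norm (l g)" for z g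
  proof -
    define x where "x = norm (l g)"
    have x: "x > 0" using g by (simp add: x_def)
    have "\<kappa> * x \<le> x" using \<kappa> x by simp
    then have "N g + x \<le> 2 * x" using g(2) unfolding x_def by linarith
    then have e2: "\<epsilon> * (N g + norm (l g)) \<le> \<epsilon> * (2 * x)" using \<epsilon> unfolding x_def by (intro mult_left_mono) auto
    have 1: "norm (l (E z g) - l g) \<le> (2 * \<kappa> + 2 * \<epsilon>) * x" using lE[OF z, of g] e2 g by (simp add: x_def algebra_simps)
    have "norm (l (E z g)) \<ge> x - norm (l (E z g) - l g)"
      using norm_triangle_ineq2[of "l g" "l g - l (E z g)"] by (simp add: x_def norm_minus_commute)
    then have 2: "norm (l (E z g)) \<ge> (1 - 2 * \<kappa> - 2 * \<epsilon>) * x" using 1 by (simp add: algebra_simps)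
    moreover have "(1 - 2 * \<kappa> - 2 * \<epsilon>) * x > 0" using den x by (intro mult_pos_pos) auto
    ultimately have 3: "l (E z g) \<noteq> 0" by auto
    have "N (E z g) \<le> \<delta> * (\<kappa> * x) + \<epsilon> * (2 * x)"
      using NE[OF z, of g] e2 mult_left_mono[OF g(2) less_imp_le[OF \<delta>(1)]] unfolding x_def by linarith
    also have "\<dots> = (\<delta> * \<kappa> + 2 * \<epsilon>) * x" by (simp add: algebra_simps)
    also have "\<dots> \<le> \<kappa> * (1 - 2 * \<kappa> - 2 * \<epsilon>) * x"
    proof (intro mult_right_mono)
      have "\<kappa> * (2 * \<epsilon> + 2 * \<kappa>) \<le> \<kappa> * (t / 2)" using \<kappa> \<epsilon> by (intro mult_left_mono) (auto simp: \<kappa>_def)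
      moreover have "2 * \<epsilon> = \<kappa> * t / 2" by (simp add: \<epsilon>_def)
      moreover have "\<delta> * \<kappa> = \<kappa> - \<kappa> * t" by (simp add: t_def algebra_simps)
      moreover have "\<kappa> * (1 - 2 * \<kappa> - 2 * \<epsilon>) = \<kappa> - \<kappa> * (2 * \<epsilon> + 2 * \<kappa>)" by (simp add: algebra_simps)
      ultimately show "\<delta> * \<kappa> + 2 * \<epsilon> \<le> \<kappa> * (1 - 2 * \<kappa> - 2 * \<epsilon>)" by argo
    qed (use x in auto)
    also have "\<dots> = \<kappa> * ((1 - 2 * \<kappa> - 2 * \<epsilon>) * x)" by (simp add: mult.assoc)
    also have "\<dots> \<le> \<kappa> * norm (l (E z g))" using 2 \<kappa> by (intro mult_left_mono) auto
    finally show ?thesis using 1 3 by (simp add: x_def)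
  qed
  have cone: "l (G z n) \<noteq> 0 \<and> N (G z n) \<le> \<kappa> * norm (l (G z n))" if z: "norm z \<le> r" for z n
    by (induction n) (use cone_step[OF z] l_one N_one \<kappa> in \<open>auto simp: G0 GS\<close>)
  define lam where "lam = (\<lambda>z n. l (G z (Suc n)) / l (G z n))"
  have lam1: "norm (lam z n - 1) \<le> 2 * \<kappa> + 2 * \<epsilon>" if z: "norm z \<le> r" for z n
  proof -
    have "lam z n - 1 = (l (E z (G z n)) - l (G z n)) / l (G z n)"
      using cone[OF z, of n] by (simp add: lam_def GS diff_divide_distrib)
    then show ?thesis using cone_step[OF z, of "G z n"] cone[OF z, of n]
      by (simp add: norm_divide pos_divide_le_eq)
  qed
  \<comment> \<open>Normalising by \<open>l\<close> makes successive iterates comparable: their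
    differences \<open>d\<close> lie in the kernel of \<open>l\<close>, so the bounds
    \<open>NE\<close> and \<open>lE\<close> involve \<open>N (d z n)\<close> alone.\<close>
  define H where "H = (\<lambda>z n. (1 / l (G z n)) *\<^sub>C G z n)"
  have lH: "l (H z n) = 1" and NH: "N (H z n) \<le> \<kappa>" if z: "norm z \<le> r" for z n
    using cone[OF z, of n] by (auto simp: H_def l_scale N_scale norm_divide pos_divide_le_eq)
  have lam_ge: "norm (lam z n) \<ge> 1 - 2 * \<kappa> - 2 * \<epsilon>" if z: "norm z \<le> r" for z n
    using lam1[OF z, of n] norm_triangle_ineq2[of 1 "1 - lam z n"] by (simp add: norm_minus_commute)
  have EH: "E z (H z n) = lam z n *\<^sub>C H z (Suc n)" if z: "norm z \<le> r" for z n
    using cone[OF z, of n] cone[OF z, of "Suc n"] by (simp add: H_def E_scale lam_def GS scaleC_scaleC)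
  define d where "d = (\<lambda>z n. H z (Suc n) - H z n)"
  have ld: "l (d z n) = 0" if z: "norm z \<le> r" for z n using lH[OF z] by (simp add: d_def l_diff)
  have lamdiff: "lam z (Suc n) - lam z n = l (E z (d z n))" if z: "norm z \<le> r" for z n
    using lH[OF z] by (simp add: d_def E_diff l_diff EH[OF z] l_scale)
  have lam_d: "norm (lam z (Suc n) - lam z n) \<le> 3 * N (d z n)" if z: "norm z \<le> r" for z n
  proof -
    have "norm (l (E z (d z n))) \<le> 2 * N (d z n) + \<epsilon> * N (d z n)"
      using lE[OF z, of "d z n"] ld[OF z, of n] by simp
    moreover have "\<epsilon> * N (d z n) \<le> 1 * N (d z n)" using \<epsilon> \<kappa> N_nonneg by (intro mult_right_mono) auto
    ultimately show ?thesis using lamdiff[OF z] by simp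
  qed
  have Nd: "N (d z n) \<le> \<theta> ^ n" if z: "norm z \<le> r" for z n
  proof (induction n)
    case 0
    have "H z 0 = one" by (simp add: H_def G0 l_one)
    then have "N (d z 0) \<le> N (H z (Suc 0)) + N (- one)" using N_add[of "H z (Suc 0)" "- one"] by (simp add: d_def)
    then show ?case using NH[OF z, of "Suc 0"] N_uminus N_one \<kappa> by simp
  next
    case (Suc n)
    \<comment> \<open>\<open>lam z (Suc n)\<close> times the next difference is the image of the
      current one, corrected by the change of \<open>lam\<close> along \<open>H z (Suc n)\<close>.
      That change is at most \<open>3 * N (d z n)\<close> and \<open>N\<close> of \<open>H\<close>
      is at most \<open>\<kappa>\<close>, whence the term \<open>3 * \<kappa>\<close> in
      \<open>\<theta>\<close>.\<close>
    define w where "w = E z (d z n) - (lam z (Suc n) - lam z n) *\<^sub>C H z (Suc n)"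
    have "lam z (Suc n) *\<^sub>C d z (Suc n) = w"
    proof -
      have "lam z (Suc n) *\<^sub>C d z (Suc n) + lam z (Suc n) *\<^sub>C H z (Suc n) = lam z (Suc n) *\<^sub>C H z (Suc (Suc n))"
        by (simp add: d_def scaleC_add_right[symmetric])
      moreover have "w + lam z (Suc n) *\<^sub>C H z (Suc n) = lam z (Suc n) *\<^sub>C H z (Suc (Suc n))"
        using scaleC_add_left[of "lam z (Suc n) - lam z n" "lam z n" "H z (Suc n)"]
        by (simp add: w_def d_def E_diff EH[OF z] algebra_simps)
      ultimately show ?thesis by (metis add_right_cancel)
    qed
    then have "norm (lam z (Suc n)) * N (d z (Suc n)) = N w" using N_scale by metis
    also have "N w \<le> N (E z (d z n)) + norm (lam z (Suc n) - lam z n) * N (H z (Suc n))"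
      using N_add[of "E z (d z n)" "- ((lam z (Suc n) - lam z n) *\<^sub>C H z (Suc n))"]
      by (simp add: w_def N_uminus N_scale)
    also have "\<dots> \<le> (\<delta> * N (d z n) + \<epsilon> * N (d z n)) + (3 * N (d z n)) * \<kappa>"
      using NE[OF z, of "d z n"] ld[OF z, of n] lam_d[OF z, of n] NH[OF z, of "Suc n"] N_nonneg
      by (intro add_mono mult_mono) auto
    also have "\<dots> = (\<delta> + \<epsilon> + 3 * \<kappa>) * N (d z n)" by (simp add: algebra_simps)
    also have "\<dots> \<le> (\<delta> + \<epsilon> + 3 * \<kappa>) * \<theta> ^ n" using Suc \<delta> \<epsilon> \<kappa> by (intro mult_left_mono) auto
    finally have *: "norm (lam z (Suc n)) * N (d z (Suc n)) \<le> (\<delta> + \<epsilon> + 3 * \<kappa>) * \<theta> ^ n" .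
    have "(1 - 2 * \<kappa> - 2 * \<epsilon>) * N (d z (Suc n)) \<le> norm (lam z (Suc n)) * N (d z (Suc n))"
      using lam_ge[OF z] N_nonneg by (intro mult_right_mono) auto
    with * have "N (d z (Suc n)) * (1 - 2 * \<kappa> - 2 * \<epsilon>) \<le> (\<delta> + \<epsilon> + 3 * \<kappa>) * \<theta> ^ n" by (simp add: mult.commute)
    then show ?case using den by (simp add: \<theta>_def pos_le_divide_eq)
  qed
  show ?thesis
  proof (rule that[OF r \<theta>])
    fix z :: complex and n assume z: "norm z \<le> r"
    show "l ((E z ^^ n) one) \<noteq> 0" using cone[OF z, of n] by (simp add: G_def)
    show "norm (l ((E z ^^ Suc n) one) / l ((E z ^^ n) one) - 1) \<le> 2/5"
      using lam1[OF z, of n] den by (simp add: lam_def G_def)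
    show "norm (l ((E z ^^ Suc (Suc n)) one) / l ((E z ^^ Suc n) one)
           - l ((E z ^^ Suc n) one) / l ((E z ^^ n) one)) \<le> 3 * \<theta> ^ n"
      using lam_d[OF z, of n] Nd[OF z, of n] by (simp add: lam_def G_def)
  qed
qed

section \<open>Moment generating functions of the partial sums\<close>

lemma (in prob_space) integrable_bounded:
  fixes h :: "'a \<Rightarrow> 'b::{banach, second_countable_topology}"
  assumes "h \<in> borel_measurable M" "\<And>x. x \<in> space M \<Longrightarrow> norm (h x) \<le> b"
  shows "integrable M h"
  by (rule integrable_const_bound[where B=b]) (use assms in auto)

section \<open>The Markov property for bounded functions of the past\<close>

text \<open>The Markov property is given for indicators. With the nonnegative \<open>Y\<close> as a
  density, the two sides become integrals of \<open>h\<close> against the weighted law of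
  \<open>\<xi> (Suc n)\<close> and against the weighted law of \<open>\<xi> n\<close> followed by
  \<open>K\<close>. These measures agree on all sets, so \<open>h\<close> may be any bounded
  measurable function at once.\<close>

lemma markov_property_nonneg:
  fixes h :: "'a \<Rightarrow> complex" and Y :: "'w \<Rightarrow> real"
  assumes chain: "markov_chain P M K \<xi>" and K: "K \<in> M \<rightarrow>\<^sub>M prob_algebra M"
    and Y: "Y \<in> borel_measurable (vimage_algebra (space P) (\<lambda>\<omega>. \<lambda>i\<in>{..n}. \<xi> i \<omega>) (\<Pi>\<^sub>M i\<in>{..n}. M))"
    and Y_bd: "\<And>\<omega>. \<omega> \<in> space P \<Longrightarrow> 0 \<le> Y \<omega> \<and> Y \<omega> \<le> c"
    and h[measurable]: "h \<in> borel_measurable M" and h_bd: "\<And>x. x \<in> space M \<Longrightarrow> cmod (h x) \<le> b"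
  shows "(LINT \<omega>|P. Y \<omega> *\<^sub>R h (\<xi> (Suc n) \<omega>)) = (LINT \<omega>|P. Y \<omega> *\<^sub>R (LINT y|K (\<xi> n \<omega>). h y))"
proof -
  define F where "F = vimage_algebra (space P) (\<lambda>\<omega>. \<lambda>i\<in>{..n}. \<xi> i \<omega>) (\<Pi>\<^sub>M i\<in>{..n}. M)"
  interpret prob_space P using chain by (simp add: markov_chain_def)
  have \<xi>[measurable]: "\<xi> i \<in> P \<rightarrow>\<^sub>M M" for i using chain by (simp add: markov_chain_def)
  have cond: "A \<in> sets M \<Longrightarrow> AE \<omega> in P. real_cond_exp P F (\<lambda>\<omega>. indicator A (\<xi> (Suc n) \<omega>)) \<omega>
      = measure (K (\<xi> n \<omega>)) A" for A
    using chain by (simp add: markov_chain_def F_def)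
  have sub: "subalgebra P F"
  proof -
    have "(\<lambda>\<omega>. \<lambda>i\<in>{..n}. \<xi> i \<omega>) \<in> P \<rightarrow>\<^sub>M (\<Pi>\<^sub>M i\<in>{..n}. M)" by measurable
    then show ?thesis
      by (auto simp: subalgebra_def F_def measurable_iff_sets)
  qed
  interpret finite_measure_subalgebra P F by unfold_locales (rule sub)
  have YF: "Y \<in> borel_measurable F" using Y by (simp add: F_def)
  have [measurable]: "Y \<in> borel_measurable P" by (rule measurable_from_subalg[OF sub YF])
  have K'[measurable]: "K \<in> M \<rightarrow>\<^sub>M subprob_algebra M" by (rule measurable_prob_algebraD[OF K])
  have Kp: "x \<in> space M \<Longrightarrow> prob_space (K x) \<and> sets (K x) = sets M" for x
    using measurable_space[OF K] by (auto simp: space_prob_algebra)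
  define D where "D = density P Y"
  have [measurable_cong]: "sets D = sets P" by (simp add: D_def)
  define m1 where "m1 = distr D M (\<xi> (Suc n))"
  define m0 where "m0 = distr D M (\<xi> n)"
  have sm0[measurable_cong, simp]: "sets m0 = sets M" by (simp add: m0_def)
  have ne: "space M \<noteq> {}" using measurable_space[OF \<xi>] not_empty by auto
  have ne0: "space m0 \<noteq> {}" using ne by (simp add: m0_def)
  have K0: "K \<in> m0 \<rightarrow>\<^sub>M subprob_algebra M" using K' by (simp add: m0_def)
  define m2 where "m2 = m0 \<bind> K"
  have sm2[simp]: "sets m2 = sets M" unfolding m2_def by (rule sets_bind[OF _ ne0]) (use Kp in \<open>auto simp: m0_def\<close>)
  have eq: "m1 = m2"
  proof (rule measure_eqI)
    show "sets m1 = sets m2" by (simp add: m1_def)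
    fix A assume "A \<in> sets m1"
    then have A[measurable]: "A \<in> sets M" by (simp add: m1_def)
    have i1: "integrable P (\<lambda>\<omega>. Y \<omega> * indicator A (\<xi> (Suc n) \<omega>))"
      by (rule integrable_bounded[where b=c]) (use Y_bd in \<open>auto split: split_indicator dest: order_trans\<close>)
    note ce = real_cond_exp_intg[OF i1 YF]
    have mK[measurable]: "(\<lambda>\<omega>. measure (K (\<xi> n \<omega>)) A) \<in> borel_measurable P" by measurable
    have e: "(\<integral>\<omega>. Y \<omega> * measure (K (\<xi> n \<omega>)) A \<partial>P) = (\<integral>\<omega>. Y \<omega> * indicator A (\<xi> (Suc n) \<omega>) \<partial>P)"
    proof -
      have "(\<integral>\<omega>. Y \<omega> * measure (K (\<xi> n \<omega>)) A \<partial>P) =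
          (\<integral>\<omega>. Y \<omega> * real_cond_exp P F (\<lambda>\<omega>. indicator A (\<xi> (Suc n) \<omega>)) \<omega> \<partial>P)"
        using cond[OF A] by (intro integral_cong_AE) auto
      also have "\<dots> = (\<integral>\<omega>. Y \<omega> * indicator A (\<xi> (Suc n) \<omega>) \<partial>P)" by (rule ce(2)) measurable
      finally show ?thesis .
    qed
    have i2: "integrable P (\<lambda>\<omega>. Y \<omega> * measure (K (\<xi> n \<omega>)) A)"
    proof (rule integrable_bounded[where b="c * 1"])
      fix \<omega> assume w: "\<omega> \<in> space P"
      have "measure (K (\<xi> n \<omega>)) A \<le> 1"
        using Kp[of "\<xi> n \<omega>"] measurable_space[OF \<xi> w] prob_space.prob_le_1 by metis
      then show "norm (Y \<omega> * measure (K (\<xi> n \<omega>)) A) \<le> c * 1"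
        using Y_bd[OF w] mult_mono[of "Y \<omega>" c "measure (K (\<xi> n \<omega>)) A" 1] by simp
    qed measurable
    have "emeasure m1 A = (\<integral>\<^sup>+\<omega>. ennreal (Y \<omega>) * indicator A (\<xi> (Suc n) \<omega>) \<partial>P)"
      unfolding m1_def D_def by (subst emeasure_distr) (auto simp: emeasure_density intro!: nn_integral_cong split: split_indicator)
    also have "\<dots> = (\<integral>\<^sup>+\<omega>. ennreal (Y \<omega> * indicator A (\<xi> (Suc n) \<omega>)) \<partial>P)"
      by (intro nn_integral_cong) (auto split: split_indicator)
    also have "\<dots> = ennreal (\<integral>\<omega>. Y \<omega> * indicator A (\<xi> (Suc n) \<omega>) \<partial>P)"
      by (rule nn_integral_eq_integral[OF i1]) (use Y_bd in auto)
    also have "\<dots> = (\<integral>\<^sup>+\<omega>. ennreal (Y \<omega> * measure (K (\<xi> n \<omega>)) A) \<partial>P)"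
      unfolding e[symmetric] by (rule nn_integral_eq_integral[OF i2, symmetric]) (use Y_bd in auto)
    also have "\<dots> = (\<integral>\<^sup>+\<omega>. ennreal (Y \<omega>) * emeasure (K (\<xi> n \<omega>)) A \<partial>P)"
    proof (intro nn_integral_cong)
      fix \<omega> assume w: "\<omega> \<in> space P"
      interpret Kx: prob_space "K (\<xi> n \<omega>)" using Kp measurable_space[OF \<xi> w] by blast
      show "ennreal (Y \<omega> * measure (K (\<xi> n \<omega>)) A) = ennreal (Y \<omega>) * emeasure (K (\<xi> n \<omega>)) A"
        using Y_bd[OF w] by (simp add: Kx.emeasure_eq_measure ennreal_mult)
    qed
    also have "\<dots> = (\<integral>\<^sup>+x. emeasure (K x) A \<partial>m0)"
      unfolding m0_def D_def by (subst nn_integral_distr) (auto simp: nn_integral_density)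
    also have "\<dots> = emeasure m2 A"
      unfolding m2_def by (rule emeasure_bind[OF ne0 K0 A, symmetric])
    finally show "emeasure m1 A = emeasure m2 A" .
  qed
  have fin0: "finite_measure m0"
  proof
    have "emeasure m0 (space m0) = (\<integral>\<^sup>+\<omega>. ennreal (Y \<omega>) \<partial>P)"
      using measurable_space[OF \<xi>[of n]] unfolding m0_def D_def
      by (subst emeasure_distr) (auto simp: emeasure_density intro!: nn_integral_cong split: split_indicator)
    also have "\<dots> \<le> (\<integral>\<^sup>+\<omega>. ennreal c \<partial>P)" by (intro nn_integral_mono) (use Y_bd in \<open>auto intro!: ennreal_leI\<close>)
    finally show "emeasure m0 (space m0) \<noteq> \<infinity>"
      by (auto simp: emeasure_space_1 top_unique)
  qed
  have bnd: "AE x in m0. emeasure (K x) (space (K x)) \<le> ennreal 1"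
    using Kp by (intro AE_I2) (auto simp: m0_def prob_space.emeasure_space_1)
  have Rh: "(\<integral>x. u x \<partial>m2) = (\<integral>x. (\<integral>y. u y \<partial>K x) \<partial>m0)" "integrable m2 u"
    if "u \<in> borel_measurable M" "\<And>x. x \<in> space M \<Longrightarrow> \<bar>u x\<bar> \<le> b" for u :: "'a \<Rightarrow> real"
    unfolding m2_def using integral_bind[OF that K0 fin0 bnd] integrable_bind[OF that K0 fin0 bnd] by auto
  have ih: "integrable (K x) h" if "x \<in> space M" for x
  proof -
    interpret Kx: prob_space "K x" using Kp[OF that] by blast
    show ?thesis by (rule Kx.integrable_bounded[where b=b])
        (use Kp[OF that] h h_bd in \<open>auto cong: measurable_cong_sets dest: sets_eq_imp_space_eq\<close>)
  qed
  have hK[measurable]: "(\<lambda>x. \<integral>y. h y \<partial>K x) \<in> borel_measurable M"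
    by (rule measurable_compose[OF K' integral_measurable_subprob_algebra[OF h]])
  have ihK: "integrable m0 (\<lambda>x. \<integral>y. h y \<partial>K x)"
  proof (rule finite_measure.integrable_const_bound[OF fin0, where B=b])
    show "AE x in m0. norm (\<integral>y. h y \<partial>K x) \<le> b"
    proof (rule AE_I2)
      fix x assume "x \<in> space m0" then have x: "x \<in> space M" by (simp add: m0_def)
      interpret Kx: prob_space "K x" using Kp[OF x] by blast
      have "norm (\<integral>y. h y \<partial>K x) \<le> (\<integral>y. norm (h y) \<partial>K x)" by (rule integral_norm_bound)
      also have "\<dots> \<le> (\<integral>y. b \<partial>K x)"
        using ih[OF x] Kp[OF x] h_bd by (intro integral_mono) (auto dest: sets_eq_imp_space_eq)
      finally show "norm (\<integral>y. h y \<partial>K x) \<le> b" by (simp add: Kx.prob_space)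
    qed
  qed simp
  have "(\<integral>x. h x \<partial>m1) = (\<integral>x. (\<integral>y. h y \<partial>K x) \<partial>m0)"
  proof -
    have b1: "\<bar>Re (h x)\<bar> \<le> b" "\<bar>Im (h x)\<bar> \<le> b" if "x \<in> space M" for x
      using h_bd[OF that] abs_Re_le_cmod[of "h x"] abs_Im_le_cmod[of "h x"] by linarith+
    have i2: "integrable m2 h"
    proof -
      have "integrable m2 (\<lambda>x. complex_of_real (Re (h x)) + \<i> * complex_of_real (Im (h x)))"
        using Rh(2)[of "\<lambda>x. Re (h x)"] Rh(2)[of "\<lambda>x. Im (h x)"] b1 by auto
      then show ?thesis by (simp add: complex_eq[symmetric])
    qed
    have "Re (\<integral>x. h x \<partial>m2) = Re (\<integral>x. (\<integral>y. h y \<partial>K x) \<partial>m0)"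
      using Rh(1)[of "\<lambda>x. Re (h x)"] b1 i2 ihK ih
      by (auto simp: m0_def simp flip: integral_Re intro!: Bochner_Integration.integral_cong)
    moreover have "Im (\<integral>x. h x \<partial>m2) = Im (\<integral>x. (\<integral>y. h y \<partial>K x) \<partial>m0)"
      using Rh(1)[of "\<lambda>x. Im (h x)"] b1 i2 ihK ih
      by (auto simp: m0_def simp flip: integral_Im intro!: Bochner_Integration.integral_cong)
    ultimately show ?thesis unfolding eq by (simp add: complex_eq_iff)
  qed
  moreover have "(\<integral>x. h x \<partial>m1) = (LINT \<omega>|P. Y \<omega> *\<^sub>R h (\<xi> (Suc n) \<omega>))"
    unfolding m1_def D_def using Y_bd by (subst integral_distr) (auto intro!: integral_density)
  moreover have "(\<integral>x. (\<integral>y. h y \<partial>K x) \<partial>m0) = (LINT \<omega>|P. Y \<omega> *\<^sub>R (LINT y|K (\<xi> n \<omega>). h y))"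
    unfolding m0_def D_def using Y_bd by (subst integral_distr) (auto intro!: integral_density)
  ultimately show ?thesis by simp
qed

text \<open>A real weight \<open>U\<close> bounded by \<open>c\<close> is the difference of the
  nonnegative weights \<open>U + c\<close> and \<open>c\<close>; a complex weight splits into real
  and imaginary part.\<close>

lemma markov_property_expectation:
  fixes h :: "'a \<Rightarrow> complex" and Y :: "'w \<Rightarrow> complex"
  assumes chain: "markov_chain P M K \<xi>" and K: "K \<in> M \<rightarrow>\<^sub>M prob_algebra M"
    and Y: "Y \<in> borel_measurable (vimage_algebra (space P) (\<lambda>\<omega>. \<lambda>i\<in>{..n}. \<xi> i \<omega>) (\<Pi>\<^sub>M i\<in>{..n}. M))"
    and Y_bd: "\<And>\<omega>. \<omega> \<in> space P \<Longrightarrow> cmod (Y \<omega>) \<le> c"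
    and h[measurable]: "h \<in> borel_measurable M" and h_bd: "\<And>x. x \<in> space M \<Longrightarrow> cmod (h x) \<le> b"
  shows "(LINT \<omega>|P. Y \<omega> * h (\<xi> (Suc n) \<omega>)) = (LINT \<omega>|P. Y \<omega> * (LINT y|K (\<xi> n \<omega>). h y))"
proof -
  define F where "F = vimage_algebra (space P) (\<lambda>\<omega>. \<lambda>i\<in>{..n}. \<xi> i \<omega>) (\<Pi>\<^sub>M i\<in>{..n}. M)"
  interpret prob_space P using chain by (simp add: markov_chain_def)
  have \<xi>[measurable]: "\<xi> i \<in> P \<rightarrow>\<^sub>M M" for i using chain by (simp add: markov_chain_def)
  have sub: "subalgebra P F"
  proof -
    have "(\<lambda>\<omega>. \<lambda>i\<in>{..n}. \<xi> i \<omega>) \<in> P \<rightarrow>\<^sub>M (\<Pi>\<^sub>M i\<in>{..n}. M)" by measurable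
    then show ?thesis
      by (auto simp: subalgebra_def F_def measurable_iff_sets)
  qed
  have K'[measurable]: "K \<in> M \<rightarrow>\<^sub>M subprob_algebra M" by (rule measurable_prob_algebraD[OF K])
  define H where "H = (\<lambda>x. LINT y|K x. h y)"
  have H[measurable]: "H \<in> borel_measurable M"
    unfolding H_def by (rule measurable_compose[OF K' integral_measurable_subprob_algebra[OF h]])
  have H_bd: "cmod (H x) \<le> b" if x: "x \<in> space M" for x
  proof -
    have Kx: "prob_space (K x)" "sets (K x) = sets M"
      using measurable_space[OF K x] by (auto simp: space_prob_algebra)
    interpret Kx: prob_space "K x" by (rule Kx)
    have ih: "integrable (K x) h"
      by (rule Kx.integrable_bounded[where b=b])
        (use Kx h h_bd in \<open>auto cong: measurable_cong_sets dest: sets_eq_imp_space_eq\<close>)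
    have "norm (H x) \<le> (\<integral>y. norm (h y) \<partial>K x)" unfolding H_def by (rule integral_norm_bound)
    also have "\<dots> \<le> (\<integral>y. b \<partial>K x)"
      using ih Kx h_bd by (intro integral_mono) (auto dest: sets_eq_imp_space_eq)
    finally show ?thesis by (simp add: Kx.prob_space)
  qed
  have YF[measurable]: "Y \<in> borel_measurable F" using Y by (simp add: F_def)
  have int: "integrable P (\<lambda>\<omega>. U \<omega> *\<^sub>R g (\<xi> i \<omega>))"
    if "U \<in> borel_measurable F" "\<And>\<omega>. \<omega> \<in> space P \<Longrightarrow> \<bar>U \<omega>\<bar> \<le> B" "g \<in> borel_measurable M"
      "\<And>x. x \<in> space M \<Longrightarrow> cmod (g x) \<le> b" for U :: "'w \<Rightarrow> real" and g :: "'a \<Rightarrow> complex" and B i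
  proof (rule integrable_bounded[where b="B * b"])
    show "(\<lambda>\<omega>. U \<omega> *\<^sub>R g (\<xi> i \<omega>)) \<in> borel_measurable P"
      using measurable_from_subalg[OF sub that(1)] that(3) by measurable
    fix \<omega> assume w: "\<omega> \<in> space P"
    show "norm (U \<omega> *\<^sub>R g (\<xi> i \<omega>)) \<le> B * b"
      unfolding norm_scaleR using that(2)[OF w] that(4)[OF measurable_space[OF \<xi> w]]
      by (intro mult_mono) (use norm_ge_zero order_trans in \<open>auto intro: order_trans[OF abs_ge_zero]\<close>)
  qed
  have real: "(LINT \<omega>|P. U \<omega> *\<^sub>R h (\<xi> (Suc n) \<omega>)) = (LINT \<omega>|P. U \<omega> *\<^sub>R H (\<xi> n \<omega>))"
    if U: "U \<in> borel_measurable F" "\<And>\<omega>. \<omega> \<in> space P \<Longrightarrow> \<bar>U \<omega>\<bar> \<le> c" for U :: "'w \<Rightarrow> real"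
  proof -
    have c0: "0 \<le> c" using U(2) not_empty by (metis abs_ge_zero all_not_in_conv order_trans)
    have 1: "(LINT \<omega>|P. (U \<omega> + c) *\<^sub>R h (\<xi> (Suc n) \<omega>)) = (LINT \<omega>|P. (U \<omega> + c) *\<^sub>R H (\<xi> n \<omega>))"
      unfolding H_def
      by (rule markov_property_nonneg[OF chain K _ _ h h_bd, where c="2 * c"])
        (use U in \<open>auto simp: F_def[symmetric] abs_le_iff dest!: U(2)\<close>)
    have 2: "(LINT \<omega>|P. c *\<^sub>R h (\<xi> (Suc n) \<omega>)) = (LINT \<omega>|P. c *\<^sub>R H (\<xi> n \<omega>))"
      unfolding H_def
      by (rule markov_property_nonneg[OF chain K _ _ h h_bd, where c="c"]) (use c0 in auto)
    have e: "(LINT \<omega>|P. U \<omega> *\<^sub>R g (\<xi> i \<omega>)) = (LINT \<omega>|P. (U \<omega> + c) *\<^sub>R g (\<xi> i \<omega>)) - (LINT \<omega>|P. c *\<^sub>R g (\<xi> i \<omega>))"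
      if g: "g \<in> borel_measurable M" "\<And>x. x \<in> space M \<Longrightarrow> cmod (g x) \<le> b" for g :: "'a \<Rightarrow> complex" and i
    proof -
      have "(LINT \<omega>|P. U \<omega> *\<^sub>R g (\<xi> i \<omega>)) = (LINT \<omega>|P. (U \<omega> + c) *\<^sub>R g (\<xi> i \<omega>) - c *\<^sub>R g (\<xi> i \<omega>))"
        by (simp add: algebra_simps)
      also have "\<dots> = (LINT \<omega>|P. (U \<omega> + c) *\<^sub>R g (\<xi> i \<omega>)) - (LINT \<omega>|P. c *\<^sub>R g (\<xi> i \<omega>))"
      proof (rule Bochner_Integration.integral_diff)
        have "\<And>\<omega>. \<omega> \<in> space P \<Longrightarrow> \<bar>U \<omega> + c\<bar> \<le> 2 * c" using U(2) c0 by (force simp: abs_le_iff)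
        from int[OF _ this g] show "integrable P (\<lambda>\<omega>. (U \<omega> + c) *\<^sub>R g (\<xi> i \<omega>))" using U(1) by simp
        have "\<And>\<omega>. \<omega> \<in> space P \<Longrightarrow> \<bar>c\<bar> \<le> c" using c0 by simp
        from int[OF _ this g] show "integrable P (\<lambda>\<omega>. c *\<^sub>R g (\<xi> i \<omega>))" by simp
      qed
      finally show ?thesis .
    qed
    show ?thesis using 1 2 e[OF h h_bd] e[OF H H_bd] by simp
  qed
  have Re: "(LINT \<omega>|P. Re (Y \<omega>) *\<^sub>R h (\<xi> (Suc n) \<omega>)) = (LINT \<omega>|P. Re (Y \<omega>) *\<^sub>R H (\<xi> n \<omega>))"
    by (rule real) (auto intro: order_trans[OF abs_Re_le_cmod Y_bd])
  have Im: "(LINT \<omega>|P. Im (Y \<omega>) *\<^sub>R h (\<xi> (Suc n) \<omega>)) = (LINT \<omega>|P. Im (Y \<omega>) *\<^sub>R H (\<xi> n \<omega>))"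
    by (rule real) (auto intro: order_trans[OF abs_Im_le_cmod Y_bd])
  have e: "(LINT \<omega>|P. Y \<omega> * g (\<xi> i \<omega>)) =
      (LINT \<omega>|P. Re (Y \<omega>) *\<^sub>R g (\<xi> i \<omega>)) + \<i> * (LINT \<omega>|P. Im (Y \<omega>) *\<^sub>R g (\<xi> i \<omega>))"
    if g: "g \<in> borel_measurable M" "\<And>x. x \<in> space M \<Longrightarrow> cmod (g x) \<le> b" for g :: "'a \<Rightarrow> complex" and i
  proof -
    have "(LINT \<omega>|P. Y \<omega> * g (\<xi> i \<omega>)) = (LINT \<omega>|P. Re (Y \<omega>) *\<^sub>R g (\<xi> i \<omega>) + \<i> * (Im (Y \<omega>) *\<^sub>R g (\<xi> i \<omega>)))"
      by (intro Bochner_Integration.integral_cong refl)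
        (simp add: scaleR_conv_of_real complex_eq_iff algebra_simps)
    also have "\<dots> = (LINT \<omega>|P. Re (Y \<omega>) *\<^sub>R g (\<xi> i \<omega>)) + (LINT \<omega>|P. \<i> * (Im (Y \<omega>) *\<^sub>R g (\<xi> i \<omega>)))"
      by (intro Bochner_Integration.integral_add integrable_mult_right int[OF _ _ g])
        (auto intro: order_trans[OF abs_Re_le_cmod Y_bd] order_trans[OF abs_Im_le_cmod Y_bd])
    finally show ?thesis by (simp only: integral_mult_right_zero)
  qed
  show ?thesis using e[OF h h_bd] e[OF H H_bd] Re Im by (simp add: H_def)
qed

text \<open>Conditioning on the past replaces the last factor, which is \<open>E z g\<close> at
  \<open>\<xi> (Suc n)\<close>, by \<open>R (E z g)\<close> at \<open>\<xi> n\<close>. Steps are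
  thus peeled off from the end, which is why \<open>g\<close> varies in the induction. The sum
  starts at index 1, so \<open>\<xi> 0\<close> enters only as the starting point.\<close>

lemma (in markov_operator) exp_sum_eq_operator_power:
  assumes chain: "markov_chain P M K \<xi>"
    and f0: "\<And>x. x \<in> space M \<Longrightarrow> ev f0 x = complex_of_real (f x)"
    and E: "\<And>z g x. x \<in> space M \<Longrightarrow> ev (E z g) x = exp (z * ev f0 x) * ev g x"
  shows "(LINT \<omega>|P. exp (z * of_real (\<Sum>j=1..n. f (\<xi> j \<omega>))) * ev g (\<xi> n \<omega>))
    = (LINT \<omega>|P. ev (((\<lambda>g. R (E z g)) ^^ n) g) (\<xi> 0 \<omega>))"
proof (induction n arbitrary: g)
  case (Suc n)
  interpret prob_space P using chain by (simp add: markov_chain_def)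
  have \<xi>[measurable]: "\<xi> i \<in> P \<rightarrow>\<^sub>M M" for i using chain by (simp add: markov_chain_def)
  have f_meas[measurable]: "f \<in> borel_measurable M"
  proof -
    have "(\<lambda>x. Re (ev f0 x)) \<in> borel_measurable M" using ev_measurable[of f0] by measurable
    then show ?thesis by (rule measurable_cong[THEN iffD1, rotated]) (simp add: f0)
  qed
  have f_bd: "\<bar>f x\<bar> \<le> norm f0" if "x \<in> space M" for x
    using norm_ge[OF that, of f0] f0[OF that] by simp
  define Y where "Y = (\<lambda>\<omega>. exp (z * of_real (\<Sum>j=1..n. f (\<xi> j \<omega>))))"
  have sp: "\<xi> i \<omega> \<in> space M" if "\<omega> \<in> space P" for i \<omega> using measurable_space[OF \<xi> that] .
  have "(LINT \<omega>|P. exp (z * of_real (\<Sum>j=1..Suc n. f (\<xi> j \<omega>))) * ev g (\<xi> (Suc n) \<omega>))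
     = (LINT \<omega>|P. Y \<omega> * ev (E z g) (\<xi> (Suc n) \<omega>))"
    by (intro Bochner_Integration.integral_cong refl) (simp add: E sp f0 Y_def exp_add algebra_simps)
  also have "\<dots> = (LINT \<omega>|P. Y \<omega> * (LINT y|K (\<xi> n \<omega>). ev (E z g) y))"
  proof (rule markov_property_expectation[OF chain kernel])
    let ?V = "vimage_algebra (space P) (\<lambda>\<omega>. \<lambda>i\<in>{..n}. \<xi> i \<omega>) (\<Pi>\<^sub>M i\<in>{..n}. M)"
    have "(\<lambda>x. exp (z * of_real (\<Sum>j=1..n. f (x j)))) \<in> borel_measurable (\<Pi>\<^sub>M i\<in>{..n}. M)"
    proof -
      have "(\<lambda>x. f (x j)) \<in> borel_measurable (\<Pi>\<^sub>M i\<in>{..n}. M)" if "j \<in> {1..n}" for j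
        by (rule measurable_compose[OF _ f_meas]) (use that in \<open>auto intro!: measurable_component_singleton\<close>)
      then show ?thesis by measurable
    qed
    moreover have "(\<lambda>\<omega>. \<lambda>i\<in>{..n}. \<xi> i \<omega>) \<in> ?V \<rightarrow>\<^sub>M (\<Pi>\<^sub>M i\<in>{..n}. M)"
      by (rule measurable_vimage_algebra1) (auto simp: space_PiM sp)
    ultimately have "(\<lambda>\<omega>. exp (z * of_real (\<Sum>j=1..n. f ((\<lambda>i\<in>{..n}. \<xi> i \<omega>) j)))) \<in> borel_measurable ?V"
      by (rule measurable_compose[rotated])
    then show "Y \<in> borel_measurable ?V" by (simp add: Y_def)
    fix \<omega> assume w: "\<omega> \<in> space P"
    have "cmod (z * of_real (\<Sum>j=1..n. f (\<xi> j \<omega>))) \<le> cmod z * (\<Sum>j=1..n. norm f0)"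
      unfolding norm_mult norm_of_real
      by (intro mult_left_mono order_trans[OF sum_abs] sum_mono f_bd sp w) auto
    then show "cmod (Y \<omega>) \<le> exp (cmod z * (\<Sum>j=1..n. norm f0))"
      unfolding Y_def norm_exp_eq_Re exp_le_cancel_iff by (rule order_trans[OF complex_Re_le_cmod])
  qed (use ev_measurable norm_ge in auto)
  also have "\<dots> = (LINT \<omega>|P. Y \<omega> * ev (R (E z g)) (\<xi> n \<omega>))"
    by (intro Bochner_Integration.integral_cong refl) (simp add: ev_R sp)
  also have "\<dots> = (LINT \<omega>|P. ev (((\<lambda>g. R (E z g)) ^^ Suc n) g) (\<xi> 0 \<omega>))"
    unfolding Y_def Suc.IH
    using funpow_swap1[of "\<lambda>g. R (E z g)" n g] by simp
  finally show ?case .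
qed simp

section \<open>Logarithms of generating functions from consecutive ratios\<close>

text \<open>Terms that approach their limit geometrically have summable deviations. This is the
  source of the bounded error in the linear growth of the variance, where mere convergence would
  leave \<open>o(n)\<close>.\<close>

lemma sum_of_geometrically_converging:
  fixes d :: "nat \<Rightarrow> 'a::banach"
  assumes step: "\<And>k. norm (d (Suc k) - d k) \<le> K * \<theta> ^ k" and \<theta>: "0 \<le> \<theta>" "\<theta> < 1"
  obtains d' K' where "\<And>n. norm ((\<Sum>k<n. d k) - real n *\<^sub>R d') \<le> K'"
proof -
  have geo: "summable (\<lambda>k. K * \<theta> ^ k)" using \<theta> by (intro summable_mult summable_geometric) auto
  have summ: "summable (\<lambda>k. d (Suc k) - d k)"
    by (rule summable_comparison_test'[OF geo]) (use step in auto)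
  define d' where "d' = d 0 + (\<Sum>k. d (Suc k) - d k)"
  have tele: "(\<Sum>k<n. d (Suc k) - d k) = d n - d 0" for n by (rule sum_lessThan_telescope)
  have K0: "K \<ge> 0" using order_trans[OF norm_ge_zero step[of 0]] by simp
  have near: "norm (d n - d') \<le> K / (1 - \<theta>) * \<theta> ^ n" for n
  proof -
    have "d' - d n = (\<Sum>k. d (Suc (k + n)) - d (k + n))"
      using suminf_split_initial_segment[OF summ, of n] tele[of n] by (simp add: d'_def)
    also have "norm \<dots> \<le> (\<Sum>k. K * \<theta> ^ n * \<theta> ^ k)"
    proof (rule norm_suminf_le)
      show "norm (d (Suc (k + n)) - d (k + n)) \<le> K * \<theta> ^ n * \<theta> ^ k" for k
        using step[of "k + n"] by (simp add: power_add mult_ac)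
      show "summable (\<lambda>k. K * \<theta> ^ n * \<theta> ^ k)" using \<theta> by (intro summable_mult summable_geometric) auto
    qed
    also have "\<dots> = K / (1 - \<theta>) * \<theta> ^ n" using \<theta> by (simp add: suminf_mult suminf_geometric summable_geometric)
    finally show ?thesis by (simp add: norm_minus_commute)
  qed
  have "norm ((\<Sum>k<n. d k) - real n *\<^sub>R d') \<le> K / (1 - \<theta>) * (1 / (1 - \<theta>))" for n
  proof -
    have "(\<Sum>k<n. d k) - real n *\<^sub>R d' = (\<Sum>k<n. d k - d')" by (simp add: sum_subtractf sum_constant_scaleR)
    also have "norm \<dots> \<le> (\<Sum>k<n. K / (1 - \<theta>) * \<theta> ^ k)" by (rule sum_norm_le) (rule near)
    also have "\<dots> = K / (1 - \<theta>) * (\<Sum>k<n. \<theta> ^ k)" by (simp add: sum_distrib_left)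
    also have "\<dots> \<le> K / (1 - \<theta>) * (\<Sum>k. \<theta> ^ k)"
      using \<theta> K0 by (intro mult_left_mono sum_le_suminf summable_geometric) auto
    finally show ?thesis using \<theta> by (simp add: suminf_geometric)
  qed
  then show ?thesis by (rule that)
qed

text \<open>On the disk of radius \<open>2/5\<close> around 1 the modulus is at least
  \<open>3/5\<close> and the real part is positive, so the derivative \<open>1 / z\<close> is
  bounded by \<open>5/3\<close> and the branch cut is avoided.\<close>

lemma Ln_lipschitz:
  fixes a b :: complex
  assumes "norm (a - 1) \<le> 2/5" "norm (b - 1) \<le> 2/5"
  shows "norm (Ln a - Ln b) \<le> 5/3 * norm (a - b)"
proof (rule field_differentiable_bound[where S="cball 1 (2/5)"])
  fix z :: complex assume "z \<in> cball 1 (2/5)"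
  then have z: "norm (1 - z) \<le> 2/5" by (simp add: dist_norm)
  have nz: "norm z \<ge> 3/5" using z norm_triangle_ineq2[of 1 "1 - z"] by simp
  have "\<bar>Re (1 - z)\<bar> \<le> 2/5" using z abs_Re_le_cmod order_trans by blast
  then have "Re z > 0" unfolding minus_complex.simps one_complex.simps by linarith
  then have "z \<notin> \<real>\<^sub>\<le>\<^sub>0" by (auto simp: complex_nonpos_Reals_iff)
  then show "(Ln has_field_derivative 1 / z) (at z within cball 1 (2/5))"
    by (auto intro!: derivative_eq_intros simp: inverse_eq_divide)
  show "norm (1 / z) \<le> 5/3"
  proof -
    have "0 < norm z" using nz by linarith
    then show ?thesis using nz by (simp add: norm_divide field_simps)
  qed
qed (use assms in \<open>auto simp: dist_norm norm_minus_commute\<close>)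

text \<open>\<open>L n\<close> is the sum of the principal logarithms of the ratios. Each ratio
  stays within \<open>2/5\<close> of 1, so every summand is holomorphic and bounded by 1, with no
  choice of branch for the product. The second derivatives of the summands at 0 converge
  geometrically, hence their sum is linear in \<open>n\<close> up to a bounded error.\<close>

lemma log_of_ratios:
  fixes M :: "nat \<Rightarrow> complex \<Rightarrow> complex"
  assumes r: "r > 0" and \<theta>: "0 \<le> \<theta>" "\<theta> < 1"
    and hol: "\<And>n. M n holomorphic_on ball 0 r" and M0: "\<And>z. M 0 z = 1" and M_0: "\<And>n. M n 0 = 1"
    and nz: "\<And>n z. norm z < r \<Longrightarrow> M n z \<noteq> 0"
    and rat1: "\<And>n z. norm z < r \<Longrightarrow> norm (M (Suc n) z / M n z - 1) \<le> 2/5"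
    and rat2: "\<And>n z. norm z < r \<Longrightarrow>
      norm (M (Suc (Suc n)) z / M (Suc n) z - M (Suc n) z / M n z) \<le> 3 * \<theta> ^ n"
    and real: "\<And>n u. \<bar>u\<bar> < r \<Longrightarrow> \<exists>m>0. M n (of_real u) = of_real m"
  obtains L d C where "\<And>n. L n holomorphic_on ball 0 r"
    and "\<And>n z. norm z < r \<Longrightarrow> exp (L n z) = M n z"
    and "\<And>n z. norm z < r \<Longrightarrow> norm (L n z) \<le> real n"
    and "\<And>n. L n 0 = 0"
    and "\<And>n u. \<bar>u\<bar> < r \<Longrightarrow> L n (of_real u) \<in> \<real>"
    and "\<And>n. norm ((deriv ^^ 2) (L n) 0 - of_nat n * d) \<le> C"
proof -
  define lam where "lam = (\<lambda>n z. M (Suc n) z / M n z)"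
  define L where "L = (\<lambda>n z. \<Sum>k<n. Ln (lam k z))"
  have lam1: "norm (lam n z - 1) \<le> 2/5" if "norm z < r" for n z using rat1[OF that] by (simp add: lam_def)
  have nonneg: "lam n z \<notin> \<real>\<^sub>\<le>\<^sub>0" if "norm z < r" for n z
  proof -
    have "\<bar>Re (lam n z - 1)\<bar> \<le> 2/5" using lam1[OF that] abs_Re_le_cmod order_trans by blast
    then have "Re (lam n z) > 0" unfolding minus_complex.simps one_complex.simps by linarith
    then show ?thesis by (auto simp: complex_nonpos_Reals_iff)
  qed
  have hol_lam: "lam n holomorphic_on ball 0 r" for n
    unfolding lam_def by (intro holomorphic_intros hol) (use nz in \<open>auto simp: dist_norm\<close>)
  have hol_Ln: "(\<lambda>z. Ln (lam n z)) holomorphic_on ball 0 r" for n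
    by (intro holomorphic_intros hol_lam) (use nonneg in \<open>auto simp: dist_norm\<close>)
  have lam_nz: "lam n z \<noteq> 0" if "norm z < r" for n z using nz[OF that] by (simp add: lam_def)
  have 2: "exp (L n z) = M n z" if "norm z < r" for n z
    by (induction n) (use lam_nz[OF that] nz[OF that] in \<open>auto simp: L_def M0 exp_add lam_def\<close>)
  have nLn: "norm (Ln (lam n z)) \<le> 1" if "norm z < r" for n z
    using norm_Ln_le[of "lam n z - 1"] lam1[OF that, of n] by simp
  \<comment> \<open>Second derivatives of the increments of \<open>L\<close>. Cauchy's inequality on
    the circle of radius \<open>r/2\<close> carries the geometric convergence of the ratios over to
    them; the 5 is \<open>3 * 5/3\<close>, from \<open>rat2\<close> and
    \<open>Ln_lipschitz\<close>.\<close>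
  define d where "d = (\<lambda>k. (deriv ^^ 2) (\<lambda>z. Ln (lam k z)) 0)"
  have sub: "ball 0 (r/2) \<subseteq> ball (0::complex) r" "cball 0 (r/2) \<subseteq> ball (0::complex) r" using r by auto
  have step: "norm (d (Suc k) - d k) \<le> (2 * 5 / (r/2)\<^sup>2) * \<theta> ^ k" for k
  proof -
    let ?h = "\<lambda>z. Ln (lam (Suc k) z) - Ln (lam k z)"
    have "d (Suc k) - d k = (deriv ^^ 2) ?h 0"
      unfolding d_def by (rule higher_deriv_diff[OF hol_Ln hol_Ln open_ball, symmetric]) (use r in auto)
    also have "norm \<dots> \<le> fact 2 * (5 * \<theta> ^ k) / (r/2)\<^sup>2"
    proof (rule Cauchy_inequality)
      show "?h holomorphic_on ball 0 (r/2)"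
        by (intro holomorphic_on_diff holomorphic_on_subset[OF hol_Ln sub(1)])
      show "continuous_on (cball 0 (r/2)) ?h"
        by (intro continuous_on_diff holomorphic_on_imp_continuous_on holomorphic_on_subset[OF hol_Ln sub(2)])
      fix x :: complex assume "norm (0 - x) = r/2"
      then have x: "norm x < r" using r by simp
      show "norm (?h x) \<le> 5 * \<theta> ^ k"
        using Ln_lipschitz[OF lam1[OF x, of "Suc k"] lam1[OF x, of k]] rat2[OF x, of k] by (simp add: lam_def)
    qed (use r in auto)
    finally show ?thesis by simp
  qed
  obtain d' K' where d': "\<And>n. norm ((\<Sum>k<n. d k) - real n *\<^sub>R d') \<le> K'"
    using sum_of_geometrically_converging[OF step \<theta>] by blast
  have hd: "(deriv ^^ 2) (L n) 0 = (\<Sum>k<n. d k)" for n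
  proof (induction n)
    case 0
    have "(deriv ^^ 2) (\<lambda>z. 0 :: complex) 0 = 0" by simp
    then show ?case by (simp add: L_def numeral_2_eq_2)
  next
    case (Suc n)
    have holL: "L n holomorphic_on ball 0 r" unfolding L_def by (intro holomorphic_on_sum hol_Ln)
    have "L (Suc n) = (\<lambda>z. L n z + Ln (lam n z))" by (simp add: L_def fun_eq_iff)
    then have "(deriv ^^ 2) (L (Suc n)) 0 = (deriv ^^ 2) (\<lambda>z. L n z + Ln (lam n z)) 0" by simp
    also have "\<dots> = (deriv ^^ 2) (L n) 0 + d n"
      unfolding d_def by (rule higher_deriv_add[OF holL hol_Ln open_ball]) (use r in auto)
    finally show ?case using Suc by simp
  qed
  show ?thesis
  proof (rule that)
    show "L n holomorphic_on ball 0 r" for n unfolding L_def by (intro holomorphic_on_sum hol_Ln)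
    show "norm (L n z) \<le> real n" if "norm z < r" for n z
      unfolding L_def using sum_norm_le[of "{..<n}" "\<lambda>k. Ln (lam k z)" "\<lambda>_. 1"] nLn[OF that] by simp
    show "L n 0 = 0" for n by (simp add: L_def lam_def M_0)
    show "L n (of_real u) \<in> \<real>" if u: "\<bar>u\<bar> < r" for n u
      unfolding L_def
    proof (rule sum_in_Reals)
      fix k
      obtain m1 m2 where m: "m1 > 0" "M (Suc k) (of_real u) = of_real m1" "m2 > 0" "M k (of_real u) = of_real m2"
        using real[OF u, of k] real[OF u, of "Suc k"] by blast
      have "lam k (of_real u) = of_real (m1 / m2)" by (simp add: lam_def m)
      then have "Ln (lam k (of_real u)) = of_real (ln (m1 / m2))" using m Ln_of_real[of "m1 / m2"] by simp
      then show "Ln (lam k (of_real u)) \<in> \<real>" by simp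
    qed
    show "norm ((deriv ^^ 2) (L n) 0 - of_nat n * d') \<le> K'" for n
      using d'[of n] by (simp add: hd scaleR_conv_of_real)
  qed (use 2 in auto)
qed

text \<open>Differentiation under the integral. As \<open>X\<close> is bounded, the second-order
  Taylor remainder of the exponential bounds the error of the difference quotient by a multiple of
  \<open>cmod h\<close>, uniformly over the space. The weight \<open>W\<close> allows a second
  application to the first derivative.\<close>

lemma (in prob_space) bounded_exp_moment_derivative:
  fixes X :: "'a \<Rightarrow> real" and W :: "'a \<Rightarrow> complex"
  assumes X[measurable]: "X \<in> borel_measurable M" and W[measurable]: "W \<in> borel_measurable M"
    and X_bd: "\<And>x. x \<in> space M \<Longrightarrow> \<bar>X x\<bar> \<le> b" and W_bd: "\<And>x. x \<in> space M \<Longrightarrow> cmod (W x) \<le> c"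
  shows "((\<lambda>z. LINT x|M. W x * exp (z * of_real (X x))) has_field_derivative
    (LINT x|M. W x * of_real (X x) * exp (z * of_real (X x)))) (at z)"
proof -
  have b0: "b \<ge> 0" and c0: "c \<ge> 0"
    using not_empty X_bd W_bd by (metis abs_ge_zero all_not_in_conv order_trans norm_ge_zero)+
  define K where "K = c * exp (cmod z * b) * (b\<^sup>2 * exp b)"
  have ex: "cmod (exp (w * of_real (X x))) \<le> exp (cmod w * b)" if "x \<in> space M" for w x
  proof -
    have "cmod (w * of_real (X x)) \<le> cmod w * b"
      unfolding norm_mult norm_of_real by (intro mult_left_mono X_bd that) auto
    then show ?thesis unfolding norm_exp_eq_Re exp_le_cancel_iff using complex_Re_le_cmod order_trans by blast
  qed
  have int: "integrable M (\<lambda>x. U x * exp (w * of_real (X x)))"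
    if "U \<in> borel_measurable M" "\<And>x. x \<in> space M \<Longrightarrow> cmod (U x) \<le> a" for U a w
    by (rule integrable_bounded[where b="a * exp (cmod w * b)"])
      (use that ex in \<open>auto simp del: norm_exp_eq_Re simp: norm_mult intro!: mult_mono intro: order_trans[OF norm_ge_zero]\<close>)
  have intW: "integrable M (\<lambda>x. W x * exp (w * of_real (X x)))" for w by (rule int[OF W W_bd])
  have intWX: "integrable M (\<lambda>x. W x * of_real (X x) * exp (w * of_real (X x)))" for w
  proof (rule int)
    show "cmod (W x * of_real (X x)) \<le> c * b" if "x \<in> space M" for x
      using X_bd[OF that] W_bd[OF that] c0 by (auto simp: norm_mult intro!: mult_mono)
  qed simp
  let ?F = "\<lambda>z. LINT x|M. W x * exp (z * of_real (X x))"
  let ?D = "LINT x|M. W x * of_real (X x) * exp (z * of_real (X x))"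
  have bound: "cmod ((?F (z + h) - ?F z) / h - ?D) \<le> K * cmod h" if h: "h \<noteq> 0" "cmod h \<le> 1" for h
  proof -
    have *: "(?F (z + h) - ?F z) / h - ?D =
      (LINT x|M. (W x * exp ((z + h) * of_real (X x)) - W x * exp (z * of_real (X x))) / h - W x * of_real (X x) * exp (z * of_real (X x)))"
      by (simp add: Bochner_Integration.integral_diff intW intWX)
    show ?thesis unfolding *
    proof (rule order_trans[OF integral_norm_bound] , rule order_trans[OF integral_mono[where g="\<lambda>_. K * cmod h"]])
      show "integrable M (\<lambda>x. norm ((W x * exp ((z + h) * of_real (X x)) - W x * exp (z * of_real (X x))) / h - W x * of_real (X x) * exp (z * of_real (X x))))"
        by (intro integrable_norm Bochner_Integration.integrable_diff integrable_divide intW intWX)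
      fix x assume x: "x \<in> space M"
      define y where "y = h * complex_of_real (X x)"
      have ny: "cmod y \<le> cmod h * b" unfolding y_def norm_mult norm_of_real by (intro mult_left_mono X_bd x) auto
      also have "\<dots> \<le> b" using h(2) b0 by (simp add: mult_left_le_one_le)
      finally have nyb: "cmod y \<le> b" .
      have eq: "(W x * exp ((z + h) * of_real (X x)) - W x * exp (z * of_real (X x))) / h - W x * of_real (X x) * exp (z * of_real (X x))
        = W x * exp (z * of_real (X x)) * ((exp y - (\<Sum>i\<le>1. y ^ i / fact i)) / h)"
        using h by (simp add: y_def exp_add field_simps)
      have "cmod (exp y - (\<Sum>i\<le>1. y ^ i / fact i)) \<le> exp \<bar>Re y\<bar> * cmod y ^ Suc 1 / fact 1" by (rule Taylor_exp)
      also have "\<dots> \<le> exp b * (cmod h * b)\<^sup>2"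
        using nyb ny abs_Re_le_cmod[of y] by (auto simp: power2_eq_square intro!: mult_mono)
      finally have t: "cmod (exp y - (\<Sum>i\<le>1. y ^ i / fact i)) \<le> exp b * (cmod h * b)\<^sup>2" .
      have "cmod ((exp y - (\<Sum>i\<le>1. y ^ i / fact i)) / h) \<le> exp b * b\<^sup>2 * cmod h"
        using t h by (simp add: norm_divide pos_divide_le_eq power2_eq_square mult_ac)
      then have "cmod (W x * exp (z * of_real (X x)) * ((exp y - (\<Sum>i\<le>1. y ^ i / fact i)) / h))
         \<le> c * exp (cmod z * b) * (exp b * b\<^sup>2 * cmod h)"
        unfolding norm_mult using W_bd[OF x] ex[OF x, of z] c0 by (intro mult_mono) auto
      then show "cmod ((W x * exp ((z + h) * of_real (X x)) - W x * exp (z * of_real (X x))) / h - W x * of_real (X x) * exp (z * of_real (X x)))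
         \<le> K * cmod h" unfolding eq by (simp add: K_def mult_ac)
    qed (auto simp: prob_space)
  qed
  show ?thesis
    unfolding DERIV_def
  proof (rule LIM_zero_cancel, rule Lim_null_comparison[where g="\<lambda>h. K * cmod h"])
    have "eventually (\<lambda>h::complex. h \<in> ball 0 1 - {0}) (at 0)"
      by (rule eventually_at_in_open) auto
    then show "\<forall>\<^sub>F h in at 0. cmod ((?F (z + h) - ?F z) / h - ?D) \<le> K * cmod h"
      by eventually_elim (use bound in auto)
    have "((\<lambda>h::complex. K * cmod h) \<longlongrightarrow> K * cmod 0) (at 0)" by (intro tendsto_intros)
    then show "((\<lambda>h::complex. K * cmod h) \<longlongrightarrow> 0) (at 0)" by simp
  qed
qed

section \<open>A contracting seminorm for the chain and the cumulants of its partial sums\<close>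

context markov_operator
begin

text \<open>The exponential of \<open>0 * g\<close> is the constant 1; \<open>undefined\<close>
  serves as some element \<open>g\<close>.\<close>

lemma constant_member: "member (\<lambda>_. c)"
proof -
  obtain g where "\<forall>x\<in>space M. ev g x = exp (0 * ev undefined x)"
    using exp_member[of 0 undefined] unfolding member_def by blast
  then show ?thesis unfolding member_def by (intro exI[of _ "c *\<^sub>C g"]) (simp add: ev_scaleC)
qed

lemma ev_constant: "x \<in> space M \<Longrightarrow> ev (elem (\<lambda>_. c)) x = c"
  by (rule ev_elem[OF constant_member])

lemma space_nonempty: "space M \<noteq> {}"
proof -
  obtain \<mu> where "stationary M K \<mu>" using spectral_gap by blast
  then have "prob_space \<mu>" "sets \<mu> = sets M" by (auto simp: stationary_def space_prob_algebra)
  then show ?thesis using prob_space.not_empty by (metis sets_eq_imp_space_eq)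
qed

text \<open>\<open>bounded_linear\<close> speaks of real scalars. Complex homogeneity comes from the
  representation of \<open>R\<close> as an integral against the kernel.\<close>

lemma R_add: "R (g + h) = R g + R h" and R_scaleC: "R (c *\<^sub>C g) = c *\<^sub>C R g"
proof -
  show "R (g + h) = R g + R h" using R_bounded by (simp add: bounded_linear.linear linear_add)
  show "R (c *\<^sub>C g) = c *\<^sub>C R g"
  proof (rule ev_inject)
    fix x assume x: "x \<in> space M"
    then have "space (K x) = space M"
      using measurable_space[OF kernel x] by (auto simp: space_prob_algebra dest: sets_eq_imp_space_eq)
    then have "(LINT y|K x. ev (c *\<^sub>C g) y) = (LINT y|K x. c * ev g y)"
      by (intro Bochner_Integration.integral_cong) (auto simp: ev_scaleC)
    then show "ev (R (c *\<^sub>C g)) x = ev (c *\<^sub>C R g) x" using x by (simp add: ev_R ev_scaleC)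
  qed
qed

text \<open>\<open>N g\<close> is the supremum over \<open>n\<close> of the distance of
  \<open>(R ^^ n) g\<close> to its limit, divided by \<open>\<delta> ^ n\<close>. The weights make a
  single application of \<open>R\<close> contract by \<open>\<delta>\<close>; the prefactor
  \<open>C\<close> of the spectral gap, which may exceed 1, moves into the comparison of
  \<open>N\<close> with the norm.\<close>

lemma stationary_seminorm:
  obtains \<delta> D :: real and N :: "'b \<Rightarrow> real" and v :: "'b \<Rightarrow> complex"
  where "0 < \<delta>" "\<delta> < 1" "D \<ge> 1"
    and "\<And>g h. N (g + h) \<le> N g + N h" and "\<And>c g. N (c *\<^sub>C g) = norm c * N g"
    and "\<And>g. N (R g) \<le> \<delta> * N g" and "\<And>g. N g \<le> D * norm g" and "N (elem (\<lambda>_. 1)) = 0"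
    and "\<And>g. norm (R g - g) \<le> 2 * N g"
    and "\<And>g. norm (g - v g *\<^sub>C elem (\<lambda>_. 1)) \<le> N g"
proof -
  obtain \<mu> \<delta> C where \<delta>: "0 < \<delta>" "\<delta> < 1" "0 < C"
    and gap: "\<And>g n. norm ((R ^^ n) g - elem (\<lambda>_. LINT y|\<mu>. ev g y)) \<le> C * norm g * \<delta> ^ n"
    using spectral_gap by blast
  define one where "one = elem (\<lambda>_. 1)"
  define v where "v = (\<lambda>g. LINT y|\<mu>. ev g y)"
  have el: "elem (\<lambda>_. c) = c *\<^sub>C one" for c
    by (rule ev_inject) (simp add: ev_constant ev_scaleC one_def)
  have gap': "norm ((R ^^ n) g - v g *\<^sub>C one) \<le> C * norm g * \<delta> ^ n" for g n
    using gap[of n g] unfolding el v_def .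
  have lim: "(\<lambda>n. (R ^^ n) g) \<longlonglongrightarrow> v g *\<^sub>C one" for g
  proof (rule LIM_zero_cancel, rule Lim_null_comparison[where g="\<lambda>n. C * norm g * \<delta> ^ n"])
    show "(\<lambda>n. C * norm g * \<delta> ^ n) \<longlonglongrightarrow> 0"
      using \<delta> by (intro tendsto_mult_right_zero LIMSEQ_power_zero) auto
  qed (use gap' in auto)
  have scale_inj: "a = b" if "a *\<^sub>C one = b *\<^sub>C one" for a b
  proof -
    obtain x where x: "x \<in> space M" using space_nonempty by blast
    then show ?thesis using arg_cong[OF that, of "\<lambda>g. ev g x"] by (simp add: ev_scaleC one_def ev_constant)
  qed
  \<comment> \<open>Invariance and complex linearity of \<open>v\<close> are read off from the
    uniqueness of the limit of \<open>(R ^^ n) g\<close>.\<close>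
  have v_R: "v (R g) = v g" for g
  proof (rule scale_inj[OF LIMSEQ_unique])
    show "(\<lambda>n. (R ^^ n) (R g)) \<longlonglongrightarrow> v (R g) *\<^sub>C one" by (rule lim)
    show "(\<lambda>n. (R ^^ n) (R g)) \<longlonglongrightarrow> v g *\<^sub>C one"
      using LIMSEQ_Suc[OF lim[of g]] by (simp add: funpow_swap1)
  qed
  have Rn_add: "(R ^^ n) (g + h) = (R ^^ n) g + (R ^^ n) h"
    and Rn_scale: "(R ^^ n) (c *\<^sub>C g) = c *\<^sub>C (R ^^ n) g" for n g h c
    by (induction n) (auto simp: R_add R_scaleC)
  have v_add: "v (g + h) = v g + v h" for g h
  proof (rule scale_inj[OF LIMSEQ_unique[OF lim]])
    show "(\<lambda>n. (R ^^ n) (g + h)) \<longlonglongrightarrow> (v g + v h) *\<^sub>C one"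
      unfolding Rn_add scaleC_add_left by (intro tendsto_add lim)
  qed
  have scaleC_bl: "bounded_linear (\<lambda>g::'b. c *\<^sub>C g)" for c
    by (intro bounded_linear_intro[where K="cmod c"])
      (auto simp: scaleC_add_right norm_scaleC scaleC_of_real[symmetric] scaleC_scaleC mult.commute)
  have v_scale: "v (c *\<^sub>C g) = c * v g" for c g
  proof (rule scale_inj[OF LIMSEQ_unique[OF lim]])
    show "(\<lambda>n. (R ^^ n) (c *\<^sub>C g)) \<longlonglongrightarrow> (c * v g) *\<^sub>C one"
      unfolding Rn_scale scaleC_scaleC[symmetric] by (rule bounded_linear.tendsto[OF scaleC_bl lim])
  qed
  define q where "q = (\<lambda>g n. norm ((R ^^ n) g - v g *\<^sub>C one) / \<delta> ^ n)"
  have q_le: "q g n \<le> C * norm g" for g n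
    using gap'[of n g] \<delta> by (simp add: q_def pos_divide_le_eq)
  define N where "N = (\<lambda>g. SUP n. q g n)"
  have bdd: "bdd_above (range (q g))" for g by (intro bdd_aboveI2[where M="C * norm g"] q_le)
  have N_ge: "q g n \<le> N g" for g n unfolding N_def by (rule cSUP_upper[OF _ bdd]) auto
  have N_leI: "N g \<le> a" if "\<And>n. q g n \<le> a" for g a unfolding N_def by (rule cSUP_least) (use that in auto)
  have q0: "norm (g - v g *\<^sub>C one) \<le> N g" for g using N_ge[of g 0] by (simp add: q_def)
  have one_fix: "R one = one"
  proof (rule ev_inject)
    fix x assume x: "x \<in> space M"
    have Kx: "prob_space (K x)" "space (K x) = space M"
      using measurable_space[OF kernel x] by (auto simp: space_prob_algebra dest: sets_eq_imp_space_eq)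
    have "ev (R one) x = (LINT y|K x. 1)" unfolding ev_R[OF x]
      by (intro Bochner_Integration.integral_cong) (auto simp: Kx one_def ev_constant)
    then show "ev (R one) x = ev one x"
      using x prob_space.prob_space[OF Kx(1)] Kx(2) by (simp add: one_def ev_constant)
  qed
  have Rn_one: "(R ^^ n) one = one" for n by (induction n) (auto simp: one_fix)
  have v_one: "v one = 1"
    by (rule scale_inj[OF LIMSEQ_unique[OF lim[of one]]]) (simp add: Rn_one)
  have R_near: "norm (R g - g) \<le> 2 * N g" for g
  proof -
    have "norm (R g - v g *\<^sub>C one) \<le> \<delta> * N g"
      using N_ge[of g 1] \<delta> by (simp add: q_def pos_divide_le_eq mult.commute)
    also have "\<dots> \<le> 1 * N g" using order_trans[OF norm_ge_zero q0] \<delta> by (intro mult_right_mono) auto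
    finally show ?thesis using q0[of g] norm_triangle_ineq4[of "R g - v g *\<^sub>C one" "g - v g *\<^sub>C one"] by simp
  qed
  have N_R: "N (R g) \<le> \<delta> * N g" for g
  proof (rule N_leI)
    fix n
    have "q (R g) n = \<delta> * q g (Suc n)" using \<delta> by (simp add: q_def v_R funpow_swap1)
    also have "\<dots> \<le> \<delta> * N g" using \<delta> N_ge by (intro mult_left_mono) auto
    finally show "q (R g) n \<le> \<delta> * N g" .
  qed
  have N_add: "N (g + h) \<le> N g + N h" for g h
  proof (rule N_leI)
    fix n
    have "norm ((R ^^ n) (g + h) - v (g + h) *\<^sub>C one) \<le> norm ((R ^^ n) g - v g *\<^sub>C one) + norm ((R ^^ n) h - v h *\<^sub>C one)"
      using norm_triangle_ineq[of "(R ^^ n) g - v g *\<^sub>C one" "(R ^^ n) h - v h *\<^sub>C one"]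
      by (simp add: Rn_add v_add scaleC_add_left algebra_simps)
    then have "q (g + h) n \<le> q g n + q h n" using \<delta> by (simp add: q_def divide_right_mono flip: add_divide_distrib)
    then show "q (g + h) n \<le> N g + N h" using N_ge[of g n] N_ge[of h n] by linarith
  qed
  have q_scale: "q (c *\<^sub>C g) n = cmod c * q g n" for c g n
  proof -
    have "(R ^^ n) (c *\<^sub>C g) - v (c *\<^sub>C g) *\<^sub>C one = c *\<^sub>C ((R ^^ n) g - v g *\<^sub>C one)"
      using linear_diff[OF bounded_linear.linear[OF scaleC_bl[of c]]] by (simp add: Rn_scale v_scale scaleC_scaleC)
    then show ?thesis by (simp add: q_def norm_scaleC)
  qed
  have N_scale_le: "N (c *\<^sub>C g) \<le> cmod c * N g" for c g
    by (rule N_leI) (simp add: q_scale mult_left_mono N_ge)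
  have N_scale: "N (c *\<^sub>C g) = cmod c * N g" for c g
  proof (cases "c = 0")
    case False
    have "N (inverse c *\<^sub>C c *\<^sub>C g) \<le> cmod (inverse c) * N (c *\<^sub>C g)" by (rule N_scale_le)
    then have "cmod c * N g \<le> N (c *\<^sub>C g)" using False by (simp add: scaleC_scaleC norm_inverse norm_divide field_simps)
    then show ?thesis using N_scale_le[of c g] by simp
  next
    case True
    then show ?thesis using N_scale_le[of c g] order_trans[OF norm_ge_zero q0, of "c *\<^sub>C g"] by simp
  qed
  have N_one: "N one = 0"
    using N_leI[of one 0] order_trans[OF norm_ge_zero q0, of one] by (simp add: q_def Rn_one v_one)
  have N_le: "N g \<le> max 1 C * norm g" for g
    by (rule N_leI) (meson q_le order_trans max.cobounded2 mult_right_mono norm_ge_zero)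
  show ?thesis
    by (rule that[of \<delta> "max 1 C" N v])
      (use \<delta> N_add N_scale N_R N_le N_one R_near q0 in \<open>auto simp: one_def\<close>)
qed

text \<open>This is the interface between the chain and the limit theorems: everything used later
  about \<open>S n\<close> is the existence of a holomorphic logarithm of size \<open>O(n)\<close>
  on a fixed disk, together with the linear growth of the variance.\<close>

lemma log_moment_generating_function:
  fixes P :: "'w measure" and S :: "nat \<Rightarrow> 'w \<Rightarrow> real"
  assumes chain: "markov_chain P M K \<xi>"
    and f0: "\<And>x. x \<in> space M \<Longrightarrow> ev f0 x = complex_of_real (f x)"
    and S: "S = centered_sum P \<xi> f"
  obtains r C d L where "0 < r" "0 \<le> C"
    and "\<And>n. S n \<in> borel_measurable P"
    and "\<And>n \<omega>. \<omega> \<in> space P \<Longrightarrow> \<bar>S n \<omega>\<bar> \<le> C * real n"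
    and "\<And>n. L n holomorphic_on ball 0 r"
    and "\<And>n z. norm z < r \<Longrightarrow> exp (L n z) = (LINT \<omega>|P. exp (z * of_real (S n \<omega>)))"
    and "\<And>n z. norm z < r \<Longrightarrow> norm (L n z) \<le> C * real n"
    and "\<And>n. L n 0 = 0" and "\<And>n. deriv (L n) 0 = 0"
    and "\<And>n. (deriv ^^ 2) (L n) 0 = of_real (LINT \<omega>|P. (S n \<omega>)\<^sup>2)"
    and "\<And>n u. \<bar>u\<bar> < r \<Longrightarrow> L n (of_real u) \<in> \<real>"
    and "\<And>n. \<bar>(LINT \<omega>|P. (S n \<omega>)\<^sup>2) - real n * d\<bar> \<le> C"
    and "\<And>n. (LINT \<omega>|P. S n \<omega>) = 0"
proof -
  interpret prob_space P using chain by (simp add: markov_chain_def)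
  have \<xi>[measurable]: "\<xi> i \<in> P \<rightarrow>\<^sub>M M" for i using chain by (simp add: markov_chain_def)
  have sp: "\<xi> i \<omega> \<in> space M" if "\<omega> \<in> space P" for i \<omega> using measurable_space[OF \<xi> that] .
  have f_meas[measurable]: "f \<in> borel_measurable M"
  proof -
    have "(\<lambda>x. Re (ev f0 x)) \<in> borel_measurable M" using ev_measurable[of f0] by measurable
    then show ?thesis by (rule measurable_cong[THEN iffD1, rotated]) (simp add: f0)
  qed
  define b where "b = norm f0"
  have f_bd: "\<bar>f x\<bar> \<le> b" if "x \<in> space M" for x
    using norm_ge[OF that, of f0] f0[OF that] by (simp add: b_def)
  have b0: "b \<ge> 0" by (simp add: b_def)
  define T where "T = (\<lambda>n \<omega>. \<Sum>j=1..n. f (\<xi> j \<omega>))"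
  have T_meas[measurable]: "T n \<in> borel_measurable P" for n unfolding T_def by measurable
  have T_bd: "\<bar>T n \<omega>\<bar> \<le> b * real n" if "\<omega> \<in> space P" for n \<omega>
  proof -
    have "\<bar>T n \<omega>\<bar> \<le> (\<Sum>j=1..n. b)" unfolding T_def by (intro order_trans[OF sum_abs] sum_mono f_bd sp that)
    then show ?thesis by (simp add: mult.commute)
  qed
  have intf: "integrable P (\<lambda>\<omega>. f (\<xi> j \<omega>))" for j by (rule integrable_bounded[where b=b]) (use f_bd sp in auto)
  define a where "a = (\<lambda>n. LINT \<omega>|P. T n \<omega>)"
  have intT: "integrable P (T n)" for n by (rule integrable_bounded[where b="b * real n"]) (use T_bd in auto)
  have S_eq: "S n \<omega> = T n \<omega> - a n" for n \<omega>
    unfolding S centered_sum_def T_def a_def by (simp add: sum_subtractf intf)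
  have [measurable]: "S n \<in> borel_measurable P" for n unfolding S_eq[abs_def] by measurable
  have a_bd: "\<bar>a n\<bar> \<le> b * real n" for n
  proof -
    have "\<bar>a n\<bar> \<le> (LINT \<omega>|P. \<bar>T n \<omega>\<bar>)" unfolding a_def by (rule integral_abs_bound)
    also have "\<dots> \<le> (LINT \<omega>|P. b * real n)" by (intro integral_mono) (use T_bd intT in auto)
    finally show ?thesis by (simp add: prob_space)
  qed
  have S_bd: "\<bar>S n \<omega>\<bar> \<le> 2 * b * real n" if "\<omega> \<in> space P" for n \<omega>
    using T_bd[OF that, of n] a_bd[of n] unfolding S_eq by linarith
  have ES: "(LINT \<omega>|P. S n \<omega>) = 0" for n unfolding S_eq by (simp add: intT prob_space a_def)
  obtain E C where C: "C \<ge> 0" and E: "\<And>z g x. x \<in> space M \<Longrightarrow> ev (E z g) x = exp (z * ev f0 x) * ev g x"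
    and E_near: "\<And>z g. norm z \<le> 1 \<Longrightarrow> norm (E z g - g) \<le> C * norm z * norm g"
    by (rule exp_mult_operator[where f=f0]) (rule that, assumption+)
  define one where "one = elem (\<lambda>_. 1)"
  have ev_one: "x \<in> space M \<Longrightarrow> ev one x = 1" for x by (simp add: one_def ev_constant)
  \<comment> \<open>Expectation under the initial law; with it \<open>l ((E' z ^^ n) one)\<close> is
    the moment generating function of the uncentred sum for an arbitrary start.\<close>
  define l where "l = (\<lambda>g. LINT \<omega>|P. ev g (\<xi> 0 \<omega>))"
  define E' where "E' = (\<lambda>z g. R (E z g))"
  have int_ev: "integrable P (\<lambda>\<omega>. ev g (\<xi> 0 \<omega>))" for g
    by (rule integrable_bounded[where b="norm g"]) (use norm_ge sp measurable_compose[OF \<xi> ev_measurable] in auto)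
  have l_add: "l (g + h) = l g + l h" for g h
  proof -
    have "l (g + h) = (LINT \<omega>|P. ev g (\<xi> 0 \<omega>) + ev h (\<xi> 0 \<omega>))"
      unfolding l_def by (intro Bochner_Integration.integral_cong) (auto simp: ev_add sp)
    then show ?thesis by (simp add: l_def int_ev)
  qed
  have l_scale: "l (c *\<^sub>C g) = c * l g" for c g
  proof -
    have "l (c *\<^sub>C g) = (LINT \<omega>|P. c * ev g (\<xi> 0 \<omega>))"
      unfolding l_def by (intro Bochner_Integration.integral_cong) (auto simp: ev_scaleC sp)
    then show ?thesis by (simp add: l_def)
  qed
  have l_bd: "norm (l g) \<le> norm g" for g
  proof -
    have "norm (l g) \<le> (LINT \<omega>|P. norm (ev g (\<xi> 0 \<omega>)))" unfolding l_def by (rule integral_norm_bound)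
    also have "\<dots> \<le> (LINT \<omega>|P. norm g)" by (intro integral_mono) (use norm_ge sp int_ev in auto)
    finally show ?thesis by (simp add: prob_space)
  qed
  have l_one: "l one = 1"
  proof -
    have "l one = (LINT \<omega>|P. 1)" unfolding l_def by (intro Bochner_Integration.integral_cong) (auto simp: ev_one sp)
    then show ?thesis by (simp add: prob_space)
  qed
  obtain \<delta> D N v where \<delta>: "0 < \<delta>" "\<delta> < 1" and D: "D \<ge> 1"
    and N_add: "\<And>g h. N (g + h) \<le> N g + N h" and N_scale: "\<And>c g. N (c *\<^sub>C g) = norm c * N g"
    and N_R: "\<And>g. N (R g) \<le> \<delta> * N g" and N_le: "\<And>g. N g \<le> D * norm g" and N_one: "N one = 0"
    and R_near: "\<And>g. norm (R g - g) \<le> 2 * N g"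
    and v: "\<And>g. norm (g - v g *\<^sub>C one) \<le> N g"
  proof (rule stationary_seminorm[folded one_def])
    fix \<delta> D and N :: "'b \<Rightarrow> real" and v
    assume "0 < \<delta>" "\<delta> < 1" "D \<ge> 1"
      "\<And>g h. N (g + h) \<le> N g + N h" "\<And>c g. N (c *\<^sub>C g) = norm c * N g"
      "\<And>g. N (R g) \<le> \<delta> * N g" "\<And>g. N g \<le> D * norm g" "N one = 0"
      "\<And>g. norm (R g - g) \<le> 2 * N g" "\<And>g. norm (g - v g *\<^sub>C one) \<le> N g"
    then show thesis by (rule that[of \<delta> D N v])
  qed
  have E_add: "E' z (g + h) = E' z g + E' z h" for z g h
  proof -
    have "E z (g + h) = E z g + E z h" by (rule ev_inject) (simp add: E ev_add algebra_simps)
    then show ?thesis by (simp add: E'_def R_add)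
  qed
  have E_scale: "E' z (c *\<^sub>C g) = c *\<^sub>C E' z g" for z c g
  proof -
    have "E z (c *\<^sub>C g) = c *\<^sub>C E z g" by (rule ev_inject) (simp add: E ev_scaleC)
    then show ?thesis by (simp add: E'_def R_scaleC)
  qed
  obtain c where c: "c > 0" "\<And>g. norm (R g) \<le> norm g * c"
    using bounded_linear.pos_bounded[OF R_bounded] by auto
  have pert: "norm (E' z g - R g) \<le> (c * C) * norm z * norm g" if "norm z \<le> 1" for z g
  proof -
    have "E' z g - R g = R (E z g - g)" unfolding E'_def
      by (rule linear_diff[OF bounded_linear.linear[OF R_bounded], symmetric])
    then have "norm (E' z g - R g) \<le> norm (E z g - g) * c" using c(2) by simp
    also have "\<dots> \<le> (C * norm z * norm g) * c" using E_near[OF that] c(1) by (intro mult_right_mono) auto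
    finally show ?thesis by (simp add: mult_ac)
  qed
  \<comment> \<open>\<open>l\<close> and the limit functional \<open>v\<close> agree on constants,
    so they differ at \<open>g\<close> by at most \<open>N g\<close>. Hence
    \<open>N g + norm (l g)\<close> controls the norm although \<open>l\<close> belongs to the
    initial law.\<close>
  have norm_le: "norm g \<le> (1 + norm one) * (N g + norm (l g))" for g
  proof -
    have "l g - v g = l (g - v g *\<^sub>C one)"
    proof -
      have "l (g - v g *\<^sub>C one) + l (v g *\<^sub>C one) = l g" by (simp flip: l_add)
      then show ?thesis by (simp add: l_scale l_one algebra_simps)
    qed
    then have "norm (l g - v g) \<le> N g" using l_bd v order_trans by metis
    then have "norm (v g) \<le> N g + norm (l g)" using norm_triangle_ineq2[of "v g" "l g"] by (simp add: norm_minus_commute)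
    then have "norm (v g *\<^sub>C one) \<le> norm one * (N g + norm (l g))"
      unfolding norm_scaleC using mult_right_mono[of "cmod (v g)" "N g + norm (l g)" "norm one"] by (simp add: mult.commute)
    moreover have "norm g \<le> norm (g - v g *\<^sub>C one) + norm (v g *\<^sub>C one)"
      using norm_triangle_ineq[of "g - v g *\<^sub>C one" "v g *\<^sub>C one"] by simp
    ultimately show ?thesis using v[of g] norm_ge_zero[of "l g"] unfolding distrib_right mult_1 by linarith
  qed
  obtain r \<theta> where r: "0 < r" "r \<le> 1" and \<theta>: "0 \<le> \<theta>" "\<theta> < 1"
    and nz: "\<And>z n. norm z \<le> r \<Longrightarrow> l ((E' z ^^ n) one) \<noteq> 0"
    and rat1: "\<And>z n. norm z \<le> r \<Longrightarrow> norm (l ((E' z ^^ Suc n) one) / l ((E' z ^^ n) one) - 1) \<le> 2/5"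
    and rat2: "\<And>z n. norm z \<le> r \<Longrightarrow> norm (l ((E' z ^^ Suc (Suc n)) one) / l ((E' z ^^ Suc n) one)
           - l ((E' z ^^ Suc n) one) / l ((E' z ^^ n) one)) \<le> 3 * \<theta> ^ n"
  proof (rule perturbed_iteration[where l=l and E=E' and R=R and N=N and one=one and C="c * C" and \<delta>=\<delta>
          and D=D and A="1 + norm one", OF l_add l_scale l_bd l_one E_add E_scale pert _ N_add N_scale N_R \<delta>
          N_le N_one D R_near norm_le])
    show "0 \<le> c * C" "1 \<le> 1 + norm one" using c(1) C by auto
  qed (assumption | rule that)+
  define MG where "MG = (\<lambda>n (z::complex). LINT \<omega>|P. exp (z * of_real (T n \<omega>)))"
  have MG: "MG n z = l ((E' z ^^ n) one)" for n z
  proof -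
    have "MG n z = (LINT \<omega>|P. exp (z * of_real (\<Sum>j=1..n. f (\<xi> j \<omega>))) * ev one (\<xi> n \<omega>))"
      unfolding MG_def T_def by (intro Bochner_Integration.integral_cong) (auto simp: ev_one sp)
    also have "\<dots> = l ((E' z ^^ n) one)"
      unfolding l_def E'_def using exp_sum_eq_operator_power[OF chain f0 E] by simp
    finally show ?thesis .
  qed
  have MG_deriv: "(MG n has_field_derivative (LINT \<omega>|P. of_real (T n \<omega>) * exp (z * of_real (T n \<omega>)))) (at z)" for n z
    unfolding MG_def using bounded_exp_moment_derivative[of "T n" "\<lambda>_. 1" "b * real n" 1 z] T_bd by simp
  have MG_hol: "MG n holomorphic_on A" for n A
    by (rule holomorphic_onI) (use MG_deriv field_differentiable_def has_field_derivative_at_within in blast)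
  have MG_real: "\<exists>m>0. MG n (of_real u) = of_real m" for n u
  proof -
    have "exp (complex_of_real u * of_real (T n \<omega>)) = of_real (exp (u * T n \<omega>))" for \<omega>
      by (simp add: exp_of_real flip: of_real_mult)
    then have 1: "MG n (of_real u) = of_real (LINT \<omega>|P. exp (u * T n \<omega>))" by (simp add: MG_def)
    have uT: "u * T n \<omega> \<le> \<bar>u\<bar> * (b * real n)" "- (\<bar>u\<bar> * (b * real n)) \<le> u * T n \<omega>"
      if "\<omega> \<in> space P" for \<omega>
    proof -
      have "\<bar>u * T n \<omega>\<bar> \<le> \<bar>u\<bar> * (b * real n)"
        unfolding abs_mult by (intro mult_left_mono T_bd that) auto
      then show "u * T n \<omega> \<le> \<bar>u\<bar> * (b * real n)" "- (\<bar>u\<bar> * (b * real n)) \<le> u * T n \<omega>" by linarith+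
    qed
    have "exp (- (\<bar>u\<bar> * (b * real n))) = (LINT \<omega>|P. exp (- (\<bar>u\<bar> * (b * real n))))" by (simp add: prob_space)
    also have "\<dots> \<le> (LINT \<omega>|P. exp (u * T n \<omega>))"
    proof (rule integral_mono)
      show "integrable P (\<lambda>\<omega>. exp (u * T n \<omega>))"
        by (rule integrable_bounded[where b="exp (\<bar>u\<bar> * (b * real n))"]) (use uT in auto)
    qed (use uT in auto)
    finally have "(LINT \<omega>|P. exp (u * T n \<omega>)) > 0" using exp_gt_zero less_le_trans by blast
    with 1 show ?thesis by blast
  qed
  obtain L0 C0 d0 where L0_hol: "\<And>n. L0 n holomorphic_on ball 0 r"
    and L0_exp: "\<And>n z. norm z < r \<Longrightarrow> exp (L0 n z) = MG n z"
    and L0_bd: "\<And>n z. norm z < r \<Longrightarrow> norm (L0 n z) \<le> real n"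
    and L0_0: "\<And>n. L0 n 0 = 0"
    and L0_real: "\<And>n u. \<bar>u\<bar> < r \<Longrightarrow> L0 n (of_real u) \<in> \<real>"
    and L0_d: "\<And>n. norm ((deriv ^^ 2) (L0 n) 0 - of_nat n * d0) \<le> C0"
  proof (rule log_of_ratios[where M=MG and r=r and \<theta>=\<theta>])
    show "MG 0 z = 1" for z by (simp add: MG_def T_def prob_space)
    show "MG n 0 = 1" for n by (simp add: MG_def prob_space)
    show "MG n z \<noteq> 0" if "norm z < r" for n z using nz[of z n] that by (simp add: MG)
    show "norm (MG (Suc n) z / MG n z - 1) \<le> 2/5" if "norm z < r" for n z
      unfolding MG using that by (intro rat1) simp
    show "norm (MG (Suc (Suc n)) z / MG (Suc n) z - MG (Suc n) z / MG n z) \<le> 3 * \<theta> ^ n" if "norm z < r" for n z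
      unfolding MG using that by (intro rat2) simp
    show "\<exists>m>0. MG n (of_real u) = of_real m" for n u by (rule MG_real)
  qed (rule r(1) \<theta> MG_hol | (rule that; blast))+
  \<comment> \<open>Centring multiplies the generating function by \<open>exp (- a n * z)\<close>.
    The logarithm changes by a linear term, which leaves its second derivative alone.\<close>
  define L where "L = (\<lambda>n (z::complex). L0 n z - of_real (a n) * z)"
  have L_hol: "L n holomorphic_on ball 0 r" for n unfolding L_def by (intro holomorphic_intros L0_hol)
  define MS where "MS = (\<lambda>n (z::complex). LINT \<omega>|P. exp (z * of_real (S n \<omega>)))"
  define M1 where "M1 = (\<lambda>n (z::complex). LINT \<omega>|P. of_real (S n \<omega>) * exp (z * of_real (S n \<omega>)))"
  define M2 where "M2 = (\<lambda>n (z::complex). LINT \<omega>|P. of_real (S n \<omega>) * of_real (S n \<omega>) * exp (z * of_real (S n \<omega>)))"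
  have MS_deriv: "(MS n has_field_derivative M1 n z) (at z)" for n z
    unfolding MS_def M1_def using bounded_exp_moment_derivative[of "S n" "\<lambda>_. 1" "2 * b * real n" 1 z] S_bd by simp
  have M1_deriv: "(M1 n has_field_derivative M2 n z) (at z)" for n z
    unfolding M1_def M2_def using bounded_exp_moment_derivative[of "S n" "\<lambda>\<omega>. of_real (S n \<omega>)" "2 * b * real n" "2 * b * real n" z] S_bd
    by simp
  have L_exp: "exp (L n z) = MS n z" if "norm z < r" for n z
  proof -
    have "exp (L n z) = MG n z * exp (- (of_real (a n) * z))"
      using L0_exp[OF that] by (simp add: L_def exp_diff exp_minus divide_inverse)
    also have "\<dots> = (LINT \<omega>|P. exp (z * of_real (T n \<omega>)) * exp (- (of_real (a n) * z)))" by (simp add: MG_def)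
    also have "\<dots> = MS n z" unfolding MS_def
      by (intro Bochner_Integration.integral_cong) (auto simp: S_eq algebra_simps simp flip: exp_add)
    finally show ?thesis .
  qed
  have L_d: "(L n has_field_derivative deriv (L n) z) (at z)" if "norm z < r" for n z
    by (rule holomorphic_derivI[OF L_hol open_ball]) (use that in \<open>auto simp: dist_norm\<close>)
  have L_d2: "(deriv (L n) has_field_derivative (deriv ^^ 2) (L n) z) (at z)" if "norm z < r" for n z
  proof -
    have "deriv (L n) holomorphic_on ball 0 r" by (rule holomorphic_deriv[OF L_hol open_ball])
    from holomorphic_derivI[OF this open_ball] show ?thesis using that by (simp add: dist_norm numeral_2_eq_2)
  qed
  \<comment> \<open>The derivative of \<open>exp (L n) = MS n\<close> in product form.
    Differentiating once more at 0, where \<open>MS n\<close> is 1 and \<open>M1 n\<close> vanishes,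
    yields the variance.\<close>
  have e1: "deriv (L n) z * MS n z = M1 n z" if z: "norm z < r" for n z
  proof (rule DERIV_unique)
    show "(MS n has_field_derivative M1 n z) (at z)" by (rule MS_deriv)
    have "((\<lambda>z. exp (L n z)) has_field_derivative exp (L n z) * deriv (L n) z) (at z)"
      using L_d[OF z] by (auto intro!: derivative_eq_intros)
    then have "((\<lambda>z. exp (L n z)) has_field_derivative deriv (L n) z * MS n z) (at z)"
      by (simp add: L_exp[OF z] mult.commute)
    then show "(MS n has_field_derivative deriv (L n) z * MS n z) (at z)"
      by (rule has_field_derivative_transform_within_open[OF _ open_ball[of 0 r]]) (use z L_exp in auto)
  qed
  have MS0: "MS n 0 = 1" for n by (simp add: MS_def prob_space)
  have M10: "M1 n 0 = 0" for n by (simp add: M1_def ES)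
  have M20: "M2 n 0 = of_real (LINT \<omega>|P. (S n \<omega>)\<^sup>2)" for n by (simp add: M2_def power2_eq_square flip: of_real_mult)
  have d1: "deriv (L n) 0 = 0" for n using e1[of 0 n] r by (simp add: MS0 M10)
  have d2: "(deriv ^^ 2) (L n) 0 = of_real (LINT \<omega>|P. (S n \<omega>)\<^sup>2)" for n
  proof -
    have "((\<lambda>z. deriv (L n) z * MS n z) has_field_derivative (deriv ^^ 2) (L n) 0 * MS n 0 + M1 n 0 * deriv (L n) 0) (at 0)"
      using r by (intro DERIV_mult L_d2 MS_deriv) simp
    then have "(M1 n has_field_derivative (deriv ^^ 2) (L n) 0 * MS n 0 + M1 n 0 * deriv (L n) 0) (at 0)"
      by (rule has_field_derivative_transform_within_open[OF _ open_ball[of 0 r]]) (use e1 r in auto)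
    from DERIV_unique[OF this M1_deriv] show ?thesis by (simp add: MS0 M10 M20)
  qed
  have dL: "(deriv ^^ 2) (L n) 0 = (deriv ^^ 2) (L0 n) 0" for n
  proof -
    have "(deriv ^^ 2) (L n) 0 = (deriv ^^ 2) (L0 n) 0 - (deriv ^^ 2) (\<lambda>z. of_real (a n) * z) 0"
      unfolding L_def by (rule higher_deriv_diff[OF L0_hol _ open_ball]) (use r in \<open>auto intro!: holomorphic_intros\<close>)
    also have "deriv (\<lambda>z. of_real (a n) * z) = (\<lambda>_. complex_of_real (a n))" by (intro ext) simp
    then have "(deriv ^^ 2) (\<lambda>z. complex_of_real (a n) * z) 0 = 0" by (simp add: numeral_2_eq_2)
    finally show ?thesis by simp
  qed
  \<comment> \<open>One constant for three purposes: \<open>2 * b\<close> bounds the sums,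
    \<open>1 + b\<close> the logarithm after centring, and \<open>C0\<close> the variance
    error.\<close>
  define C' where "C' = max C0 (2 * b + 1)"
  have C': "2 * b \<le> C'" "0 \<le> C'" "C0 \<le> C'" "1 + b \<le> C'" using b0 by (auto simp: C'_def)
  show ?thesis
  proof (rule that[of r C' L "Re d0"])
    show "\<bar>S n \<omega>\<bar> \<le> C' * real n" if w: "\<omega> \<in> space P" for n \<omega>
      using S_bd[OF w, of n] mult_right_mono[OF C'(1), of "real n"] by simp
    show "norm (L n z) \<le> C' * real n" if z: "norm z < r" for n z
    proof -
      have "norm (complex_of_real (a n) * z) \<le> (b * real n) * 1"
        unfolding norm_mult norm_of_real using z r a_bd b0 by (intro mult_mono) auto
      then have "norm (L n z) \<le> real n + b * real n"
        using L0_bd[OF z, of n] norm_triangle_ineq4[of "L0 n z" "of_real (a n) * z"] unfolding L_def by linarith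
      also have "\<dots> \<le> C' * real n" using mult_right_mono[OF C'(4), of "real n"] by (simp add: algebra_simps)
      finally show ?thesis .
    qed
    show "L n (of_real u) \<in> \<real>" if u: "\<bar>u\<bar> < r" for n u
      unfolding L_def by (intro Reals_diff L0_real u) (simp flip: of_real_mult)
    show "\<bar>(LINT \<omega>|P. (S n \<omega>)\<^sup>2) - real n * Re d0\<bar> \<le> C'" for n
    proof -
      have "Re ((deriv ^^ 2) (L0 n) 0 - of_nat n * d0) = (LINT \<omega>|P. (S n \<omega>)\<^sup>2) - real n * Re d0"
        using d2[of n] unfolding dL by simp
      then show ?thesis using order_trans[OF abs_Re_le_cmod L0_d, of n] C'(3) by simp
    qed
    show "0 < r" "0 \<le> C'" "S n \<in> borel_measurable P" "L n holomorphic_on ball 0 r" "deriv (L n) 0 = 0"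
      "(deriv ^^ 2) (L n) 0 = of_real (LINT \<omega>|P. (S n \<omega>)\<^sup>2)" "(LINT \<omega>|P. S n \<omega>) = 0" for n
      using r C'(2) L_hol d1 d2 ES by simp_all
    show "exp (L n z) = (LINT \<omega>|P. exp (z * of_real (S n \<omega>)))" if z: "norm z < r" for n z
      using L_exp[OF z] by (simp add: MS_def)
    show "L n 0 = 0" for n by (simp add: L_def L0_0)
  qed
qed

end

section \<open>The normal tail\<close>

text \<open>The upper tail, not the distribution function, because the comparison to come is
  multiplicative in the tail.\<close>

definition normal_tail :: "real \<Rightarrow> real" where
  "normal_tail a = measure std_normal_distribution {a<..}"

lemma std_normal_density_eq: "std_normal_density x = exp (- x\<^sup>2 / 2) / sqrt (2 * pi)"
  by (simp add: std_normal_density_def)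

interpretation std_normal: real_distribution std_normal_distribution
  by (rule real_dist_normal_dist)

lemma emeasure_normal_tail: "emeasure std_normal_distribution {a<..} = ennreal (normal_tail a)"
  by (simp add: normal_tail_def std_normal.emeasure_eq_measure)

lemma normal_tail_eq_cdf: "normal_tail a = 1 - cdf std_normal_distribution a"
proof -
  have "measure std_normal_distribution (space std_normal_distribution - {..a}) = 1 - measure std_normal_distribution {..a}"
    by (rule std_normal.prob_compl) simp
  moreover have "space std_normal_distribution - {..a} = {a<..}" by auto
  ultimately show ?thesis by (simp add: normal_tail_def cdf_def)
qed

lemma std_normal_density_continuous: "continuous_on A std_normal_density"
  unfolding std_normal_density_eq by (intro continuous_intros) (use pi_gt_zero in auto)

lemma normal_tail_diff:
  assumes "a \<le> b" shows "normal_tail a - normal_tail b = integral {a..b} std_normal_density"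
proof -
  have ii: "set_integrable lborel {a..b} std_normal_density"
    by (rule borel_integrable_atLeastAtMost') (rule std_normal_density_continuous)
  have "{a<..} = {a<..b} \<union> {b<..}" "{a<..b} \<inter> {b<..} = {}" using assms by auto
  then have 1: "normal_tail a = measure std_normal_distribution {a<..b} + normal_tail b"
    unfolding normal_tail_def using std_normal.finite_measure_Union[of "{a<..b}" "{b<..}"] by simp
  have "emeasure std_normal_distribution {a<..b} = (\<integral>\<^sup>+x. ennreal (std_normal_density x) * indicator {a<..b} x \<partial>lborel)"
    by (rule emeasure_density) auto
  also have "\<dots> = (\<integral>\<^sup>+x. ennreal (indicator {a..b} x * std_normal_density x) \<partial>lborel)"
  proof (rule nn_integral_cong_AE)
    show "AE x in lborel. ennreal (std_normal_density x) * indicator {a<..b} x = ennreal (indicator {a..b} x * std_normal_density x)"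
      using AE_lborel_singleton[of a] by eventually_elim (auto split: split_indicator)
  qed
  also have "\<dots> = ennreal (\<integral>x. indicator {a..b} x * std_normal_density x \<partial>lborel)"
  proof (rule nn_integral_eq_integral)
    show "integrable lborel (\<lambda>x. indicator {a..b} x * std_normal_density x)"
      using ii by (simp add: set_integrable_def)
  qed simp
  also have "(\<integral>x. indicator {a..b} x * std_normal_density x \<partial>lborel) = integral {a..b} std_normal_density"
    using set_borel_integral_eq_integral(2)[OF ii] by (simp add: set_lebesgue_integral_def)
  finally have "emeasure std_normal_distribution {a<..b} = ennreal (integral {a..b} std_normal_density)" .
  moreover have "integral {a..b} std_normal_density \<ge> 0"
    by (rule integral_nonneg) (rule integrable_continuous_real[OF std_normal_density_continuous], simp)
  ultimately have "measure std_normal_distribution {a<..b} = integral {a..b} std_normal_density"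
    by (simp add: measure_def)
  with 1 show ?thesis by linarith
qed

lemma normal_tail_deriv: "(normal_tail has_real_derivative - std_normal_density x) (at x)"
proof -
  have "((\<lambda>y. integral {x-1..y} std_normal_density) has_real_derivative std_normal_density x) (at x within {x-1..x+1})"
    by (rule integral_has_real_derivative[OF std_normal_density_continuous]) simp
  then have "((\<lambda>y. normal_tail (x - 1) - integral {x-1..y} std_normal_density) has_real_derivative - std_normal_density x)
      (at x within {x-1..x+1})"
    by (auto intro!: derivative_eq_intros)
  moreover have "at x within {x-1..x+1} = at x" by (rule at_within_interior) (simp add: interior_atLeastAtMost_real)
  ultimately have "((\<lambda>y. normal_tail (x - 1) - integral {x-1..y} std_normal_density) has_real_derivative - std_normal_density x) (at x)"
    by simp
  then show ?thesis
    by (rule has_field_derivative_transform_within_open[where S="{x-1<..<x+1}"])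
      (use normal_tail_diff[of "x-1"] in \<open>auto simp: algebra_simps\<close>)
qed

lemma std_normal_density_bounds: "0 < std_normal_density x" "std_normal_density x \<le> 1"
proof -
  show "0 < std_normal_density x" by (simp add: std_normal_density_eq)
  have "1 \<le> sqrt (2 * pi)" using pi_gt3 by simp
  then show "std_normal_density x \<le> 1"
    unfolding std_normal_density_eq by (subst divide_le_eq_1_pos) (auto intro: order_trans[of _ 1])
qed

lemma normal_tail_strict_antimono: "a < b \<Longrightarrow> normal_tail b < normal_tail a"
  by (rule DERIV_neg_imp_decreasing) (use normal_tail_deriv std_normal_density_bounds(1) in force)+

lemma normal_tail_antimono: "a \<le> b \<Longrightarrow> normal_tail b \<le> normal_tail a"
  using normal_tail_strict_antimono[of a b] by (cases "a = b") auto

lemma normal_tail_less_iff: "normal_tail a < normal_tail b \<longleftrightarrow> b < a"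
  using normal_tail_strict_antimono normal_tail_antimono by (meson leD leI)

lemma normal_tail_le_iff: "normal_tail a \<le> normal_tail b \<longleftrightarrow> b \<le> a"
  using normal_tail_less_iff[of b a] by (simp add: not_less[symmetric])

lemma normal_tail_continuous: "continuous_on A normal_tail"
  using normal_tail_deriv DERIV_isCont by (blast intro: continuous_at_imp_continuous_on)

lemma normal_tail_bounds: "0 < normal_tail a" "normal_tail a < 1"
proof -
  have "0 \<le> normal_tail (a + 1)" "normal_tail (a - 1) \<le> 1" by (auto simp: normal_tail_def)
  then show "0 < normal_tail a" "normal_tail a < 1"
    using normal_tail_strict_antimono[of a "a+1"] normal_tail_strict_antimono[of "a-1" a] by auto
qed

lemma normal_tail_surj:
  assumes "0 < p" "p < 1" shows "\<exists>a. normal_tail a = p"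
proof -
  have "(cdf std_normal_distribution \<longlongrightarrow> 0) at_bot" by (rule std_normal.cdf_lim_at_bot)
  then have "eventually (\<lambda>x. cdf std_normal_distribution x < 1 - p) at_bot" using assms by (intro order_tendstoD) auto
  then obtain x where x: "cdf std_normal_distribution x < 1 - p" by (auto simp: eventually_at_bot_linorder)
  have "(cdf std_normal_distribution \<longlongrightarrow> 1) at_top" by (rule std_normal.cdf_lim_at_top_prob)
  then have "eventually (\<lambda>x. cdf std_normal_distribution x > 1 - p) at_top" using assms by (intro order_tendstoD) auto
  then obtain y where y: "cdf std_normal_distribution y > 1 - p" by (auto simp: eventually_at_top_linorder)
  have "normal_tail y < normal_tail x" using x y by (simp add: normal_tail_eq_cdf)
  then have "x < y" by (simp add: normal_tail_less_iff)
  then show ?thesis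
    using IVT2'[of normal_tail y p x] x y normal_tail_continuous by (auto simp: normal_tail_eq_cdf)
qed

text \<open>The density is even, so the sum of the tails at \<open>x\<close> and \<open>- x\<close>
  has derivative 0; its value is the limit at infinity.\<close>

lemma normal_tail_uminus: "normal_tail (- a) = 1 - normal_tail a"
proof -
  define h where "h = (\<lambda>x. normal_tail x + normal_tail (- x))"
  have "((\<lambda>x. normal_tail (- x)) has_real_derivative - std_normal_density (- x) * (-1)) (at x)" for x
    by (rule DERIV_chain2[OF normal_tail_deriv]) (auto intro!: derivative_eq_intros)
  then have "(h has_real_derivative 0) (at x)" for x
    unfolding h_def by (auto intro!: derivative_eq_intros normal_tail_deriv simp: std_normal_density_eq)
  then have const: "h x = h 0" for x by (intro DERIV_isconst_all allI)
  have "(h \<longlongrightarrow> (1 - 1) + (1 - 0)) at_top"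
    unfolding normal_tail_eq_cdf h_def
    by (intro tendsto_intros std_normal.cdf_lim_at_top_prob
        filterlim_compose[OF std_normal.cdf_lim_at_bot filterlim_uminus_at_bot_at_top])
  then have "(h \<longlongrightarrow> 1) at_top" by simp
  then have "((\<lambda>x::real. h 0) \<longlongrightarrow> 1) at_top"
    by (rule Lim_transform_eventually) (rule always_eventually, rule allI, rule const)
  then have "h 0 = 1" by (simp add: tendsto_const_iff)
  then show ?thesis using const[of a] by (simp add: h_def)
qed

section \<open>Mills ratio and hazard rate of the normal law\<close>

text \<open>Over the interval from \<open>a\<close> to \<open>a + 1/(1 + a)\<close> the square of
  the argument grows by at most 3, so the density drops by at most \<open>exp (3/2)\<close>; the
  mass of this interval alone gives the bound.\<close>

lemma mills_lower:
  assumes "a \<ge> 0" shows "exp (- a\<^sup>2 / 2) \<le> exp (3/2) * sqrt (2 * pi) * (1 + a) * normal_tail a"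
proof -
  define s where "s = 1 / (1 + a)"
  have s: "0 < s" "s \<le> 1" "a * s \<le> 1" using assms by (auto simp: s_def field_simps)
  have "\<exists>z. a < z \<and> z < a + s \<and> normal_tail (a + s) - normal_tail a = (a + s - a) * - std_normal_density z"
    by (rule MVT2) (use s(1) normal_tail_deriv in auto)
  then obtain z where z: "a < z" "z < a + s" "normal_tail (a + s) - normal_tail a = (a + s - a) * - std_normal_density z"
    by (elim exE conjE)
  have "z\<^sup>2 \<le> (a + s)\<^sup>2" using z assms by (intro power_mono) auto
  also have "\<dots> = a\<^sup>2 + 2 * (a * s) + s * s" by (simp add: power2_eq_square algebra_simps)
  also have "\<dots> \<le> a\<^sup>2 + 3" using s mult_mono[of s 1 s 1] by simp
  finally have "- a\<^sup>2 / 2 - 3/2 \<le> - z\<^sup>2 / 2" by linarith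
  then have "exp (- a\<^sup>2 / 2) / exp (3/2) \<le> exp (- z\<^sup>2 / 2)" unfolding exp_diff[symmetric] exp_le_cancel_iff .
  then have "exp (- a\<^sup>2 / 2) / exp (3/2) / sqrt (2 * pi) \<le> std_normal_density z"
    unfolding std_normal_density_eq by (intro divide_right_mono) auto
  then have "s * (exp (- a\<^sup>2 / 2) / exp (3/2) / sqrt (2 * pi)) \<le> s * std_normal_density z"
    using s by (intro mult_left_mono) auto
  also have "\<dots> = normal_tail a - normal_tail (a + s)" using z by simp
  also have "\<dots> \<le> normal_tail a" using normal_tail_bounds(1)[of "a + s"] by simp
  finally have "s * (exp (- a\<^sup>2 / 2) / exp (3/2) / sqrt (2 * pi)) \<le> normal_tail a" .
  then have "exp (- a\<^sup>2 / 2) / ((1 + a) * exp (3/2) * sqrt (2 * pi)) \<le> normal_tail a"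
    by (simp add: s_def mult_ac)
  then show ?thesis using assms by (subst (asm) pos_divide_le_eq) (auto simp: mult_ac)
qed

lemma std_normal_density_antimono:
  assumes "\<bar>x\<bar> \<le> y" shows "std_normal_density y \<le> std_normal_density x"
proof -
  have "\<bar>x\<bar>\<^sup>2 \<le> y\<^sup>2" using assms by (rule power_mono) (rule abs_ge_zero)
  then have "- y\<^sup>2 / 2 \<le> - x\<^sup>2 / 2" unfolding power2_abs by linarith
  then have "exp (- y\<^sup>2 / 2) \<le> exp (- x\<^sup>2 / 2)" unfolding exp_le_cancel_iff .
  moreover have "0 \<le> sqrt (2 * pi)" using pi_ge_zero by simp
  ultimately show ?thesis unfolding std_normal_density_eq by (rule divide_right_mono)
qed

text \<open>Under the tail integral \<open>b\<close> is at most \<open>x\<close>, and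
  \<open>x\<close> times the density has minus the density as antiderivative.\<close>

lemma mills_upper:
  assumes "b \<ge> 0" shows "b * normal_tail b \<le> std_normal_density b"
proof -
  have "ennreal b * ennreal (normal_tail b) = (\<integral>\<^sup>+x. ennreal b * (ennreal (std_normal_density x) * indicator {b<..} x) \<partial>lborel)"
    unfolding emeasure_normal_tail[symmetric] by (subst emeasure_density) (auto simp: nn_integral_cmult)
  also have "\<dots> \<le> (\<integral>\<^sup>+x. ennreal (x * std_normal_density x) * indicator {b..} x \<partial>lborel)"
    using assms std_normal_density_bounds(1)
    by (intro nn_integral_mono) (auto simp flip: ennreal_mult intro!: ennreal_leI mult_right_mono less_imp_le split: split_indicator)
  also have "\<dots> = ennreal (0 - (- std_normal_density b))"
  proof (rule nn_integral_FTC_atLeast[where F="\<lambda>x. - std_normal_density x" and f="\<lambda>x. x * std_normal_density x" and T=0])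
    show "((\<lambda>x. - std_normal_density x) has_real_derivative x * std_normal_density x) (at x)" for x
      unfolding std_normal_density_eq by (auto intro!: derivative_eq_intros simp: field_simps)
    show "0 \<le> x * std_normal_density x" if "b \<le> x" for x
      using assms that std_normal_density_bounds(1)[of x] by simp
    have "((\<lambda>x::real. - (exp (- x\<^sup>2 / 2) / sqrt (2 * pi))) \<longlongrightarrow> 0) at_top" by real_asymp
    then show "((\<lambda>x. - std_normal_density x) \<longlongrightarrow> 0) at_top" unfolding std_normal_density_eq .
  qed simp
  finally show ?thesis
    using assms normal_tail_bounds(1)[of b] std_normal_density_bounds(1)[of b]
    by (simp flip: ennreal_mult add: less_imp_le)
qed

text \<open>The hazard rate of the normal law is at least \<open>c * (2 + x)\<close> for
  \<open>x \<ge> -1\<close>; integrating this along the shift gives the exponential factor. The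
  affine form \<open>2 + x\<close> stays at least 1 on this range, so one formula serves the bulk
  and the tail.\<close>

lemma normal_tail_shift:
  obtains c where "c > 0" "c \<le> 1"
    and "\<And>b \<eta>. b \<ge> -1 \<Longrightarrow> \<eta> \<ge> 0 \<Longrightarrow> normal_tail (b + \<eta>) \<le> normal_tail b * exp (- c * \<eta> * (2 + b))"
proof -
  \<comment> \<open>For \<open>x\<close> between -1 and 1 one has \<open>2 + x \<le> 3\<close> and a
    density at least as large as at 1; for \<open>x \<ge> 1\<close>,
    \<open>2 + x \<le> 3 * x\<close> reduces the claim to \<open>mills_upper\<close>.\<close>
  define c where "c = std_normal_density 1 / 3"
  have c: "c > 0" "c \<le> 1/3" using std_normal_density_bounds[of 1] by (auto simp: c_def)
  have up: "c * (2 + x) * normal_tail x \<le> std_normal_density x" if x: "x \<ge> -1" for x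
  proof (cases "x \<ge> 1")
    case True
    have "c * (2 + x) \<le> 1/3 * (3 * x)" using c True by (intro mult_mono) auto
    then have "c * (2 + x) * normal_tail x \<le> x * normal_tail x"
      using normal_tail_bounds(1)[of x] by (intro mult_right_mono) auto
    then show ?thesis using mills_upper[of x] True by simp
  next
    case False
    have "c * (2 + x) * normal_tail x \<le> c * 3 * 1"
      by (intro mult_mono mult_nonneg_nonneg) (use c(1) False x normal_tail_bounds[of x] in linarith)+
    also have "\<dots> = std_normal_density 1" by (simp add: c_def)
    also have "\<dots> \<le> std_normal_density x"
      by (rule std_normal_density_antimono) (use False x in linarith)
    finally show ?thesis .
  qed
  show ?thesis
  proof (rule that)
    fix b \<eta> :: real assume b: "b \<ge> -1" and \<eta>: "\<eta> \<ge> 0"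
    let ?G = "\<lambda>s. normal_tail (b + s) * exp (c * s * (2 + b))"
    have "?G \<eta> \<le> ?G 0"
    proof (rule DERIV_nonpos_imp_nonincreasing[where f="?G", OF \<eta>])
      fix s :: real assume s: "0 \<le> s" "s \<le> \<eta>"
      have "((\<lambda>s. normal_tail (b + s)) has_real_derivative - std_normal_density (b + s) * 1) (at s)"
        by (rule DERIV_chain2[OF normal_tail_deriv]) (auto intro!: derivative_eq_intros)
      then have "(?G has_real_derivative (- std_normal_density (b + s)) * exp (c * s * (2 + b))
          + exp (c * s * (2 + b)) * (c * (2 + b)) * normal_tail (b + s)) (at s)"
        by (auto intro!: derivative_eq_intros)
      moreover have "(- std_normal_density (b + s)) * exp (c * s * (2 + b))
          + exp (c * s * (2 + b)) * (c * (2 + b)) * normal_tail (b + s) \<le> 0"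
      proof -
        have "c * (2 + b) * normal_tail (b + s) \<le> c * (2 + (b + s)) * normal_tail (b + s)"
          using c s normal_tail_bounds(1)[of "b+s"] by (intro mult_right_mono) auto
        also have "\<dots> \<le> std_normal_density (b + s)" using up[of "b + s"] b s by simp
        finally have "exp (c * s * (2 + b)) * (c * (2 + b) * normal_tail (b + s) - std_normal_density (b + s)) \<le> 0"
          by (simp add: mult_le_0_iff)
        then show ?thesis by (simp add: algebra_simps)
      qed
      ultimately show "\<exists>y. (?G has_real_derivative y) (at s) \<and> y \<le> 0" by blast
    qed
    then have "normal_tail (b + \<eta>) * exp (c * \<eta> * (2 + b)) \<le> normal_tail b" by simp
    then show "normal_tail (b + \<eta>) \<le> normal_tail b * exp (- c * \<eta> * (2 + b))"
      using exp_minus[of "c * \<eta> * (2 + b)"] by (simp add: divide_inverse[symmetric] pos_le_divide_eq)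
  qed (use c in auto)
qed

section \<open>Esseen's smoothing inequality\<close>

text \<open>The Fejer kernel up to normalisation: nonnegative, integrable, and with a compactly
  supported tent function as Fourier transform, so that smoothing by it sees characteristic
  functions on a bounded interval only.\<close>

definition fejer :: "real \<Rightarrow> real" where "fejer x = (sinc (x / 2))\<^sup>2"

lemma fejer_eq: "x \<noteq> 0 \<Longrightarrow> fejer x = 2 * (1 - cos x) / x\<^sup>2"
  using cos_double_sin[of "x / 2"] by (simp add: fejer_def power_divide)

lemma fejer_nonneg: "0 \<le> fejer x" by (simp add: fejer_def)

lemma fejer_measurable [measurable]: "fejer \<in> borel_measurable borel"
  unfolding fejer_def[abs_def] by measurable

lemma fejer_le: "fejer x \<le> 8 / (1 + x\<^sup>2)"
proof (cases "x\<^sup>2 \<le> 1")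
  case True
  have "\<bar>sinc (x / 2)\<bar> \<le> 1"
  proof (cases "x = 0")
    case False
    then show ?thesis using abs_sin_x_le_abs_x[of "x / 2"] by (simp add: field_simps)
  qed simp
  then have "fejer x \<le> 1" unfolding fejer_def by (simp only: abs_square_le_1)
  moreover have "1 \<le> 8 / (1 + x\<^sup>2)" using True by (simp add: pos_le_divide_eq add_pos_nonneg)
  ultimately show ?thesis by (rule order_trans)
next
  case False
  then have x: "x \<noteq> 0" by auto
  have "2 * (1 - cos x) \<le> 4" using cos_ge_minus_one[of x] by argo
  then have "fejer x \<le> 4 / x\<^sup>2" unfolding fejer_eq[OF x] by (rule divide_right_mono) simp
  also have "4 / x\<^sup>2 = 8 / (x\<^sup>2 + x\<^sup>2)" by simp
  also have "\<dots> \<le> 8 / (1 + x\<^sup>2)"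
  proof (rule divide_left_mono)
    have "0 < x\<^sup>2" using x by simp
    then show "0 < (x\<^sup>2 + x\<^sup>2) * (1 + x\<^sup>2)" by (intro mult_pos_pos add_pos_pos) (auto intro: add_pos_nonneg)
  qed (use False in auto)
  finally show ?thesis .
qed

lemma integrable_fejer: "integrable lborel fejer"
proof (rule integrableI_bounded)
  have half: "(\<integral>\<^sup>+x. ennreal (8 / (1 + x\<^sup>2)) * indicator {0..} x \<partial>lborel) = ennreal (8 * (pi / 2) - 8 * arctan 0)"
  proof (rule nn_integral_FTC_atLeast[where F="\<lambda>x. 8 * arctan x"])
    show "((\<lambda>x. 8 * arctan x) has_real_derivative 8 / (1 + x\<^sup>2)) (at x)" for x :: real
      by (auto intro!: derivative_eq_intros simp: inverse_eq_divide)
    show "((\<lambda>x. 8 * arctan x) \<longlongrightarrow> 8 * (pi / 2)) at_top" by (intro tendsto_intros tendsto_arctan_at_top)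
  qed (auto simp: add_nonneg_nonneg)
  have "ennreal (fejer 0) \<le> 16" using ennreal_leI[OF order_trans[OF fejer_le[of 0], of 16]] by simp
  then have "(\<integral>\<^sup>+x. ennreal (norm (fejer x)) \<partial>lborel)
    \<le> (\<integral>\<^sup>+x. ennreal (8 / (1 + x\<^sup>2)) * indicator {0..} x + ennreal (8 / (1 + (- x)\<^sup>2)) * indicator {0..} (- x) \<partial>lborel)"
    using fejer_le fejer_nonneg by (intro nn_integral_mono) (auto split: split_indicator intro!: ennreal_leI add_increasing add_increasing2)
  also have "\<dots> = (\<integral>\<^sup>+x. ennreal (8 / (1 + x\<^sup>2)) * indicator {0..} x \<partial>lborel) + (\<integral>\<^sup>+x. ennreal (8 / (1 + (- x)\<^sup>2)) * indicator {0..} (- x) \<partial>lborel)"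
    by (rule nn_integral_add) auto
  also have "(\<integral>\<^sup>+x. ennreal (8 / (1 + (- x)\<^sup>2)) * indicator {0..} (- x) \<partial>lborel) = (\<integral>\<^sup>+x. ennreal (8 / (1 + x\<^sup>2)) * indicator {0..} x \<partial>lborel)"
    by (subst (2) nn_integral_real_affine[where c="-1" and t=0]) auto
  finally show "(\<integral>\<^sup>+x. ennreal (norm (fejer x)) \<partial>lborel) < \<infinity>" unfolding half by (rule le_less_trans) simp
qed simp

lemma integral_fejer_pos: "0 < (\<integral>x. fejer x \<partial>lborel)"
proof -
  have "(\<integral>x. fejer x \<partial>lborel) \<noteq> 0"
  proof
    assume "(\<integral>x. fejer x \<partial>lborel) = 0"
    then have ae: "AE x in lborel. fejer x = 0"
      by (subst (asm) integral_nonneg_eq_0_iff_AE[OF integrable_fejer]) (auto simp: fejer_nonneg)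
    have pos: "fejer x \<noteq> 0" if "0 < x" "x < 1" for x
    proof -
      have "sin (x / 2) > 0" by (rule sin_gt_zero) (use that pi_gt3 in auto)
      then show ?thesis using that by (simp add: fejer_def)
    qed
    have "AE x in lborel. \<not> (0 < x \<and> x < (1::real))" using ae by eventually_elim (use pos in blast)
    then have "emeasure lborel {0<..<1::real} = 0" by (subst (asm) AE_iff_measurable[where N="{0<..<1::real}"]) auto
    then show False by simp
  qed
  moreover have "0 \<le> (\<integral>x. fejer x \<partial>lborel)" by (simp add: fejer_nonneg)
  ultimately show ?thesis by linarith
qed

text \<open>Over \<open>{0..T}\<close> integration by parts gives an antiderivative in which
  \<open>1 - cos (T * x)\<close> appears at the end points; the other half of the interval is the
  mirror image. The antiderivative divides by \<open>x\<close>, hence the separate case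
  \<open>x = 0\<close>.\<close>

lemma fejer_fourier:
  assumes T: "T > 0"
  shows "(\<integral>t. (1 - \<bar>t\<bar> / T) * cos (t * x) * indicator {-T..T} t \<partial>lborel) = T * fejer (T * x)"
proof -
  have half: "has_bochner_integral lborel (\<lambda>t. ((1 - t / T) * cos (t * x)) * indicator {0..T} t) (T * fejer (T * x) / 2)"
  proof (cases "x = 0")
    case True
    have "has_bochner_integral lborel (\<lambda>t. (1 - t / T) * indicator {0..T} t) ((T - T\<^sup>2 / (2 * T)) - (0 - 0\<^sup>2 / (2 * T)))"
      by (rule has_bochner_integral_FTC_Icc_real) (use T in \<open>auto intro!: derivative_eq_intros simp: field_simps\<close>)
    moreover have "T * fejer 0 / 2 = ((T - T\<^sup>2 / (2 * T)) - (0 - 0\<^sup>2 / (2 * T)))"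
      using T by (simp add: fejer_def power2_eq_square field_simps)
    ultimately have "has_bochner_integral lborel (\<lambda>t. (1 - t / T) * indicator {0..T} t) (T * fejer 0 / 2)"
      by (simp only:)
    then show ?thesis using True by simp
  next
    case False
    let ?F = "\<lambda>t. (1 - t / T) * sin (t * x) / x - cos (t * x) / (T * x\<^sup>2)"
    have "has_bochner_integral lborel (\<lambda>t. ((1 - t / T) * cos (t * x)) * indicator {0..T} t) (?F T - ?F 0)"
    proof (rule has_bochner_integral_FTC_Icc_real)
      show "(?F has_real_derivative (1 - t / T) * cos (t * x)) (at t)" for t
        using T False by (auto intro!: derivative_eq_intros simp: field_simps power2_eq_square)
    qed (use T in \<open>auto intro!: continuous_intros\<close>)
    moreover have "?F T - ?F 0 = T * fejer (T * x) / 2"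
      using T False by (simp add: fejer_eq power2_eq_square field_simps)
    ultimately show ?thesis by (simp only:)
  qed
  have half2: "has_bochner_integral lborel (\<lambda>t. ((1 - (- t) / T) * cos ((- t) * x)) * indicator {0..T} (- t)) (T * fejer (T * x) / 2)"
    using lborel_has_bochner_integral_real_affine_iff[of "-1" _ _ 0, THEN iffD1, OF _ half] by simp
  have "has_bochner_integral lborel (\<lambda>t. (1 - \<bar>t\<bar> / T) * cos (t * x) * indicator {-T..T} t)
    (T * fejer (T * x) / 2 + T * fejer (T * x) / 2)"
  proof (rule has_bochner_integral_cong_AE[THEN iffD1, OF _ _ _ has_bochner_integral_add[OF half half2]])
    show "AE t in lborel. ((1 - t / T) * cos (t * x)) * indicator {0..T} t + ((1 - (- t) / T) * cos ((- t) * x)) * indicator {0..T} (- t)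
      = (1 - \<bar>t\<bar> / T) * cos (t * x) * indicator {-T..T} t"
      using AE_lborel_singleton[of 0] by eventually_elim (auto split: split_indicator)
  qed auto
  then show ?thesis by (simp add: has_bochner_integral_integral_eq)
qed

lemma fubini_bounded:
  fixes f :: "'a \<Rightarrow> 'b \<Rightarrow> real"
  assumes "finite_measure M1" "finite_measure M2"
    and [measurable]: "(\<lambda>(x, y). f x y) \<in> borel_measurable (M1 \<Otimes>\<^sub>M M2)" and bd: "\<And>x y. \<bar>f x y\<bar> \<le> B"
  shows "(\<integral>x. (\<integral>y. f x y \<partial>M2) \<partial>M1) = (\<integral>y. (\<integral>x. f x y \<partial>M1) \<partial>M2)"
proof -
  interpret M1: finite_measure M1 by fact
  interpret M2: finite_measure M2 by fact
  interpret pair_sigma_finite M1 M2 ..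
  have "finite_measure (M1 \<Otimes>\<^sub>M M2)" by (rule finite_measure_pair_measure) fact+
  then have "integrable (M1 \<Otimes>\<^sub>M M2) (\<lambda>(x, y). f x y)"
    by (rule finite_measure.integrable_const_bound[where B=B]) (use bd in auto)
  from Fubini_integral[OF this] show ?thesis by simp
qed

text \<open>Both sides are the mass that the convolution of \<open>M\<close> with the kernel gives to \<open>(a, x]\<close>.\<close>

lemma fejer_smoothing:
  assumes M: "real_distribution M" and T: "T > 0"
  shows "(\<integral>u. (cdf M (x - u) - cdf M (a - u)) * indicator {a<..} x * (T * fejer (T * u)) \<partial>lborel)
    = (\<integral>t. (1 - \<bar>t\<bar> / T) * indicator {-T..T} t *
        (\<integral>s. (cos (t * s) * Re (char M t) + sin (t * s) * Im (char M t)) * indicator {a<..x} s \<partial>lborel) \<partial>lborel)"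
proof (cases "a < x")
  case True
  interpret M: real_distribution M by (rule M)
  \<comment> \<open>\<open>V\<close> carries the kernel, \<open>\<kappa>\<close> the tent function,
    \<open>\<Lambda>\<close> Lebesgue measure on the bounded interval. All are finite, so every
    exchange of integrals below concerns a bounded integrand.\<close>
  define V where "V = density lborel (\<lambda>u. T * fejer (T * u))"
  define \<kappa> where "\<kappa> = density lborel (\<lambda>t. (1 - \<bar>t\<bar> / T) * indicator {-T..T} t)"
  define \<Lambda> where "\<Lambda> = density lborel (indicator {a<..x} :: real \<Rightarrow> real)"
  have [measurable_cong]: "sets V = sets borel" "sets \<kappa> = sets borel" "sets \<Lambda> = sets borel"
    by (auto simp: V_def \<kappa>_def \<Lambda>_def)
  have fin: "finite_measure (density lborel g)" if "integrable lborel g" "\<And>x. g x \<ge> 0" for g :: "real \<Rightarrow> real"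
  proof
    have "emeasure (density lborel g) (space (density lborel g)) = (\<integral>\<^sup>+x. ennreal (g x) \<partial>lborel)"
      using that by (subst emeasure_density) auto
    also have "\<dots> = ennreal (\<integral>x. g x \<partial>lborel)" using that by (intro nn_integral_eq_integral) auto
    finally show "emeasure (density lborel g) (space (density lborel g)) \<noteq> \<infinity>" by simp
  qed
  have kpos: "0 \<le> (1 - \<bar>t\<bar> / T) * indicator {-T..T} t" for t
    using T by (auto split: split_indicator simp: field_simps)
  have ki: "integrable lborel (\<lambda>t. (1 - \<bar>t\<bar> / T) * indicator {-T..T} t)"
  proof -
    have "continuous_on {-T..T} (\<lambda>t. 1 - \<bar>t\<bar> / T)" by (intro continuous_intros) (use T in auto)
    from borel_integrable_atLeastAtMost'[OF this] show ?thesis by (simp add: set_integrable_def mult.commute)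
  qed
  have Vi: "integrable lborel (\<lambda>u. T * fejer (T * u))"
    using lborel_integrable_real_affine_iff[of T fejer 0] T integrable_fejer by auto
  have fV: "finite_measure V" unfolding V_def by (rule fin[OF Vi]) (use T fejer_nonneg in auto)
  have f\<kappa>: "finite_measure \<kappa>" unfolding \<kappa>_def by (rule fin[OF ki kpos])
  have f\<Lambda>: "finite_measure \<Lambda>" unfolding \<Lambda>_def by (rule fin) (use True in \<open>auto intro!: integrable_real_indicator\<close>)
  have fM: "finite_measure M" by (rule M.finite_measure_axioms)
  interpret \<Lambda>: finite_measure \<Lambda> by (rule f\<Lambda>)
  have Re: "Re (char M t) = (\<integral>y. cos (t * y) \<partial>M)" and Im: "Im (char M t) = (\<integral>y. sin (t * y) \<partial>M)" for t
  proof -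
    have "integrable M (\<lambda>y. iexp (t * y))" by (rule M.integrable_const_bound[where B=1]) auto
    then show "Re (char M t) = (\<integral>y. cos (t * y) \<partial>M)" "Im (char M t) = (\<integral>y. sin (t * y) \<partial>M)"
      unfolding char_def by (auto simp: Re_exp Im_exp simp flip: integral_Re integral_Im)
  qed
  have int_trig: "integrable M (\<lambda>y. cos (t * y))" "integrable M (\<lambda>y. sin (t * y))" for t
    by (auto intro!: M.integrable_const_bound[where B=1])
  have char_int: "cos (t * s) * Re (char M t) + sin (t * s) * Im (char M t) = (\<integral>y. cos (t * (s - y)) \<partial>M)" for t s
    by (simp add: Re Im int_trig right_diff_distrib cos_diff)
  have kernel: "(\<integral>t. cos (t * y) \<partial>\<kappa>) = T * fejer (T * y)" for y
    unfolding \<kappa>_def fejer_fourier[OF T, symmetric] using kpos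
    by (subst integral_density) (auto intro!: Bochner_Integration.integral_cong)
  have "(\<integral>u. (cdf M (x - u) - cdf M (a - u)) * indicator {a<..} x * (T * fejer (T * u)) \<partial>lborel)
    = (\<integral>u. (\<integral>y. indicator {a<..x} (u + y) \<partial>M) \<partial>V)"
  proof -
    have "cdf M (x - u) - cdf M (a - u) = (\<integral>y. indicator {a<..x} (u + y) \<partial>M)" for u
    proof -
      have "cdf M (x - u) - cdf M (a - u) = measure M {a - u<..x - u}"
        using M.cdf_diff_eq[of "a - u" "x - u"] True by simp
      also have "\<dots> = (\<integral>y. indicator {a - u<..x - u} y \<partial>M)" by simp
      also have "\<dots> = (\<integral>y. indicator {a<..x} (u + y) \<partial>M)"
        by (intro Bochner_Integration.integral_cong) (auto split: split_indicator)
      finally show ?thesis .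
    qed
    then show ?thesis unfolding V_def using T fejer_nonneg True
      by (subst integral_density) (auto intro!: Bochner_Integration.integral_cong)
  qed
  also have "\<dots> = (\<integral>y. (\<integral>u. indicator {a<..x} (u + y) \<partial>V) \<partial>M)"
    by (rule fubini_bounded[OF fV fM, where B=1]) (auto split: split_indicator)
  also have "\<dots> = (\<integral>y. (\<integral>s. T * fejer (T * (s - y)) \<partial>\<Lambda>) \<partial>M)"
  proof (rule Bochner_Integration.integral_cong[OF refl])
    fix y
    have "(\<integral>u. indicator {a<..x} (u + y) \<partial>V) = (\<integral>u. T * fejer (T * u) * indicator {a<..x} (u + y) \<partial>lborel)"
      unfolding V_def using T fejer_nonneg by (subst integral_density) auto
    also have "\<dots> = (\<integral>s. T * fejer (T * (s - y)) * indicator {a<..x} s \<partial>lborel)"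
      by (subst lborel_integral_real_affine[where c=1 and t="- y"]) (auto simp: algebra_simps)
    also have "\<dots> = (\<integral>s. T * fejer (T * (s - y)) \<partial>\<Lambda>)"
      unfolding \<Lambda>_def by (subst integral_density) (auto simp: mult.commute)
    finally show "(\<integral>u. indicator {a<..x} (u + y) \<partial>V) = (\<integral>s. T * fejer (T * (s - y)) \<partial>\<Lambda>)" .
  qed
  also have "\<dots> = (\<integral>s. (\<integral>y. T * fejer (T * (s - y)) \<partial>M) \<partial>\<Lambda>)"
  proof (rule fubini_bounded[OF fM f\<Lambda>, where B="T * 8"])
    fix y s
    have "8 / (1 + (T * (s - y))\<^sup>2) \<le> 8 / 1" by (rule divide_left_mono) (auto simp: add_pos_nonneg)
    then have "fejer (T * (s - y)) \<le> 8" using fejer_le[of "T * (s - y)"] by simp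
    then show "\<bar>T * fejer (T * (s - y))\<bar> \<le> T * 8" using T fejer_nonneg by (simp add: abs_mult)
  qed measurable
  also have "\<dots> = (\<integral>s. (\<integral>t. (\<integral>y. cos (t * (s - y)) \<partial>M) \<partial>\<kappa>) \<partial>\<Lambda>)"
    unfolding kernel[symmetric]
    by (rule Bochner_Integration.integral_cong[OF refl], rule fubini_bounded[OF fM f\<kappa>, where B=1]) auto
  also have "\<dots> = (\<integral>s. (\<integral>t. cos (t * s) * Re (char M t) + sin (t * s) * Im (char M t) \<partial>\<kappa>) \<partial>\<Lambda>)"
    by (simp only: char_int)
  also have "\<dots> = (\<integral>t. (\<integral>s. cos (t * s) * Re (char M t) + sin (t * s) * Im (char M t) \<partial>\<Lambda>) \<partial>\<kappa>)"
  proof (rule fubini_bounded[OF f\<Lambda> f\<kappa>, where B=1])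
    show "\<bar>cos (t * s) * Re (char M t) + sin (t * s) * Im (char M t)\<bar> \<le> 1" for t s
    proof -
      have "\<bar>\<integral>y. cos (t * (s - y)) \<partial>M\<bar> \<le> (\<integral>y. \<bar>cos (t * (s - y))\<bar> \<partial>M)" by (rule integral_abs_bound)
      also have "\<dots> \<le> (\<integral>y. 1 \<partial>M)"
        by (intro integral_mono) (auto intro!: M.integrable_const_bound[where B=1])
      finally show ?thesis using M.prob_space by (simp add: char_int)
    qed
  qed measurable
  also have "\<dots> = (\<integral>t. (1 - \<bar>t\<bar> / T) * indicator {-T..T} t *
        (\<integral>s. cos (t * s) * Re (char M t) + sin (t * s) * Im (char M t) \<partial>\<Lambda>) \<partial>lborel)"
    unfolding \<kappa>_def using kpos by (subst integral_density) auto
  also have "\<dots> = (\<integral>t. (1 - \<bar>t\<bar> / T) * indicator {-T..T} t *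
        (\<integral>s. (cos (t * s) * Re (char M t) + sin (t * s) * Im (char M t)) * indicator {a<..x} s \<partial>lborel) \<partial>lborel)"
    unfolding \<Lambda>_def by (subst integral_density) (auto simp: mult.commute)
  finally show ?thesis .
qed simp

lemma trig_integral:
  fixes t a x R I :: real
  assumes t: "t \<noteq> 0" and ax: "a < x"
  shows "(\<integral>s. (cos (t * s) * R + sin (t * s) * I) * indicator {a<..x} s \<partial>lborel)
    = (R * (sin (t * x) - sin (t * a)) - I * (cos (t * x) - cos (t * a))) / t"
proof -
  let ?F = "\<lambda>s. (R * sin (t * s) - I * cos (t * s)) / t"
  have "(\<integral>s. (cos (t * s) * R + sin (t * s) * I) * indicator {a<..x} s \<partial>lborel)
     = (\<integral>s. (cos (t * s) * R + sin (t * s) * I) * indicator {a..x} s \<partial>lborel)"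
  proof (rule integral_cong_AE)
    show "AE s in lborel. (cos (t * s) * R + sin (t * s) * I) * indicator {a<..x} s
        = (cos (t * s) * R + sin (t * s) * I) * indicator {a..x} s"
      using AE_lborel_singleton[of a] by eventually_elim (auto split: split_indicator)
  qed auto
  also have "\<dots> = ?F x - ?F a"
  proof (rule integral_FTC_Icc_real)
    show "(?F has_real_derivative cos (t * s) * R + sin (t * s) * I) (at s)" for s
      using t by (auto intro!: derivative_eq_intros simp: field_simps)
  qed (use ax in auto)
  also have "\<dots> = (R * (sin (t * x) - sin (t * a)) - I * (cos (t * x) - cos (t * a))) / t"
    using t by (simp add: field_simps)
  finally show ?thesis .
qed

lemma integrable_fejer_scaled: "T > 0 \<Longrightarrow> integrable lborel (\<lambda>u. T * fejer (T * u))"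
  using lborel_integrable_real_affine_iff[of T fejer 0] integrable_fejer by auto

text \<open>Smoothed increments over \<open>(a, x]\<close> are compared first, then \<open>a\<close>
  tends to minus infinity. Integrating the trigonometric terms over the interval produces
  \<open>1 / t\<close>, which cancels the factor \<open>\<bar>t\<bar>\<close> of the assumption;
  differences of two sines and of two cosines are at most 2 each, which gives the 4.\<close>

lemma smoothed_cdf_bound:
  assumes M: "real_distribution M" and G: "real_distribution G" and T: "T > 0"
    and \<psi>: "set_integrable lborel {-T..T} \<psi>"
    and char: "\<And>t. \<bar>t\<bar> \<le> T \<Longrightarrow> cmod (char M t - char G t) \<le> \<bar>t\<bar> * \<psi> t"
  shows "\<bar>\<integral>u. (cdf M (x - u) - cdf G (x - u)) * (T * fejer (T * u)) \<partial>lborel\<bar> \<le> 4 * (LINT t:{-T..T}|lborel. \<psi> t)"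
proof -
  interpret M: real_distribution M by (rule M)
  interpret G: real_distribution G by (rule G)
  define p where "p = (\<lambda>u. T * fejer (T * u))"
  have pi[simp]: "integrable lborel p" unfolding p_def by (rule integrable_fejer_scaled[OF T])
  have p0: "p u \<ge> 0" for u using T fejer_nonneg by (simp add: p_def)
  have [measurable]: "p \<in> borel_measurable borel" unfolding p_def by measurable
  have cdf_bd: "0 \<le> cdf D y \<and> cdf D y \<le> 1" if "real_distribution D" for D y
  proof -
    interpret D: real_distribution D by fact
    show ?thesis using D.cdf_nonneg D.cdf_bounded_prob by blast
  qed
  define H where "H = (\<lambda>y. cdf M y - cdf G y)"
  have H1: "\<bar>H y\<bar> \<le> 1" for y using cdf_bd[OF M, of y] cdf_bd[OF G, of y] by (simp add: H_def abs_le_iff)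
  have cdf_m: "cdf D \<in> borel_measurable borel" if "real_distribution D" for D
  proof -
    interpret D: real_distribution D by fact
    show ?thesis by (rule borel_measurable_mono) (auto simp: mono_def intro: D.cdf_nondecreasing)
  qed
  note [measurable] = cdf_m[OF M] cdf_m[OF G]
  have [measurable]: "H \<in> borel_measurable borel" unfolding H_def by measurable
  have bdi: "integrable lborel (\<lambda>u. h u * p u)" if "h \<in> borel_measurable borel" "\<And>u. \<bar>h u\<bar> \<le> 1" for h
    by (rule Bochner_Integration.integrable_bound[OF pi])
      (use that p0 in \<open>auto simp: abs_mult intro!: AE_I2 mult_left_le_one_le\<close>)
  define A where "A = (\<lambda>y. \<integral>u. H (y - u) * p u \<partial>lborel)"
  define k where "k = (\<lambda>t. (1 - \<bar>t\<bar> / T) * indicator {-T..T} t)"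
  have k01: "0 \<le> k t" "k t \<le> indicator {-T..T} t" for t
    using T by (auto simp: k_def field_simps split: split_indicator)
  have [measurable]: "k \<in> borel_measurable borel" unfolding k_def by measurable
  define J where "J = (LINT t:{-T..T}|lborel. \<psi> t)"
  have step: "\<bar>A x - A a\<bar> \<le> 4 * J" if ax: "a < x" for a
  proof -
    define W where "W = (\<lambda>D t. \<integral>s. (cos (t * s) * Re (char D t) + sin (t * s) * Im (char D t)) * indicator {a<..x} s \<partial>lborel)"
    have W_eq: "W D t = (Re (char D t) * (sin (t * x) - sin (t * a)) - Im (char D t) * (cos (t * x) - cos (t * a))) / t"
      if "t \<noteq> 0" for D t unfolding W_def by (rule trig_integral[OF that ax])
    have sin_d: "\<bar>sin (t * x) - sin (t * a)\<bar> \<le> 2" and cos_d: "\<bar>cos (t * x) - cos (t * a)\<bar> \<le> 2" for t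
      using abs_triangle_ineq4[of "sin (t * x)" "sin (t * a)"] abs_triangle_ineq4[of "cos (t * x)" "cos (t * a)"]
        abs_sin_le_one[of "t * x"] abs_sin_le_one[of "t * a"] abs_cos_le_one[of "t * x"] abs_cos_le_one[of "t * a"]
      by linarith+
    have smooth: "(\<integral>u. (cdf D (x - u) - cdf D (a - u)) * p u \<partial>lborel) = (\<integral>t. k t * W D t \<partial>lborel)"
      if "real_distribution D" for D
      using fejer_smoothing[OF that T, where a=a and x=x] ax by (simp add: p_def k_def W_def)
    have Wi: "integrable lborel (\<lambda>t. k t * W D t)" if D: "real_distribution D" for D
    proof -
      interpret D: real_distribution D by (rule D)
      have "set_integrable lborel {-T..T} (\<lambda>t. 2 * (x - a))"
        by (rule borel_integrable_atLeastAtMost') auto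
      then have "integrable lborel (\<lambda>t. 2 * (x - a) * indicator {-T..T} t)" by (simp add: set_integrable_def mult.commute)
      then show ?thesis
      proof (rule Bochner_Integration.integrable_bound)
        show "(\<lambda>t. k t * W D t) \<in> borel_measurable lborel" unfolding W_def by measurable
        have "\<bar>W D t\<bar> \<le> 2 * (x - a)" for t
        proof -
          have "\<bar>W D t\<bar> \<le> (\<integral>s. 2 * indicator {a<..x} s \<partial>lborel)" unfolding W_def
          proof (rule order_trans[OF integral_abs_bound], rule integral_mono')
            show "integrable lborel (\<lambda>s. 2 * indicator {a<..x} s :: real)"
              using ax by (intro integrable_mult_right integrable_real_indicator) auto
            fix s
            have "\<bar>cos (t * s) * Re (char D t) + sin (t * s) * Im (char D t)\<bar> \<le> 1 * 1 + 1 * 1"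
              by (rule order_trans[OF abs_triangle_ineq], unfold abs_mult, intro add_mono mult_mono)
                (auto intro: order_trans[OF abs_Re_le_cmod] order_trans[OF abs_Im_le_cmod] D.cmod_char_le_1)
            then show "\<bar>(cos (t * s) * Re (char D t) + sin (t * s) * Im (char D t)) * indicator {a<..x} s\<bar> \<le> 2 * indicator {a<..x} s"
              by (auto split: split_indicator)
          qed simp
          then show ?thesis using ax by simp
        qed
        then show "AE t in lborel. norm (k t * W D t) \<le> norm (2 * (x - a) * indicator {-T..T} t)"
        proof (intro AE_I2)
          fix t
          have "k t * \<bar>W D t\<bar> \<le> indicator {-T..T} t * (2 * (x - a))"
            using k01[of t] \<open>\<And>t. \<bar>W D t\<bar> \<le> 2 * (x - a)\<close> by (intro mult_mono) auto
          then show "norm (k t * W D t) \<le> norm (2 * (x - a) * indicator {-T..T} t)"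
            using k01(1)[of t] ax by (simp add: abs_mult mult.commute)
        qed
      qed
    qed
    have "A x - A a = (\<integral>u. (cdf M (x - u) - cdf M (a - u)) * p u \<partial>lborel) - (\<integral>u. (cdf G (x - u) - cdf G (a - u)) * p u \<partial>lborel)"
    proof -
      have d: "\<bar>cdf D y - cdf D z\<bar> \<le> 1" if "real_distribution D" for D y z
        using cdf_bd[OF that, of y] cdf_bd[OF that, of z] by (simp add: abs_le_iff)
      have "A x - A a = (\<integral>u. H (x - u) * p u - H (a - u) * p u \<partial>lborel)"
        unfolding A_def by (rule Bochner_Integration.integral_diff[symmetric]) (auto intro!: bdi H1)
      also have "\<dots> = (\<integral>u. (cdf M (x - u) - cdf M (a - u)) * p u - (cdf G (x - u) - cdf G (a - u)) * p u \<partial>lborel)"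
        by (simp add: H_def algebra_simps)
      also have "\<dots> = (\<integral>u. (cdf M (x - u) - cdf M (a - u)) * p u \<partial>lborel) - (\<integral>u. (cdf G (x - u) - cdf G (a - u)) * p u \<partial>lborel)"
        by (rule Bochner_Integration.integral_diff)
          (auto intro!: bdi d M G)
      finally show ?thesis .
    qed
    also have "\<dots> = (\<integral>t. k t * W M t - k t * W G t \<partial>lborel)"
      unfolding smooth[OF M] smooth[OF G] by (rule Bochner_Integration.integral_diff[symmetric]) (auto intro!: Wi M G)
    also have "\<bar>\<dots>\<bar> \<le> (\<integral>t. \<bar>k t * W M t - k t * W G t\<bar> \<partial>lborel)" by (rule integral_abs_bound)
    also have "\<dots> \<le> (\<integral>t. 4 * (indicator {-T..T} t *\<^sub>R \<psi> t) \<partial>lborel)"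
    proof (rule integral_mono_AE)
      show "integrable lborel (\<lambda>t. \<bar>k t * W M t - k t * W G t\<bar>)"
        by (intro integrable_abs Bochner_Integration.integrable_diff Wi M G)
      show "integrable lborel (\<lambda>t. 4 * (indicator {-T..T} t *\<^sub>R \<psi> t))"
        using \<psi> unfolding set_integrable_def by (rule integrable_mult_right)
      show "AE t in lborel. \<bar>k t * W M t - k t * W G t\<bar> \<le> 4 * (indicator {-T..T} t *\<^sub>R \<psi> t)"
        using AE_lborel_singleton[of 0]
      proof eventually_elim
        fix t :: real assume t: "t \<noteq> 0"
        show "\<bar>k t * W M t - k t * W G t\<bar> \<le> 4 * (indicator {-T..T} t *\<^sub>R \<psi> t)"
        proof (cases "\<bar>t\<bar> \<le> T")
          case True
          define R where "R = Re (char M t - char G t)"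
          define I where "I = Im (char M t - char G t)"
          have RI: "\<bar>R\<bar> \<le> \<bar>t\<bar> * \<psi> t" "\<bar>I\<bar> \<le> \<bar>t\<bar> * \<psi> t"
            unfolding R_def I_def using char[OF True] abs_Re_le_cmod abs_Im_le_cmod order_trans by blast+
          have "W M t - W G t = (R * (sin (t * x) - sin (t * a)) - I * (cos (t * x) - cos (t * a))) / t"
            using t by (simp add: W_eq R_def I_def diff_divide_distrib[symmetric] algebra_simps)
          moreover have "\<bar>R * (sin (t * x) - sin (t * a)) - I * (cos (t * x) - cos (t * a))\<bar> \<le> (\<bar>t\<bar> * \<psi> t) * 2 + (\<bar>t\<bar> * \<psi> t) * 2"
          proof (rule order_trans[OF abs_triangle_ineq4], unfold abs_mult, intro add_mono mult_mono)
            show "0 \<le> \<bar>t\<bar> * \<psi> t" using RI(1) abs_ge_zero order_trans by blast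
            then show "0 \<le> \<bar>t\<bar> * \<psi> t" .
          qed (use RI sin_d cos_d in auto)
          ultimately have "\<bar>W M t - W G t\<bar> \<le> 4 * \<psi> t" using t by (simp add: abs_divide pos_divide_le_eq mult_ac)
          moreover have "k t \<le> 1" using k01(2)[of t] by (auto split: split_indicator_asm)
          ultimately have "k t * \<bar>W M t - W G t\<bar> \<le> 1 * (4 * \<psi> t)" using k01(1)[of t] by (intro mult_mono) auto
          then show ?thesis using True k01(1)[of t]
            by (simp add: abs_mult right_diff_distrib[symmetric] indicator_def abs_le_iff)
        next
          case False
          then have "indicator {-T..T} t = (0 :: real)" by (auto simp: indicator_def)
          then show ?thesis by (simp add: k_def)
        qed
      qed
    qed
    also have "\<dots> = 4 * J" by (simp add: J_def set_lebesgue_integral_def)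
    finally show ?thesis .
  qed
  have lim0: "((\<lambda>n. A (- real n)) \<longlonglongrightarrow> (\<integral>(u::real). 0 \<partial>lborel))"
    unfolding A_def
  proof (rule integral_dominated_convergence[where w=p and f="\<lambda>_. 0" and s="\<lambda>n u. H (- real n - u) * p u"])
    show "AE u in lborel. (\<lambda>n. H (- real n - u) * p u) \<longlonglongrightarrow> 0"
    proof (rule AE_I2)
      fix u
      have "filterlim (\<lambda>n. - real n - u) at_bot sequentially" by real_asymp
      then have "(\<lambda>n. H (- real n - u)) \<longlonglongrightarrow> 0 - 0" unfolding H_def
        by (intro tendsto_diff filterlim_compose[OF M.cdf_lim_at_bot] filterlim_compose[OF G.cdf_lim_at_bot])
      then show "(\<lambda>n. H (- real n - u) * p u) \<longlonglongrightarrow> 0" by (intro tendsto_mult_left_zero) simp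
    qed
    show "AE u in lborel. norm (H (- real n - u) * p u) \<le> p u" for n
      using H1 p0 by (intro AE_I2) (auto simp: abs_mult intro!: mult_left_le_one_le)
  qed auto
  have "eventually (\<lambda>n. \<bar>A x - A (- real n)\<bar> \<le> 4 * J) sequentially"
  proof -
    have "eventually (\<lambda>n. - real n < x) sequentially" by real_asymp
    then show ?thesis by eventually_elim (rule step)
  qed
  moreover have "(\<lambda>n. \<bar>A x - A (- real n)\<bar>) \<longlonglongrightarrow> \<bar>A x - 0\<bar>"
    using lim0 by (intro tendsto_intros) simp
  ultimately have "\<bar>A x - 0\<bar> \<le> 4 * J" by (intro tendsto_upperbound) auto
  then show ?thesis by (simp add: A_def H_def p_def J_def)
qed

lemma fejer_tail:
  obtains b where "b > 0" "(\<integral>y. fejer y * indicator {y. b < \<bar>y\<bar>} y \<partial>lborel) \<le> (\<integral>y. fejer y \<partial>lborel) / 4"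
proof -
  let ?c = "\<integral>y. fejer y \<partial>lborel"
  have "(\<lambda>n. \<integral>y. fejer y * indicator {y. real n < \<bar>y\<bar>} y \<partial>lborel) \<longlonglongrightarrow> (\<integral>(y::real). 0 \<partial>lborel)"
  proof (rule integral_dominated_convergence[where w=fejer and f="\<lambda>_. 0" and s="\<lambda>n y. fejer y * indicator {y. real n < \<bar>y\<bar>} y"])
    show "AE y in lborel. (\<lambda>n. fejer y * indicator {y. real n < \<bar>y\<bar>} y) \<longlonglongrightarrow> 0"
    proof (rule AE_I2)
      fix y
      have "eventually (\<lambda>n. real n \<ge> \<bar>y\<bar>) sequentially" by real_asymp
      then have "eventually (\<lambda>n. fejer y * indicator {y. real n < \<bar>y\<bar>} y = 0) sequentially"
        by eventually_elim simp
      then show "(\<lambda>n. fejer y * indicator {y. real n < \<bar>y\<bar>} y) \<longlonglongrightarrow> 0" by (rule tendsto_eventually)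
    qed
    show "AE y in lborel. norm (fejer y * indicator {y. real n < \<bar>y\<bar>} y) \<le> fejer y" for n
      using fejer_nonneg by (intro AE_I2) (auto split: split_indicator)
  qed (auto simp: integrable_fejer)
  then have "eventually (\<lambda>n. (\<integral>y. fejer y * indicator {y. real n < \<bar>y\<bar>} y \<partial>lborel) < ?c / 4) sequentially"
    using integral_fejer_pos by (intro order_tendstoD(2)) auto
  then have "eventually (\<lambda>n. (\<integral>y. fejer y * indicator {y. real n < \<bar>y\<bar>} y \<partial>lborel) < ?c / 4 \<and> n \<ge> 1) sequentially"
    using eventually_ge_at_top by (rule eventually_conj)
  then obtain n where "(\<integral>y. fejer y * indicator {y. real n < \<bar>y\<bar>} y \<partial>lborel) < ?c / 4" "n \<ge> 1"
    by (auto simp: eventually_sequentially)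
  then show ?thesis by (intro that[of "real n"]) auto
qed

text \<open>A large difference of the distribution functions at one point persists over an interval
  of length \<open>2 * b\<close> on one side, because one function is monotone and the other
  Lipschitz. Centring the kernel on that interval recovers most of the difference; the part of the
  kernel outside costs at most the supremum \<open>\<Delta>\<close> times a quarter of the total
  mass.\<close>

lemma esseen_inequality:
  obtains C where "C > 0"
    and "\<And>M G T m \<psi> x. \<lbrakk>real_distribution M; real_distribution G; T > 0; m \<ge> 0;
      set_integrable lborel {-T..T} \<psi>; \<And>t. \<bar>t\<bar> \<le> T \<Longrightarrow> cmod (char M t - char G t) \<le> \<bar>t\<bar> * \<psi> t;
      \<And>x y. x \<le> y \<Longrightarrow> cdf G y - cdf G x \<le> m * (y - x)\<rbrakk>
      \<Longrightarrow> \<bar>cdf M x - cdf G x\<bar> \<le> C * ((LINT t:{-T..T}|lborel. \<psi> t) + m / T)"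
proof -
  define c where "c = (\<integral>y. fejer y \<partial>lborel)"
  have c: "c > 0" using integral_fejer_pos by (simp add: c_def)
  obtain b0 where b0: "b0 > 0" "(\<integral>y. fejer y * indicator {y. b0 < \<bar>y\<bar>} y \<partial>lborel) \<le> c / 4"
    using fejer_tail unfolding c_def by blast
  define C where "C = 8 / c + 4 * b0"
  have C: "C > 0" using c b0 by (simp add: C_def add_pos_pos)
  show ?thesis
  proof (rule that[OF C])
    fix M G :: "real measure" and T m :: real and \<psi> :: "real \<Rightarrow> real" and x :: real
    assume M: "real_distribution M" and G: "real_distribution G" and T: "T > 0" and m: "m \<ge> 0"
      and \<psi>: "set_integrable lborel {-T..T} \<psi>"
      and char: "\<And>t. \<bar>t\<bar> \<le> T \<Longrightarrow> cmod (char M t - char G t) \<le> \<bar>t\<bar> * \<psi> t"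
      and lip: "\<And>x y. x \<le> y \<Longrightarrow> cdf G y - cdf G x \<le> m * (y - x)"
    interpret M: real_distribution M by (rule M)
    interpret G: real_distribution G by (rule G)
    define p where "p = (\<lambda>u. T * fejer (T * u))"
    have pi: "integrable lborel p" unfolding p_def by (rule integrable_fejer_scaled[OF T])
    have p0: "p u \<ge> 0" for u using T fejer_nonneg by (simp add: p_def)
    define b where "b = b0 / T"
    have b: "b > 0" using b0 T by (simp add: b_def)
    have p_int: "(\<integral>u. p u \<partial>lborel) = c"
      using lborel_integral_real_affine[of T fejer 0] T by (simp add: p_def c_def)
    have q: "(\<integral>u. p u * indicator {u. b < \<bar>u\<bar>} u \<partial>lborel) \<le> c / 4"
    proof -
      have "(\<integral>y. fejer y * indicator {y. b0 < \<bar>y\<bar>} y \<partial>lborel) = (\<integral>u. p u * indicator {u. b < \<bar>u\<bar>} u \<partial>lborel)"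
        using lborel_integral_real_affine[of T "\<lambda>y. fejer y * indicator {y. b0 < \<bar>y\<bar>} y" 0] T
        by (simp add: p_def b_def indicator_def abs_mult pos_divide_less_eq mult.commute mult_ac)
      then show ?thesis using b0 by simp
    qed
    have qi: "integrable lborel (\<lambda>u. p u * indicator {u. b < \<bar>u\<bar>} u)"
      by (rule integrable_real_mult_indicator[OF _ pi]) auto
    have cdf01: "0 \<le> cdf M y" "cdf M y \<le> 1" "0 \<le> cdf G y" "cdf G y \<le> 1" for y
      using M.cdf_nonneg M.cdf_bounded_prob G.cdf_nonneg G.cdf_bounded_prob by blast+
    define H where "H = (\<lambda>y. cdf M y - cdf G y)"
    have H1: "\<bar>H y\<bar> \<le> 1" for y using cdf01[of y] by (simp add: H_def abs_le_iff)
    have bdd: "bdd_above (range (\<lambda>y. \<bar>H y\<bar>))" by (rule bdd_aboveI2[where M=1]) (rule H1)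
    define \<Delta> where "\<Delta> = (SUP y. \<bar>H y\<bar>)"
    have \<Delta>: "\<bar>H y\<bar> \<le> \<Delta>" for y unfolding \<Delta>_def by (rule cSUP_upper[OF _ bdd]) simp
    have \<Delta>0: "\<Delta> \<ge> 0" using order_trans[OF abs_ge_zero \<Delta>] .
    define J where "J = (LINT t:{-T..T}|lborel. \<psi> t)"
    have smooth: "\<bar>\<integral>u. H (x - u) * p u \<partial>lborel\<bar> \<le> 4 * J" for x
      unfolding H_def p_def J_def by (rule smoothed_cdf_bound[OF M G T \<psi> char])
    have [measurable]: "H \<in> borel_measurable borel"
    proof -
      have "cdf M \<in> borel_measurable borel" by (rule borel_measurable_mono) (auto simp: mono_def intro: M.cdf_nondecreasing)
      moreover have "cdf G \<in> borel_measurable borel" by (rule borel_measurable_mono) (auto simp: mono_def intro: G.cdf_nondecreasing)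
      ultimately show ?thesis unfolding H_def by measurable
    qed
    have [measurable]: "p \<in> borel_measurable borel" unfolding p_def by measurable
    have Hi: "integrable lborel (\<lambda>u. H (y - u) * p u)" for y
      by (rule Bochner_Integration.integrable_bound[OF pi])
        (use H1 p0 in \<open>auto simp: abs_mult intro!: AE_I2 mult_left_le_one_le\<close>)
    \<comment> \<open>\<open>\<epsilon>\<close> is the sign of the difference. Inside the window it
      keeps the size \<open>a - 2 * m * b\<close>, outside only \<open>- \<Delta>\<close> is known;
      the kernel mass outside is at most \<open>c / 4\<close>.\<close>
    have key: "3 / 4 * a * c \<le> 4 * J + 2 * m * b * c + \<Delta> * c / 4"
      if \<epsilon>: "\<epsilon> = 1 \<or> \<epsilon> = -1" and a: "0 \<le> a" "a \<le> \<Delta>" and near: "\<And>u. \<bar>u\<bar> \<le> b \<Longrightarrow> \<epsilon> * H (y - u) \<ge> a - 2 * m * b" for \<epsilon> a y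
    proof -
      have "(a - 2 * m * b) * c - (a + \<Delta>) * (c / 4) \<le>
        (a - 2 * m * b) * c - (a + \<Delta>) * (\<integral>u. p u * indicator {u. b < \<bar>u\<bar>} u \<partial>lborel)"
        using mult_left_mono[OF q, of "a + \<Delta>"] a \<Delta>0 by simp
      also have "\<dots> = (\<integral>u. (a - 2 * m * b) * p u - (a + \<Delta>) * (p u * indicator {u. b < \<bar>u\<bar>} u) \<partial>lborel)"
        using pi qi by (simp add: p_int)
      also have "\<dots> \<le> (\<integral>u. \<epsilon> * (H (y - u) * p u) \<partial>lborel)"
      proof (rule integral_mono)
        show "integrable lborel (\<lambda>u. (a - 2 * m * b) * p u - (a + \<Delta>) * (p u * indicator {u. b < \<bar>u\<bar>} u))"
          using pi qi by (intro Bochner_Integration.integrable_diff integrable_mult_right)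
        show "integrable lborel (\<lambda>u. \<epsilon> * (H (y - u) * p u))" using Hi by (rule integrable_mult_right)
        fix u
        have "a - 2 * m * b - (a + \<Delta>) * indicator {u. b < \<bar>u\<bar>} u \<le> \<epsilon> * H (y - u)"
        proof (cases "b < \<bar>u\<bar>")
          case True
          have "a - 2 * m * b - (a + \<Delta>) * indicator {u. b < \<bar>u\<bar>} u = - \<Delta> - 2 * m * b"
            using True by simp
          moreover have "- \<Delta> \<le> \<epsilon> * H (y - u)" using \<Delta>[of "y - u"] \<epsilon> by (auto simp: abs_le_iff)
          moreover have "0 \<le> 2 * m * b" using m b by simp
          ultimately show ?thesis by linarith
        qed (use near in simp)
        from mult_right_mono[OF this p0[of u]]
        show "(a - 2 * m * b) * p u - (a + \<Delta>) * (p u * indicator {u. b < \<bar>u\<bar>} u) \<le> \<epsilon> * (H (y - u) * p u)"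
          by (simp add: algebra_simps)
      qed
      also have "\<dots> \<le> 4 * J" using smooth[of y] \<epsilon> by (auto simp: abs_le_iff)
      finally have "(a - 2 * m * b) * c - (a + \<Delta>) * (c / 4) \<le> 4 * J" .
      moreover have "(a - 2 * m * b) * c - (a + \<Delta>) * (c / 4) = 3 / 4 * a * c - 2 * m * b * c - \<Delta> * c / 4"
        by (simp add: field_simps)
      ultimately show ?thesis by linarith
    qed
    \<comment> \<open>A positive difference persists to the right of \<open>y\<close>, a negative
      one to the left, so the window is centred at \<open>y + b\<close> or
      \<open>y - b\<close>.\<close>
    have all: "3 / 4 * \<bar>H y\<bar> * c \<le> 4 * J + 2 * m * b * c + \<Delta> * c / 4" for y
    proof (cases "H y \<ge> 0")
      case True
      show ?thesis
      proof (rule key[of 1 "\<bar>H y\<bar>" "y + b"])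
        fix u assume u: "\<bar>u\<bar> \<le> b"
        have "cdf M y \<le> cdf M (y + b - u)" using u by (intro M.cdf_nondecreasing) auto
        moreover have "cdf G (y + b - u) - cdf G y \<le> m * (b - u)" using lip[of y "y + b - u"] u by simp
        moreover have "m * (b - u) \<le> m * (2 * b)" using u m by (intro mult_left_mono) auto
        ultimately show "\<bar>H y\<bar> - 2 * m * b \<le> 1 * H (y + b - u)" using True by (simp add: H_def)
      qed (use \<Delta> in auto)
    next
      case False
      show ?thesis
      proof (rule key[of "-1" "\<bar>H y\<bar>" "y - b"])
        fix u assume u: "\<bar>u\<bar> \<le> b"
        have "cdf M (y - b - u) \<le> cdf M y" using u by (intro M.cdf_nondecreasing) auto
        moreover have "cdf G y - cdf G (y - b - u) \<le> m * (b + u)" using lip[of "y - b - u" y] u by simp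
        moreover have "m * (b + u) \<le> m * (2 * b)" using u m by (intro mult_left_mono) auto
        ultimately show "\<bar>H y\<bar> - 2 * m * b \<le> - 1 * H (y - b - u)" using False by (simp add: H_def)
      qed (use \<Delta> in auto)
    qed
    \<comment> \<open>The estimate holds at every point and passes to the supremum, whether or not
      it is attained; the quarter of \<open>\<Delta>\<close> on the right is then absorbed.\<close>
    have "\<Delta> \<le> (4 * J + 2 * m * b * c + \<Delta> * c / 4) / (3 / 4 * c)"
      unfolding \<Delta>_def
    proof (rule cSUP_least)
      show "\<bar>H y\<bar> \<le> (4 * J + 2 * m * b * c + (SUP y. \<bar>H y\<bar>) * c / 4) / (3 / 4 * c)" for y
        using all[of y] c by (simp add: \<Delta>_def[symmetric] pos_le_divide_eq mult_ac)
    qed simp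
    then have "\<Delta> * (3 / 4 * c) \<le> 4 * J + 2 * m * b * c + \<Delta> * c / 4" using c by (subst (asm) pos_le_divide_eq) auto
    then have "\<Delta> * c \<le> (8 * J / c + 4 * m * b) * c" using c by (simp add: algebra_simps)
    then have 1: "\<Delta> \<le> 8 * J / c + 4 * m * b" using c by (simp only: mult_le_cancel_right_pos)
    have J0: "J \<ge> 0" using smooth[of 0] abs_ge_zero[of "\<integral>u. H (0 - u) * p u \<partial>lborel"] by linarith
    have "C * (J + m / T) = (8 * J / c + 4 * m * b) + (8 * (m / T) / c + 4 * b0 * J)"
      by (simp add: C_def b_def algebra_simps add_divide_distrib)
    moreover have "0 \<le> 8 * (m / T) / c + 4 * b0 * J" using b0 c J0 m T by (intro add_nonneg_nonneg) auto
    ultimately have "8 * J / c + 4 * m * b \<le> C * (J + m / T)" by linarith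
    then show "\<bar>cdf M x - cdf G x\<bar> \<le> C * ((LINT t:{-T..T}|lborel. \<psi> t) + m / T)"
      using 1 \<Delta>[of x] by (simp add: H_def J_def)
  qed
qed

section \<open>Exponential tilting\<close>

text \<open>The imaginary part vanishes along the real axis, so its derivative in that direction
  vanishes too.\<close>

lemma deriv_real_on_reals:
  assumes g: "g holomorphic_on ball 0 r" and real: "\<And>u. \<bar>u\<bar> < r \<Longrightarrow> g (of_real u) \<in> \<real>" and u: "\<bar>u\<bar> < r"
  shows "deriv g (of_real u) \<in> \<real>"
proof -
  have "(g has_field_derivative deriv g (of_real u)) (at (of_real u))"
    by (rule holomorphic_derivI[OF g open_ball]) (use u in simp)
  then have "((\<lambda>t. g (of_real t)) has_vector_derivative deriv g (of_real u)) (at u)"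
    by (rule has_vector_derivative_real_field)
  then have "((\<lambda>t. Im (g (of_real t))) has_real_derivative Im (deriv g (of_real u))) (at u)"
    unfolding has_real_derivative_iff_has_vector_derivative
    by (rule bounded_linear.has_vector_derivative[OF bounded_linear_Im])
  then have "((\<lambda>t. 0) has_real_derivative Im (deriv g (of_real u))) (at u)"
    by (rule has_field_derivative_transform_within_open[where S="{-r<..<r}"])
      (use u real in \<open>auto simp: complex_is_Real_iff\<close>)
  then have "Im (deriv g (of_real u)) = 0" using DERIV_unique DERIV_const by blast
  then show ?thesis by (simp add: complex_is_Real_iff)
qed

text \<open>The log-Laplace transform is of size \<open>N\<close> on a fixed disk; \<open>N\<close> plays the role of the number of summands.\<close>

locale log_laplace = real_distribution \<mu> for \<mu> :: "real measure" +
  fixes r C c N v :: real and L :: "complex \<Rightarrow> complex"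
  assumes r: "0 < r" and C: "0 < C" and c: "0 < c" and N: "1 \<le> N"
    and hol: "L holomorphic_on ball 0 r"
    and bound: "\<And>z. norm z < r \<Longrightarrow> norm (L z) \<le> C * N"
    and zero: "L 0 = 0" and deriv_zero: "deriv L 0 = 0"
    and deriv2_zero: "(deriv ^^ 2) L 0 = of_real v" and v_ge: "c * N \<le> v"
    and real: "\<And>u. \<bar>u\<bar> < r \<Longrightarrow> L (of_real u) \<in> \<real>"
    and integrable_exp: "\<And>u. \<bar>u\<bar> < r \<Longrightarrow> integrable \<mu> (\<lambda>x. exp (u * x))"
    and laplace: "\<And>z. norm z < r \<Longrightarrow> (\<integral>x. exp (z * of_real x) \<partial>\<mu>) = exp (L z)"
begin

text \<open>\<open>C3 * N\<close> is Cauchy's bound for the third derivative on circles of radius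
  \<open>r / 2\<close>. \<open>umax\<close> limits the tilt so that the second derivative keeps at
  least \<open>c * N / 2\<close>; \<open>Tmax\<close> limits the frequency so that the cubic
  remainder takes at most half of the resulting Gaussian decay. Both are at most
  \<open>r / 8\<close>, which keeps \<open>u + i t\<close> inside the disk of radius
  \<open>r / 2\<close>.\<close>

definition "C3 = 48 * C / r ^ 3"
definition "umax = min (r / 8) (c / (2 * C3))"
definition "Tmax = min (r / 8) (c / (4 * C3))"

text \<open>The cumulant generating function on the real axis and its first two derivatives, which
  are the mean and the variance of the law tilted by \<open>u\<close>.\<close>

definition "k0 u = Re (L (of_real u))"
definition "k1 u = Re (deriv L (of_real u))"
definition "k2 u = Re ((deriv ^^ 2) L (of_real u))"

lemma C3_pos: "C3 > 0" using C r by (simp add: C3_def)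
lemma umax_pos: "umax > 0" and Tmax_pos: "Tmax > 0" using C3_pos c r by (auto simp: umax_def Tmax_def)

lemma umax_le: "umax \<le> r / 8" "C3 * umax \<le> c / 2"
proof -
  show "umax \<le> r / 8" by (simp add: umax_def)
  have "umax \<le> c / (2 * C3)" by (simp add: umax_def)
  then show "C3 * umax \<le> c / 2" using C3_pos by (simp add: field_simps)
qed

lemma Tmax_le: "Tmax \<le> r / 8" "C3 * Tmax \<le> c / 4"
proof -
  show "Tmax \<le> r / 8" by (simp add: Tmax_def)
  have "Tmax \<le> c / (4 * C3)" by (simp add: Tmax_def)
  then show "C3 * Tmax \<le> c / 4" using C3_pos by (simp add: field_simps)
qed

lemma higher_deriv_holomorphic: "(deriv ^^ k) L holomorphic_on ball 0 r"
  by (rule holomorphic_higher_deriv[OF hol open_ball])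

lemma third_deriv_bound:
  assumes "norm z < r / 2" shows "norm ((deriv ^^ 3) L z) \<le> C3 * N"
proof -
  have sub: "cball z (r / 2) \<subseteq> ball 0 r"
  proof
    fix w assume "w \<in> cball z (r / 2)"
    then have "norm (w - z) \<le> r / 2" by (simp add: dist_norm norm_minus_commute)
    then show "w \<in> ball 0 r" using norm_triangle_sub[of w z] assms by (simp add: dist_norm norm_minus_commute)
  qed
  have "norm ((deriv ^^ 3) L z) \<le> fact 3 * (C * N) / (r / 2) ^ 3"
  proof (rule Cauchy_inequality)
    show "L holomorphic_on ball z (r / 2)" using hol sub ball_subset_cball by (metis holomorphic_on_subset order_trans)
    show "continuous_on (cball z (r / 2)) L"
      using hol sub by (metis holomorphic_on_imp_continuous_on holomorphic_on_subset)
    show "0 < r / 2" using r by simp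
    fix w assume "norm (z - w) = r / 2"
    then have "w \<in> ball 0 r" using sub by (auto simp: dist_norm)
    then show "norm (L w) \<le> C * N" by (intro bound) simp
  qed
  also have "\<dots> = C3 * N" using r by (simp add: C3_def fact_numeral power_divide)
  finally show ?thesis .
qed

lemma taylor:
  assumes z: "norm z < r / 2" and w: "norm w < r / 2"
  shows "norm (L z - (L w + deriv L w * (z - w) + (deriv ^^ 2) L w * (z - w)\<^sup>2 / 2)) \<le> C3 * N * norm (z - w) ^ 3 / 2"
    and "norm (deriv L z - (deriv L w + (deriv ^^ 2) L w * (z - w))) \<le> C3 * N * norm (z - w) ^ 2"
    and "norm ((deriv ^^ 2) L z - (deriv ^^ 2) L w) \<le> C3 * N * norm (z - w)"
proof -
  have d: "((deriv ^^ i) L has_field_derivative (deriv ^^ Suc i) L x) (at x within ball 0 (r/2))"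
    if "x \<in> ball 0 (r/2)" for i x
  proof -
    have "2 * norm x < r" using that by simp
    then have "x \<in> ball 0 r" using norm_ge_zero[of x] unfolding mem_ball dist_0_norm by linarith
    from holomorphic_derivI[OF higher_deriv_holomorphic open_ball this]
    show ?thesis by (simp add: has_field_derivative_at_within)
  qed
  have zw: "z \<in> ball 0 (r/2)" "w \<in> ball 0 (r/2)" using z w by auto
  have b: "norm ((deriv ^^ 3) L x) \<le> C3 * N" if "x \<in> ball 0 (r/2)" for x using third_deriv_bound that by simp
  \<comment> \<open>One Taylor formula for \<open>L\<close> and its first two derivatives:
    \<open>n + m = 2\<close> always puts the third derivative into the remainder.\<close>
  have T: "norm ((deriv ^^ m) L z - (\<Sum>i\<le>n. (deriv ^^ (i + m)) L w * (z - w) ^ i / fact i))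
      \<le> C3 * N * norm (z - w) ^ Suc n / fact n" if nm: "n + m = 2" for n m
  proof -
    have 3: "Suc n + m = 3" using nm by simp
    have "norm ((deriv ^^ (0 + m)) L z - (\<Sum>i\<le>n. (deriv ^^ (i + m)) L w * (z - w) ^ i / fact i))
      \<le> C3 * N * norm (z - w) ^ Suc n / fact n"
    proof (rule complex_Taylor[where f="\<lambda>i. (deriv ^^ (i + m)) L" and S="ball 0 (r/2)"])
      show "((deriv ^^ (i + m)) L has_field_derivative (deriv ^^ (Suc i + m)) L x) (at x within ball 0 (r/2))"
        if "x \<in> ball 0 (r/2)" for i x using d[OF that, of "i + m"] by simp
      show "norm ((deriv ^^ (Suc n + m)) L x) \<le> C3 * N" if "x \<in> ball 0 (r/2)" for x
        unfolding 3 by (rule b[OF that])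
    qed (use zw in auto)
    then show ?thesis by simp
  qed
  show "norm (L z - (L w + deriv L w * (z - w) + (deriv ^^ 2) L w * (z - w)\<^sup>2 / 2)) \<le> C3 * N * norm (z - w) ^ 3 / 2"
    using T[of 2 0] by (simp add: eval_nat_numeral)
  show "norm (deriv L z - (deriv L w + (deriv ^^ 2) L w * (z - w))) \<le> C3 * N * norm (z - w) ^ 2"
    using T[of 1 1] by (simp add: eval_nat_numeral)
  show "norm ((deriv ^^ 2) L z - (deriv ^^ 2) L w) \<le> C3 * N * norm (z - w)"
    using T[of 0 2] by (simp add: eval_nat_numeral)
qed

lemma of_real_k:
  assumes "\<bar>u\<bar> < r"
  shows "L (of_real u) = of_real (k0 u)" "deriv L (of_real u) = of_real (k1 u)" "(deriv ^^ 2) L (of_real u) = of_real (k2 u)"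
proof -
  have 1: "deriv L (of_real u) \<in> \<real>" if "\<bar>u\<bar> < r" for u by (rule deriv_real_on_reals[OF hol real that])
  have "deriv L holomorphic_on ball 0 r" using higher_deriv_holomorphic[of 1] by simp
  from deriv_real_on_reals[OF this 1 assms] have 2: "(deriv ^^ 2) L (of_real u) \<in> \<real>" by (simp add: eval_nat_numeral)
  show "L (of_real u) = of_real (k0 u)" "deriv L (of_real u) = of_real (k1 u)" "(deriv ^^ 2) L (of_real u) = of_real (k2 u)"
    using real[OF assms] 1[OF assms] 2 by (simp_all add: k0_def k1_def k2_def of_real_Re)
qed

lemma k_expansion:
  assumes u: "0 \<le> u" "u \<le> umax"
  shows "\<bar>k0 u - v * u\<^sup>2 / 2\<bar> \<le> C3 * N * u ^ 3 / 2" "\<bar>k1 u - v * u\<bar> \<le> C3 * N * u\<^sup>2" "\<bar>k2 u - v\<bar> \<le> C3 * N * u"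
proof -
  have ur: "u < r / 2" "\<bar>u\<bar> < r" using u umax_le r by auto
  have n: "norm (complex_of_real u) < r / 2" "norm (0::complex) < r / 2" using ur u r by auto
  note t = taylor[OF n, unfolded zero deriv_zero deriv2_zero of_real_k[OF ur(2)]]
  have "complex_of_real (k0 u) - (0 + 0 * (of_real u - 0) + of_real v * (of_real u - 0)\<^sup>2 / 2) = of_real (k0 u - v * u\<^sup>2 / 2)"
    by simp
  with t(1) show "\<bar>k0 u - v * u\<^sup>2 / 2\<bar> \<le> C3 * N * u ^ 3 / 2" using u(1) by (simp only: norm_of_real diff_zero abs_of_nonneg)
  have "complex_of_real (k1 u) - (0 + of_real v * (of_real u - 0)) = of_real (k1 u - v * u)" by simp
  with t(2) show "\<bar>k1 u - v * u\<bar> \<le> C3 * N * u\<^sup>2" using u(1) by (simp only: norm_of_real diff_zero abs_of_nonneg)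
  have "complex_of_real (k2 u) - of_real v = of_real (k2 u - v)" by simp
  with t(3) show "\<bar>k2 u - v\<bar> \<le> C3 * N * u" using u(1) by (simp only: norm_of_real diff_zero abs_of_nonneg)
qed

lemma k2_ge:
  assumes u: "0 \<le> u" "u \<le> umax" shows "k2 u \<ge> c * N / 2"
proof -
  have "C3 * N * u \<le> (C3 * umax) * N" using u C3_pos N by (simp add: mult_ac mult_left_mono)
  also have "\<dots> \<le> (c / 2) * N" using umax_le N by (intro mult_right_mono) auto
  finally show ?thesis using k_expansion(3)[OF u] v_ge by (simp add: abs_le_iff)
qed

end

section \<open>Tools for comparing tilted laws with normal laws\<close>

text \<open>An image of the standard normal law is a distribution for every \<open>w\<close>; for
  \<open>w \<ge> 0\<close> it is the centred normal law with variance \<open>w\<close>.\<close>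

definition gauss :: "real \<Rightarrow> real measure" where
  "gauss w = distr std_normal_distribution borel (\<lambda>x. sqrt w * x)"

lemma real_distribution_gauss: "real_distribution (gauss w)"
  unfolding gauss_def by (rule std_normal.real_distribution_distr) simp

lemma cdf_gauss:
  assumes "w > 0" shows "cdf (gauss w) y = 1 - normal_tail (y / sqrt w)"
proof -
  have "cdf (gauss w) y = measure std_normal_distribution ((\<lambda>x. sqrt w * x) -` {..y} \<inter> space std_normal_distribution)"
    unfolding cdf_def gauss_def by (rule measure_distr) auto
  also have "(\<lambda>x. sqrt w * x) -` {..y} \<inter> space std_normal_distribution = {..y / sqrt w}"
    using assms by (auto simp: pos_le_divide_eq mult.commute)
  finally show ?thesis by (simp add: normal_tail_eq_cdf cdf_def)
qed

lemma char_gauss: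
  assumes "w \<ge> 0" shows "char (gauss w) t = exp (- of_real (w * t\<^sup>2 / 2))"
proof -
  have "char (gauss w) t = char std_normal_distribution (t * sqrt w)"
    unfolding char_def gauss_def by (subst integral_distr) (auto simp: mult_ac)
  moreover have "(t * sqrt w)\<^sup>2 = w * t\<^sup>2" using assms by (simp add: power_mult_distrib)
  ultimately show ?thesis unfolding char_std_normal_distribution by (simp only: exp_of_real[symmetric] of_real_minus minus_divide_left[symmetric])
qed

lemma cdf_gauss_lipschitz:
  assumes w: "w > 0" and xy: "x \<le> y"
  shows "cdf (gauss w) y - cdf (gauss w) x \<le> 1 / sqrt w * (y - x)"
proof -
  have *: "normal_tail a - normal_tail b \<le> b - a" if ab: "a \<le> b" for a b
  proof -
    have "normal_tail b + b \<ge> normal_tail a + a"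
    proof (rule DERIV_nonneg_imp_nondecreasing[where f="\<lambda>z. normal_tail z + z", OF ab])
      fix z
      have "((\<lambda>z. normal_tail z + z) has_real_derivative - std_normal_density z + 1) (at z)"
        by (intro derivative_intros normal_tail_deriv)
      then show "\<exists>d. ((\<lambda>z. normal_tail z + z) has_real_derivative d) (at z) \<and> 0 \<le> d"
        using std_normal_density_bounds(2)[of z] by (intro exI[of _ "- std_normal_density z + 1"]) auto
    qed
    then show ?thesis by simp
  qed
  have "x / sqrt w \<le> y / sqrt w" using w xy by (simp add: divide_right_mono)
  from *[OF this] show ?thesis using w by (simp add: cdf_gauss diff_divide_distrib)
qed

text \<open>\<open>exp (- u * s)\<close> is the probability that an exponential variable
  \<open>y\<close> of rate \<open>u\<close> is at least \<open>s\<close>. The integral is therefore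
  an average of \<open>cdf y - cdf 0\<close> over \<open>y > 0\<close>, and the uniform distance of
  the distribution functions bounds the difference independently of \<open>u\<close>. There is no
  exponential law of rate 0, hence the separate case.\<close>

lemma exponential_weight_comparison:
  assumes M: "real_distribution M" and G: "real_distribution G" and u: "u \<ge> 0"
    and close: "\<And>x. \<bar>cdf M x - cdf G x\<bar> \<le> \<Delta>"
  shows "\<bar>(\<integral>s. indicator {0<..} s * exp (- u * s) \<partial>M) - (\<integral>s. indicator {0<..} s * exp (- u * s) \<partial>G)\<bar> \<le> 2 * \<Delta>"
proof (cases "u = 0")
  case True
  have "(\<integral>s. indicator {0<..} s * exp (- u * s) \<partial>D) = 1 - cdf D 0" if "real_distribution D" for D
  proof -
    interpret D: real_distribution D by fact
    have "measure D (space D - {..0}) = 1 - measure D {..0}" by (rule D.prob_compl) simp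
    moreover have "space D - {..0} = {0<..}" by auto
    ultimately show ?thesis using True by (simp add: cdf_def)
  qed
  then show ?thesis using M G close[of 0] by (simp add: abs_minus_commute)
next
  case False
  define \<kappa> where "\<kappa> = density lborel (exponential_density u)"
  have u0: "u > 0" using False u by simp
  interpret \<kappa>: prob_space \<kappa> unfolding \<kappa>_def by (rule prob_space_exponential_density[OF u0])
  have [measurable_cong, simp]: "sets \<kappa> = sets borel" by (simp add: \<kappa>_def)
  have tail: "(\<integral>y. indicator {0<..y} s \<partial>\<kappa>) = indicator {0<..} s * exp (- u * s)" for s
  proof (cases "s > 0")
    case True
    have "emeasure \<kappa> {s..} = (\<integral>\<^sup>+y. ennreal (u * exp (- y * u)) * indicator {s..} y \<partial>lborel)"
      unfolding \<kappa>_def using True by (subst emeasure_density) (auto simp: exponential_density_def intro!: nn_integral_cong split: split_indicator)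
    also have "\<dots> = ennreal (0 - (- exp (- s * u)))"
    proof (rule nn_integral_FTC_atLeast[where F="\<lambda>y. - exp (- y * u)" and f="\<lambda>y. u * exp (- y * u)" and T=0])
      show "((\<lambda>y. - exp (- y * u)) \<longlongrightarrow> 0) at_top" using u0 by real_asymp
      show "((\<lambda>y. - exp (- y * u)) has_real_derivative u * exp (- y * u)) (at y)" for y
        by (auto intro!: derivative_eq_intros)
    qed (use u0 in auto)
    finally have "measure \<kappa> {s..} = exp (- s * u)" by (simp add: measure_def)
    also have "- s * u = - u * s" by simp
    finally have "measure \<kappa> {s..} = exp (- u * s)" .
    moreover have "(\<integral>y. indicat_real {0<..y} s \<partial>\<kappa>) = (\<integral>y. indicat_real {s..} y \<partial>\<kappa>)"
      using True by (intro Bochner_Integration.integral_cong) (auto split: split_indicator)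
    moreover have "space \<kappa> = UNIV" by (simp add: \<kappa>_def)
    ultimately show ?thesis using True by simp
  qed simp
  have eq: "(\<integral>s. indicator {0<..} s * exp (- u * s) \<partial>D) = (\<integral>y. (cdf D y - cdf D 0) * indicator {0<..} y \<partial>\<kappa>)"
    if D: "real_distribution D" for D
  proof -
    interpret D: real_distribution D by (rule D)
    have "(\<integral>s. indicator {0<..} s * exp (- u * s) \<partial>D) = (\<integral>s. (\<integral>y. indicator {0<..y} s \<partial>\<kappa>) \<partial>D)"
      by (simp only: tail)
    also have "\<dots> = (\<integral>y. (\<integral>s. indicator {0<..y} s \<partial>D) \<partial>\<kappa>)"
    proof (rule fubini_bounded[where B=1])
      have "(\<lambda>(s, y). if 0 < s \<and> s \<le> y then 1 else 0 :: real) \<in> borel_measurable (D \<Otimes>\<^sub>M \<kappa>)" by measurable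
      then show "(\<lambda>(s, y). indicat_real {0<..y} s) \<in> borel_measurable (D \<Otimes>\<^sub>M \<kappa>)" by (simp add: indicator_def)
    qed (auto intro: D.finite_measure_axioms \<kappa>.finite_measure_axioms split: split_indicator)
    also have "\<dots> = (\<integral>y. (cdf D y - cdf D 0) * indicator {0<..} y \<partial>\<kappa>)"
      using D.cdf_diff_eq[of 0] by (intro Bochner_Integration.integral_cong refl) (auto split: split_indicator)
    finally show ?thesis .
  qed
  have meas: "(\<lambda>y. (cdf D y - cdf D 0) * indicator {0<..} y) \<in> borel_measurable borel" if D: "real_distribution D" for D
  proof -
    interpret D: real_distribution D by (rule D)
    have [measurable]: "cdf D \<in> borel_measurable borel" by (rule borel_measurable_mono) (auto simp: mono_def intro: D.cdf_nondecreasing)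
    show ?thesis by measurable
  qed
  have int: "integrable \<kappa> (\<lambda>y. (cdf D y - cdf D 0) * indicator {0<..} y)" if D: "real_distribution D" for D
  proof (rule \<kappa>.integrable_const_bound[where B=1])
    interpret D: real_distribution D by (rule D)
    have b: "0 \<le> cdf D y" "cdf D y \<le> 1" for y using D.cdf_nonneg D.cdf_bounded_prob by auto
    have "\<bar>cdf D y - cdf D 0\<bar> \<le> 1" for y unfolding abs_le_iff using b[of y] b[of 0] by linarith
    then show "AE y in \<kappa>. norm ((cdf D y - cdf D 0) * indicator {0<..} y) \<le> 1"
      by (intro AE_I2) (auto split: split_indicator)
  qed (use meas[OF D] in simp)
  have d: "(\<integral>s. indicator {0<..} s * exp (- u * s) \<partial>M) - (\<integral>s. indicator {0<..} s * exp (- u * s) \<partial>G)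
    = (\<integral>y. (cdf M y - cdf M 0) * indicator {0<..} y - (cdf G y - cdf G 0) * indicator {0<..} y \<partial>\<kappa>)"
    unfolding eq[OF M] eq[OF G] by (rule Bochner_Integration.integral_diff[symmetric]) (use int M G in auto)
  show ?thesis
    unfolding d
  proof (rule order_trans[OF integral_abs_bound])
  have "(\<integral>y. \<bar>(cdf M y - cdf M 0) * indicator {0<..} y - (cdf G y - cdf G 0) * indicator {0<..} y\<bar> \<partial>\<kappa>)
     \<le> (\<integral>y. 2 * \<Delta> \<partial>\<kappa>)"
  proof (rule integral_mono)
    show "integrable \<kappa> (\<lambda>y. \<bar>(cdf M y - cdf M 0) * indicator {0<..} y - (cdf G y - cdf G 0) * indicator {0<..} y\<bar>)"
      using int M G by (intro integrable_abs Bochner_Integration.integrable_diff) auto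
    show "\<bar>(cdf M y - cdf M 0) * indicator {0<..} y - (cdf G y - cdf G 0) * indicator {0<..} y\<bar> \<le> 2 * \<Delta>" for y
      using close[of y] close[of 0] by (auto simp: abs_le_iff split: split_indicator)
  qed simp
  then show "(\<integral>y. \<bar>(cdf M y - cdf M 0) * indicator {0<..} y - (cdf G y - cdf G 0) * indicator {0<..} y\<bar> \<partial>\<kappa>) \<le> 2 * \<Delta>"
    by (simp add: \<kappa>.prob_space)
qed
qed

text \<open>Completing the square: the exponential weight translates the standard normal density by
  \<open>u * sqrt w\<close>.\<close>

lemma gauss_exponential_tail:
  assumes w: "w > 0"
  shows "(\<integral>s. indicator {0<..} s * exp (- u * s) \<partial>gauss w) = exp (u\<^sup>2 * w / 2) * normal_tail (u * sqrt w)"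
proof -
  define a where "a = u * sqrt w"
  have "(\<integral>s. indicator {0<..} s * exp (- u * s) \<partial>gauss w) = (\<integral>z. indicator {0<..} z * exp (- a * z) \<partial>std_normal_distribution)"
    unfolding gauss_def using w
    by (subst integral_distr) (auto simp: a_def indicator_def zero_less_mult_iff mult_ac intro!: Bochner_Integration.integral_cong)
  also have "\<dots> = (\<integral>z. std_normal_density z * (indicator {0<..} z * exp (- a * z)) \<partial>lborel)"
    by (subst integral_density) auto
  also have "\<dots> = (\<integral>z. std_normal_density (- a + z) * (indicator {0<..} (- a + z) * exp (- a * (- a + z))) \<partial>lborel)"
    by (subst lborel_integral_real_affine[where c=1 and t="- a"]) auto
  also have "\<dots> = (\<integral>z. exp (a\<^sup>2 / 2) * (std_normal_density z * indicator {a<..} z) \<partial>lborel)"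
  proof (rule Bochner_Integration.integral_cong[OF refl])
    fix z
    have "- (- a + z)\<^sup>2 / 2 + - a * (- a + z) = a\<^sup>2 / 2 + - z\<^sup>2 / 2" by (simp add: power2_eq_square field_simps)
    then have "exp (- (- a + z)\<^sup>2 / 2) * exp (- a * (- a + z)) = exp (a\<^sup>2 / 2) * exp (- z\<^sup>2 / 2)"
      unfolding exp_add[symmetric] by (rule arg_cong)
    then have "std_normal_density (- a + z) * exp (- a * (- a + z)) = exp (a\<^sup>2 / 2) * std_normal_density z"
      unfolding std_normal_density_eq by simp
    moreover have "indicator {0<..} (- a + z) = (indicator {a<..} z :: real)" by (auto simp: indicator_def)
    ultimately show "std_normal_density (- a + z) * (indicator {0<..} (- a + z) * exp (- a * (- a + z)))
        = exp (a\<^sup>2 / 2) * (std_normal_density z * indicator {a<..} z)" by (simp add: mult_ac)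
  qed
  also have "\<dots> = exp (a\<^sup>2 / 2) * (\<integral>z. std_normal_density z * indicator {a<..} z \<partial>lborel)" by simp
  also have "(\<integral>z. std_normal_density z * indicator {a<..} z \<partial>lborel) = (\<integral>z. indicator {a<..} z \<partial>std_normal_distribution)"
    by (subst integral_density) auto
  also have "\<dots> = normal_tail a" by (simp add: normal_tail_def)
  also have "a\<^sup>2 = u\<^sup>2 * w" using w by (simp add: a_def power_mult_distrib)
  finally show ?thesis by (simp add: a_def)
qed

text \<open>Esseen's constant as a predicate, so that one \<open>K\<close> can be fixed before the
  law varies.\<close>

definition esseen_bound :: "real \<Rightarrow> bool" where
  "esseen_bound K \<longleftrightarrow> K > 0 \<and> (\<forall>M G T m \<psi> x. real_distribution M \<longrightarrow> real_distribution G \<longrightarrow> T > 0 \<longrightarrow> m \<ge> 0 \<longrightarrow>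
      set_integrable lborel {-T..T} \<psi> \<longrightarrow> (\<forall>t. \<bar>t\<bar> \<le> T \<longrightarrow> cmod (char M t - char G t) \<le> \<bar>t\<bar> * \<psi> t) \<longrightarrow>
      (\<forall>x y. x \<le> y \<longrightarrow> cdf G y - cdf G x \<le> m * (y - x)) \<longrightarrow>
      \<bar>cdf M x - cdf G x\<bar> \<le> K * ((LINT t:{-T..T}|lborel. \<psi> t) + m / T))"

lemma esseen_bound_ex: "\<exists>K. esseen_bound K"
proof (rule esseen_inequality)
  fix C :: real
  assume C: "C > 0" and *: "\<And>M G T m \<psi> x. \<lbrakk>real_distribution M; real_distribution G; T > 0; m \<ge> 0;
      set_integrable lborel {-T..T} \<psi>; \<And>t. \<bar>t\<bar> \<le> T \<Longrightarrow> cmod (char M t - char G t) \<le> \<bar>t\<bar> * \<psi> t;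
      \<And>x y. x \<le> y \<Longrightarrow> cdf G y - cdf G x \<le> m * (y - x)\<rbrakk>
      \<Longrightarrow> \<bar>cdf M x - cdf G x\<bar> \<le> C * ((LINT t:{-T..T}|lborel. \<psi> t) + m / T)"
  show ?thesis unfolding esseen_bound_def
    by (intro exI[of _ C] conjI allI impI C *) auto
qed

lemma esseen_boundD:
  assumes "esseen_bound K" "real_distribution M" "real_distribution G" "T > 0" "m \<ge> 0"
    "set_integrable lborel {-T..T} \<psi>" "\<And>t. \<bar>t\<bar> \<le> T \<Longrightarrow> cmod (char M t - char G t) \<le> \<bar>t\<bar> * \<psi> t"
    "\<And>x y. x \<le> y \<Longrightarrow> cdf G y - cdf G x \<le> m * (y - x)"
  shows "\<bar>cdf M x - cdf G x\<bar> \<le> K * ((LINT t:{-T..T}|lborel. \<psi> t) + m / T)"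
  using assms unfolding esseen_bound_def by blast

section \<open>Tilted laws: characteristic functions, normal approximation and tails\<close>

context log_laplace
begin

text \<open>The Esscher transform of \<open>\<mu>\<close>. Its mean is \<open>k1 u\<close>, so
  \<open>ctilt u\<close> is centred and has variance \<open>k2 u\<close>.\<close>

definition "tilt u = density \<mu> (\<lambda>x. exp (u * x - k0 u))"
definition "ctilt u = distr (tilt u) borel (\<lambda>x. x - k1 u)"

lemma laplace_real:
  assumes "\<bar>u\<bar> < r" shows "(\<integral>x. exp (u * x) \<partial>\<mu>) = exp (k0 u)"
proof -
  have "(\<integral>x. exp (complex_of_real u * of_real x) \<partial>\<mu>) = (\<integral>x. complex_of_real (exp (u * x)) \<partial>\<mu>)"
    by (simp add: exp_of_real flip: of_real_mult)
  also have "\<dots> = of_real (\<integral>x. exp (u * x) \<partial>\<mu>)" by simp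
  finally have "complex_of_real (\<integral>x. exp (u * x) \<partial>\<mu>) = of_real (exp (k0 u))"
    using laplace[of "of_real u"] assms by (simp add: of_real_k exp_of_real)
  then show ?thesis by (simp only: of_real_eq_iff)
qed

lemma prob_space_tilt:
  assumes u: "\<bar>u\<bar> < r" shows "prob_space (tilt u)"
proof
  have "emeasure (tilt u) (space (tilt u)) = (\<integral>\<^sup>+x. ennreal (exp (u * x - k0 u)) \<partial>\<mu>)"
    unfolding tilt_def by (subst emeasure_density) auto
  also have "\<dots> = ennreal (\<integral>x. exp (u * x - k0 u) \<partial>\<mu>)"
    by (rule nn_integral_eq_integral) (use integrable_exp[OF u] in \<open>auto simp: exp_diff\<close>)
  also have "(\<integral>x. exp (u * x - k0 u) \<partial>\<mu>) = 1" by (simp add: exp_diff laplace_real[OF u])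
  finally show "emeasure (tilt u) (space (tilt u)) = 1" by simp
qed

lemma real_distribution_ctilt: "\<bar>u\<bar> < r \<Longrightarrow> real_distribution (ctilt u)"
  unfolding ctilt_def
  by (intro prob_space.real_distribution_distr prob_space_tilt) (simp_all add: tilt_def)

lemma char_ctilt:
  assumes u: "\<bar>u\<bar> < r" and ut: "norm (of_real u + \<i> * of_real t) < r"
  shows "char (ctilt u) t = exp (L (of_real u + \<i> * of_real t) - of_real (k0 u) - \<i> * of_real (t * k1 u))"
proof -
  have "char (ctilt u) t = (\<integral>x. iexp (t * (x - k1 u)) \<partial>tilt u)"
    unfolding char_def ctilt_def by (subst integral_distr) (auto simp: tilt_def)
  also have "\<dots> = (\<integral>x. exp (u * x - k0 u) *\<^sub>R iexp (t * (x - k1 u)) \<partial>\<mu>)"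
    unfolding tilt_def by (subst integral_density) auto
  also have "\<dots> = (\<integral>x. exp (- of_real (k0 u) - \<i> * of_real (t * k1 u)) * exp ((of_real u + \<i> * of_real t) * of_real x) \<partial>\<mu>)"
    by (intro Bochner_Integration.integral_cong refl)
      (simp add: scaleR_conv_of_real exp_of_real[symmetric] algebra_simps flip: exp_add)
  also have "\<dots> = exp (- of_real (k0 u) - \<i> * of_real (t * k1 u)) * exp (L (of_real u + \<i> * of_real t))"
    by (simp add: laplace[OF ut])
  finally show ?thesis by (simp add: algebra_simps flip: exp_add)
qed

text \<open>Taylor expansion of \<open>L\<close> at \<open>u\<close>: centring removes the linear
  term, the quadratic one belongs to the normal law with variance \<open>k2 u\<close>, and
  \<open>\<rho>\<close> is the cubic remainder. The surplus factor \<open>N * t^2\<close> is paid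
  for with part of the Gaussian decay, so that the bound divided by \<open>\<bar>t\<bar>\<close>
  integrates to \<open>O(1/sqrt N)\<close>.\<close>

lemma char_ctilt_near_gauss:
  assumes u: "0 \<le> u" "u \<le> umax" and t: "\<bar>t\<bar> \<le> Tmax"
  shows "cmod (char (ctilt u) t - char (gauss (k2 u)) t) \<le> \<bar>t\<bar> * (8 * C3 / c * exp (- (c * N / 16 * t\<^sup>2)))"
proof -
  let ?z = "complex_of_real u + \<i> * of_real t"
  have ur: "u < r / 2" "\<bar>u\<bar> < r" using u umax_le r by auto
  have "norm ?z \<le> \<bar>u\<bar> + \<bar>t\<bar>" using norm_triangle_ineq[of "complex_of_real u" "\<i> * of_real t"] by (simp add: norm_mult)
  then have z: "norm ?z < r / 2" "norm ?z < r" using u umax_le Tmax_le t r by auto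
  have nu: "norm (complex_of_real u) < r / 2" using ur u by simp
  have k2: "k2 u \<ge> c * N / 2" by (rule k2_ge[OF u])
  then have k2_0: "k2 u \<ge> 0" using c N by (meson divide_nonneg_pos less_imp_le mult_nonneg_nonneg order_trans zero_le_one zero_less_numeral)
  define \<rho> where "\<rho> = L ?z - (of_real (k0 u) + of_real (k1 u) * (\<i> * of_real t) + of_real (k2 u) * (\<i> * of_real t)\<^sup>2 / 2)"
  have "norm \<rho> \<le> C3 * N * \<bar>t\<bar> ^ 3 / 2"
    using taylor(1)[OF z(1) nu] by (simp add: \<rho>_def of_real_k[OF ur(2)] norm_mult)
  moreover have "\<bar>t\<bar> ^ 3 = \<bar>t\<bar> * t\<^sup>2" by (simp add: power3_eq_cube power2_eq_square)
  ultimately have \<rho>: "norm \<rho> \<le> C3 * N * \<bar>t\<bar> * t\<^sup>2 / 2" by simp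
  \<comment> \<open>The choice of \<open>Tmax\<close> at work: of the decay
    \<open>c * N / 4 * t^2\<close> provided by \<open>k2_ge\<close>, half survives multiplication by
    \<open>exp (norm \<rho>)\<close>.\<close>
  have "C3 * \<bar>t\<bar> \<le> c / 4" by (rule order_trans[OF mult_left_mono[OF t] Tmax_le(2)]) (use C3_pos in simp)
  then have "C3 * \<bar>t\<bar> * (N * t\<^sup>2 / 2) \<le> c / 4 * (N * t\<^sup>2 / 2)" using N by (intro mult_right_mono) auto
  then have \<rho>2: "norm \<rho> \<le> c * N / 8 * t\<^sup>2" using \<rho> by (simp add: mult_ac)
  have split: "L ?z - of_real (k0 u) - \<i> * of_real (t * k1 u) = - of_real (k2 u * t\<^sup>2 / 2) + \<rho>"
    by (simp add: \<rho>_def power_mult_distrib algebra_simps)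
  have "char (ctilt u) t - char (gauss (k2 u)) t = exp (- of_real (k2 u * t\<^sup>2 / 2)) * (exp \<rho> - 1)"
    unfolding char_ctilt[OF ur(2) z(2)] char_gauss[OF k2_0] split exp_add by (simp add: algebra_simps)
  then have "cmod (char (ctilt u) t - char (gauss (k2 u)) t) = exp (- (k2 u * t\<^sup>2 / 2)) * cmod (exp \<rho> - 1)"
    by (simp add: norm_mult)
  also have "\<dots> \<le> exp (- (c * N / 4 * t\<^sup>2)) * (exp (c * N / 8 * t\<^sup>2) * (C3 * N * \<bar>t\<bar> * t\<^sup>2 / 2))"
  proof (rule mult_mono)
    have "c * N / 2 * (t\<^sup>2 / 2) \<le> k2 u * (t\<^sup>2 / 2)" using k2 by (intro mult_right_mono) auto
    then show "exp (- (k2 u * t\<^sup>2 / 2)) \<le> exp (- (c * N / 4 * t\<^sup>2))" by simp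
    have "cmod (exp \<rho> - 1) \<le> exp (cmod \<rho>) * cmod \<rho>" using Taylor_exp_field[of \<rho> 0] by simp
    also have "\<dots> \<le> exp (c * N / 8 * t\<^sup>2) * (C3 * N * \<bar>t\<bar> * t\<^sup>2 / 2)" using \<rho> \<rho>2 by (intro mult_mono) auto
    finally show "cmod (exp \<rho> - 1) \<le> exp (c * N / 8 * t\<^sup>2) * (C3 * N * \<bar>t\<bar> * t\<^sup>2 / 2)" .
  qed auto
  also have "\<dots> = \<bar>t\<bar> * (4 * C3 / c * ((c * N / 8 * t\<^sup>2) * exp (- (c * N / 8 * t\<^sup>2))))"
  proof -
    have "exp (- (c * N / 4 * t\<^sup>2)) * exp (c * N / 8 * t\<^sup>2) = exp (- (c * N / 8 * t\<^sup>2))"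
      by (simp flip: exp_add)
    then have "exp (- (c * N / 4 * t\<^sup>2)) * (exp (c * N / 8 * t\<^sup>2) * (C3 * N * \<bar>t\<bar> * t\<^sup>2 / 2))
      = exp (- (c * N / 8 * t\<^sup>2)) * (C3 * N * \<bar>t\<bar> * t\<^sup>2 / 2)" by (simp only: mult.assoc[symmetric])
    then show ?thesis using c by (simp add: mult_ac)
  qed
  also have "\<dots> \<le> \<bar>t\<bar> * (4 * C3 / c * (2 * exp (- (c * N / 16 * t\<^sup>2))))"
  proof (intro mult_left_mono)
    define s where "s = c * N / 16 * t\<^sup>2"
    have "s \<le> exp s" using exp_ge_add_one_self[of s] by linarith
    then have "2 * s * exp (- (2 * s)) \<le> 2 * exp s * exp (- (2 * s))" by (intro mult_right_mono) auto
    also have "\<dots> = 2 * exp (- s)" by (simp flip: exp_add)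
    finally have "2 * s * exp (- (2 * s)) \<le> 2 * exp (- s)" .
    moreover have "c * N / 8 * t\<^sup>2 = 2 * s" by (simp add: s_def)
    ultimately show "(c * N / 8 * t\<^sup>2) * exp (- (c * N / 8 * t\<^sup>2)) \<le> 2 * exp (- (c * N / 16 * t\<^sup>2))"
      by (simp only: s_def)
  qed (use C3_pos c in auto)
  also have "\<dots> = \<bar>t\<bar> * (8 * C3 / c * exp (- (c * N / 16 * t\<^sup>2)))" by simp
  finally show ?thesis .
qed

text \<open>Bounds for the two terms of Esseen's inequality, multiplied by \<open>sqrt N\<close>:
  the integral of the Gaussian majorant, and the Lipschitz constant of the normal distribution
  function divided by \<open>Tmax\<close>.\<close>

definition "D0 = 8 * C3 / c * (sqrt (2 * pi) * sqrt (8 / c)) + sqrt (2 / c) / Tmax"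

lemma D0_pos: "D0 > 0" using C3_pos c Tmax_pos by (auto simp: D0_def intro!: add_pos_pos)

lemma berry_esseen_tilt:
  assumes K: "esseen_bound K" and u: "0 \<le> u" "u \<le> umax"
  shows "\<bar>cdf (ctilt u) x - cdf (gauss (k2 u)) x\<bar> \<le> K * D0 / sqrt N"
proof -
  define \<psi> where "\<psi> = (\<lambda>t. 8 * C3 / c * exp (- (c * N / 16 * t\<^sup>2)))"
  have ur: "\<bar>u\<bar> < r" using u umax_le r by auto
  have cN: "c * N > 0" using c N by simp
  have k2: "k2 u \<ge> c * N / 2" by (rule k2_ge[OF u])
  then have k2_pos: "k2 u > 0" using cN by linarith
  have K0: "K > 0" using K by (simp add: esseen_bound_def)
  have \<psi>i: "set_integrable lborel {-Tmax..Tmax} \<psi>"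
    unfolding \<psi>_def by (intro borel_integrable_atLeastAtMost' continuous_intros) 
  have 1: "\<bar>cdf (ctilt u) x - cdf (gauss (k2 u)) x\<bar> \<le> K * ((LINT t:{-Tmax..Tmax}|lborel. \<psi> t) + (1 / sqrt (k2 u)) / Tmax)"
  proof (rule esseen_boundD[OF K real_distribution_ctilt[OF ur] real_distribution_gauss Tmax_pos _ \<psi>i])
    show "cmod (char (ctilt u) t - char (gauss (k2 u)) t) \<le> \<bar>t\<bar> * \<psi> t" if "\<bar>t\<bar> \<le> Tmax" for t
      unfolding \<psi>_def by (rule char_ctilt_near_gauss[OF u that])
    show "cdf (gauss (k2 u)) y - cdf (gauss (k2 u)) x \<le> 1 / sqrt (k2 u) * (y - x)" if "x \<le> y" for x y
      by (rule cdf_gauss_lipschitz[OF k2_pos that])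
  qed (use k2_pos in simp)
  \<comment> \<open>The standard deviation for which \<open>\<psi>\<close> is a multiple of a normal
    density, so that its integral is explicit.\<close>
  define s where "s = sqrt (8 / c) / sqrt N"
  have s: "s > 0" using c N by (simp add: s_def)
  have s2: "s\<^sup>2 = 8 / (c * N)" using c N by (simp add: s_def power_divide)
  have \<psi>_eq: "\<psi> t = 8 * C3 / c * (sqrt (2 * pi) * s) * normal_density 0 s t" for t
  proof -
    have "sqrt (2 * pi * s\<^sup>2) = sqrt (2 * pi) * s" using s by (simp add: real_sqrt_mult)
    moreover have "- (t - 0)\<^sup>2 / (2 * s\<^sup>2) = - (c * N / 16 * t\<^sup>2)" using cN by (simp add: s2 field_simps)
    moreover have "sqrt (2 * pi) * s \<noteq> 0" using s by simp
    ultimately show ?thesis by (simp add: normal_density_def \<psi>_def)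
  qed
  have "(LINT t:{-Tmax..Tmax}|lborel. \<psi> t) \<le> (\<integral>t. \<psi> t \<partial>lborel)"
    unfolding set_lebesgue_integral_def
  proof (rule integral_mono)
    show "integrable lborel (\<lambda>t. indicator {-Tmax..Tmax} t *\<^sub>R \<psi> t)" using \<psi>i by (simp add: set_integrable_def)
    show "integrable lborel \<psi>" unfolding \<psi>_eq[abs_def] using s by (intro integrable_mult_right integrable_normal_density)
    show "indicator {-Tmax..Tmax} t *\<^sub>R \<psi> t \<le> \<psi> t" for t
      using C3_pos c by (auto simp: \<psi>_def split: split_indicator)
  qed
  also have "\<dots> = 8 * C3 / c * (sqrt (2 * pi) * s)"
    unfolding \<psi>_eq using integral_normal_density[of s 0] s by simp
  finally have i: "(LINT t:{-Tmax..Tmax}|lborel. \<psi> t) \<le> 8 * C3 / c * (sqrt (2 * pi) * sqrt (8 / c)) / sqrt N"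
    by (simp add: s_def)
  have "sqrt (c * N / 2) \<le> sqrt (k2 u)" using k2 by simp
  moreover have "sqrt (c * N / 2) > 0" using cN by simp
  ultimately have "1 / sqrt (k2 u) \<le> 1 / sqrt (c * N / 2)" by (intro divide_left_mono) auto
  also have "\<dots> = sqrt (2 / c) / sqrt N" by (simp add: real_sqrt_divide real_sqrt_mult)
  finally have "(1 / sqrt (k2 u)) / Tmax \<le> (sqrt (2 / c) / sqrt N) / Tmax"
    using Tmax_pos by (intro divide_right_mono) auto
  then have "(1 / sqrt (k2 u)) / Tmax \<le> sqrt (2 / c) / Tmax / sqrt N" by (simp add: mult.commute)
  with i have "(LINT t:{-Tmax..Tmax}|lborel. \<psi> t) + (1 / sqrt (k2 u)) / Tmax \<le> D0 / sqrt N"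
    unfolding D0_def add_divide_distrib by linarith
  then have "K * ((LINT t:{-Tmax..Tmax}|lborel. \<psi> t) + (1 / sqrt (k2 u)) / Tmax) \<le> K * (D0 / sqrt N)"
    using K0 by (intro mult_left_mono) auto
  with 1 show ?thesis by simp
qed

text \<open>With the threshold at the mean \<open>k1 u\<close> of the tilted law, the large factor
  comes out and the weight left under the integral is at most 1. An additive error for the tilted
  law thus remains of the same order in the integral.\<close>

lemma tail_tilt_formula:
  assumes u: "\<bar>u\<bar> < r"
  shows "measure \<mu> {k1 u<..} = exp (k0 u - u * k1 u) * (\<integral>s. indicator {0<..} s * exp (- u * s) \<partial>ctilt u)"
proof -
  have "(\<integral>s. indicator {0<..} s * exp (- u * s) \<partial>ctilt u) = (\<integral>x. indicator {0<..} (x - k1 u) * exp (- u * (x - k1 u)) \<partial>tilt u)"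
    unfolding ctilt_def by (subst integral_distr) (auto simp: tilt_def)
  also have "\<dots> = (\<integral>x. exp (u * x - k0 u) * (indicator {0<..} (x - k1 u) * exp (- u * (x - k1 u))) \<partial>\<mu>)"
    unfolding tilt_def by (subst integral_density) auto
  also have "\<dots> = (\<integral>x. exp (u * k1 u - k0 u) * indicator {k1 u<..} x \<partial>\<mu>)"
  proof (rule Bochner_Integration.integral_cong[OF refl])
    fix x
    have "exp (u * x - k0 u) * exp (- u * (x - k1 u)) = exp (u * k1 u - k0 u)"
      by (simp add: algebra_simps flip: exp_add)
    then show "exp (u * x - k0 u) * (indicator {0<..} (x - k1 u) * exp (- u * (x - k1 u))) = exp (u * k1 u - k0 u) * indicator {k1 u<..} x"
      by (simp add: indicator_def)
  qed
  also have "\<dots> = exp (u * k1 u - k0 u) * measure \<mu> {k1 u<..}" by simp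
  finally have e: "(\<integral>s. indicator {0<..} s * exp (- u * s) \<partial>ctilt u) = exp (u * k1 u - k0 u) * measure \<mu> {k1 u<..}" .
  have "exp (k0 u - u * k1 u) * exp (u * k1 u - k0 u) = 1" by (simp flip: exp_add)
  then show ?thesis unfolding e mult.assoc[symmetric] by simp
qed

text \<open>\<open>W * N\<close> dominates \<open>v\<close> and every \<open>k2 u\<close>: Cauchy's
  estimate for the second derivative at 0, plus the variation \<open>C3 * N * umax\<close>.
  \<open>M0\<close> is the constant of \<open>mills_lower\<close>.\<close>

definition "W = 8 * C / r\<^sup>2 + c / 2"
definition "M0 = exp (3/2) * sqrt (2 * pi)"

lemma W_pos: "W > 0" using C r c by (simp add: W_def add_pos_pos)

lemma M0_pos: "M0 > 0" by (simp add: M0_def)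

lemma v_le: "v \<le> 8 * C / r\<^sup>2 * N"
proof -
  have "norm ((deriv ^^ 2) L 0) \<le> fact 2 * (C * N) / (r / 2)\<^sup>2"
  proof (rule Cauchy_inequality)
    have sub: "cball 0 (r / 2) \<subseteq> ball (0::complex) r" using r by auto
    show "L holomorphic_on ball 0 (r / 2)" using hol sub ball_subset_cball by (metis holomorphic_on_subset order_trans)
    show "continuous_on (cball 0 (r / 2)) L"
      using hol sub by (metis holomorphic_on_imp_continuous_on holomorphic_on_subset)
    show "norm (L w) \<le> C * N" if "norm (0 - w) = r / 2" for w using that r by (intro bound) simp
  qed (use r in simp)
  then have "\<bar>v\<bar> \<le> 8 * C / r\<^sup>2 * N" unfolding deriv2_zero by (simp add: power_divide mult_ac)
  then show ?thesis by simp
qed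

lemma v_pos: "v > 0" using v_ge mult_pos_pos[OF c, of N] N by linarith

lemma v_le_W: "v \<le> W * N"
  using v_le mult_pos_pos[OF c, of N] N by (simp add: W_def distrib_right)

lemma k2_le:
  assumes u: "0 \<le> u" "u \<le> umax" shows "k2 u \<le> W * N"
proof -
  have "C3 * N * u \<le> (C3 * umax) * N" using u C3_pos N by (simp add: mult_ac mult_left_mono)
  also have "\<dots> \<le> (c / 2) * N" using umax_le N by (intro mult_right_mono) auto
  finally show ?thesis using k_expansion(3)[OF u] v_le by (simp add: abs_le_iff W_def distrib_right)
qed

text \<open>\<open>2 * C3\<close> comes from the exponent. The rest is twice the relative error of
  the normal approximation, as \<open>1 + \<tau>\<close> and \<open>1 - \<tau>\<close> are replaced
  by \<open>exp (2 * \<tau>)\<close> and \<open>exp (- 2 * \<tau>)\<close>.\<close>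

definition "C1 K = 2 * C3 + 4 * K * D0 * M0 * (1 + sqrt W)"

lemma C1_pos: "K > 0 \<Longrightarrow> C1 K > 0"
  using C3_pos D0_pos M0_pos W_pos by (auto simp: C1_def intro!: add_pos_nonneg mult_nonneg_nonneg add_nonneg_nonneg)

text \<open>The additive error \<open>\<eta>\<close> of order \<open>1/sqrt N\<close> is measured
  against the Gaussian value \<open>exp (a^2 / 2) * normal_tail a\<close> of the same integral,
  which \<open>mills_lower\<close> keeps above a multiple of \<open>1 / (1 + a)\<close>. Since
  \<open>a\<close> is \<open>O(u * sqrt N)\<close>, the quotient is \<open>O(1/sqrt N + u)\<close>.
  The term \<open>N * u^3\<close> of \<open>\<Theta>\<close> stems from the exponents.\<close>

lemma tail_two_sided:
  assumes K: "esseen_bound K" and u: "0 \<le> u" "u \<le> umax"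
    and small: "2 * K * D0 * M0 * (1 + sqrt W) * (1 / sqrt N + u) \<le> 1/2"
  defines "a \<equiv> u * sqrt (k2 u)" and "\<Theta> \<equiv> 1 / sqrt N + u + N * u ^ 3"
  shows "normal_tail a * exp (- C1 K * \<Theta>) \<le> measure \<mu> {k1 u<..}"
    and "measure \<mu> {k1 u<..} \<le> normal_tail a * exp (C1 K * \<Theta>)"
proof -
  have K0: "K > 0" using K by (simp add: esseen_bound_def)
  have ur: "\<bar>u\<bar> < r" using u umax_le r by auto
  have cN: "c * N > 0" using c N by simp
  have k2: "k2 u \<ge> c * N / 2" by (rule k2_ge[OF u])
  then have k2_pos: "k2 u > 0" using cN by linarith
  have a0: "a \<ge> 0" using u k2_pos by (simp add: a_def)
  define J where "J = (\<integral>s. indicator {0<..} s * exp (- u * s) \<partial>ctilt u)"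
  define \<eta> where "\<eta> = 2 * (K * D0 / sqrt N)"
  have \<eta>0: "\<eta> \<ge> 0" using K0 D0_pos N by (simp add: \<eta>_def)
  have a2: "u\<^sup>2 * k2 u = a\<^sup>2" using k2_pos by (simp add: a_def power_mult_distrib)
  have J: "\<bar>J - exp (a\<^sup>2 / 2) * normal_tail a\<bar> \<le> \<eta>"
    using exponential_weight_comparison[OF real_distribution_ctilt[OF ur] real_distribution_gauss u(1) berry_esseen_tilt[OF K u]]
    unfolding gauss_exponential_tail[OF k2_pos] J_def \<eta>_def a2 by (simp add: a_def)
  define Q where "Q = normal_tail a"
  have Q: "Q > 0" using normal_tail_bounds by (simp add: Q_def)
  have e1: "1 \<le> exp (a\<^sup>2 / 2) * (M0 * (1 + a) * Q)"
  proof -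
    have "exp (a\<^sup>2 / 2) * exp (- a\<^sup>2 / 2) \<le> exp (a\<^sup>2 / 2) * (M0 * (1 + a) * Q)"
      using mills_lower[OF a0] by (intro mult_left_mono) (auto simp: M0_def Q_def mult_ac)
    moreover have "exp (a\<^sup>2 / 2) * exp (- a\<^sup>2 / 2) = 1" by (simp flip: exp_add)
    ultimately show ?thesis by (simp only:)
  qed
  define \<tau> where "\<tau> = \<eta> * M0 * (1 + a)"
  have \<tau>0: "\<tau> \<ge> 0" using \<eta>0 M0_pos a0 by (simp add: \<tau>_def)
  have "\<eta> * 1 \<le> \<eta> * (exp (a\<^sup>2 / 2) * (M0 * (1 + a) * Q))" using e1 \<eta>0 by (rule mult_left_mono)
  then have "\<eta> \<le> exp (a\<^sup>2 / 2) * Q * \<tau>" by (simp add: \<tau>_def mult_ac)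
  with J have J2: "\<bar>J - exp (a\<^sup>2 / 2) * Q\<bar> \<le> exp (a\<^sup>2 / 2) * Q * \<tau>" by (simp add: Q_def)
  define D where "D = 2 * K * D0 * M0 * (1 + sqrt W)"
  have D: "D > 0" using K0 D0_pos M0_pos W_pos by (simp add: D_def add_pos_pos)
  have \<tau>_le: "\<tau> \<le> D * (1 / sqrt N + u)"
  proof -
    have "a \<le> u * (sqrt W * sqrt N)"
      unfolding a_def using u k2_le[OF u] by (intro mult_left_mono) (simp_all add: real_sqrt_mult[symmetric])
    then have "\<tau> \<le> \<eta> * M0 * (1 + u * (sqrt W * sqrt N))" unfolding \<tau>_def using \<eta>0 M0_pos by (intro mult_left_mono) auto
    also have "\<dots> = 2 * K * D0 * M0 * (1 / sqrt N + sqrt W * u)" using N by (simp add: \<eta>_def field_simps)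
    also have "\<dots> \<le> 2 * K * D0 * M0 * ((1 + sqrt W) * (1 / sqrt N + u))"
    proof (rule mult_left_mono)
      have "0 \<le> sqrt W * (1 / sqrt N)" using W_pos N by simp
      then show "1 / sqrt N + sqrt W * u \<le> (1 + sqrt W) * (1 / sqrt N + u)"
        using u unfolding distrib_right distrib_left mult_1 by linarith
    qed (use K0 D0_pos M0_pos in simp)
    finally show ?thesis by (simp add: D_def mult_ac)
  qed
  have \<tau>_half: "\<tau> \<le> 1/2" using \<tau>_le small by (simp add: D_def)
  define \<zeta> where "\<zeta> = k0 u - u * k1 u + a\<^sup>2 / 2"
  have F: "measure \<mu> {k1 u<..} = exp (\<zeta> - a\<^sup>2 / 2) * J" unfolding tail_tilt_formula[OF ur] J_def \<zeta>_def by simp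
  have ee: "exp (\<zeta> - a\<^sup>2 / 2) * (exp (a\<^sup>2 / 2) * X) = exp \<zeta> * X" for X by (simp add: exp_diff)
  \<comment> \<open>The quadratic parts \<open>v u^2 / 2\<close>, \<open>- v u^2\<close> and
    \<open>v u^2 / 2\<close> of the three terms cancel, so only cubic remainders are left.\<close>
  have \<zeta>: "\<bar>\<zeta>\<bar> \<le> 2 * C3 * (N * u ^ 3)"
  proof -
    note k = k_expansion[OF u]
    have "\<zeta> = (k0 u - v * u\<^sup>2 / 2) - u * (k1 u - v * u) + u\<^sup>2 * (k2 u - v) / 2"
      unfolding \<zeta>_def a2[symmetric] by (simp add: power2_eq_square field_simps)
    moreover have "\<bar>u * (k1 u - v * u)\<bar> \<le> u * (C3 * N * u\<^sup>2)"
      unfolding abs_mult using k(2) u by (intro mult_mono) auto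
    moreover have "\<bar>u\<^sup>2 * (k2 u - v) / 2\<bar> \<le> u\<^sup>2 * (C3 * N * u) / 2"
      using mult_left_mono[OF k(3), of "u\<^sup>2"] by (simp add: abs_mult)
    ultimately have "\<bar>\<zeta>\<bar> \<le> C3 * N * u ^ 3 / 2 + u * (C3 * N * u\<^sup>2) + u\<^sup>2 * (C3 * N * u) / 2"
      using k(1) unfolding abs_le_iff by linarith
    also have "\<dots> = 2 * C3 * (N * u ^ 3)" by (simp add: power2_eq_square power3_eq_cube)
    finally show ?thesis .
  qed
  have total: "2 * C3 * (N * u ^ 3) + 2 * \<tau> \<le> C1 K * \<Theta>"
  proof -
    have "2 * \<tau> \<le> 2 * D * (1 / sqrt N + u)" using \<tau>_le by simp
    also have "\<dots> \<le> 2 * D * \<Theta>" unfolding \<Theta>_def using D u N by (intro mult_left_mono) auto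
    finally have "2 * \<tau> \<le> 2 * D * \<Theta>" .
    moreover have "2 * C3 * (N * u ^ 3) \<le> 2 * C3 * \<Theta>" unfolding \<Theta>_def using C3_pos u N by (intro mult_left_mono) auto
    moreover have "C1 K * \<Theta> = 2 * C3 * \<Theta> + 2 * D * \<Theta>" by (simp add: C1_def D_def algebra_simps)
    ultimately show ?thesis by linarith
  qed
  \<comment> \<open>The hypothesis \<open>small\<close> was arranged for
    \<open>\<tau> \<le> 1/2\<close>, the range in which this lower bound is proved.\<close>
  have low1: "exp (- (2 * \<tau>)) \<le> 1 - \<tau>"
  proof -
    have "1 / (1 - \<tau>) \<le> 1 + 2 * \<tau>" 
    proof -
      have "0 \<le> \<tau> * (1 - 2 * \<tau>)" using \<tau>0 \<tau>_half by (intro mult_nonneg_nonneg) auto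
      then have "1 \<le> (1 + 2 * \<tau>) * (1 - \<tau>)" by (simp add: algebra_simps)
      then show ?thesis using \<tau>_half by (simp add: pos_divide_le_eq)
    qed
    also have "\<dots> \<le> exp (2 * \<tau>)" using exp_ge_add_one_self[of "2 * \<tau>"] by simp
    finally have "1 \<le> exp (2 * \<tau>) * (1 - \<tau>)" using \<tau>_half by (simp add: pos_divide_le_eq)
    then have "exp (- (2 * \<tau>)) * 1 \<le> exp (- (2 * \<tau>)) * (exp (2 * \<tau>) * (1 - \<tau>))" by (intro mult_left_mono) auto
    then show ?thesis by (simp add: mult.assoc[symmetric] flip: exp_add)
  qed
  have up1: "1 + \<tau> \<le> exp (2 * \<tau>)" using exp_ge_add_one_self[of "2 * \<tau>"] \<tau>0 by linarith
  have J3: "exp (a\<^sup>2 / 2) * (Q * (1 - \<tau>)) \<le> J" "J \<le> exp (a\<^sup>2 / 2) * (Q * (1 + \<tau>))"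
    using J2 unfolding abs_le_iff by (simp_all add: algebra_simps)
  have "Q * exp (- C1 K * \<Theta>) \<le> Q * (exp \<zeta> * exp (- (2 * \<tau>)))"
    using total \<zeta> Q by (intro mult_left_mono) (auto simp: abs_le_iff simp flip: exp_add)
  also have "\<dots> \<le> Q * (exp \<zeta> * (1 - \<tau>))" using low1 Q by (intro mult_left_mono) auto
  also have "\<dots> = exp (\<zeta> - a\<^sup>2 / 2) * (exp (a\<^sup>2 / 2) * (Q * (1 - \<tau>)))" unfolding ee by (simp add: mult_ac)
  also have "\<dots> \<le> measure \<mu> {k1 u<..}" unfolding F using J3(1) by (intro mult_left_mono) auto
  finally show "normal_tail a * exp (- C1 K * \<Theta>) \<le> measure \<mu> {k1 u<..}" by (simp add: Q_def)
  have "measure \<mu> {k1 u<..} \<le> exp (\<zeta> - a\<^sup>2 / 2) * (exp (a\<^sup>2 / 2) * (Q * (1 + \<tau>)))"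
    unfolding F using J3(2) by (intro mult_left_mono) auto
  also have "\<dots> = Q * (exp \<zeta> * (1 + \<tau>))" unfolding ee by (simp add: mult_ac)
  also have "\<dots> \<le> Q * (exp \<zeta> * exp (2 * \<tau>))" using up1 Q by (intro mult_left_mono) auto
  also have "\<dots> \<le> Q * exp (C1 K * \<Theta>)"
    using total \<zeta> Q by (intro mult_left_mono) (auto simp: abs_le_iff simp flip: exp_add)
  finally show "measure \<mu> {k1 u<..} \<le> normal_tail a * exp (C1 K * \<Theta>)" by (simp add: Q_def)
qed

end

section \<open>Comparison with normal quantiles\<close>

text \<open>A relative error \<open>exp (O(1/sqrt N + u + N u^3))\<close> of the tail is absorbed by a shift of the
  argument by \<open>O(1/sqrt N + u^2 sqrt N)\<close>, which is \<open>O(1 + x^2/N)\<close> on the original scale.\<close>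

lemma shift_absorbs_error:
  assumes cs: "0 < cs" "\<And>b \<eta>. b \<ge> -1 \<Longrightarrow> \<eta> \<ge> 0 \<Longrightarrow> normal_tail (b + \<eta>) \<le> normal_tail b * exp (- cs * \<eta> * (2 + b))"
    and a1: "0 < a1" "a1 \<le> 1" and N: "N \<ge> 1" and u: "u \<ge> 0" and a: "a1 * (u * sqrt N) \<le> a"
    and C1: "C1 > 0" and B: "2 * C1 \<le> B * (cs * a1)" and uB: "B * u \<le> a1 / 2" and NB: "B / sqrt N \<le> 1/2"
  defines "\<eta> \<equiv> B * (1 / sqrt N + u\<^sup>2 * sqrt N)" and "\<Theta> \<equiv> 1 / sqrt N + u + N * u ^ 3"
  shows "normal_tail (a + \<eta>) \<le> normal_tail a * exp (- C1 * \<Theta>)"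
    and "normal_tail a * exp (C1 * \<Theta>) \<le> normal_tail (a - \<eta>)"
proof -
  \<comment> \<open>In these variables the shift is \<open>B * p * (1 + q^2)\<close> and the error
    is \<open>p * (1 + q + q^3)\<close>. Their quotient grows like \<open>q\<close>, and so does the
    hazard rate at \<open>a \<ge> a1 * q\<close>.\<close>
  define p where "p = 1 / sqrt N"
  define q where "q = u * sqrt N"
  have p: "p > 0" using N by (simp add: p_def)
  have q: "q \<ge> 0" using N u by (simp add: q_def)
  have pq: "p * q = u" using N by (simp add: p_def q_def)
  have ss: "sqrt N * sqrt N = N" using N by simp
  have \<eta>_eq: "\<eta> = B * p * (1 + q\<^sup>2)"
  proof -
    have "p * q\<^sup>2 = u\<^sup>2 * sqrt N" using N by (simp add: p_def q_def power2_eq_square)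
    then show ?thesis by (simp add: \<eta>_def p_def[symmetric] algebra_simps)
  qed
  have \<Theta>_eq: "\<Theta> = p * (1 + q + q ^ 3)"
  proof -
    have "p * q ^ 3 = u * (u * u * (sqrt N * sqrt N))" using N by (simp add: p_def q_def power3_eq_cube)
    then have "p * q ^ 3 = N * u ^ 3" unfolding ss by (simp add: power3_eq_cube)
    then show ?thesis using pq by (simp add: \<Theta>_def p_def[symmetric] algebra_simps)
  qed
  have B0: "B > 0"
  proof (rule ccontr)
    assume "\<not> B > 0"
    then have "B * (cs * a1) \<le> 0" using cs a1 by (intro mult_nonpos_nonneg) auto
    then show False using B C1 by linarith
  qed
  have \<eta>0: "\<eta> \<ge> 0" unfolding \<eta>_eq using B0 p by simp
  have a0: "a \<ge> 0" by (rule order_trans[OF _ a]) (use a1 u N in simp)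
  \<comment> \<open>Half of \<open>y\<close> suffices, which leaves room for the leftward shift,
    where the hazard rate is evaluated at \<open>a - \<eta>\<close>.\<close>
  have core: "C1 * \<Theta> \<le> cs * \<eta> * (y / 2)" if y: "y \<ge> 1 + a1 * q" for y
  proof -
    have "1 + q + q ^ 3 \<le> (1 + q\<^sup>2) * (1 + q)" using q by (simp add: power2_eq_square power3_eq_cube algebra_simps)
    also have "\<dots> \<le> (1 + q\<^sup>2) * (y / a1)"
    proof (rule mult_left_mono)
      have "a1 * (1 + q) \<le> 1 + a1 * q" using a1 by (simp add: algebra_simps)
      then have "(1 + q) * a1 \<le> y" using y by (simp add: mult.commute)
      then show "1 + q \<le> y / a1" using a1 by (simp add: pos_le_divide_eq)
    qed simp
    finally have "C1 * (p * (1 + q + q ^ 3)) \<le> C1 * (p * ((1 + q\<^sup>2) * (y / a1)))"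
      using C1 p by (intro mult_left_mono) auto
    also have "\<dots> = (2 * C1) * (p * (1 + q\<^sup>2) * y / (2 * a1))" using a1 by (simp add: field_simps)
    also have "\<dots> \<le> (B * (cs * a1)) * (p * (1 + q\<^sup>2) * y / (2 * a1))"
    proof (rule mult_right_mono[OF B])
      have "a1 * q \<ge> 0" using a1 q by simp
      then have "y \<ge> 0" using y by linarith
      then show "0 \<le> p * (1 + q\<^sup>2) * y / (2 * a1)" using p a1 by simp
    qed
    also have "\<dots> = cs * \<eta> * (y / 2)" unfolding \<eta>_eq using a1 by (simp add: field_simps)
    finally show ?thesis by (simp add: \<Theta>_eq)
  qed
  have aq: "a1 * q \<le> a" using a by (simp add: q_def)
  have "C1 * \<Theta> \<le> cs * \<eta> * ((2 + a) / 2)" by (rule core) (use aq in simp)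
  also have "\<dots> \<le> cs * \<eta> * (2 + a)" using cs \<eta>0 a0 by (intro mult_left_mono) auto
  finally have "exp (- cs * \<eta> * (2 + a)) \<le> exp (- C1 * \<Theta>)" by simp
  then have "normal_tail a * exp (- cs * \<eta> * (2 + a)) \<le> normal_tail a * exp (- C1 * \<Theta>)"
    using normal_tail_bounds(1)[of a] by (intro mult_left_mono) auto
  with cs(2)[of a \<eta>] a0 \<eta>0 show "normal_tail (a + \<eta>) \<le> normal_tail a * exp (- C1 * \<Theta>)" by linarith
  \<comment> \<open>\<open>uB\<close> and \<open>NB\<close> keep the shift below
    \<open>1/2 + a/2\<close>. Hence \<open>2 + b\<close> is at least half of \<open>2 + a\<close>,
    and in particular \<open>b \<ge> -1\<close>, as the shift inequality demands.\<close>
  define b where "b = a - \<eta>"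
  have "B * u * (u * sqrt N) \<le> a1 / 2 * (u * sqrt N)" using uB u N by (intro mult_right_mono) auto
  moreover have "\<eta> = B / sqrt N + B * u * (u * sqrt N)" by (simp add: \<eta>_def power2_eq_square algebra_simps)
  moreover have "a1 / 2 * (u * sqrt N) \<le> a / 2" using a by simp
  ultimately have "\<eta> \<le> 1 / 2 + a / 2" using NB by linarith
  then have b: "2 + b \<ge> (2 + a) / 2" by (simp add: b_def field_simps)
  have "C1 * \<Theta> \<le> cs * \<eta> * ((2 + a) / 2)" by (rule core) (use aq in simp)
  also have "\<dots> \<le> cs * \<eta> * (2 + b)" using cs \<eta>0 b by (intro mult_left_mono) auto
  finally have 1: "C1 * \<Theta> \<le> cs * \<eta> * (2 + b)" .
  have "normal_tail (b + \<eta>) \<le> normal_tail b * exp (- cs * \<eta> * (2 + b))"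
    by (rule cs(2)) (use b a0 \<eta>0 in auto)
  also have "\<dots> \<le> normal_tail b * exp (- (C1 * \<Theta>))"
    using 1 normal_tail_bounds(1)[of b] by (intro mult_left_mono) auto
  finally have "normal_tail a * exp (C1 * \<Theta>) \<le> normal_tail b * exp (- (C1 * \<Theta>)) * exp (C1 * \<Theta>)"
    unfolding b_def by (intro mult_right_mono) auto
  also have "\<dots> = normal_tail b" by (simp add: mult.assoc flip: exp_add)
  finally show "normal_tail a * exp (C1 * \<Theta>) \<le> normal_tail (a - \<eta>)" by (simp add: b_def)
qed

text \<open>At \<open>u1\<close> the quadratic remainder takes at most half of the linear term of
  \<open>k1\<close>, so \<open>k1\<close> rises from 0 past \<open>x\<close>; the intermediate value
  theorem does the rest.\<close>

lemma (in log_laplace) saddle_point: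
  assumes u1: "0 < u1" "u1 \<le> umax" and x: "0 \<le> x" "x \<le> c * N * u1 / 2"
  obtains u where "0 \<le> u" "u \<le> u1" "k1 u = x"
proof -
  have k10: "k1 0 = 0" by (simp add: k1_def deriv_zero)
  have ur: "u1 < r / 2" using u1 umax_le r by auto
  have "C3 * N * u1 * u1 \<le> c / 2 * N * u1"
  proof -
    have "C3 * u1 \<le> C3 * umax" using u1 C3_pos by simp
    then have "C3 * u1 \<le> c / 2" using umax_le by linarith
    then have "(C3 * u1) * (N * u1) \<le> c / 2 * (N * u1)" using u1 N by (intro mult_right_mono) auto
    then show ?thesis by (simp add: mult_ac)
  qed
  moreover have "c * N * u1 \<le> v * u1" using v_ge u1 by (intro mult_right_mono) auto
  moreover have "v * u1 - k1 u1 \<le> C3 * N * u1 * u1"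
    using k_expansion(2)[of u1] u1 by (simp add: abs_le_iff power2_eq_square mult.assoc)
  moreover have "c / 2 * N * u1 = c * N * u1 / 2" by simp
  ultimately have "c * N * u1 / 2 \<le> k1 u1" by linarith
  then have "x \<le> k1 u1" using x by simp
  moreover have "continuous_on {0..u1} k1"
  proof -
    have "continuous_on (ball 0 r) (deriv L)"
      using higher_deriv_holomorphic[of 1] by (simp add: holomorphic_on_imp_continuous_on)
    then have "continuous_on {0..u1} (\<lambda>u. deriv L (complex_of_real u))"
      by (rule continuous_on_compose2) (use ur r in \<open>auto intro!: continuous_intros\<close>)
    then show ?thesis unfolding k1_def[abs_def] by (intro continuous_intros)
  qed
  ultimately show ?thesis using IVT'[of k1 0 x u1] x u1 k10 that by auto
qed

text \<open>At the saddle point, \<open>a = u * sqrt (k2 u)\<close> and \<open>x / sqrt v\<close>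
  both equal \<open>u * sqrt v\<close> to first order and differ by \<open>O(u^2 * sqrt N)\<close>.
  Since \<open>x \<ge> c * N * u / 2\<close>, powers of \<open>u\<close> turn into powers of
  \<open>x / N\<close>; multiplying by \<open>sqrt v \<le> sqrt (W * N)\<close> gives a total shift
  of \<open>O(1 + x^2 / N)\<close>.\<close>

lemma (in log_laplace) tail_quantile:
  assumes K: "esseen_bound K"
    and cs: "0 < cs" "\<And>b \<eta>. b \<ge> -1 \<Longrightarrow> \<eta> \<ge> 0 \<Longrightarrow> normal_tail (b + \<eta>) \<le> normal_tail b * exp (- cs * \<eta> * (2 + b))"
    and a1: "0 < a1" "a1 \<le> 1" "a1\<^sup>2 \<le> c / 2" and B: "2 * C1 K \<le> B * (cs * a1)"
    and u1: "0 < u1" "u1 \<le> umax" "B * u1 \<le> a1 / 2" "2 * K * D0 * M0 * (1 + sqrt W) * u1 \<le> 1/4"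
    and NB: "B / sqrt N \<le> 1/2" and NK: "2 * K * D0 * M0 * (1 + sqrt W) / sqrt N \<le> 1/4"
    and C': "C' \<ge> sqrt W * B" "C' * (c\<^sup>2 / 4) \<ge> sqrt W * (B + 2 * C3 / sqrt c)"
    and x: "0 \<le> x" "x \<le> c * N * u1 / 2"
  shows "normal_tail ((x + C' * (1 + x\<^sup>2 / N)) / sqrt v) \<le> measure \<mu> {x<..}"
    and "measure \<mu> {x<..} \<le> normal_tail ((x - C' * (1 + x\<^sup>2 / N)) / sqrt v)"
proof -
  obtain u where u: "0 \<le> u" "u \<le> u1" "k1 u = x" using saddle_point[OF u1(1,2) x] .
  have uu: "u \<le> umax" using u u1 by simp
  have K0: "K > 0" using K by (simp add: esseen_bound_def)
  have N0: "N > 0" "sqrt N > 0" using N by auto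
  define a where "a = u * sqrt (k2 u)"
  define \<eta> where "\<eta> = B * (1 / sqrt N + u\<^sup>2 * sqrt N)"
  define \<Theta> where "\<Theta> = 1 / sqrt N + u + N * u ^ 3"
  have cN: "c * N > 0" using c N by simp
  have k2: "k2 u \<ge> c * N / 2" by (rule k2_ge[OF u(1) uu])
  have k2_pos: "k2 u > 0" using k2 cN by linarith
  have B0: "B > 0"
  proof (rule ccontr)
    assume "\<not> B > 0"
    then have "B * (cs * a1) \<le> 0" using cs a1 by (intro mult_nonpos_nonneg) auto
    then show False using B C1_pos[OF K0] by linarith
  qed
  have a_ge: "a1 * (u * sqrt N) \<le> a"
  proof -
    have "a1 * sqrt N = sqrt (a1\<^sup>2 * N)" using a1 by (simp add: real_sqrt_mult)
    also have "\<dots> \<le> sqrt (k2 u)"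
    proof (rule real_sqrt_le_mono)
      have "c / 2 * N = c * N / 2" by simp
      then show "a1\<^sup>2 * N \<le> k2 u" using mult_right_mono[OF a1(3), of N] N0 k2 by linarith
    qed
    finally have "u * (a1 * sqrt N) \<le> u * sqrt (k2 u)" using u by (intro mult_left_mono) auto
    then show ?thesis by (simp add: a_def mult_ac)
  qed
  have uB: "B * u \<le> a1 / 2" using mult_left_mono[OF u(2), of B] B0 u1(3) by linarith
  define D where "D = 2 * K * D0 * M0 * (1 + sqrt W)"
  have D: "D > 0" using K0 D0_pos M0_pos W_pos by (simp add: D_def add_pos_pos)
  have small: "D * (1 / sqrt N + u) \<le> 1/2"
  proof -
    have "D * u \<le> D * u1" using u D by simp
    moreover have "D * (1 / sqrt N + u) = D / sqrt N + D * u" by (simp add: distrib_left)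
    ultimately show ?thesis using u1(4) NK unfolding D_def[symmetric] by linarith
  qed
  note ts = tail_two_sided[OF K u(1) uu small[unfolded D_def], folded a_def \<Theta>_def, unfolded u(3)]
  note sh = shift_absorbs_error[OF cs a1(1,2) N u(1) a_ge C1_pos[OF K0] B uB NB, folded \<eta>_def \<Theta>_def]
  have v0: "v > 0" "sqrt v > 0" using v_pos by auto
  have D1: "\<bar>a - x / sqrt v\<bar> \<le> 2 * C3 / sqrt c * (u\<^sup>2 * sqrt N)"
  proof -
    have sv: "sqrt (c * N) \<le> sqrt v" "sqrt (c * N) > 0" using v_ge cN by auto
    have "\<bar>x - v * u\<bar> \<le> C3 * N * u\<^sup>2" using k_expansion(2)[OF u(1) uu] u(3) by simp
    then have 1: "\<bar>(x - v * u) / sqrt v\<bar> \<le> C3 * N * u\<^sup>2 / sqrt (c * N)"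
      unfolding abs_divide using sv C3_pos N0 by (intro frac_le) auto
    \<comment> \<open>Multiplication by the conjugate, whose second summand is at least
      \<open>sqrt (c * N)\<close>.\<close>
    have 2: "\<bar>sqrt (k2 u) - sqrt v\<bar> \<le> C3 * N * u / sqrt (c * N)"
    proof -
      have "(sqrt (k2 u) - sqrt v) * (sqrt (k2 u) + sqrt v) = k2 u - v"
        using k2_pos v_pos by (simp add: algebra_simps)
      then have "\<bar>sqrt (k2 u) - sqrt v\<bar> * (sqrt (k2 u) + sqrt v) \<le> C3 * N * u"
      proof -
        assume e: "(sqrt (k2 u) - sqrt v) * (sqrt (k2 u) + sqrt v) = k2 u - v"
        have "\<bar>sqrt (k2 u) - sqrt v\<bar> * (sqrt (k2 u) + sqrt v) = \<bar>(sqrt (k2 u) - sqrt v) * (sqrt (k2 u) + sqrt v)\<bar>"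
          unfolding abs_mult using k2_pos v_pos by simp
        then show ?thesis unfolding e using k_expansion(3)[OF u(1) uu] by linarith
      qed
      moreover have "\<bar>sqrt (k2 u) - sqrt v\<bar> * sqrt (c * N) \<le> \<bar>sqrt (k2 u) - sqrt v\<bar> * (sqrt (k2 u) + sqrt v)"
      proof (rule mult_left_mono)
        have "sqrt (k2 u) \<ge> 0" using k2_pos by simp
        then show "sqrt (c * N) \<le> sqrt (k2 u) + sqrt v" using sv by linarith
      qed simp
      ultimately show ?thesis using sv by (simp add: pos_le_divide_eq)
    qed
    have "v * u / sqrt v = v / sqrt v * u" by simp
    also have "v / sqrt v = sqrt v" by (rule real_div_sqrt) (use v_pos in simp)
    finally have "x / sqrt v = (x - v * u) / sqrt v + u * sqrt v"
      by (simp only: diff_divide_distrib mult.commute[of "sqrt v"])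
    then have "a - x / sqrt v = u * (sqrt (k2 u) - sqrt v) - (x - v * u) / sqrt v"
      by (simp add: a_def algebra_simps)
    then have "\<bar>a - x / sqrt v\<bar> \<le> \<bar>u * (sqrt (k2 u) - sqrt v)\<bar> + \<bar>(x - v * u) / sqrt v\<bar>"
      by (simp only: abs_triangle_ineq4)
    also have "\<dots> \<le> u * (C3 * N * u / sqrt (c * N)) + C3 * N * u\<^sup>2 / sqrt (c * N)"
      using 1 mult_left_mono[OF 2 u(1)] u(1) by (simp add: abs_mult)
    also have "\<dots> = 2 * C3 * (N / sqrt (c * N)) * u\<^sup>2" by (simp add: power2_eq_square)
    also have "N / sqrt (c * N) = sqrt N / sqrt c" proof -
      have "N / sqrt (c * N) = N / sqrt N / sqrt c" by (simp add: real_sqrt_mult mult.commute)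
      also have "N / sqrt N = sqrt N" by (rule real_div_sqrt) (use N0 in simp)
      finally show ?thesis .
    qed
    finally show ?thesis by (simp add: mult_ac)
  qed
  have xu: "x \<ge> c * N * u / 2"
  proof -
    have "C3 * u \<le> c / 2" using mult_left_mono[OF uu, of C3] C3_pos umax_le by linarith
    then have "(C3 * u) * (N * u) \<le> c / 2 * (N * u)" using u N by (intro mult_right_mono) auto
    moreover have "c * N * u \<le> v * u" using v_ge u by (intro mult_right_mono) auto
    ultimately show ?thesis using k_expansion(2)[OF u(1) uu] u(3) by (simp add: abs_le_iff power2_eq_square mult_ac)
  qed
  have shift: "\<eta> + 2 * C3 / sqrt c * (u\<^sup>2 * sqrt N) \<le> C' * (1 + x\<^sup>2 / N) / sqrt v"
  proof -
    have C'0: "C' \<ge> 0" by (rule order_trans[OF _ C'(1)]) (use W_pos B0 in simp)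
    have "(c * N * u / 2)\<^sup>2 \<le> x\<^sup>2" using xu cN u(1) by (intro power_mono) auto
    then have "(c * N * u / 2)\<^sup>2 / N \<le> x\<^sup>2 / N" using N0 by (intro divide_right_mono) auto
    then have x2: "c\<^sup>2 / 4 * (N * u\<^sup>2) \<le> x\<^sup>2 / N" using N0 by (simp add: power2_eq_square mult_ac)
    define E where "E = B + 2 * C3 / sqrt c"
    have y: "N * u\<^sup>2 / sqrt N = u\<^sup>2 * sqrt N"
    proof -
      have "N * u\<^sup>2 / sqrt N = N / sqrt N * u\<^sup>2" by simp
      also have "N / sqrt N = sqrt N" by (rule real_div_sqrt) (use N0 in simp)
      finally show ?thesis by (simp only: mult.commute)
    qed
    have "\<eta> + 2 * C3 / sqrt c * (u\<^sup>2 * sqrt N) = B / sqrt N + E * (N * u\<^sup>2 / sqrt N)"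
      unfolding y by (simp add: \<eta>_def E_def algebra_simps)
    also have "\<dots> = (B + E * (N * u\<^sup>2)) / sqrt N" by (simp add: add_divide_distrib)
    also have "\<dots> = (sqrt W * (B + E * (N * u\<^sup>2))) / (sqrt W * sqrt N)" using W_pos by simp
    also have "\<dots> = (sqrt W * B + sqrt W * E * (N * u\<^sup>2)) / sqrt (W * N)"
      by (simp add: real_sqrt_mult distrib_left mult.assoc)
    also have "\<dots> \<le> (C' + C' * (c\<^sup>2 / 4) * (N * u\<^sup>2)) / sqrt (W * N)"
      using C' W_pos N0 unfolding E_def by (intro divide_right_mono add_mono mult_right_mono) auto
    also have "\<dots> \<le> (C' + C' * (x\<^sup>2 / N)) / sqrt (W * N)"
      using mult_left_mono[OF x2 C'0] W_pos N0 by (intro divide_right_mono) (auto simp: mult_ac)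
    also have "\<dots> \<le> (C' + C' * (x\<^sup>2 / N)) / sqrt v"
      using v0 v_le_W C'0 N0 by (intro divide_left_mono) (auto intro!: add_nonneg_nonneg mult_pos_pos W_pos)
    finally show ?thesis by (simp add: distrib_left)
  qed
  have "normal_tail ((x + C' * (1 + x\<^sup>2 / N)) / sqrt v) \<le> normal_tail (a + \<eta>)"
    using shift D1 by (intro normal_tail_antimono) (simp add: add_divide_distrib abs_le_iff)
  with sh(1) ts(1) show "normal_tail ((x + C' * (1 + x\<^sup>2 / N)) / sqrt v) \<le> measure \<mu> {x<..}" by linarith
  have "normal_tail (a - \<eta>) \<le> normal_tail ((x - C' * (1 + x\<^sup>2 / N)) / sqrt v)"
    using shift D1 by (intro normal_tail_antimono) (simp add: diff_divide_distrib abs_le_iff)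
  with sh(2) ts(2) show "measure \<mu> {x<..} \<le> normal_tail ((x - C' * (1 + x\<^sup>2 / N)) / sqrt v)" by linarith
qed

text \<open>The constants built inside the locale depend on \<open>r\<close>, \<open>C\<close> and
  \<open>c\<close> only, so an arbitrary instance supplies them for all others. If there is no
  instance, the claim about the tails is vacuous.\<close>

lemma uniform_tail_quantile:
  fixes r C c :: real
  obtains \<epsilon> B N0 where "\<epsilon> > 0" "B > 0" "N0 \<ge> 1" "B * \<epsilon> \<le> 1/2"
    and "\<And>\<mu> N v L x. log_laplace \<mu> r C c N v L \<Longrightarrow> N \<ge> N0 \<Longrightarrow> 0 \<le> x \<Longrightarrow> x \<le> \<epsilon> * N \<Longrightarrow>
      normal_tail ((x + B * (1 + x\<^sup>2 / N)) / sqrt v) \<le> measure \<mu> {x<..} \<and>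
      measure \<mu> {x<..} \<le> normal_tail ((x - B * (1 + x\<^sup>2 / N)) / sqrt v)"
proof (cases "\<exists>\<mu> N v L. log_laplace \<mu> r C c N v L")
  case False
  show ?thesis by (rule that[of "1/2" 1 1]) (use False in auto)
next
  case True
  then obtain \<mu>0 N0 v0 L0 where "log_laplace \<mu>0 r C c N0 v0 L0" by blast
  then interpret I: log_laplace \<mu>0 r C c N0 v0 L0 .
  obtain K where K: "esseen_bound K" using esseen_bound_ex by blast
  then have K0: "K > 0" by (simp add: esseen_bound_def)
  obtain cs where cs: "cs > 0"
    "\<And>b \<eta>. b \<ge> -1 \<Longrightarrow> \<eta> \<ge> 0 \<Longrightarrow> normal_tail (b + \<eta>) \<le> normal_tail b * exp (- cs * \<eta> * (2 + b))"
    using normal_tail_shift by metis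
  \<comment> \<open>Chosen so that \<open>k2 u \<ge> c * N / 2\<close> yields
    \<open>a1 * (u * sqrt N) \<le> a\<close>.\<close>
  define a1 where "a1 = min 1 (sqrt (c / 2))"
  have a1: "0 < a1" "a1 \<le> 1" using I.c by (auto simp: a1_def)
  have a1c: "a1\<^sup>2 \<le> c / 2"
  proof -
    have "a1\<^sup>2 \<le> (sqrt (c / 2))\<^sup>2" using a1 by (intro power_mono) (auto simp: a1_def)
    then show ?thesis using I.c by simp
  qed
  define B where "B = 2 * I.C1 K / (cs * a1)"
  have B: "B > 0" "2 * I.C1 K \<le> B * (cs * a1)" using I.C1_pos[OF K0] cs a1 by (auto simp: B_def)
  define D where "D = 2 * K * I.D0 * I.M0 * (1 + sqrt I.W)"
  have D: "D > 0" using K0 I.D0_pos I.M0_pos I.W_pos by (simp add: D_def add_pos_pos)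
  define G where "G = sqrt I.W * (B + 2 * I.C3 / sqrt c)"
  define B' where "B' = max (sqrt I.W * B) (G * 4 / c\<^sup>2)"
  have B'0: "B' > 0" using B I.W_pos by (auto simp: B'_def less_max_iff_disj)
  have B'1: "B' \<ge> sqrt I.W * B" by (simp add: B'_def)
  have "B' \<ge> G * 4 / c\<^sup>2" by (simp add: B'_def)
  then have B'2: "B' * (c\<^sup>2 / 4) \<ge> G" using I.c by (simp add: field_simps)
  \<comment> \<open>Four demands: an admissible tilt, a leftward shift that stays moderate, the
    smallness needed for \<open>tail_two_sided\<close>, and \<open>B' * \<epsilon> \<le> 1/2\<close>
    for the resulting \<open>\<epsilon> = c * u1 / 2\<close>.\<close>
  define u1 where "u1 = min (min I.umax (a1 / (2 * B))) (min (1 / (4 * D)) (1 / (B' * c)))"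
  have u1: "0 < u1" "u1 \<le> I.umax" using I.umax_pos a1 B D B'0 I.c by (auto simp: u1_def)
  have "u1 \<le> a1 / (2 * B)" "u1 \<le> 1 / (4 * D)" "u1 \<le> 1 / (B' * c)" by (auto simp: u1_def)
  then have u1': "B * u1 \<le> a1 / 2" "D * u1 \<le> 1/4" "B' * (c * u1 / 2) \<le> 1/2"
    using B D B'0 I.c by (auto simp: field_simps)
  \<comment> \<open>Beyond this size \<open>B / sqrt N \<le> 1/2\<close> and
    \<open>D / sqrt N \<le> 1/4\<close>, the parts of the smallness conditions that do not involve
    \<open>u\<close>.\<close>
  define n0 where "n0 = 1 + (2 * B)\<^sup>2 + (4 * D)\<^sup>2"
  show ?thesis
  proof (rule that[of "c * u1 / 2" B' n0])
    show "c * u1 / 2 > 0" "B' > 0" "n0 \<ge> 1" "B' * (c * u1 / 2) \<le> 1/2" using I.c u1 B'0 u1' by (auto simp: n0_def)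
    fix \<mu> N v L and x :: real
    assume "log_laplace \<mu> r C c N v L" and Nn: "N \<ge> n0" and x: "0 \<le> x" "x \<le> c * u1 / 2 * N"
    then interpret log_laplace \<mu> r C c N v L by simp
    have nn: "0 \<le> (2 * B)\<^sup>2" "0 \<le> (4 * D)\<^sup>2" by auto
    have "2 * B \<le> sqrt N" "4 * D \<le> sqrt N"
      by (rule real_le_rsqrt; use Nn nn in \<open>unfold n0_def, linarith\<close>)+
    moreover have "sqrt N > 0" using N by simp
    ultimately have NB: "B / sqrt N \<le> 1/2" and ND: "D / sqrt N \<le> 1/4" by (auto simp: pos_divide_le_eq)
    have x': "x \<le> c * N * u1 / 2" using x(2) by (simp add: mult_ac)
    note tq = tail_quantile[OF K cs a1 a1c B(2) u1 u1'(1) u1'(2)[unfolded D_def] NB ND[unfolded D_def] B'1 B'2[unfolded G_def] x(1) x']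
    show "normal_tail ((x + B' * (1 + x\<^sup>2 / N)) / sqrt v) \<le> measure \<mu> {x<..} \<and>
      measure \<mu> {x<..} \<le> normal_tail ((x - B' * (1 + x\<^sup>2 / N)) / sqrt v)"
      using tq by blast
  qed
qed

text \<open>The tail estimates concern nonnegative points. Reflection keeps \<open>r\<close>,
  \<open>C\<close>, \<open>c\<close>, \<open>N\<close> and \<open>v\<close>, so it yields the left
  tail with the same constants.\<close>

lemma (in log_laplace) reflect: "log_laplace (distr \<mu> borel uminus) r C c N v (\<lambda>z. L (- z))"
proof -
  have rd: "real_distribution (distr \<mu> borel uminus)" by (rule real_distribution_distr) simp
  have hd: "(deriv ^^ k) (\<lambda>z. L (-1 * z)) 0 = (-1) ^ k * (deriv ^^ k) L (-1 * 0)" for k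
    by (rule higher_deriv_compose_linear[OF hol open_ball[of 0 r] open_ball]) (use r in auto)
  show ?thesis
    unfolding log_laplace_def log_laplace_axioms_def
  proof (intro conjI allI impI rd r C c N v_ge)
    show "(\<lambda>z. L (- z)) holomorphic_on ball 0 r"
      by (rule holomorphic_on_compose_gen[where t="ball 0 r", unfolded comp_def, OF _ hol]) (auto intro!: holomorphic_intros)
    show "deriv (\<lambda>z. L (- z)) 0 = 0" using hd[of 1] by (simp add: deriv_zero)
    show "(deriv ^^ 2) (\<lambda>z. L (- z)) 0 = complex_of_real v" using hd[of 2] by (simp add: deriv2_zero)
    show "cmod (L (- z)) \<le> C * N" if "cmod z < r" for z using bound[of "- z"] that by simp
    show "L (- 0) = 0" by (simp add: zero)
    show "L (- complex_of_real u) \<in> \<real>" if "\<bar>u\<bar> < r" for u using real[of "- u"] that by simp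
    show "integrable (distr \<mu> borel uminus) (\<lambda>x. exp (u * x))" if "\<bar>u\<bar> < r" for u
      using integrable_exp[of "- u"] that by (simp add: integrable_distr_eq)
    show "(\<integral>x. exp (z * complex_of_real x) \<partial>distr \<mu> borel uminus) = exp (L (- z))" if "cmod z < r" for z
      using laplace[of "- z"] that by (simp add: integral_distr)
  qed
qed

text \<open>Up to \<open>\<epsilon> * N\<close> this is the tail comparison read through the
  monotone \<open>normal_tail\<close>. Beyond, the comparison at the boundary point
  \<open>z = \<epsilon> * N\<close> gives \<open>y \<ge> z / 2 - B\<close>; then \<open>x\<close>
  and \<open>y\<close> are so large that each is itself \<open>O(1 + x^2 / N + y^2 / N)\<close>, and
  nothing more precise is required of their difference.\<close>

lemma quantile_displacement_nonneg:
  fixes x t N v \<epsilon> B :: real and \<mu> :: "real measure"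
  assumes eps: "\<epsilon> > 0" "B > 0" "B * \<epsilon> \<le> 1/2" and N: "N \<ge> 1" and v: "v > 0" and \<mu>: "prob_space \<mu>" "sets \<mu> = sets borel"
    and tail: "\<And>x. 0 \<le> x \<Longrightarrow> x \<le> \<epsilon> * N \<Longrightarrow>
      normal_tail ((x + B * (1 + x\<^sup>2 / N)) / sqrt v) \<le> measure \<mu> {x<..} \<and>
      measure \<mu> {x<..} \<le> normal_tail ((x - B * (1 + x\<^sup>2 / N)) / sqrt v)"
    and x: "x \<ge> 0" and t: "normal_tail t = measure \<mu> {x<..}"
  defines "y \<equiv> sqrt v * t" and "B' \<equiv> B + B\<^sup>2 / \<epsilon> + 3 / \<epsilon>"
  shows "\<bar>x - y\<bar> \<le> B' * (1 + x\<^sup>2 / N + y\<^sup>2 / N)"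
proof -
  have sv: "sqrt v > 0" using v by simp
  have ge: "normal_tail t \<le> normal_tail (z / sqrt v) \<Longrightarrow> z \<le> y" for z
    using sv by (simp add: normal_tail_le_iff y_def pos_divide_le_eq mult.commute)
  have le: "normal_tail (z / sqrt v) \<le> normal_tail t \<Longrightarrow> y \<le> z" for z
    using sv by (simp add: normal_tail_le_iff y_def pos_le_divide_eq mult.commute)
  have B'B: "B \<le> B'" "0 < B'" using eps by (auto simp: B'_def add_pos_pos)
  have nn: "0 \<le> x\<^sup>2 / N" "0 \<le> y\<^sup>2 / N" using N by auto
  show ?thesis
  proof (cases "x \<le> \<epsilon> * N")
    case True
    have "\<bar>x - y\<bar> \<le> B * (1 + x\<^sup>2 / N)"
      using ge[of "x - B * (1 + x\<^sup>2 / N)"] le[of "x + B * (1 + x\<^sup>2 / N)"] tail[OF x True] t by (simp add: abs_le_iff)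
    also have "\<dots> \<le> B' * (1 + x\<^sup>2 / N + y\<^sup>2 / N)" using B'B nn by (intro mult_mono) auto
    finally show ?thesis .
  next
    case False
    interpret prob_space \<mu> by (rule \<mu>)
    define z where "z = \<epsilon> * N"
    have z0: "z > 0" using eps N by (simp add: z_def)
    have "measure \<mu> {x<..} \<le> measure \<mu> {z<..}"
      using False by (intro finite_measure_mono) (auto simp: z_def \<mu>)
    then have "z - B * (1 + z\<^sup>2 / N) \<le> y" using tail[of z] z0 t by (intro ge) (auto simp: z_def)
    moreover have "B * (z\<^sup>2 / N) = (B * \<epsilon>) * z" using N by (simp add: z_def power2_eq_square)
    moreover have "(B * \<epsilon>) * z \<le> 1/2 * z" using eps z0 by (intro mult_right_mono) auto
    ultimately have y: "z / 2 - B \<le> y" by (simp add: distrib_left)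
    have zx: "z \<le> x" using False by (simp add: z_def)
    have "x * z \<le> x * x" using zx x by (intro mult_left_mono) auto
    then have xb: "x \<le> x\<^sup>2 / z" using z0 by (simp add: pos_le_divide_eq power2_eq_square)
    \<comment> \<open>For \<open>y \<ge> 0\<close> this combines \<open>z / 2 \<le> y + B\<close>
      with \<open>2 * B * y \<le> y^2 + B^2\<close>.\<close>
    have yb: "\<bar>y\<bar> \<le> B + (3 * y\<^sup>2 + B\<^sup>2) / z"
    proof (cases "y \<ge> 0")
      case True
      have "y * (z / 2) \<le> y * (y + B)" using y True by (intro mult_left_mono) auto
      moreover have "0 \<le> (y - B)\<^sup>2" by simp
      ultimately have "y * z \<le> 3 * y\<^sup>2 + B\<^sup>2" by (simp add: power2_eq_square algebra_simps)
      then have "y \<le> (3 * y\<^sup>2 + B\<^sup>2) / z" using z0 by (simp add: pos_le_divide_eq)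
      then show ?thesis using True eps by simp
    next
      case False
      have "\<bar>y\<bar> \<le> B" using y z0 False by simp
      moreover have "0 \<le> (3 * y\<^sup>2 + B\<^sup>2) / z" using z0 by (intro divide_nonneg_pos add_nonneg_nonneg) auto
      ultimately show ?thesis by linarith
    qed
    have "\<bar>x - y\<bar> \<le> x + \<bar>y\<bar>" using abs_triangle_ineq4[of x y] x by simp
    also have "\<dots> \<le> x\<^sup>2 / z + (B + (3 * y\<^sup>2 + B\<^sup>2) / z)" using xb yb by linarith
    also have "\<dots> = B + B\<^sup>2 / \<epsilon> * (1 / N) + 1 / \<epsilon> * (x\<^sup>2 / N) + 3 / \<epsilon> * (y\<^sup>2 / N)"
      by (simp add: z_def add_divide_distrib)
    also have "\<dots> \<le> B' + B' * (x\<^sup>2 / N) + B' * (y\<^sup>2 / N)"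
    proof -
      have p: "0 < 1 / \<epsilon>" "0 \<le> B\<^sup>2 / \<epsilon>" "3 / \<epsilon> = 3 * (1 / \<epsilon>)" using eps by auto
      have "B\<^sup>2 / \<epsilon> * (1 / N) \<le> B\<^sup>2 / \<epsilon> * 1" using N p by (intro mult_left_mono) auto
      then have "B + B\<^sup>2 / \<epsilon> * (1 / N) \<le> B'" using p unfolding B'_def by linarith
      moreover have "1 / \<epsilon> * (x\<^sup>2 / N) \<le> B' * (x\<^sup>2 / N)"
        unfolding B'_def by (rule mult_right_mono) (use eps p nn in linarith)+
      moreover have "3 / \<epsilon> * (y\<^sup>2 / N) \<le> B' * (y\<^sup>2 / N)"
        unfolding B'_def by (rule mult_right_mono) (use eps p nn in linarith)+
      ultimately show ?thesis by linarith
    qed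
    finally show ?thesis by (simp add: algebra_simps)
  qed
qed

section \<open>Monotone rearrangement to the standard normal law\<close>

text \<open>\<open>T\<close> is the inverse of \<open>normal_tail\<close> applied to the tail of
  \<open>\<mu>\<close>. Strictness keeps that tail strictly between 0 and 1, so the inverse exists
  at every point; continuity makes every level attained, so preimages of half lines are half lines
  of the right mass.\<close>

lemma quantile_transform:
  fixes \<mu> :: "real measure"
  assumes "real_distribution \<mu>" and cont: "\<And>x. isCont (cdf \<mu>) x" and strict: "strict_mono (cdf \<mu>)"
  obtains T where "T \<in> borel_measurable borel" "distr \<mu> borel T = std_normal_distribution"
    and "\<And>x. normal_tail (T x) = measure \<mu> {x<..}"
proof -
  interpret real_distribution \<mu> by fact
  define G where "G = (\<lambda>x. measure \<mu> {x<..})"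
  have G: "G x = 1 - cdf \<mu> x" for x
  proof -
    have "measure \<mu> (space \<mu> - {..x}) = 1 - measure \<mu> {..x}" by (rule prob_compl) simp
    moreover have "space \<mu> - {..x} = {x<..}" by auto
    ultimately show ?thesis by (simp add: G_def cdf_def)
  qed
  have G_le: "G x \<le> G y \<longleftrightarrow> y \<le> x" for x y using strict_mono_less_eq[OF strict] by (simp add: G)
  have G01: "0 < G x" "G x < 1" for x
  proof -
    have "cdf \<mu> x < cdf \<mu> (x + 1)" "cdf \<mu> (x - 1) < cdf \<mu> x" using strict by (auto simp: strict_mono_def)
    then show "0 < G x" "G x < 1" using cdf_bounded_prob[of "x + 1"] cdf_nonneg[of "x - 1"] by (auto simp: G)
  qed
  have "\<forall>x. \<exists>a. normal_tail a = G x" using normal_tail_surj G01 by blast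
  then have "\<exists>T. \<forall>x. normal_tail (T x) = G x" by (rule choice)
  then obtain T where T: "\<And>x. normal_tail (T x) = G x" by blast
  have T_mono: "T x \<le> T y \<longleftrightarrow> x \<le> y" for x y using G_le[of y x] by (simp add: T[symmetric] normal_tail_le_iff)
  have T_meas: "T \<in> borel_measurable borel" by (rule borel_measurable_mono) (simp add: mono_def T_mono)
  have "distr \<mu> borel T = std_normal_distribution"
  proof (rule cdf_unique)
    show "real_distribution (distr \<mu> borel T)" by (rule real_distribution_distr) (use T_meas in simp)
    show "real_distribution std_normal_distribution" by (rule real_dist_normal_dist)
    show "cdf (distr \<mu> borel T) = cdf std_normal_distribution"
    proof
      fix a
      have q: "0 < normal_tail a" "normal_tail a < 1" by (rule normal_tail_bounds)+
      have "eventually (\<lambda>x. cdf \<mu> x < 1 - normal_tail a) at_bot"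
        using order_tendstoD(2)[OF cdf_lim_at_bot] q by simp
      then obtain x1 where x1: "cdf \<mu> x1 < 1 - normal_tail a" by (auto simp: eventually_at_bot_linorder)
      have "eventually (\<lambda>x. cdf \<mu> x > 1 - normal_tail a) at_top"
        using order_tendstoD(1)[OF cdf_lim_at_top_prob] q by simp
      then obtain x2 where x2: "cdf \<mu> x2 > 1 - normal_tail a" by (auto simp: eventually_at_top_linorder)
      have "x1 \<le> x2" using x1 x2 strict_mono_less_eq[OF strict, of x2 x1] by linarith
      then obtain x0 where x0: "cdf \<mu> x0 = 1 - normal_tail a"
        using IVT[of "cdf \<mu>" x1 "1 - normal_tail a" x2] x1 x2 cont by auto
      then have "normal_tail (T x0) = normal_tail a" by (simp add: T G)
      then have "T x0 = a" by (intro antisym) (simp_all flip: normal_tail_le_iff)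
      then have "T -` {..a} \<inter> space \<mu> = {..x0}" using T_mono[of _ x0] by auto
      then have "cdf (distr \<mu> borel T) a = cdf \<mu> x0" using T_meas by (simp add: cdf_def measure_distr)
      then show "cdf (distr \<mu> borel T) a = cdf std_normal_distribution a" using x0 by (simp add: normal_tail_eq_cdf)
    qed
  qed
  then show ?thesis using that T_meas T by (simp add: G_def)
qed

lemma cdf_continuous_no_atom: "real_distribution \<mu> \<Longrightarrow> isCont (cdf \<mu>) x \<Longrightarrow> measure \<mu> {x} = 0"
  by (simp add: finite_borel_measure.isCont_cdf real_distribution.finite_borel_measure_M)

lemma quantile_displacement:
  fixes r C c :: real
  obtains B N0 where "B > 0" "N0 \<ge> 1"
    and "\<And>\<mu> N v L x t. log_laplace \<mu> r C c N v L \<Longrightarrow> N \<ge> N0 \<Longrightarrow> isCont (cdf \<mu>) x \<Longrightarrow>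
      normal_tail t = measure \<mu> {x<..} \<Longrightarrow>
      \<bar>x - sqrt v * t\<bar> \<le> B * (1 + x\<^sup>2 / N + (sqrt v * t)\<^sup>2 / N)"
proof (rule uniform_tail_quantile[of r C c])
  fix \<epsilon> B N0 :: real
  assume eps: "\<epsilon> > 0" "B > 0" "N0 \<ge> 1" "B * \<epsilon> \<le> 1/2"
    and tail: "\<And>\<mu> N v L x. log_laplace \<mu> r C c N v L \<Longrightarrow> N \<ge> N0 \<Longrightarrow> 0 \<le> x \<Longrightarrow> x \<le> \<epsilon> * N \<Longrightarrow>
      normal_tail ((x + B * (1 + x\<^sup>2 / N)) / sqrt v) \<le> measure \<mu> {x<..} \<and>
      measure \<mu> {x<..} \<le> normal_tail ((x - B * (1 + x\<^sup>2 / N)) / sqrt v)"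
  show ?thesis
  proof (rule that[of "B + B\<^sup>2 / \<epsilon> + 3 / \<epsilon>" N0])
    show "B + B\<^sup>2 / \<epsilon> + 3 / \<epsilon> > 0" using eps by (simp add: add_pos_pos)
    show "N0 \<ge> 1" by fact
    fix \<mu> N v L x t
    assume LL: "log_laplace \<mu> r C c N v L" and NN: "N \<ge> N0" and cont: "isCont (cdf \<mu>) x"
      and t: "normal_tail t = measure \<mu> {x<..}"
    interpret log_laplace \<mu> r C c N v L by (rule LL)
    show "\<bar>x - sqrt v * t\<bar> \<le> (B + B\<^sup>2 / \<epsilon> + 3 / \<epsilon>) * (1 + x\<^sup>2 / N + (sqrt v * t)\<^sup>2 / N)"
    proof (cases "x \<ge> 0")
      case True
      show ?thesis
        by (rule quantile_displacement_nonneg[OF eps(1,2,4) _ v_pos prob_space_axioms _ tail[OF LL NN] True t])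
          (use log_laplace.N[OF LL] in auto)
    next
      case False
      \<comment> \<open>Reflection turns \<open>x\<close> into \<open>- x > 0\<close> and
        \<open>t\<close> into \<open>- t\<close>. Continuity at \<open>x\<close> removes the
        difference between \<open>{..<x}\<close> and \<open>{..x}\<close>.\<close>
      let ?\<nu> = "distr \<mu> borel uminus"
      interpret R: log_laplace ?\<nu> r C c N v "\<lambda>z. L (- z)" by (rule reflect)
      have "measure ?\<nu> {- x<..} = measure \<mu> (uminus -` {- x<..} \<inter> space \<mu>)" by (rule measure_distr) auto
      also have "uminus -` {- x<..} \<inter> space \<mu> = {..<x}" by auto
      also have "measure \<mu> {..<x} = measure \<mu> {..x}"
      proof -
        have "{..x} = {..<x} \<union> {x}" "{..<x} \<inter> {x} = {}" by auto
        then have "measure \<mu> {..x} = measure \<mu> {..<x} + measure \<mu> {x}"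
          using finite_measure_Union[of "{..<x}" "{x}"] by auto
        then show ?thesis using cdf_continuous_no_atom[OF real_distribution_axioms cont] by simp
      qed
      also have "\<dots> = 1 - measure \<mu> {x<..}"
      proof -
        have "measure \<mu> (space \<mu> - {x<..}) = 1 - measure \<mu> {x<..}" by (rule prob_compl) simp
        moreover have "space \<mu> - {x<..} = {..x}" by auto
        ultimately show ?thesis by simp
      qed
      finally have t': "normal_tail (- t) = measure ?\<nu> {- x<..}" by (simp add: normal_tail_uminus t)
      have "\<bar>- x - sqrt v * - t\<bar> \<le> (B + B\<^sup>2 / \<epsilon> + 3 / \<epsilon>) * (1 + (- x)\<^sup>2 / N + (sqrt v * - t)\<^sup>2 / N)"
        by (rule quantile_displacement_nonneg[OF eps(1,2,4) _ v_pos R.prob_space_axioms _ tail[OF R.log_laplace_axioms NN] _ t'])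
          (use False log_laplace.N[OF LL] in auto)
      then show ?thesis by (simp add: abs_minus_commute)
    qed
  qed
qed

section \<open>Gaussian regularisation\<close>

text \<open>Translating the integration variable by the real part of \<open>z\<close> completes the
  square. What remains is the characteristic function of the normal law at the imaginary part, so no
  contour has to be moved.\<close>

lemma normal_laplace:
  fixes z :: complex
  shows "integrable std_normal_distribution (\<lambda>x. exp (z * of_real x))"
    and "(\<integral>x. exp (z * of_real x) \<partial>std_normal_distribution) = exp (z\<^sup>2 / 2)"
proof -
  define u t where "u = Re z" and "t = Im z"
  have z: "z = of_real u + \<i> * of_real t" by (simp add: u_def t_def complex_eq_iff)
  have shift: "std_normal_density (u + y) *\<^sub>R exp (z * of_real (u + y))
     = exp (of_real (u\<^sup>2 / 2) + \<i> * of_real (t * u)) * (std_normal_density y *\<^sub>R iexp (t * y))" for y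
  proof -
    have "exp (- (u + y)\<^sup>2 / 2) = exp (- (u * y)) * (exp (- u\<^sup>2 / 2) * exp (- y\<^sup>2 / 2))"
      by (simp add: power2_eq_square field_simps flip: exp_add)
    then have d: "std_normal_density (u + y) = exp (- (u * y)) * (exp (- u\<^sup>2 / 2) * std_normal_density y)"
      by (simp add: std_normal_density_eq)
    have "complex_of_real (exp (- (u * y)) * exp (- u\<^sup>2 / 2)) * exp (z * of_real (u + y))
      = exp (of_real (u\<^sup>2 / 2) + \<i> * of_real (t * u)) * iexp (t * y)"
      unfolding of_real_mult exp_of_real[symmetric] exp_add[symmetric]
      by (rule arg_cong[where f=exp]) (simp add: z power2_eq_square algebra_simps add_divide_distrib[symmetric])
    then show ?thesis unfolding d by (simp add: scaleR_conv_of_real mult_ac)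
  qed
  have base: "integrable lborel (\<lambda>y. std_normal_density y *\<^sub>R iexp (t * y))"
    "(\<integral>y. std_normal_density y *\<^sub>R iexp (t * y) \<partial>lborel) = exp (- (of_real t)\<^sup>2 / 2)"
  proof -
    have "integrable std_normal_distribution (\<lambda>y. iexp (t * y))" by (rule std_normal.integrable_const_bound[where B=1]) auto
    then show "integrable lborel (\<lambda>y. std_normal_density y *\<^sub>R iexp (t * y))"
      by (subst (asm) integrable_density) auto
    have "(\<integral>y. std_normal_density y *\<^sub>R iexp (t * y) \<partial>lborel) = char std_normal_distribution t"
      unfolding char_def by (subst integral_density) auto
    then show "(\<integral>y. std_normal_density y *\<^sub>R iexp (t * y) \<partial>lborel) = exp (- (of_real t)\<^sup>2 / 2)"
      by (simp add: char_std_normal_distribution exp_of_real[symmetric])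
  qed
  have "integrable lborel (\<lambda>y. std_normal_density (u + y) *\<^sub>R exp (z * of_real (u + y)))"
    unfolding shift by (rule integrable_mult_right[OF base(1)])
  then have i: "integrable lborel (\<lambda>x. std_normal_density x *\<^sub>R exp (z * of_real x))"
    using lborel_integrable_real_affine_iff[of 1 "\<lambda>x. std_normal_density x *\<^sub>R exp (z * of_real x)" u] by simp
  then show "integrable std_normal_distribution (\<lambda>x. exp (z * of_real x))"
    by (subst integrable_density) auto
  have "(\<integral>x. exp (z * of_real x) \<partial>std_normal_distribution) = (\<integral>x. std_normal_density x *\<^sub>R exp (z * of_real x) \<partial>lborel)"
    by (subst integral_density) auto
  also have "\<dots> = (\<integral>y. std_normal_density (u + y) *\<^sub>R exp (z * of_real (u + y)) \<partial>lborel)"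
    by (subst lborel_integral_real_affine[where c=1 and t=u]) auto
  also have "\<dots> = exp (of_real (u\<^sup>2 / 2) + \<i> * of_real (t * u)) * exp (- (of_real t)\<^sup>2 / 2)"
    unfolding shift base(2)[symmetric] by (rule integral_mult_right_zero)
  also have "\<dots> = exp (z\<^sup>2 / 2)"
    unfolding exp_add[symmetric] by (rule arg_cong[where f=exp]) (simp add: z power2_eq_square field_simps)
  finally show "(\<integral>x. exp (z * of_real x) \<partial>std_normal_distribution) = exp (z\<^sup>2 / 2)" .
qed

context
  fixes P :: "'w measure" and S :: "'w \<Rightarrow> real" and b \<kappa> :: real
  assumes P: "prob_space P" and S[measurable]: "S \<in> borel_measurable P"
    and S_bd: "\<And>\<omega>. \<omega> \<in> space P \<Longrightarrow> \<bar>S \<omega>\<bar> \<le> b" and \<kappa>: "\<kappa> > 0"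
begin

definition smoothed :: "real measure" where
  "smoothed = distr (P \<Otimes>\<^sub>M std_normal_distribution) borel (\<lambda>(\<omega>, g). S \<omega> + \<kappa> * g)"

interpretation prob_space P by (rule P)
interpretation PN: pair_prob_space P std_normal_distribution ..

lemma real_distribution_smoothed: "real_distribution smoothed"
  unfolding smoothed_def by (rule PN.real_distribution_distr) measurable

lemma smoothed_laplace:
  fixes z :: complex
  shows "integrable smoothed (\<lambda>x. exp (z * of_real x))"
    and "(\<integral>x. exp (z * of_real x) \<partial>smoothed) = (\<integral>\<omega>. exp (z * of_real (S \<omega>)) \<partial>P) * exp (of_real (\<kappa>\<^sup>2) * z\<^sup>2 / 2)"
proof -
  let ?f = "\<lambda>(\<omega>, g). exp (z * of_real (S \<omega> + \<kappa> * g))"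
  have split: "exp (z * of_real (S \<omega> + \<kappa> * g)) = exp (z * of_real (S \<omega>)) * exp ((z * of_real \<kappa>) * of_real g)" for \<omega> g
    by (simp add: algebra_simps flip: exp_add)
  have i0: "integrable std_normal_distribution (\<lambda>g. exp ((z * of_real \<kappa>) * of_real g))" by (rule normal_laplace(1))
  have zS: "cmod (exp (z * of_real (S \<omega>))) \<le> exp (cmod z * b)" if "\<omega> \<in> space P" for \<omega>
  proof -
    have "cmod (z * of_real (S \<omega>)) \<le> cmod z * b"
      unfolding norm_mult norm_of_real by (intro mult_left_mono S_bd that) auto
    then show ?thesis unfolding norm_exp_eq_Re exp_le_cancel_iff by (rule order_trans[OF complex_Re_le_cmod])
  qed
  have i: "integrable (P \<Otimes>\<^sub>M std_normal_distribution) ?f"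
  proof (rule PN.Fubini_integrable)
    show "?f \<in> borel_measurable (P \<Otimes>\<^sub>M std_normal_distribution)" by measurable
    define I where "I = (\<integral>g. norm (exp ((z * of_real \<kappa>) * of_real g)) \<partial>std_normal_distribution)"
    have "(\<integral>g. norm (?f (\<omega>, g)) \<partial>std_normal_distribution) = norm (exp (z * of_real (S \<omega>))) * I" for \<omega>
      unfolding prod.case split norm_mult I_def by simp
    moreover have "integrable P (\<lambda>\<omega>. norm (exp (z * of_real (S \<omega>))) * I)"
      by (intro integrable_mult_left integrable_norm integrable_const_bound[where B="exp (cmod z * b)"] AE_I2 zS) auto
    ultimately show "integrable P (\<lambda>\<omega>. \<integral>g. norm (?f (\<omega>, g)) \<partial>std_normal_distribution)" by simp
    show "AE \<omega> in P. integrable std_normal_distribution (\<lambda>g. ?f (\<omega>, g))"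
      unfolding prod.case split by (intro AE_I2 integrable_mult_right i0)
  qed
  have m: "(\<lambda>(\<omega>, g). S \<omega> + \<kappa> * g) \<in> borel_measurable (P \<Otimes>\<^sub>M std_normal_distribution)" by measurable
  show "integrable smoothed (\<lambda>x. exp (z * of_real x))"
    unfolding smoothed_def using i by (subst integrable_distr_eq[OF m]) (auto simp: case_prod_unfold)
  have "(\<integral>x. exp (z * of_real x) \<partial>smoothed) = (\<integral>p. ?f p \<partial>(P \<Otimes>\<^sub>M std_normal_distribution))"
    unfolding smoothed_def by (subst integral_distr[OF m]) (auto simp: case_prod_unfold)
  also have "\<dots> = (\<integral>\<omega>. (\<integral>g. ?f (\<omega>, g) \<partial>std_normal_distribution) \<partial>P)" by (rule PN.integral_fst'[OF i, symmetric])
  also have "\<dots> = (\<integral>\<omega>. exp (z * of_real (S \<omega>)) \<partial>P) * exp ((z * of_real \<kappa>)\<^sup>2 / 2)"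
    unfolding prod.case split by (simp add: normal_laplace(2))
  finally show "(\<integral>x. exp (z * of_real x) \<partial>smoothed) = (\<integral>\<omega>. exp (z * of_real (S \<omega>)) \<partial>P) * exp (of_real (\<kappa>\<^sup>2) * z\<^sup>2 / 2)"
    by (simp add: power_mult_distrib mult.commute)
qed

text \<open>As an average of translated normal distribution functions, this one inherits their
  strict monotonicity and their Lipschitz constant.\<close>

lemma cdf_smoothed: "cdf smoothed y = (\<integral>\<omega>. cdf (gauss (\<kappa>\<^sup>2)) (y - S \<omega>) \<partial>P)"
proof -
  have m: "(\<lambda>(\<omega>, g). S \<omega> + \<kappa> * g) \<in> borel_measurable (P \<Otimes>\<^sub>M std_normal_distribution)" by measurable
  have m2: "(\<lambda>(\<omega>, g). indicator {..y} (S \<omega> + \<kappa> * g) :: real) \<in> borel_measurable (P \<Otimes>\<^sub>M std_normal_distribution)" by measurable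
  interpret sm: real_distribution smoothed by (rule real_distribution_smoothed)
  have "cdf smoothed y = (\<integral>x. indicator {..y} x \<partial>smoothed)" by (simp add: cdf_def)
  also have "\<dots> = (\<integral>p. (\<lambda>(\<omega>, g). indicator {..y} (S \<omega> + \<kappa> * g)) p \<partial>(P \<Otimes>\<^sub>M std_normal_distribution))"
    unfolding smoothed_def by (subst integral_distr[OF m]) (auto simp: case_prod_unfold)
  also have "\<dots> = (\<integral>\<omega>. (\<integral>g. indicator {..y} (S \<omega> + \<kappa> * g) \<partial>std_normal_distribution) \<partial>P)"
    by (subst PN.integral_fst'[symmetric])
      (auto intro!: PN.integrable_const_bound[where B=1] m2 simp: case_prod_unfold split: split_indicator)
  also have "\<dots> = (\<integral>\<omega>. cdf (gauss (\<kappa>\<^sup>2)) (y - S \<omega>) \<partial>P)"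
  proof (rule Bochner_Integration.integral_cong[OF refl])
    fix \<omega>
    have "cdf (gauss (\<kappa>\<^sup>2)) (y - S \<omega>) = (\<integral>x. indicator {..y - S \<omega>} x \<partial>gauss (\<kappa>\<^sup>2))"
      by (simp add: cdf_def gauss_def)
    also have "\<dots> = (\<integral>g. indicator {..y - S \<omega>} (sqrt (\<kappa>\<^sup>2) * g) \<partial>std_normal_distribution)"
      unfolding gauss_def by (subst integral_distr) auto
    also have "\<dots> = (\<integral>g. indicator {..y} (S \<omega> + \<kappa> * g) \<partial>std_normal_distribution)"
      using \<kappa> by (intro Bochner_Integration.integral_cong refl) (auto simp: indicator_def)
    finally show "(\<integral>g. indicator {..y} (S \<omega> + \<kappa> * g) \<partial>std_normal_distribution) = cdf (gauss (\<kappa>\<^sup>2)) (y - S \<omega>)" by simp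
  qed
  finally show ?thesis .
qed

lemma integrable_cdf_gauss: "integrable P (\<lambda>\<omega>. cdf (gauss (\<kappa>\<^sup>2)) (y - S \<omega>))"
proof -
  interpret G: real_distribution "gauss (\<kappa>\<^sup>2)" by (rule real_distribution_gauss)
  have [measurable]: "cdf (gauss (\<kappa>\<^sup>2)) \<in> borel_measurable borel"
    by (rule borel_measurable_mono) (auto simp: mono_def intro: G.cdf_nondecreasing)
  show ?thesis
    by (rule integrable_const_bound[where B=1]) (use G.cdf_nonneg G.cdf_bounded_prob in auto)
qed

lemma strict_mono_cdf_smoothed: "strict_mono (cdf smoothed)"
proof (rule strict_monoI)
  fix x y :: real assume xy: "x < y"
  show "cdf smoothed x < cdf smoothed y" unfolding cdf_smoothed
  proof (rule integral_less_AE_space)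
    have "cdf (gauss (\<kappa>\<^sup>2)) (x - S \<omega>) < cdf (gauss (\<kappa>\<^sup>2)) (y - S \<omega>)" for \<omega>
      using \<kappa> xy by (simp add: cdf_gauss normal_tail_less_iff divide_strict_right_mono)
    then show "AE \<omega> in P. cdf (gauss (\<kappa>\<^sup>2)) (x - S \<omega>) < cdf (gauss (\<kappa>\<^sup>2)) (y - S \<omega>)" by simp
  qed (use emeasure_space_1 integrable_cdf_gauss in auto)
qed

lemma isCont_cdf_smoothed: "isCont (cdf smoothed) x"
proof -
  interpret sm: real_distribution smoothed by (rule real_distribution_smoothed)
  have lip: "cdf smoothed y - cdf smoothed x \<le> 1 / \<kappa> * (y - x)" if "x \<le> y" for x y
  proof -
    have "cdf smoothed y - cdf smoothed x = (\<integral>\<omega>. cdf (gauss (\<kappa>\<^sup>2)) (y - S \<omega>) - cdf (gauss (\<kappa>\<^sup>2)) (x - S \<omega>) \<partial>P)"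
      unfolding cdf_smoothed by (simp add: integrable_cdf_gauss)
    also have "\<dots> \<le> (\<integral>\<omega>. 1 / \<kappa> * (y - x) \<partial>P)"
    proof (rule integral_mono)
      show "cdf (gauss (\<kappa>\<^sup>2)) (y - S \<omega>) - cdf (gauss (\<kappa>\<^sup>2)) (x - S \<omega>) \<le> 1 / \<kappa> * (y - x)" for \<omega>
        using cdf_gauss_lipschitz[of "\<kappa>\<^sup>2" "x - S \<omega>" "y - S \<omega>"] \<kappa> that by simp
    qed (auto intro: integrable_cdf_gauss)
    finally show ?thesis by (simp add: prob_space)
  qed
  have bd: "dist (cdf smoothed y) (cdf smoothed x) \<le> 1 / \<kappa> * dist y x" for y
  proof (cases "x \<le> y")
    case True
    then show ?thesis using lip[OF True] sm.cdf_nondecreasing[OF True] by (simp add: dist_real_def)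
  next
    case False
    then have "y \<le> x" by simp
    then show ?thesis using lip[of y x] sm.cdf_nondecreasing[of y x] by (simp add: dist_real_def abs_minus_commute)
  qed
  show ?thesis unfolding isCont_def
  proof (rule tendsto_dist_iff[THEN iffD2], rule tendsto_sandwich[where f="\<lambda>_. 0" and h="\<lambda>y. 1 / \<kappa> * dist y x"])
    have "((\<lambda>y. 1 / \<kappa> * dist y x) \<longlongrightarrow> 1 / \<kappa> * dist x x) (at x)" by (intro tendsto_intros)
    then show "((\<lambda>y. 1 / \<kappa> * dist y x) \<longlongrightarrow> 0) (at x)" by simp
  qed (use bd in auto)
qed

text \<open>Convolution with a normal law adds a quadratic term to the logarithm. The size parameter
  and the variance grow by the same \<open>\<kappa>\<^sup>2\<close>, so \<open>r\<close>,
  \<open>C\<close> and \<open>c\<close> can stay fixed while \<open>n + \<kappa>\<^sup>2\<close> is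
  made as large as desired. The conditions \<open>r \<le> 1 \<le> C\<close> make the added term fit
  the bound.\<close>

lemma log_laplace_smoothed:
  assumes r: "0 < r" "r \<le> 1" and C: "1 \<le> C" and c: "0 < c" "c * (n + \<kappa>\<^sup>2) \<le> v + \<kappa>\<^sup>2" and n: "n \<ge> 1"
    and hol: "L holomorphic_on ball 0 r"
    and exp: "\<And>z. norm z < r \<Longrightarrow> exp (L z) = (\<integral>\<omega>. exp (z * of_real (S \<omega>)) \<partial>P)"
    and bound: "\<And>z. norm z < r \<Longrightarrow> norm (L z) \<le> C * n"
    and L0: "L 0 = 0" "deriv L 0 = 0" "(deriv ^^ 2) L 0 = of_real v"
    and real: "\<And>u. \<bar>u\<bar> < r \<Longrightarrow> L (of_real u) \<in> \<real>"
  shows "log_laplace smoothed r C c (n + \<kappa>\<^sup>2) (v + \<kappa>\<^sup>2) (\<lambda>z. L z + of_real (\<kappa>\<^sup>2) * z\<^sup>2 / 2)"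
proof -
  let ?q = "\<lambda>z::complex. of_real (\<kappa>\<^sup>2) * z\<^sup>2 / 2"
  have "deriv (\<lambda>z::complex. k * z\<^sup>2 / 2) = (\<lambda>z. k * z)" for k
    by (intro ext DERIV_imp_deriv) (auto intro!: derivative_eq_intros)
  note qd = this[of "of_real (\<kappa>\<^sup>2)"]
  have "deriv (\<lambda>z::complex. k * z) = (\<lambda>z. k)" for k
    by (intro ext DERIV_imp_deriv) (auto intro!: derivative_eq_intros)
  note q2 = this[of "of_real (\<kappa>\<^sup>2)"]
  have d1: "(deriv ^^ 1) ?q 0 = 0" unfolding One_nat_def funpow.simps comp_def id_apply qd by (rule mult_zero_right)
  have "(deriv ^^ 2) h = deriv (deriv h)" for h :: "complex \<Rightarrow> complex" by (simp add: numeral_2_eq_2)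
  note f2 = this[of ?q]
  have d2: "(deriv ^^ 2) ?q 0 = of_real (\<kappa>\<^sup>2)" unfolding f2 qd q2 by (rule refl)
  have hd: "(deriv ^^ k) (\<lambda>z. L z + ?q z) 0 = (deriv ^^ k) L 0 + (deriv ^^ k) ?q 0" for k
    by (rule higher_deriv_add[OF hol _ open_ball]) (use r in \<open>auto intro!: holomorphic_intros\<close>)
  show ?thesis
    unfolding log_laplace_def log_laplace_axioms_def
  proof (intro conjI allI impI real_distribution_smoothed)
    show "0 < r" "0 < C" "0 < c" "1 \<le> n + \<kappa>\<^sup>2" "c * (n + \<kappa>\<^sup>2) \<le> v + \<kappa>\<^sup>2" using r C c n by (auto simp: add_increasing2)
    show "(\<lambda>z. L z + ?q z) holomorphic_on ball 0 r" by (intro holomorphic_intros hol) auto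
    show "cmod (L z + ?q z) \<le> C * (n + \<kappa>\<^sup>2)" if z: "cmod z < r" for z
    proof -
      have "cmod (?q z) = \<kappa>\<^sup>2 * (cmod z)\<^sup>2 / 2" by (simp add: norm_mult norm_divide norm_power)
      also have "\<dots> \<le> \<kappa>\<^sup>2 * 1"
      proof -
        have "(cmod z)\<^sup>2 \<le> 1" using z r by (simp add: power_le_one)
        then have "\<kappa>\<^sup>2 * (cmod z)\<^sup>2 \<le> \<kappa>\<^sup>2 * 1" by (intro mult_left_mono) auto
        then show ?thesis using zero_le_power2[of \<kappa>] by linarith
      qed
      also have "\<dots> \<le> C * \<kappa>\<^sup>2" using C by (simp add: mult_le_cancel_right1)
      finally show ?thesis using bound[OF z] norm_triangle_ineq[of "L z" "?q z"] by (simp add: distrib_left)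
    qed
    show "L 0 + ?q 0 = 0" by (simp add: L0)
    show "deriv (\<lambda>z. L z + ?q z) 0 = 0" using hd[of 1] unfolding d1 by (simp add: L0)
    show "(deriv ^^ 2) (\<lambda>z. L z + ?q z) 0 = complex_of_real (v + \<kappa>\<^sup>2)"
      unfolding hd[of 2] d2 L0(3) by simp
    show "L (of_real u) + ?q (of_real u) \<in> \<real>" if "\<bar>u\<bar> < r" for u
      by (intro Reals_add real that) (simp flip: of_real_power of_real_mult)
    show "integrable smoothed (\<lambda>x. exp (u * x))" for u
    proof -
      have "integrable smoothed (\<lambda>x. complex_of_real (exp (u * x)))"
        using smoothed_laplace(1)[of "of_real u"] by (simp add: exp_of_real flip: of_real_mult)
      then show ?thesis by (simp only: complex_of_real_integrable_eq)
    qed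
    show "(\<integral>x. exp (z * of_real x) \<partial>smoothed) = exp (L z + ?q z)" if "cmod z < r" for z
      by (simp add: smoothed_laplace(2) exp[OF that] exp_add)
  qed
qed

end

section \<open>Exponential moments and the coupling of a single sum\<close>

context log_laplace
begin

text \<open>At \<open>u = 1/sqrt N\<close> and \<open>u = - 1/sqrt N\<close> the quadratic term of
  the logarithm is at most \<open>W / 2\<close> and the cubic remainder at most
  \<open>C3 / 2\<close>, whatever \<open>N\<close> is. The lower bound on \<open>N\<close> places
  these points within half of the radius.\<close>

lemma exp_abs_moment:
  assumes "4 / r\<^sup>2 < N"
  shows "(\<integral>\<^sup>+x. ennreal (exp \<bar>x / sqrt N\<bar>) \<partial>\<mu>) \<le> ennreal (2 * exp ((W + C3) / 2))"
proof -
  have "(2 / r)\<^sup>2 < (sqrt N)\<^sup>2" using assms N by (simp add: power_divide)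
  then have "2 / r < sqrt N" using N by (intro power2_less_imp_less[of "2 / r"]) auto
  then have u: "1 / sqrt N < r / 2" using r N by (simp add: field_simps)
  have k: "k0 u \<le> (W + C3) / 2" "\<bar>u\<bar> < r" if "u\<^sup>2 = 1 / N" for u
  proof -
    have au: "\<bar>u\<bar> = 1 / sqrt N" using that by (metis real_sqrt_abs real_sqrt_divide real_sqrt_one)
    then show ur: "\<bar>u\<bar> < r" using u r by linarith
    have n: "norm (complex_of_real u) < r / 2" "norm (0::complex) < r / 2" using u r by (simp_all add: au)
    note t = taylor(1)[OF n, unfolded zero deriv_zero deriv2_zero of_real_k[OF ur]]
    have "complex_of_real (k0 u) - (0 + 0 * (of_real u - 0) + of_real v * (of_real u - 0)\<^sup>2 / 2) = of_real (k0 u - v * u\<^sup>2 / 2)"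
      by simp
    with t have "\<bar>k0 u - v * u\<^sup>2 / 2\<bar> \<le> C3 * N * \<bar>u\<bar> ^ 3 / 2" by (simp only: norm_of_real diff_zero)
    then have "2 * k0 u - v * u\<^sup>2 \<le> C3 * N * \<bar>u\<bar> ^ 3" by (simp add: abs_le_iff field_simps)
    moreover have "v * u\<^sup>2 \<le> W" using v_le_W N by (simp add: that field_simps)
    moreover have "C3 * N * \<bar>u\<bar> ^ 3 \<le> C3"
    proof -
      have "N * \<bar>u\<bar> ^ 3 = \<bar>u\<bar> * (N * u\<^sup>2)" by (simp add: power3_eq_cube power2_eq_square)
      also have "\<dots> = \<bar>u\<bar>" using N by (simp add: that)
      also have "\<dots> \<le> 1" using N by (simp add: au)
      finally show ?thesis using mult_left_mono[of "N * \<bar>u\<bar> ^ 3" 1 C3] C3_pos by (simp add: mult.assoc)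
    qed
    ultimately show "k0 u \<le> (W + C3) / 2" by simp
  qed
  have m: "(\<integral>\<^sup>+x. ennreal (exp (u * x)) \<partial>\<mu>) \<le> ennreal (exp ((W + C3) / 2))" if u2: "u\<^sup>2 = 1 / N" for u
  proof -
    have "(\<integral>\<^sup>+x. ennreal (exp (u * x)) \<partial>\<mu>) = ennreal (\<integral>x. exp (u * x) \<partial>\<mu>)"
      by (intro nn_integral_eq_integral integrable_exp k u2) simp
    then show ?thesis using k[OF u2] by (simp add: laplace_real)
  qed
  have "(\<integral>\<^sup>+x. ennreal (exp \<bar>x / sqrt N\<bar>) \<partial>\<mu>)
    \<le> (\<integral>\<^sup>+x. ennreal (exp (1 / sqrt N * x)) + ennreal (exp ((- 1 / sqrt N) * x)) \<partial>\<mu>)"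
    by (intro nn_integral_mono) (auto simp: abs_if simp flip: ennreal_plus)
  also have "\<dots> = (\<integral>\<^sup>+x. ennreal (exp (1 / sqrt N * x)) \<partial>\<mu>) + (\<integral>\<^sup>+x. ennreal (exp ((- 1 / sqrt N) * x)) \<partial>\<mu>)"
    by (intro nn_integral_add) auto
  also have "\<dots> \<le> ennreal (exp ((W + C3) / 2)) + ennreal (exp ((W + C3) / 2))"
    using N by (intro add_mono m) (auto simp: power_divide)
  finally show ?thesis by (simp flip: ennreal_plus)
qed

end

lemma std_normal_exp_abs: "(\<integral>\<^sup>+x. ennreal (exp \<bar>x\<bar>) \<partial>std_normal_distribution) \<le> ennreal (2 * exp (1 / 2))"
proof -
  have m: "(\<integral>\<^sup>+x. ennreal (exp (u * x)) \<partial>std_normal_distribution) = ennreal (exp (1 / 2))" if u: "u\<^sup>2 = 1" for u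
  proof -
    have e: "exp (complex_of_real u * of_real x) = complex_of_real (exp (u * x))" for x
      by (simp add: exp_of_real flip: of_real_mult)
    have "complex_of_real (\<integral>x. exp (u * x) \<partial>std_normal_distribution) = exp ((of_real u)\<^sup>2 / 2)"
      using normal_laplace(2)[of "of_real u"] unfolding e by (simp only: integral_complex_of_real)
    also have "(of_real u)\<^sup>2 / 2 = complex_of_real (1 / 2)" by (simp add: u flip: of_real_power)
    also have "exp (complex_of_real (1 / 2)) = complex_of_real (exp (1 / 2))" by (rule exp_of_real)
    finally have "(\<integral>x. exp (u * x) \<partial>std_normal_distribution) = exp (1 / 2)" by (simp only: of_real_eq_iff)
    moreover have "integrable std_normal_distribution (\<lambda>x. exp (u * x))"
      using normal_laplace(1)[of "of_real u"] unfolding e by (simp only: complex_of_real_integrable_eq)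
    ultimately show ?thesis by (simp add: nn_integral_eq_integral)
  qed
  have "(\<integral>\<^sup>+x. ennreal (exp \<bar>x\<bar>) \<partial>std_normal_distribution)
    \<le> (\<integral>\<^sup>+x. ennreal (exp (1 * x)) + ennreal (exp ((- 1) * x)) \<partial>std_normal_distribution)"
    by (intro nn_integral_mono) (auto simp: abs_if simp flip: ennreal_plus)
  also have "\<dots> = (\<integral>\<^sup>+x. ennreal (exp (1 * x)) \<partial>std_normal_distribution) + (\<integral>\<^sup>+x. ennreal (exp ((- 1) * x)) \<partial>std_normal_distribution)"
    by (intro nn_integral_add) auto
  also have "\<dots> = ennreal (exp (1 / 2)) + ennreal (exp (1 / 2))"
    by (intro arg_cong2[where f=plus] m) simp_all
  also have "\<dots> = ennreal (2 * exp (1 / 2))" by (simp flip: ennreal_plus)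
  finally show ?thesis by simp
qed

text \<open>The rate \<open>1/3\<close> is what can be afforded when \<open>w\<close> is a constant
  plus three variables of which only separate exponential moments are known. The bound comes from
  the tangent inequality for \<open>ln\<close> at \<open>3 * q + 3\<close>.\<close>

lemma powr_le_exp:
  fixes q :: real assumes "q \<ge> 0"
  obtains K where "K > 0" "\<And>w. w \<ge> 1 \<Longrightarrow> w powr q \<le> K * exp (w / 3)"
proof -
  have "w powr q \<le> exp (3 * q * ln (3 * q + 3)) * exp (w / 3)" if "w \<ge> 1" for w
  proof -
    have "ln (w / (3 * q + 3)) \<le> w / (3 * q + 3) - 1" using that assms by (intro ln_le_minus_one) auto
    then have "ln w \<le> w / (3 * q + 3) + ln (3 * q + 3)" using that assms by (simp add: ln_div)
    then have "q * ln w \<le> q * (w / (3 * q + 3) + ln (3 * q + 3))" using assms by (intro mult_left_mono)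
    also have "\<dots> = w / 3 * (q / (q + 1)) + q * ln (3 * q + 3)" using assms by (simp add: field_simps)
    also have "\<dots> \<le> w / 3 * 1 + (3 * q) * ln (3 * q + 3)"
      using assms that by (intro add_mono mult_left_mono mult_right_mono) auto
    finally show ?thesis using that by (simp add: powr_def flip: exp_add)
  qed
  then show ?thesis by (rule that[OF exp_gt_zero])
qed

text \<open>Adding \<open>\<kappa> * g\<close> with an independent standard normal \<open>g\<close> makes the law of \<open>S n\<close> diffuse, and a large
  \<open>\<kappa>\<close> brings every \<open>n \<ge> 1\<close> into the range where the quantile comparison applies.\<close>

lemma normal_coupling:
  fixes P :: "'w measure" and S :: "nat \<Rightarrow> 'w \<Rightarrow> real" and L :: "nat \<Rightarrow> complex \<Rightarrow> complex"
  assumes P: "prob_space P" and r: "0 < r" and S[measurable]: "\<And>n. S n \<in> borel_measurable P"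
    and S_bd: "\<And>n \<omega>. \<omega> \<in> space P \<Longrightarrow> \<bar>S n \<omega>\<bar> \<le> C * real n"
    and hol: "\<And>n. L n holomorphic_on ball 0 r"
    and expL: "\<And>n z. norm z < r \<Longrightarrow> exp (L n z) = (LINT \<omega>|P. exp (z * of_real (S n \<omega>)))"
    and bound: "\<And>n z. norm z < r \<Longrightarrow> norm (L n z) \<le> C * real n"
    and L0: "\<And>n. L n 0 = 0" "\<And>n. deriv (L n) 0 = 0"
      "\<And>n. (deriv ^^ 2) (L n) 0 = of_real (V n)"
    and real: "\<And>n u. \<bar>u\<bar> < r \<Longrightarrow> L n (of_real u) \<in> \<real>"
    and V: "\<And>n. \<bar>V n - real n * d\<bar> \<le> C" "\<And>n. V n \<ge> 0" and d: "d > 0"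
  obtains Y where "\<And>n. n \<ge> 1 \<Longrightarrow> Y n \<in> borel_measurable (P \<Otimes>\<^sub>M std_normal_distribution)"
    and "\<And>n. n \<ge> 1 \<Longrightarrow> distr (P \<Otimes>\<^sub>M std_normal_distribution) borel (Y n) = std_normal_distribution"
    and "\<And>p a A B. p \<ge> 1 \<Longrightarrow> (\<And>n. \<bar>A n\<bar> \<le> a) \<Longrightarrow> (\<And>n. \<bar>B n - sqrt (V n)\<bar> \<le> a) \<Longrightarrow>
      \<exists>K>0. \<forall>n\<ge>1. (\<integral>\<^sup>+x. ennreal (\<bar>S n (fst x) - A n - B n * Y n x\<bar> powr p) \<partial>(P \<Otimes>\<^sub>M std_normal_distribution)) \<le> ennreal K"
proof -
  interpret prob_space P by (rule P)
  interpret PN: pair_prob_space P std_normal_distribution ..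
  let ?PN = "P \<Otimes>\<^sub>M std_normal_distribution"
  \<comment> \<open>\<open>log_laplace_smoothed\<close> asks for \<open>r' \<le> 1 \<le> C'\<close>.
    The bound \<open>1/2\<close> in \<open>c\<close> lets \<open>c * \<kappa>\<^sup>2\<close> and
    the variance error \<open>C\<close> each take half of \<open>\<kappa>\<^sup>2\<close>.\<close>
  define r' where "r' = min r 1"
  define C' where "C' = max 1 C"
  define c where "c = min d (1/2)"
  have c: "c > 0" "c \<le> d" "c \<le> 1/2" using d by (auto simp: c_def)
  have r': "0 < r'" "r' \<le> 1" "r' \<le> r" using r by (auto simp: r'_def)
  have C': "1 \<le> C'" "C \<le> C'" by (auto simp: C'_def)
  obtain B0 N0 where B0: "B0 > 0" and N0: "N0 \<ge> 1"
    and disp: "\<And>\<mu> N v L x t. log_laplace \<mu> r' C' c N v L \<Longrightarrow> N \<ge> N0 \<Longrightarrow> isCont (cdf \<mu>) x \<Longrightarrow>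
      normal_tail t = measure \<mu> {x<..} \<Longrightarrow>
      \<bar>x - sqrt v * t\<bar> \<le> B0 * (1 + x\<^sup>2 / N + (sqrt v * t)\<^sup>2 / N)"
    by (rule quantile_displacement[of r' C' c]) (rule that, assumption+)
  \<comment> \<open>\<open>2 * C'\<close> absorbs the variance error, \<open>N0\<close> reaches the
    range of the quantile comparison, and \<open>4 / r'\<^sup>2\<close> that of
    \<open>exp_abs_moment\<close>, for every \<open>n\<close>.\<close>
  define \<kappa> where "\<kappa> = sqrt (2 * C' + N0 + 4 / r'\<^sup>2)"
  have \<kappa>2: "\<kappa>\<^sup>2 = 2 * C' + N0 + 4 / r'\<^sup>2" unfolding \<kappa>_def using C' N0 by (intro real_sqrt_pow2 add_nonneg_nonneg) auto
  have \<kappa>: "\<kappa> > 0" unfolding \<kappa>_def using C' N0 r' by (intro real_sqrt_gt_zero add_pos_nonneg) auto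
  define N where "N n = real n + \<kappa>\<^sup>2" for n
  define v where "v n = V n + \<kappa>\<^sup>2" for n
  define \<mu> where "\<mu> n = smoothed P (S n) \<kappa>" for n
  have r4: "4 / r'\<^sup>2 > 0" using r' by simp
  have N: "N n \<ge> N0" "N n > 4 / r'\<^sup>2" for n using \<kappa>2 C' N0 r4 by (simp_all add: N_def)
  have LL: "log_laplace (\<mu> n) r' C' c (N n) (v n) (\<lambda>z. L n z + of_real (\<kappa>\<^sup>2) * z\<^sup>2 / 2)" if n: "n \<ge> 1" for n
    unfolding \<mu>_def N_def v_def
  proof (rule log_laplace_smoothed[OF P S S_bd \<kappa>])
    have "c * real n \<le> d * real n" "c * \<kappa>\<^sup>2 \<le> 1/2 * \<kappa>\<^sup>2" using c by (auto intro!: mult_right_mono simp del: times_divide_eq_left)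
    moreover have "C \<le> 1/2 * \<kappa>\<^sup>2" using \<kappa>2 C' N0 r4 by linarith
    ultimately show "c * (real n + \<kappa>\<^sup>2) \<le> V n + \<kappa>\<^sup>2" using V(1)[of n] unfolding distrib_left abs_le_iff by (simp add: mult.commute)
    show "L n holomorphic_on ball 0 r'" using hol r' by (meson holomorphic_on_subset subset_ball)
    show "cmod (L n z) \<le> C' * real n" if "cmod z < r'" for z
      using bound[of z n] that r' C' mult_right_mono[of C C' "real n"] by simp
  qed (use r' C' c n L0 expL real in auto)
  have ex: "\<exists>T. T \<in> borel_measurable borel \<and> distr (\<mu> n) borel T = std_normal_distribution \<and>
      (\<forall>x. normal_tail (T x) = measure (\<mu> n) {x<..})" for n
  proof (rule quantile_transform[of "\<mu> n"])
    show "real_distribution (\<mu> n)" unfolding \<mu>_def by (rule real_distribution_smoothed[OF P S S_bd \<kappa>])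
    show "isCont (cdf (\<mu> n)) x" for x unfolding \<mu>_def by (rule isCont_cdf_smoothed[OF P S S_bd \<kappa>])
    show "strict_mono (cdf (\<mu> n))" unfolding \<mu>_def by (rule strict_mono_cdf_smoothed[OF P S S_bd \<kappa>])
  qed auto
  define T where "T n = (SOME T. T \<in> borel_measurable borel \<and> distr (\<mu> n) borel T = std_normal_distribution \<and>
      (\<forall>x. normal_tail (T x) = measure (\<mu> n) {x<..}))" for n
  have T[measurable]: "T n \<in> borel_measurable borel" and T_distr: "distr (\<mu> n) borel (T n) = std_normal_distribution"
    and T_tail: "normal_tail (T n x) = measure (\<mu> n) {x<..}" for n x
    using someI_ex[OF ex[of n]] unfolding T_def by auto
  define X where "X n = (\<lambda>(\<omega>, g). S n \<omega> + \<kappa> * g)" for n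
  have X[measurable]: "X n \<in> borel_measurable ?PN" for n unfolding X_def by measurable
  have X_distr: "distr ?PN borel (X n) = \<mu> n" for n
    unfolding \<mu>_def X_def using smoothed_def[OF P S S_bd \<kappa>] by simp
  define Y where "Y n = (\<lambda>x. T n (X n x))" for n
  have Y[measurable]: "Y n \<in> borel_measurable ?PN" for n unfolding Y_def by measurable
  have Y_distr: "distr ?PN borel (Y n) = std_normal_distribution" for n
    unfolding Y_def using distr_distr[OF T X] T_distr[of n] unfolding X_distr by (simp add: comp_def)
  define W where "W = log_laplace.W r' C' c"
  define C3 where "C3 = log_laplace.C3 r' C'"
  have W: "v n \<le> W * N n" if "n \<ge> 1" for n unfolding W_def by (rule log_laplace.v_le_W[OF LL[OF that]])
  have W0: "W > 0" unfolding W_def by (rule log_laplace.W_pos[OF LL[of 1]]) simp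
  have mX: "(\<integral>\<^sup>+x. ennreal (exp \<bar>X n x / sqrt (N n)\<bar>) \<partial>?PN) \<le> ennreal (2 * exp ((W + C3) / 2))" if "n \<ge> 1" for n
  proof -
    have "(\<integral>\<^sup>+x. ennreal (exp \<bar>X n x / sqrt (N n)\<bar>) \<partial>?PN) = (\<integral>\<^sup>+x. ennreal (exp \<bar>x / sqrt (N n)\<bar>) \<partial>\<mu> n)"
      unfolding X_distr[symmetric] by (subst nn_integral_distr) auto
    also have "\<dots> \<le> ennreal (2 * exp ((W + C3) / 2))"
      unfolding W_def C3_def by (rule log_laplace.exp_abs_moment[OF LL[OF that] N(2)])
    finally show ?thesis .
  qed
  have mY: "(\<integral>\<^sup>+x. ennreal (exp \<bar>Y n x\<bar>) \<partial>?PN) \<le> ennreal (2 * exp (1 / 2))" for n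
  proof -
    have "(\<integral>\<^sup>+x. ennreal (exp \<bar>Y n x\<bar>) \<partial>?PN) = (\<integral>\<^sup>+x. ennreal (exp \<bar>x\<bar>) \<partial>distr ?PN borel (Y n))"
      by (subst nn_integral_distr) auto
    then show ?thesis using std_normal_exp_abs by (simp add: Y_distr)
  qed
  have mg: "(\<integral>\<^sup>+x. ennreal (exp \<bar>snd x\<bar>) \<partial>?PN) \<le> ennreal (2 * exp (1 / 2))"
  proof -
    have "(\<integral>\<^sup>+x. ennreal (exp \<bar>snd x\<bar>) \<partial>?PN) = (\<integral>\<^sup>+\<omega>. \<integral>\<^sup>+g. ennreal (exp \<bar>g\<bar>) \<partial>std_normal_distribution \<partial>P)"
      by (subst std_normal.nn_integral_fst[symmetric]) auto
    also have "\<dots> = (\<integral>\<^sup>+g. ennreal (exp \<bar>g\<bar>) \<partial>std_normal_distribution)" by (simp add: emeasure_space_1)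
    finally show ?thesis using std_normal_exp_abs by simp
  qed
  show ?thesis
  proof (rule that[of Y])
    show "Y n \<in> borel_measurable ?PN" for n by (rule Y)
    show "distr ?PN borel (Y n) = std_normal_distribution" for n by (rule Y_distr)
    fix p a :: real and A B :: "nat \<Rightarrow> real"
    assume p: "p \<ge> 1" and A: "\<And>n. \<bar>A n\<bar> \<le> a" and B: "\<And>n. \<bar>B n - sqrt (V n)\<bar> \<le> a"
    have a: "a \<ge> 0" using A[of 0] by linarith
    \<comment> \<open>In this order: the quantile displacement, the smoothing variable,
      \<open>A n\<close>, and the passage from \<open>sqrt (v n)\<close> to
      \<open>B n\<close>.\<close>
    define K1 where "K1 = B0 * (1 + W) + \<kappa> + a + (\<kappa> + a)"
    have K1: "K1 > 0" unfolding K1_def using B0 W0 \<kappa> a by (intro add_pos_nonneg) auto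
    obtain K2 where K2: "K2 > 0" "\<And>w. w \<ge> 1 \<Longrightarrow> w powr (2 * p) \<le> K2 * exp (w / 3)"
      using powr_le_exp[of "2 * p"] p by (metis mult_nonneg_nonneg order_trans zero_le_numeral zero_le_one)
    define K3 where "K3 = K1 powr p * (K2 * exp (1 / 3))"
    have K3: "K3 > 0" using K1 K2 by (simp add: K3_def)
    \<comment> \<open>A common majorant: being at least 1, it has a square that dominates every term
      of the error, and its three random parts have bounded exponential moments.\<close>
    define w where "w n x = 1 + \<bar>X n x / sqrt (N n)\<bar> + \<bar>Y n x\<bar> + \<bar>snd x\<bar>" for n x
    have diff: "\<bar>S n (fst x) - A n - B n * Y n x\<bar> \<le> K1 * (w n x)\<^sup>2" if n: "n \<ge> 1" for n x
    proof -
      have N1: "N n \<ge> 1" using N(1)[of n] N0 by simp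
      have Nn: "N n > 0" using N1 by simp
      have v0: "v n \<ge> 0" using V(2)[of n] by (simp add: v_def)
      have 1: "\<bar>X n x - sqrt (v n) * Y n x\<bar> \<le> B0 * (1 + (X n x)\<^sup>2 / N n + (sqrt (v n) * Y n x)\<^sup>2 / N n)"
      proof (rule disp[OF LL[OF n] N(1)])
        show "isCont (cdf (\<mu> n)) (X n x)" unfolding \<mu>_def by (rule isCont_cdf_smoothed[OF P S S_bd \<kappa>])
        show "normal_tail (Y n x) = measure (\<mu> n) {X n x<..}" by (simp add: Y_def T_tail)
      qed
      have 2: "(X n x)\<^sup>2 / N n = \<bar>X n x / sqrt (N n)\<bar>\<^sup>2" using Nn by (simp add: power_divide)
      have "(sqrt (v n) * Y n x)\<^sup>2 / N n = (v n / N n) * \<bar>Y n x\<bar>\<^sup>2" using v0 by (simp add: power_mult_distrib)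
      also have "\<dots> \<le> W * \<bar>Y n x\<bar>\<^sup>2"
        using W[OF n] Nn by (intro mult_right_mono) (simp_all add: divide_le_eq)
      finally have 3: "(sqrt (v n) * Y n x)\<^sup>2 / N n \<le> W * \<bar>Y n x\<bar>\<^sup>2" .
      have wx: "\<bar>X n x / sqrt (N n)\<bar> \<le> w n x" "\<bar>Y n x\<bar> \<le> w n x" "\<bar>snd x\<bar> \<le> w n x" and w1: "w n x \<ge> 1" by (auto simp: w_def)
      have sq: "w n x \<le> (w n x)\<^sup>2" "1 \<le> (w n x)\<^sup>2" using w1 self_le_power[of "w n x" 2] one_le_power[of "w n x" 2] by auto
      have "1 + \<bar>X n x / sqrt (N n)\<bar>\<^sup>2 \<le> (1 + \<bar>X n x / sqrt (N n)\<bar>)\<^sup>2" unfolding power2_sum by simp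
      also have "\<dots> \<le> (w n x)\<^sup>2" by (intro power_mono) (auto simp: w_def)
      finally have 4: "1 + \<bar>X n x / sqrt (N n)\<bar>\<^sup>2 \<le> (w n x)\<^sup>2" .
      have 5: "W * \<bar>Y n x\<bar>\<^sup>2 \<le> W * (w n x)\<^sup>2" using W0 wx by (intro mult_left_mono power_mono) auto
      have "1 + (X n x)\<^sup>2 / N n + (sqrt (v n) * Y n x)\<^sup>2 / N n \<le> (1 + W) * (w n x)\<^sup>2"
        unfolding distrib_right using 2 3 4 5 by linarith
      then have "B0 * (1 + (X n x)\<^sup>2 / N n + (sqrt (v n) * Y n x)\<^sup>2 / N n) \<le> B0 * ((1 + W) * (w n x)\<^sup>2)"
        using B0 by (intro mult_left_mono) auto
      with 1 have 6: "\<bar>X n x - sqrt (v n) * Y n x\<bar> \<le> B0 * (1 + W) * (w n x)\<^sup>2" by (simp add: mult.assoc)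
      have "\<bar>\<kappa> * snd x\<bar> = \<kappa> * \<bar>snd x\<bar>" using \<kappa> by (simp add: abs_mult)
      also have "\<dots> \<le> \<kappa> * (w n x)\<^sup>2" using \<kappa> wx sq by (intro mult_left_mono) auto
      finally have 7: "\<bar>\<kappa> * snd x\<bar> \<le> \<kappa> * (w n x)\<^sup>2" .
      have 8: "\<bar>A n\<bar> \<le> a * (w n x)\<^sup>2" using mult_left_mono[OF sq(2) a] A[of n] by simp
      \<comment> \<open>Adding \<open>\<kappa>\<^sup>2\<close> to the variance moves the standard
        deviation by at most \<open>\<kappa>\<close>, so the smoothed scale is as good as
        \<open>B n\<close> up to a bounded factor of \<open>Y n\<close>.\<close>
      have "sqrt (v n) \<le> sqrt (V n) + \<kappa>"
      proof (rule real_le_lsqrt[THEN order_trans])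
        show "v n \<le> (sqrt (V n) + \<kappa>)\<^sup>2" using V(2)[of n] \<kappa> by (simp add: v_def power2_sum)
      qed (use v0 V(2)[of n] \<kappa> in auto)
      moreover have "sqrt (V n) \<le> sqrt (v n)" by (simp add: v_def)
      ultimately have "\<bar>sqrt (v n) - B n\<bar> \<le> \<kappa> + a" using B[of n] by linarith
      moreover have "\<bar>Y n x\<bar> \<le> (w n x)\<^sup>2" using wx sq by linarith
      ultimately have 9: "\<bar>(sqrt (v n) - B n) * Y n x\<bar> \<le> (\<kappa> + a) * (w n x)\<^sup>2"
        unfolding abs_mult by (intro mult_mono) (use \<kappa> a in auto)
      have "S n (fst x) - A n - B n * Y n x
        = (X n x - sqrt (v n) * Y n x) - \<kappa> * snd x - A n + (sqrt (v n) - B n) * Y n x"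
        by (simp add: X_def case_prod_unfold algebra_simps)
      then have "\<bar>S n (fst x) - A n - B n * Y n x\<bar> \<le> \<bar>X n x - sqrt (v n) * Y n x\<bar> + \<bar>\<kappa> * snd x\<bar> + \<bar>A n\<bar>
        + \<bar>(sqrt (v n) - B n) * Y n x\<bar>" by linarith
      also have "\<dots> \<le> B0 * (1 + W) * (w n x)\<^sup>2 + \<kappa> * (w n x)\<^sup>2 + a * (w n x)\<^sup>2 + (\<kappa> + a) * (w n x)\<^sup>2"
        by (intro add_mono 6 7 8 9)
      also have "\<dots> = K1 * (w n x)\<^sup>2" by (simp add: K1_def distrib_right)
      finally show ?thesis .
    qed
    have pow: "\<bar>S n (fst x) - A n - B n * Y n x\<bar> powr p
      \<le> K3 * (exp \<bar>X n x / sqrt (N n)\<bar> + exp \<bar>Y n x\<bar> + exp \<bar>snd x\<bar>)" if n: "n \<ge> 1" for n x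
    proof -
      have w1: "w n x \<ge> 1" by (auto simp: w_def)
      have "\<bar>S n (fst x) - A n - B n * Y n x\<bar> powr p \<le> (K1 * (w n x)\<^sup>2) powr p"
        using diff[OF n] p by (intro powr_mono2) auto
      also have "\<dots> = K1 powr p * w n x powr (2 * p)"
        using K1 w1 powr_powr[of "w n x" 2 p] by (simp add: powr_mult)
      also have "\<dots> \<le> K1 powr p * (K2 * exp (w n x / 3))" by (intro mult_left_mono K2 w1) auto
      also have "exp (w n x / 3) \<le> exp (1/3) * (exp \<bar>X n x / sqrt (N n)\<bar> + exp \<bar>Y n x\<bar> + exp \<bar>snd x\<bar>)"
      proof -
        \<comment> \<open>The mean of three numbers is at most their maximum. This separates the
          three variables, which are far from independent.\<close>
        have m: "exp ((s + t + u) / 3) \<le> exp s + exp t + exp u" for s t u :: real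
        proof -
          have "s \<le> max s (max t u)" "t \<le> max s (max t u)" "u \<le> max s (max t u)" by auto
          then have "(s + t + u) / 3 \<le> max s (max t u)" unfolding divide_le_eq by simp
          then have "exp ((s + t + u) / 3) \<le> exp (max s (max t u))" by simp
          also have "\<dots> \<le> exp s + exp t + exp u" by (simp add: max_def add_nonneg_nonneg)
          finally show ?thesis .
        qed
        have e: "w n x / 3 = 1/3 + (\<bar>X n x / sqrt (N n)\<bar> + \<bar>Y n x\<bar> + \<bar>snd x\<bar>) / 3"
          unfolding w_def by (simp only: add_divide_distrib add.assoc)
        show ?thesis unfolding e exp_add by (intro mult_left_mono m) simp
      qed
      finally show ?thesis using K1 K2 by (simp add: K3_def mult.assoc)
    qed
    define K where "K = K3 * (2 * exp ((W + C3) / 2) + 4 * exp (1 / 2))"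
    have "(\<integral>\<^sup>+x. ennreal (\<bar>S n (fst x) - A n - B n * Y n x\<bar> powr p) \<partial>?PN) \<le> ennreal K" if n: "n \<ge> 1" for n
    proof -
      have "(\<integral>\<^sup>+x. ennreal (\<bar>S n (fst x) - A n - B n * Y n x\<bar> powr p) \<partial>?PN)
        \<le> (\<integral>\<^sup>+x. ennreal K3 * (ennreal (exp \<bar>X n x / sqrt (N n)\<bar>) + ennreal (exp \<bar>Y n x\<bar>) + ennreal (exp \<bar>snd x\<bar>)) \<partial>?PN)"
      proof (intro nn_integral_mono)
        fix x
        have "ennreal (\<bar>S n (fst x) - A n - B n * Y n x\<bar> powr p)
          \<le> ennreal (K3 * (exp \<bar>X n x / sqrt (N n)\<bar> + exp \<bar>Y n x\<bar> + exp \<bar>snd x\<bar>))"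
          by (intro ennreal_leI pow n)
        also have "\<dots> = ennreal K3 * (ennreal (exp \<bar>X n x / sqrt (N n)\<bar>) + ennreal (exp \<bar>Y n x\<bar>) + ennreal (exp \<bar>snd x\<bar>))"
          using K3 by (simp add: ennreal_mult ennreal_plus)
        finally show "ennreal (\<bar>S n (fst x) - A n - B n * Y n x\<bar> powr p)
          \<le> ennreal K3 * (ennreal (exp \<bar>X n x / sqrt (N n)\<bar>) + ennreal (exp \<bar>Y n x\<bar>) + ennreal (exp \<bar>snd x\<bar>))" .
      qed
      also have "\<dots> = ennreal K3 * ((\<integral>\<^sup>+x. ennreal (exp \<bar>X n x / sqrt (N n)\<bar>) \<partial>?PN)
          + (\<integral>\<^sup>+x. ennreal (exp \<bar>Y n x\<bar>) \<partial>?PN) + (\<integral>\<^sup>+x. ennreal (exp \<bar>snd x\<bar>) \<partial>?PN))"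
        by (subst nn_integral_cmult, measurable, subst nn_integral_add, measurable, subst nn_integral_add, measurable)
      also have "\<dots> \<le> ennreal K3 * (ennreal (2 * exp ((W + C3) / 2)) + ennreal (2 * exp (1 / 2)) + ennreal (2 * exp (1 / 2)))"
        by (intro mult_left_mono add_mono mX[OF n] mY mg) simp
      also have "\<dots> = ennreal K3 * ennreal (2 * exp ((W + C3) / 2) + 2 * exp (1 / 2) + 2 * exp (1 / 2))"
        by (simp only: ennreal_plus add_nonneg_nonneg mult_nonneg_nonneg exp_ge_zero zero_le_numeral)
      also have "\<dots> = ennreal K" unfolding K_def using K3 by (subst ennreal_mult[symmetric]) auto
      finally show ?thesis .
    qed
    moreover have "K > 0" unfolding K_def using K3 by (simp add: add_pos_pos)
    ultimately show "\<exists>K>0. \<forall>n\<ge>1. (\<integral>\<^sup>+x. ennreal (\<bar>S n (fst x) - A n - B n * Y n x\<bar> powr p) \<partial>?PN) \<le> ennreal K"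
      by blast
  qed
qed

section \<open>Normal vectors with a given sum\<close>

lemma nn_integral_lborel_shift: "h \<in> borel_measurable borel \<Longrightarrow> (\<integral>\<^sup>+y. h (y + a) \<partial>lborel) = (\<integral>\<^sup>+y. h y \<partial>lborel)" for a :: real
  by (subst (2) nn_integral_real_affine[where c=1 and t=a]) (auto simp: add.commute)

text \<open>With one variable held fixed a shear is a translation in the other; Fubini reduces the
  claim to translation invariance.\<close>

lemma nn_integral_lborel_shear:
  fixes k :: "real \<times> real \<Rightarrow> ennreal"
  assumes [measurable]: "k \<in> borel_measurable (borel \<Otimes>\<^sub>M borel)"
  shows "(\<integral>\<^sup>+y. \<integral>\<^sup>+u. k (y + t * u, u) \<partial>lborel \<partial>lborel) = (\<integral>\<^sup>+y. \<integral>\<^sup>+u. k (y, u) \<partial>lborel \<partial>lborel)" (is ?thesis1)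
    and "(\<integral>\<^sup>+y. \<integral>\<^sup>+u. k (y, u + t * y) \<partial>lborel \<partial>lborel) = (\<integral>\<^sup>+y. \<integral>\<^sup>+u. k (y, u) \<partial>lborel \<partial>lborel)" (is ?thesis2)
proof -
  have "(\<integral>\<^sup>+y. \<integral>\<^sup>+u. k (y + t * u, u) \<partial>lborel \<partial>lborel) = (\<integral>\<^sup>+u. \<integral>\<^sup>+y. k (y + t * u, u) \<partial>lborel \<partial>lborel)"
    by (rule lborel_pair.Fubini') measurable
  also have "\<dots> = (\<integral>\<^sup>+u. \<integral>\<^sup>+y. k (y, u) \<partial>lborel \<partial>lborel)"
    by (intro nn_integral_cong nn_integral_lborel_shift[of "\<lambda>y. k (y, _)"]) measurable
  also have "\<dots> = (\<integral>\<^sup>+y. \<integral>\<^sup>+u. k (y, u) \<partial>lborel \<partial>lborel)"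
    by (rule lborel_pair.Fubini'[symmetric]) measurable
  finally show ?thesis1 .
  show ?thesis2
    by (intro nn_integral_cong nn_integral_lborel_shift[of "\<lambda>u. k (_, u)"]) measurable
qed

text \<open>A rotation of the plane by less than a half turn is a product of three shears.\<close>

lemma nn_integral_lborel_rotate:
  fixes k :: "real \<times> real \<Rightarrow> ennreal"
  assumes [measurable]: "k \<in> borel_measurable (borel \<Otimes>\<^sub>M borel)" and cs: "c\<^sup>2 + s\<^sup>2 = 1" "c \<ge> 0"
  shows "(\<integral>\<^sup>+y. \<integral>\<^sup>+u. k (c * y - s * u, s * y + c * u) \<partial>lborel \<partial>lborel) = (\<integral>\<^sup>+y. \<integral>\<^sup>+u. k (y, u) \<partial>lborel \<partial>lborel)"
proof -
  \<comment> \<open>The tangent of half the angle. The outer shears use \<open>- t\<close>, the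
    middle one \<open>s\<close>; \<open>c \<ge> 0\<close> keeps the denominator positive.\<close>
  define t where "t = s / (1 + c)"
  have t: "t * (1 + c) = s" using cs by (simp add: t_def)
  have "(t * s) * (1 + c) = (1 - c) * (1 + c)"
    unfolding mult.assoc mult.commute[of s] unfolding mult.assoc[symmetric] t using cs(1) by (simp add: algebra_simps power2_eq_square)
  then have ts: "t * s = 1 - c" using cs(2) by simp
  let ?k1 = "\<lambda>(y, u). k (y + (- t) * u, u)"
  let ?k2 = "\<lambda>(y, u). ?k1 (y, u + s * y)"
  have "k (c * y - s * u, s * y + c * u) = ?k2 (y + (- t) * u, u)" for y u
  proof -
    have 1: "u + s * (y + (- t) * u) = s * y + c * u" 
    proof -
      have "u + s * (y + (- t) * u) = s * y + (1 - t * s) * u" by (simp add: algebra_simps)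
      then show ?thesis by (simp only: ts) simp
    qed
    have "y + (- t) * u + (- t) * (s * y + c * u) = y * (1 - t * s) - u * (t * (1 + c))" by (simp add: algebra_simps)
    also have "\<dots> = c * y - s * u" by (simp only: ts t) simp
    finally show ?thesis unfolding prod.case 1 by simp
  qed
  then have "(\<integral>\<^sup>+y. \<integral>\<^sup>+u. k (c * y - s * u, s * y + c * u) \<partial>lborel \<partial>lborel)
    = (\<integral>\<^sup>+y. \<integral>\<^sup>+u. ?k2 (y + (- t) * u, u) \<partial>lborel \<partial>lborel)" by simp
  also have "\<dots> = (\<integral>\<^sup>+y. \<integral>\<^sup>+u. ?k2 (y, u) \<partial>lborel \<partial>lborel)" by (rule nn_integral_lborel_shear(1)) measurable
  also have "\<dots> = (\<integral>\<^sup>+y. \<integral>\<^sup>+u. ?k1 (y, u + s * y) \<partial>lborel \<partial>lborel)" by simp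
  also have "\<dots> = (\<integral>\<^sup>+y. \<integral>\<^sup>+u. ?k1 (y, u) \<partial>lborel \<partial>lborel)" by (rule nn_integral_lborel_shear(2)) measurable
  also have "\<dots> = (\<integral>\<^sup>+y. \<integral>\<^sup>+u. k (y + (- t) * u, u) \<partial>lborel \<partial>lborel)" by simp
  also have "\<dots> = (\<integral>\<^sup>+y. \<integral>\<^sup>+u. k (y, u) \<partial>lborel \<partial>lborel)" by (rule nn_integral_lborel_shear(1)) measurable
  finally show ?thesis .
qed

text \<open>The density of a standard normal pair depends on the sum of squares only, and Lebesgue
  measure is invariant under the rotation.\<close>

lemma nn_integral_std_normal_rotate:
  fixes k :: "real \<times> real \<Rightarrow> ennreal"
  assumes k[measurable]: "k \<in> borel_measurable (borel \<Otimes>\<^sub>M borel)" and cs: "c\<^sup>2 + s\<^sup>2 = 1" "c \<ge> 0"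
  shows "(\<integral>\<^sup>+y. \<integral>\<^sup>+u. k (c * y - s * u, s * y + c * u) \<partial>std_normal_distribution \<partial>std_normal_distribution)
    = (\<integral>\<^sup>+y. \<integral>\<^sup>+u. k (y, u) \<partial>std_normal_distribution \<partial>std_normal_distribution)"
proof -
  let ?d = "\<lambda>(y, u). ennreal (std_normal_density y) * ennreal (std_normal_density u)"
  have dens: "(\<integral>\<^sup>+y. \<integral>\<^sup>+u. h (y, u) \<partial>std_normal_distribution \<partial>std_normal_distribution)
      = (\<integral>\<^sup>+y. \<integral>\<^sup>+u. ?d (y, u) * h (y, u) \<partial>lborel \<partial>lborel)"
    if [measurable]: "h \<in> borel_measurable (borel \<Otimes>\<^sub>M borel)" for h
  proof -
    have "(\<integral>\<^sup>+y. \<integral>\<^sup>+u. h (y, u) \<partial>std_normal_distribution \<partial>std_normal_distribution)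
      = (\<integral>\<^sup>+y. ennreal (std_normal_density y) * (\<integral>\<^sup>+u. ennreal (std_normal_density u) * h (y, u) \<partial>lborel) \<partial>lborel)"
      by (subst nn_integral_density; measurable?) (intro nn_integral_cong, subst nn_integral_density, auto)
    also have "\<dots> = (\<integral>\<^sup>+y. \<integral>\<^sup>+u. ennreal (std_normal_density y) * (ennreal (std_normal_density u) * h (y, u)) \<partial>lborel \<partial>lborel)"
      by (intro nn_integral_cong nn_integral_cmult[symmetric]) measurable
    finally show ?thesis by (simp add: mult.assoc)
  qed
  have inv: "?d (c * y - s * u, s * y + c * u) = ?d (y, u)" for y u
  proof -
    have "(c * y - s * u)\<^sup>2 + (s * y + c * u)\<^sup>2 = (c\<^sup>2 + s\<^sup>2) * (y\<^sup>2 + u\<^sup>2)" by (simp add: power2_eq_square algebra_simps)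
    then have "std_normal_density (c * y - s * u) * std_normal_density (s * y + c * u) = std_normal_density y * std_normal_density u"
      using cs(1) by (simp add: std_normal_density_def add_divide_distrib[symmetric] flip: exp_add minus_add_distrib)
    then show ?thesis by (simp flip: ennreal_mult)
  qed
  have m: "(\<lambda>p. k (c * fst p - s * snd p, s * fst p + c * snd p)) \<in> borel_measurable (borel \<Otimes>\<^sub>M borel)" by measurable
  have "(\<integral>\<^sup>+y. \<integral>\<^sup>+u. k (c * y - s * u, s * y + c * u) \<partial>std_normal_distribution \<partial>std_normal_distribution)
    = (\<integral>\<^sup>+y. \<integral>\<^sup>+u. (\<lambda>p. ?d p * k p) (c * y - s * u, s * y + c * u) \<partial>lborel \<partial>lborel)"
    unfolding inv using dens[OF m] by simp
  also have "\<dots> = (\<integral>\<^sup>+y. \<integral>\<^sup>+u. (\<lambda>p. ?d p * k p) (y, u) \<partial>lborel \<partial>lborel)"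
    by (rule nn_integral_lborel_rotate[OF _ cs]) measurable
  also have "\<dots> = (\<integral>\<^sup>+y. \<integral>\<^sup>+u. k (y, u) \<partial>std_normal_distribution \<partial>std_normal_distribution)"
    by (rule dens[OF k, symmetric])
  finally show ?thesis .
qed

lemma prob_space_centered_normal: "v \<ge> 0 \<Longrightarrow> prob_space (centered_normal v)"
  by (auto simp: centered_normal_def intro!: prob_space_return prob_space_normal_density)

lemma sets_centered_normal[measurable_cong, simp]: "sets (centered_normal v) = sets borel"
  by (simp add: centered_normal_def)

text \<open>The image representation also covers variance 0, which occurs whenever \<open>B\<close>
  stays constant over a step.\<close>

lemma distr_centered_normal: "distr std_normal_distribution borel (\<lambda>x. sqrt v * x) = centered_normal v" if "v \<ge> 0"
proof (cases "v = 0")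
  case True
  have "distr std_normal_distribution borel (\<lambda>x. 0 :: real) = return borel 0"
    by (rule measure_eqI) (auto simp: emeasure_distr emeasure_return std_normal.emeasure_space_1[simplified] split: split_indicator)
  then show ?thesis using True by (simp add: centered_normal_def)
next
  case False
  have "distributed std_normal_distribution lborel (\<lambda>x. 0 + sqrt v * x) (normal_density (0 + sqrt v * 0) (\<bar>sqrt v\<bar> * 1))"
  proof (rule std_normal.normal_density_affine)
    show "distributed std_normal_distribution lborel (\<lambda>x. x) (normal_density 0 1)"
      unfolding distributed_def by (auto intro!: measure_eqI simp: emeasure_distr)
  qed (use False that in auto)
  then have "distr std_normal_distribution lborel (\<lambda>x. sqrt v * x) = density lborel (normal_density 0 (sqrt v))"
    using that by (simp add: distributed_def)
  moreover have "distr std_normal_distribution lborel (\<lambda>x. sqrt v * x) = distr std_normal_distribution borel (\<lambda>x. sqrt v * x)"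
    by (rule distr_cong) auto
  ultimately show ?thesis using False by (simp add: centered_normal_def)
qed

text \<open>\<open>(c, s)\<close> is the unit vector in the direction of \<open>(a, b)\<close>.
  After rotating by it, weights \<open>a\<close> and \<open>b\<close> on the two coordinates combine
  to the hypotenuse on one variable and cancel on the other. For \<open>a = b = 0\<close> any
  direction works.\<close>

lemma rotation_to_hypotenuse:
  fixes a b :: real assumes "a \<ge> 0" "b \<ge> 0"
  obtains c s where "c\<^sup>2 + s\<^sup>2 = 1" "c \<ge> 0" "a * c + b * s = sqrt (a\<^sup>2 + b\<^sup>2)" "b * c = a * s"
proof (cases "a\<^sup>2 + b\<^sup>2 = 0")
  case True
  then have "a = 0" "b = 0" by (simp_all add: sum_power2_eq_zero_iff)
  then show ?thesis using that[of 1 0] by simp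
next
  case False
  define h where "h = sqrt (a\<^sup>2 + b\<^sup>2)"
  have h: "h > 0" "h\<^sup>2 = a\<^sup>2 + b\<^sup>2" using False by (simp_all add: h_def sum_power2_gt_zero_iff sum_power2_eq_zero_iff)
  show ?thesis
  proof (rule that[of "a / h" "b / h"])
    show "(a / h)\<^sup>2 + (b / h)\<^sup>2 = 1"
      unfolding power_divide add_divide_distrib[symmetric] h(2)[symmetric] using h(1) by simp
    have "a * (a / h) + b * (b / h) = (a\<^sup>2 + b\<^sup>2) / h" by (simp add: power2_eq_square add_divide_distrib)
    also have "\<dots> = h\<^sup>2 / h" by (simp only: h(2))
    also have "\<dots> = h" using h(1) by (simp add: power2_eq_square)
    finally show "a * (a / h) + b * (b / h) = sqrt (a\<^sup>2 + b\<^sup>2)" by (simp add: h_def)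
  qed (use assms h in auto)
qed

text \<open>The conditional law of independent centred normals given their sum, realised as a function of the
  normalised sum \<open>y\<close> and of auxiliary standard normals \<open>x\<close>.\<close>

lemma normal_vector_with_given_sum:
  fixes \<beta> :: "nat \<Rightarrow> real"
  assumes \<beta>: "\<And>j. \<beta> j \<ge> 0"
  obtains \<Phi> where "\<Phi> \<in> borel \<Otimes>\<^sub>M (\<Pi>\<^sub>M j\<in>{1..n}. borel) \<rightarrow>\<^sub>M (\<Pi>\<^sub>M j\<in>{1..n}. borel)"
    and "\<And>y x. (\<Sum>j=1..n. \<Phi> (y, x) j) = sqrt (\<Sum>j=1..n. \<beta> j) * y"
    and "\<And>h. h \<in> borel_measurable (\<Pi>\<^sub>M j\<in>{1..n}. borel) \<Longrightarrow>
      (\<integral>\<^sup>+y. \<integral>\<^sup>+x. h (\<Phi> (y, x)) \<partial>(\<Pi>\<^sub>M j\<in>{1..n}. std_normal_distribution) \<partial>std_normal_distribution)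
      = (\<integral>\<^sup>+z. h z \<partial>(\<Pi>\<^sub>M j\<in>{1..n}. centered_normal (\<beta> j)))"
proof -
  let ?N = std_normal_distribution
  define good where "good n \<Phi> \<longleftrightarrow> \<Phi> \<in> borel \<Otimes>\<^sub>M (\<Pi>\<^sub>M j\<in>{1..n}. borel) \<rightarrow>\<^sub>M (\<Pi>\<^sub>M j\<in>{1..n}. borel) \<and>
      (\<forall>y x. (\<Sum>j=1..n. \<Phi> (y, x) j) = sqrt (\<Sum>j=1..n. \<beta> j) * y) \<and>
      (\<forall>h. h \<in> borel_measurable (\<Pi>\<^sub>M j\<in>{1..n}. borel) \<longrightarrow>
        (\<integral>\<^sup>+y. \<integral>\<^sup>+x. h (\<Phi> (y, x)) \<partial>(\<Pi>\<^sub>M j\<in>{1..n}. ?N) \<partial>?N) = (\<integral>\<^sup>+z. h z \<partial>(\<Pi>\<^sub>M j\<in>{1..n}. centered_normal (\<beta> j))))"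
    for n and \<Phi> :: "real \<times> (nat \<Rightarrow> real) \<Rightarrow> nat \<Rightarrow> real"
  have "\<exists>\<Phi>. good n \<Phi>"
  proof (induction n)
    case 0
    have "good 0 (\<lambda>_ _. undefined)"
      by (auto simp: good_def PiM_empty nn_integral_count_space_finite std_normal.emeasure_space_1[simplified])
    then show ?case by blast
  next
    case (Suc n)
    then obtain \<Phi> where "good n \<Phi>" by fastforce
    then have \<Phi>[measurable]: "\<Phi> \<in> borel \<Otimes>\<^sub>M (\<Pi>\<^sub>M j\<in>{1..n}. borel) \<rightarrow>\<^sub>M (\<Pi>\<^sub>M j\<in>{1..n}. borel)"
      and \<Phi>_sum: "(\<Sum>j=1..n. \<Phi> (y, x) j) = sqrt (\<Sum>j=1..n. \<beta> j) * y"
      and \<Phi>_law: "h \<in> borel_measurable (\<Pi>\<^sub>M j\<in>{1..n}. borel) \<Longrightarrow>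
        (\<integral>\<^sup>+y. \<integral>\<^sup>+x. h (\<Phi> (y, x)) \<partial>(\<Pi>\<^sub>M j\<in>{1..n}. ?N) \<partial>?N) = (\<integral>\<^sup>+z. h z \<partial>(\<Pi>\<^sub>M j\<in>{1..n}. centered_normal (\<beta> j)))"
      for y x h unfolding good_def by blast+
    define a b where "a = sqrt (\<Sum>j=1..n. \<beta> j)" and "b = sqrt (\<beta> (Suc n))"
    have \<beta>0: "(\<Sum>j=1..n. \<beta> j) \<ge> 0" "\<beta> (Suc n) \<ge> 0" using \<beta> by (auto intro!: sum_nonneg)
    then have ab: "a \<ge> 0" "b \<ge> 0" "a\<^sup>2 + b\<^sup>2 = (\<Sum>j=1..Suc n. \<beta> j)" by (auto simp: a_def b_def)
    obtain c s where cs: "c\<^sup>2 + s\<^sup>2 = 1" "c \<ge> 0" and acs: "a * c + b * s = sqrt (a\<^sup>2 + b\<^sup>2)" "b * c = a * s"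
      by (rule rotation_to_hypotenuse[OF ab(1,2)])
    have ins: "{1..Suc n} = insert (Suc n) {1..n}" by auto
    \<comment> \<open>The pair of \<open>y\<close> and the new auxiliary variable is rotated into
      two independent standard normals: the first becomes the normalised sum of the first
      \<open>n\<close> coordinates, the second, scaled by \<open>b\<close>, the last coordinate. By
      the choice of \<open>c\<close> and \<open>s\<close> the auxiliary variable drops out of the
      total.\<close>
    define \<Psi> where "\<Psi> = (\<lambda>(y, x). (\<Phi> (c * y - s * x (Suc n), restrict x {1..n})) (Suc n := b * (s * y + c * x (Suc n))))"
    have \<Psi>_meas: "\<Psi> \<in> borel \<Otimes>\<^sub>M (\<Pi>\<^sub>M j\<in>{1..Suc n}. borel) \<rightarrow>\<^sub>M (\<Pi>\<^sub>M j\<in>{1..Suc n}. borel)"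
      unfolding \<Psi>_def ins case_prod_unfold by measurable
    have \<Psi>_sum: "(\<Sum>j=1..Suc n. \<Psi> (y, x) j) = sqrt (\<Sum>j=1..Suc n. \<beta> j) * y" for y x
    proof -
      have "(\<Sum>j=1..Suc n. \<Psi> (y, x) j) = (\<Sum>j=1..n. \<Phi> (c * y - s * x (Suc n), restrict x {1..n}) j) + b * (s * y + c * x (Suc n))"
        by (simp add: \<Psi>_def)
      also have "\<dots> = (a * c + b * s) * y + (b * c - a * s) * x (Suc n)"
        unfolding \<Phi>_sum a_def[symmetric] by (simp add: algebra_simps)
      finally show ?thesis by (simp add: acs ab)
    qed
    interpret CP: product_sigma_finite "\<lambda>j. centered_normal (\<beta> j)"
      unfolding product_sigma_finite_def using prob_space_centered_normal[OF \<beta>] by (auto intro: prob_space_imp_sigma_finite)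
    interpret Nn: finite_product_prob_space "\<lambda>_::nat. ?N" "{1..n}" by unfold_locales auto
    interpret Cn: prob_space "\<Pi>\<^sub>M j\<in>{1..n}. centered_normal (\<beta> j)"
      by (intro prob_space_PiM prob_space_centered_normal \<beta>)
    interpret NN: pair_sigma_finite ?N "\<Pi>\<^sub>M j\<in>{1..n}. ?N" ..
    interpret NC: pair_sigma_finite ?N "\<Pi>\<^sub>M j\<in>{1..n}. centered_normal (\<beta> j)" ..
    have \<Psi>_law: "(\<integral>\<^sup>+y. \<integral>\<^sup>+x. h (\<Psi> (y, x)) \<partial>(\<Pi>\<^sub>M j\<in>{1..Suc n}. ?N) \<partial>?N)
        = (\<integral>\<^sup>+z. h z \<partial>(\<Pi>\<^sub>M j\<in>{1..Suc n}. centered_normal (\<beta> j)))"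
      if h: "h \<in> borel_measurable (\<Pi>\<^sub>M j\<in>{1..Suc n}. borel)" for h
    proof -
      let ?PN = "\<Pi>\<^sub>M j\<in>{1..n}. ?N"
      let ?PB = "\<Pi>\<^sub>M j\<in>{1..n}. (borel :: real measure)"
      have upd[measurable]: "(\<lambda>(x, u). h (x(Suc n := u))) \<in> borel_measurable (?PB \<Otimes>\<^sub>M borel)"
        using measurable_compose[OF measurable_add_dim h[unfolded ins]] by (simp add: case_prod_unfold)
      define k where "k = (\<lambda>p. h ((\<Phi> (fst (fst p), snd p))(Suc n := b * snd (fst p))))"
      have k[measurable]: "k \<in> borel_measurable ((borel \<Otimes>\<^sub>M borel) \<Otimes>\<^sub>M ?PB)"
      proof -
        have "(\<lambda>p. (\<lambda>(x, u). h (x(Suc n := u))) (\<Phi> (fst (fst p), snd p), b * snd (fst p))) \<in> borel_measurable ((borel \<Otimes>\<^sub>M borel) \<Otimes>\<^sub>M ?PB)"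
          by measurable
        then show ?thesis by (simp add: k_def)
      qed
      have "(\<integral>\<^sup>+x. h (\<Psi> (y, x)) \<partial>(\<Pi>\<^sub>M j\<in>{1..Suc n}. ?N))
          = (\<integral>\<^sup>+x. \<integral>\<^sup>+u. k ((c * y - s * u, s * y + c * u), x) \<partial>?N \<partial>?PN)" for y
      proof -
        have "(\<lambda>x. h (\<Psi> (y, x))) \<in> borel_measurable (\<Pi>\<^sub>M j\<in>{1..Suc n}. ?N)"
          using measurable_compose[OF measurable_compose[OF measurable_Pair1' \<Psi>_meas] h, of y] by (simp cong: measurable_cong_sets)
        then have "(\<integral>\<^sup>+x. h (\<Psi> (y, x)) \<partial>(\<Pi>\<^sub>M j\<in>{1..Suc n}. ?N))
          = (\<integral>\<^sup>+x. \<integral>\<^sup>+u. h (\<Psi> (y, x(Suc n := u))) \<partial>?N \<partial>?PN)"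
          unfolding ins by (intro Nn.product_nn_integral_insert) auto
        also have "\<dots> = (\<integral>\<^sup>+x. \<integral>\<^sup>+u. k ((c * y - s * u, s * y + c * u), x) \<partial>?N \<partial>?PN)"
        proof (intro nn_integral_cong)
          fix x u assume "x \<in> space ?PN"
          then have "restrict (x(Suc n := u)) {1..n} = x"
            by (auto simp: space_PiM PiE_def extensional_def restrict_def fun_eq_iff)
          then show "h (\<Psi> (y, x(Suc n := u))) = k ((c * y - s * u, s * y + c * u), x)" by (simp add: \<Psi>_def k_def)
        qed
        finally show ?thesis .
      qed
      then have "(\<integral>\<^sup>+y. \<integral>\<^sup>+x. h (\<Psi> (y, x)) \<partial>(\<Pi>\<^sub>M j\<in>{1..Suc n}. ?N) \<partial>?N)
        = (\<integral>\<^sup>+y. \<integral>\<^sup>+x. \<integral>\<^sup>+u. k ((c * y - s * u, s * y + c * u), x) \<partial>?N \<partial>?PN \<partial>?N)" by simp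
      also have "\<dots> = (\<integral>\<^sup>+x. \<integral>\<^sup>+y. \<integral>\<^sup>+u. k ((c * y - s * u, s * y + c * u), x) \<partial>?N \<partial>?N \<partial>?PN)"
        by (rule NN.Fubini'[symmetric]) measurable
      \<comment> \<open>The other auxiliary variables are fixed while the plane of \<open>y\<close>
        and the last one is rotated.\<close>
      also have "\<dots> = (\<integral>\<^sup>+x. \<integral>\<^sup>+w. \<integral>\<^sup>+z. k ((w, z), x) \<partial>?N \<partial>?N \<partial>?PN)"
        by (rule nn_integral_cong, rule nn_integral_std_normal_rotate[OF _ cs, of "\<lambda>p. k (p, _)"]) (measurable, simp add: space_PiM)
      also have "\<dots> = (\<integral>\<^sup>+w. \<integral>\<^sup>+x. \<integral>\<^sup>+z. k ((w, z), x) \<partial>?N \<partial>?PN \<partial>?N)"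
        by (rule NN.Fubini') measurable
      \<comment> \<open>The induction hypothesis is applied to \<open>h\<close> already integrated
        over the last coordinate.\<close>
      also have "\<dots> = (\<integral>\<^sup>+v. \<integral>\<^sup>+z. h (v(Suc n := b * z)) \<partial>?N \<partial>(\<Pi>\<^sub>M j\<in>{1..n}. centered_normal (\<beta> j)))"
        unfolding k_def fst_conv snd_conv by (rule \<Phi>_law) measurable
      also have "\<dots> = (\<integral>\<^sup>+v. \<integral>\<^sup>+u. h (v(Suc n := u)) \<partial>centered_normal (\<beta> (Suc n)) \<partial>(\<Pi>\<^sub>M j\<in>{1..n}. centered_normal (\<beta> j)))"
      proof (intro nn_integral_cong)
        fix v assume v: "v \<in> space (\<Pi>\<^sub>M j\<in>{1..n}. centered_normal (\<beta> j))"
        then have "v \<in> space ?PB" by (simp add: space_PiM sets_eq_imp_space_eq[OF sets_centered_normal])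
        then have "(\<lambda>u. h (v(Suc n := u))) \<in> borel_measurable borel" using measurable_Pair2[OF upd] by simp
        then show "(\<integral>\<^sup>+z. h (v(Suc n := b * z)) \<partial>?N) = (\<integral>\<^sup>+u. h (v(Suc n := u)) \<partial>centered_normal (\<beta> (Suc n)))"
          unfolding distr_centered_normal[OF \<beta>, symmetric] b_def by (subst nn_integral_distr) auto
      qed
      also have "\<dots> = (\<integral>\<^sup>+z. h z \<partial>(\<Pi>\<^sub>M j\<in>{1..Suc n}. centered_normal (\<beta> j)))"
        unfolding ins by (rule CP.product_nn_integral_insert[symmetric]) (use h ins in \<open>auto cong: measurable_cong_sets sets_PiM_cong\<close>)
      finally show ?thesis .
    qed
    have "good (Suc n) \<Psi>" unfolding good_def using \<Psi>_meas \<Psi>_sum \<Psi>_law by blast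
    then show ?case by blast
  qed
  then show ?thesis unfolding good_def using that by blast
qed

section \<open>Couplings\<close>

lemma distr_pair_in_couplings:
  assumes \<Omega>: "prob_space \<Omega>" and U[measurable]: "U \<in> \<Omega> \<rightarrow>\<^sub>M \<mu>" and V[measurable]: "V \<in> \<Omega> \<rightarrow>\<^sub>M \<nu>"
    and "distr \<Omega> \<mu> U = \<mu>" "distr \<Omega> \<nu> V = \<nu>"
  shows "distr \<Omega> (\<mu> \<Otimes>\<^sub>M \<nu>) (\<lambda>\<omega>. (U \<omega>, V \<omega>)) \<in> couplings \<mu> \<nu>"
proof -
  have "prob_space (distr \<Omega> (\<mu> \<Otimes>\<^sub>M \<nu>) (\<lambda>\<omega>. (U \<omega>, V \<omega>)))" by (rule prob_space.prob_space_distr[OF \<Omega>]) measurable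
  then show ?thesis using assms(4,5) by (simp add: couplings_def distr_distr comp_def)
qed

lemma Lp_norm_distr_le:
  assumes [measurable]: "h \<in> borel_measurable N" "X \<in> \<Omega> \<rightarrow>\<^sub>M N" and p: "p > 0"
    and le: "(\<integral>\<^sup>+\<omega>. ennreal (\<bar>h (X \<omega>)\<bar> powr p) \<partial>\<Omega>) \<le> ennreal k"
  shows "Lp_norm p (distr \<Omega> N X) h \<le> ennreal (k powr (1 / p))"
proof -
  define I where "I = (\<integral>\<^sup>+x. ennreal (\<bar>h x\<bar> powr p) \<partial>distr \<Omega> N X)"
  have I: "I \<le> ennreal k" using le unfolding I_def by (subst nn_integral_distr) auto
  then have "I \<noteq> \<infinity>" by (auto simp: top_unique)
  moreover have "enn2real I powr (1 / p) \<le> k powr (1 / p)"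
  proof (cases "k \<ge> 0")
    case True
    then have "enn2real I \<le> k" using I enn2real_leI by blast
    then show ?thesis using p by (intro powr_mono2) auto
  next
    case False
    then have "I = 0" using I by (simp add: ennreal_neg)
    then show ?thesis by simp
  qed
  ultimately show ?thesis unfolding Lp_norm_def I_def[symmetric] Let_def by (simp add: ennreal_leI)
qed

lemma interval_measure_cdf:
  assumes "real_distribution \<mu>" shows "interval_measure (cdf \<mu>) = \<mu>"
proof (rule cdf_unique)
  interpret real_distribution \<mu> by fact
  show "real_distribution (interval_measure (cdf \<mu>))"
    by (rule real_distribution_interval_measure)
      (simp_all add: cdf_nondecreasing cdf_is_right_cont cdf_lim_at_bot cdf_lim_at_top_prob)
  show "cdf (interval_measure (cdf \<mu>)) = cdf \<mu>"
    by (rule cdf_interval_measure) (simp_all add: cdf_nondecreasing cdf_is_right_cont cdf_lim_at_bot)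
qed fact

lemma bigo_one_imp_bounded:
  fixes h :: "nat \<Rightarrow> real" assumes "h \<in> O(\<lambda>n. 1)"
  obtains a where "\<And>n. \<bar>h n\<bar> \<le> a"
proof -
  obtain c where "eventually (\<lambda>n. norm (h n) \<le> c * norm (1::real)) sequentially"
    using landau_o.bigE[OF assms] by blast
  then obtain m where m: "\<And>n. n \<ge> m \<Longrightarrow> \<bar>h n\<bar> \<le> c" by (auto simp: eventually_sequentially)
  have "\<bar>h n\<bar> \<le> \<bar>c\<bar> + (\<Sum>k<m. \<bar>h k\<bar>)" for n
  proof (cases "n < m")
    case True
    then have "\<bar>h n\<bar> \<le> (\<Sum>k<m. \<bar>h k\<bar>)" by (intro member_le_sum) auto
    then show ?thesis by simp
  next
    case False
    then have "\<bar>h n\<bar> \<le> \<bar>c\<bar>" using m[of n] by simp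
    moreover have "0 \<le> (\<Sum>k<m. \<bar>h k\<bar>)" by (rule sum_nonneg) simp
    ultimately show ?thesis by linarith
  qed
  then show ?thesis by (rule that)
qed

lemma abs_sqrt_diff_le: "\<bar>sqrt x - sqrt y\<bar> \<le> sqrt \<bar>x - y\<bar>" if "x \<ge> 0" "y \<ge> 0"
proof -
  have "sqrt v - sqrt u \<le> sqrt (v - u)" if "0 \<le> u" "u \<le> v" for u v
    using sqrt_add_le_add_sqrt[of u "v - u"] that by simp
  from this[of x y] this[of y x] show ?thesis using that by (cases "x \<le> y") auto
qed

theorem theorem34:
  fixes P :: "'w measure" and M :: "'a measure"
    and ev :: "'b::complex_banach \<Rightarrow> 'a \<Rightarrow> complex"
    and K :: "'a \<Rightarrow> 'a measure" and R :: "'b \<Rightarrow> 'b"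
    and \<xi> :: "nat \<Rightarrow> 'w \<Rightarrow> 'a" and f :: "'a \<Rightarrow> real"
    and S :: "nat \<Rightarrow> 'w \<Rightarrow> real" and F :: "nat \<Rightarrow> real \<Rightarrow> real"
    and \<sigma> :: real and \<sigma>' A B :: "nat \<Rightarrow> real"
    and Q :: "'v measure" and Z :: "nat \<Rightarrow> 'v \<Rightarrow> real"
  assumes operator: "markov_operator M ev K R"
    and chain: "markov_chain P M K \<xi>"
    and f: "\<exists>g. \<forall>x\<in>space M. ev g x = complex_of_real (f x)"
    and S: "S = centered_sum P \<xi> f"
    and \<sigma>: "(\<lambda>n. prob_space.variance P (S n) / real n) \<longlonglongrightarrow> \<sigma>\<^sup>2" "\<sigma> > 0"
    and \<sigma>': "\<And>n. \<sigma>' n = sqrt (LINT \<omega>|P. (S n \<omega>)\<^sup>2)"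
    and A: "A \<in> O(\<lambda>n. 1)"
    and B_pos: "\<And>n. n \<ge> 1 \<Longrightarrow> B n > 0"
    and B: "(\<lambda>n. B n - \<sigma> * sqrt (real n)) \<in> O(\<lambda>n. 1) \<or> (\<lambda>n. B n - \<sigma>' n) \<in> O(\<lambda>n. 1)"
    and F: "\<And>n x. F n x = measure P {\<omega> \<in> space P. (S n \<omega> - A n) / B n \<le> x}"
  shows "(\<forall>p\<ge>1. \<exists>C. \<forall>n\<ge>1.
            wasserstein p (interval_measure (F n)) (interval_measure (cdf std_normal_distribution))
              \<le> ennreal (C / B n)) \<and>
         (mono B \<longrightarrow> B 0 = 0 \<longrightarrow> prob_space Q \<longrightarrow>
            prob_space.indep_vars Q (\<lambda>_. borel) Z {1..} \<longrightarrow>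
            (\<forall>j\<ge>1. distr Q borel (Z j) = centered_normal ((B j)\<^sup>2 - (B (j - 1))\<^sup>2)) \<longrightarrow>
          (\<forall>m::nat. m \<ge> 2 \<longrightarrow> (\<exists>C. \<forall>n.
            \<exists>\<gamma> \<in> couplings
                (distr P (\<Pi>\<^sub>M j\<in>{1..n}. borel) (\<lambda>\<omega>. \<lambda>j\<in>{1..n}. S j \<omega> - S (j - 1) \<omega>))
                (distr Q (\<Pi>\<^sub>M j\<in>{1..n}. borel) (\<lambda>\<omega>. \<lambda>j\<in>{1..n}. Z j \<omega>)).
              Lp_norm (real m - 1) \<gamma> (\<lambda>(s, z). (\<Sum>j=1..n. s j) - (\<Sum>j=1..n. z j))
                \<le> ennreal C)))"
proof -
  note One_nat_def[simp del]
  interpret markov_operator M ev K R by (rule operator)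
  have P: "prob_space P" using chain by (simp add: markov_chain_def)
  interpret prob_space P by (rule P)
  interpret PN: pair_prob_space P std_normal_distribution ..
  let ?N = std_normal_distribution
  let ?PN = "P \<Otimes>\<^sub>M ?N"
  obtain f0 where f0: "\<And>x. x \<in> space M \<Longrightarrow> ev f0 x = complex_of_real (f x)" using f by blast
  obtain r C d L where r: "0 < r" and C: "0 \<le> C"
    and S_meas[measurable]: "\<And>n. S n \<in> borel_measurable P"
    and S_bd: "\<And>n \<omega>. \<omega> \<in> space P \<Longrightarrow> \<bar>S n \<omega>\<bar> \<le> C * real n"
    and hol: "\<And>n. L n holomorphic_on ball 0 r"
    and expL: "\<And>n z. norm z < r \<Longrightarrow> exp (L n z) = (LINT \<omega>|P. exp (z * of_real (S n \<omega>)))"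
    and bound: "\<And>n z. norm z < r \<Longrightarrow> norm (L n z) \<le> C * real n"
    and L0: "\<And>n. L n 0 = 0" "\<And>n. deriv (L n) 0 = 0"
      "\<And>n. (deriv ^^ 2) (L n) 0 = of_real (LINT \<omega>|P. (S n \<omega>)\<^sup>2)"
    and real: "\<And>n u. \<bar>u\<bar> < r \<Longrightarrow> L n (of_real u) \<in> \<real>"
    and V: "\<And>n. \<bar>(LINT \<omega>|P. (S n \<omega>)\<^sup>2) - real n * d\<bar> \<le> C"
    and mean: "\<And>n. (LINT \<omega>|P. S n \<omega>) = 0"
    by (rule log_moment_generating_function[OF chain _ S]) (rule f0, assumption, rule that, assumption+)
  define V where "V n = (LINT \<omega>|P. (S n \<omega>)\<^sup>2)" for n
  have V0: "V n \<ge> 0" for n unfolding V_def by simp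
  have Vd: "\<bar>V n - real n * d\<bar> \<le> C" for n unfolding V_def by (rule V)
  \<comment> \<open>The growth rate \<open>d\<close> is identified with
    \<open>\<sigma>\<^sup>2\<close>. This gives \<open>d > 0\<close> and relates the two admissible
    normalisations to each other.\<close>
  have "(\<lambda>n. V n / real n) \<longlonglongrightarrow> d"
  proof (rule tendsto_dist_iff[THEN iffD2], rule tendsto_sandwich[where f="\<lambda>_. 0" and h="\<lambda>n. C / real n"])
    show "\<forall>\<^sub>F n in sequentially. dist (V n / real n) d \<le> C / real n"
    proof (rule eventually_sequentiallyI[of 1])
      fix n :: nat assume n: "n \<ge> 1"
      have "V n / real n - d = (V n - real n * d) / real n" using n by (simp add: field_simps)
      then show "dist (V n / real n) d \<le> C / real n" using Vd[of n] n by (simp add: dist_real_def divide_right_mono)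
    qed
    show "(\<lambda>n. C / real n) \<longlonglongrightarrow> 0" by (rule lim_const_over_n)
  qed auto
  moreover have "(\<lambda>n. V n / real n) \<longlonglongrightarrow> \<sigma>\<^sup>2" using \<sigma>(1) by (simp add: mean V_def)
  ultimately have d: "d = \<sigma>\<^sup>2" by (rule LIMSEQ_unique)
  have d0: "d > 0" using \<sigma>(2) by (simp add: d)
  obtain Y where Y[measurable]: "\<And>n. n \<ge> 1 \<Longrightarrow> Y n \<in> borel_measurable ?PN"
    and Y_law: "\<And>n. n \<ge> 1 \<Longrightarrow> distr ?PN borel (Y n) = ?N"
    and Y_close: "\<And>p a A B. p \<ge> 1 \<Longrightarrow> (\<And>n. \<bar>A n\<bar> \<le> a) \<Longrightarrow> (\<And>n. \<bar>B n - sqrt (V n)\<bar> \<le> a) \<Longrightarrow>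
      \<exists>K>0. \<forall>n\<ge>1. (\<integral>\<^sup>+x. ennreal (\<bar>S n (fst x) - A n - B n * Y n x\<bar> powr p) \<partial>?PN) \<le> ennreal K"
  proof (rule normal_coupling[OF P r, of S C L V d])
    fix Y
    assume Y: "\<And>n. n \<ge> 1 \<Longrightarrow> Y n \<in> borel_measurable ?PN" "\<And>n. n \<ge> 1 \<Longrightarrow> distr ?PN borel (Y n) = ?N"
      and close: "\<And>p a A B. p \<ge> 1 \<Longrightarrow> (\<And>n. \<bar>A n\<bar> \<le> a) \<Longrightarrow> (\<And>n. \<bar>B n - sqrt (V n)\<bar> \<le> a) \<Longrightarrow>
        \<exists>K>0. \<forall>n\<ge>1. (\<integral>\<^sup>+x. ennreal (\<bar>S n (fst x) - A n - B n * Y n x\<bar> powr p) \<partial>?PN) \<le> ennreal K"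
    show thesis by (rule that, rule Y(1), assumption, rule Y(2), assumption, rule close)
  qed (rule S_meas, rule S_bd, assumption, rule hol, rule expL, assumption, rule bound, assumption, rule L0(1), rule L0(2),
      rule L0(3)[folded V_def], rule real, assumption, rule Vd, rule V0, rule d0)
  obtain a1 where a1: "\<And>n. \<bar>A n\<bar> \<le> a1" by (rule bigo_one_imp_bounded[OF A]) (rule that, assumption)
  \<comment> \<open>Both alternatives for \<open>B\<close> reduce to a bounded distance from
    \<open>sqrt (V n)\<close>. For \<open>\<sigma> * sqrt n\<close> this uses that square roots of
    numbers at distance at most \<open>C\<close> differ by at most \<open>sqrt C\<close>.\<close>
  obtain a2 where a2: "\<And>n. \<bar>B n - sqrt (V n)\<bar> \<le> a2"
  proof (cases "(\<lambda>n. B n - \<sigma>' n) \<in> O(\<lambda>n. 1)")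
    case True
    from bigo_one_imp_bounded[OF this] obtain a where "\<And>n. \<bar>B n - \<sigma>' n\<bar> \<le> a" by blast
    then show ?thesis by (intro that[of a]) (simp add: \<sigma>' V_def)
  next
    case False
    then have "(\<lambda>n. B n - \<sigma> * sqrt (real n)) \<in> O(\<lambda>n. 1)" using B by simp
    from bigo_one_imp_bounded[OF this] obtain a where a: "\<And>n. \<bar>B n - \<sigma> * sqrt (real n)\<bar> \<le> a" by blast
    have "\<bar>B n - sqrt (V n)\<bar> \<le> a + sqrt C" for n
    proof -
      have "sqrt (real n * d) = \<sigma> * sqrt (real n)" using \<sigma>(2) by (simp add: d real_sqrt_mult)
      moreover have "\<bar>sqrt (V n) - sqrt (real n * d)\<bar> \<le> sqrt C"
        by (rule order_trans[OF abs_sqrt_diff_le real_sqrt_le_mono[OF Vd]]) (use V0 d0 in auto)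
      ultimately show ?thesis using a[of n] by linarith
    qed
    then show ?thesis by (rule that)
  qed
  have PN_fst: "distr ?PN N (\<lambda>x. h (fst x)) = distr P N h" if [measurable]: "h \<in> P \<rightarrow>\<^sub>M N" for h :: "'w \<Rightarrow> 'c" and N
  proof -
    have "distr P N h = distr (distr ?PN P fst) N h" by (simp add: std_normal.distr_pair_fst)
    also have "\<dots> = distr ?PN N (\<lambda>x. h (fst x))" by (subst distr_distr) (auto simp: comp_def)
    finally show ?thesis by simp
  qed
  have "\<exists>C. \<forall>n\<ge>1. wasserstein p (interval_measure (F n)) (interval_measure (cdf ?N)) \<le> ennreal (C / B n)" if p: "p \<ge> 1" for p
  proof -
    have "\<exists>k>0. \<forall>n\<ge>1. (\<integral>\<^sup>+x. ennreal (\<bar>S n (fst x) - A n - B n * Y n x\<bar> powr p) \<partial>?PN) \<le> ennreal k"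
      by (rule Y_close[OF p max.coboundedI1[OF a1] max.coboundedI2[OF a2]])
    then obtain k where k: "k > 0" and
      "\<forall>n\<ge>1. (\<integral>\<^sup>+x. ennreal (\<bar>S n (fst x) - A n - B n * Y n x\<bar> powr p) \<partial>?PN) \<le> ennreal k"
      by (elim exE conjE) (rule that, assumption+)
    note kn = this(2)[rule_format]
    have "wasserstein p (interval_measure (F n)) (interval_measure (cdf ?N)) \<le> ennreal (k powr (1 / p) / B n)" if n: "n \<ge> 1" for n
    proof -
      note Y[OF n, measurable]
      have Bn: "B n > 0" by (rule B_pos[OF n])
      \<comment> \<open>Dividing the approximation of \<open>S n - A n\<close> by
        \<open>B n * Y n\<close> through \<open>B n\<close> compares \<open>X\<close> with
        \<open>Y n\<close> itself and scales the error by \<open>1 / B n\<close>.\<close>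
      define X where "X = (\<lambda>\<omega>. (S n \<omega> - A n) / B n)"
      have X[measurable]: "X \<in> borel_measurable P" unfolding X_def by measurable
      have "F n = cdf (distr P borel X)"
        by (auto simp: fun_eq_iff F cdf_def measure_distr X_def vimage_def Int_def conj_commute intro!: arg_cong[where f=prob])
      then have FX: "interval_measure (F n) = distr P borel X" using interval_measure_cdf[OF real_distribution_distr[OF X]] by simp
      have NN: "interval_measure (cdf ?N) = ?N" by (rule interval_measure_cdf[OF real_dist_normal_dist])
      let ?\<gamma> = "distr ?PN (distr P borel X \<Otimes>\<^sub>M ?N) (\<lambda>x. (X (fst x), Y n x))"
      have "?\<gamma> \<in> couplings (distr P borel X) ?N"
      proof (rule distr_pair_in_couplings)
        show "prob_space ?PN" by unfold_locales
        show "distr ?PN (distr P borel X) (\<lambda>x. X (fst x)) = distr P borel X"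
          using PN_fst[OF X] by (simp cong: distr_cong)
        show "distr ?PN ?N (Y n) = ?N" using Y_law[OF n] by (simp cong: distr_cong)
      qed measurable
      then have "wasserstein p (distr P borel X) ?N \<le> Lp_norm p ?\<gamma> (\<lambda>(x, y). x - y)"
        unfolding wasserstein_def by (rule INF_lower)
      also have "\<dots> \<le> ennreal ((k / B n powr p) powr (1 / p))"
      proof (rule Lp_norm_distr_le)
        have "(\<integral>\<^sup>+x. ennreal (\<bar>case (X (fst x), Y n x) of (x, y) \<Rightarrow> x - y\<bar> powr p) \<partial>?PN)
          = (\<integral>\<^sup>+x. ennreal (1 / B n powr p) * ennreal (\<bar>S n (fst x) - A n - B n * Y n x\<bar> powr p) \<partial>?PN)"
        proof (intro nn_integral_cong)
          fix x
          have "X (fst x) - Y n x = (S n (fst x) - A n - B n * Y n x) / B n"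
            using Bn by (simp add: X_def field_simps)
          then have "\<bar>X (fst x) - Y n x\<bar> powr p = 1 / B n powr p * \<bar>S n (fst x) - A n - B n * Y n x\<bar> powr p"
            using Bn by (simp add: powr_divide)
          then show "ennreal (\<bar>case (X (fst x), Y n x) of (x, y) \<Rightarrow> x - y\<bar> powr p)
            = ennreal (1 / B n powr p) * ennreal (\<bar>S n (fst x) - A n - B n * Y n x\<bar> powr p)"
            by (simp only: prod.case ennreal_mult powr_ge_zero divide_nonneg_nonneg zero_le_one)
        qed
        also have "\<dots> = ennreal (1 / B n powr p) * (\<integral>\<^sup>+x. ennreal (\<bar>S n (fst x) - A n - B n * Y n x\<bar> powr p) \<partial>?PN)"
          by (rule nn_integral_cmult) measurable
        also have "\<dots> \<le> ennreal (1 / B n powr p) * ennreal k" by (intro mult_left_mono kn n) simp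
        also have "\<dots> = ennreal (k / B n powr p)" using k by (simp flip: ennreal_mult)
        finally show "(\<integral>\<^sup>+x. ennreal (\<bar>case (X (fst x), Y n x) of (x, y) \<Rightarrow> x - y\<bar> powr p) \<partial>?PN) \<le> ennreal (k / B n powr p)" .
        show "0 < p" using p by simp
      qed measurable
      also have "(k / B n powr p) powr (1 / p) = k powr (1 / p) / B n"
        using k Bn p by (simp add: powr_divide powr_powr)
      finally show ?thesis unfolding FX NN .
    qed
    then show ?thesis by blast
  qed
  moreover have "\<exists>C. \<forall>n. \<exists>\<gamma> \<in> couplings
      (distr P (\<Pi>\<^sub>M j\<in>{1..n}. borel) (\<lambda>\<omega>. \<lambda>j\<in>{1..n}. S j \<omega> - S (j - 1) \<omega>))
      (distr Q (\<Pi>\<^sub>M j\<in>{1..n}. borel) (\<lambda>\<omega>. \<lambda>j\<in>{1..n}. Z j \<omega>)).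
        Lp_norm (real m - 1) \<gamma> (\<lambda>(s, z). (\<Sum>j=1..n. s j) - (\<Sum>j=1..n. z j)) \<le> ennreal C"
    if mono: "mono B" and B0: "B 0 = 0" and Q: "prob_space Q" and Z: "prob_space.indep_vars Q (\<lambda>_. borel) Z {1..}"
      and Z_law: "\<forall>j\<ge>1. distr Q borel (Z j) = centered_normal ((B j)\<^sup>2 - (B (j - 1))\<^sup>2)" and m: "m \<ge> 2" for m :: nat
  proof -
    interpret Q: prob_space Q by (rule Q)
    \<comment> \<open>\<open>m \<ge> 2\<close> makes this exponent at least 1, the range covered by
      \<open>Y_close\<close>.\<close>
    define p where "p = real m - 1"
    have p: "p \<ge> 1" using m by (simp add: p_def)
    \<comment> \<open>This part has no shift: \<open>Y_close\<close> is used with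
      \<open>A = 0\<close>, and \<open>a2\<close> bounds that as well.\<close>
    have a2': "\<bar>0\<bar> \<le> a2" using a2[of 0] by simp
    have "\<exists>k>0. \<forall>n\<ge>1. (\<integral>\<^sup>+x. ennreal (\<bar>S n (fst x) - 0 - B n * Y n x\<bar> powr p) \<partial>?PN) \<le> ennreal k"
      by (rule Y_close[OF p a2' a2])
    then obtain k where k: "k > 0" and
      "\<forall>n\<ge>1. (\<integral>\<^sup>+x. ennreal (\<bar>S n (fst x) - 0 - B n * Y n x\<bar> powr p) \<partial>?PN) \<le> ennreal k"
      by (elim exE conjE) (rule that, assumption+)
    note kn = this(2)[rule_format]
    have Z_meas: "Z j \<in> borel_measurable Q" if "j \<ge> 1" for j
      using Z that unfolding Q.indep_vars_def2 by auto
    have ZV: "(\<lambda>\<omega>. \<lambda>j\<in>{1..n}. Z j \<omega>) \<in> Q \<rightarrow>\<^sub>M (\<Pi>\<^sub>M j\<in>{1..n}. borel)" for n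
      by (rule measurable_restrict) (simp add: Z_meas)
    have SV: "(\<lambda>\<omega>. \<lambda>j\<in>{1..n}. S j \<omega> - S (j - 1) \<omega>) \<in> P \<rightarrow>\<^sub>M (\<Pi>\<^sub>M j\<in>{1..n}. borel)" for n
      by (rule measurable_restrict) measurable
    \<comment> \<open>Monotonicity of \<open>B\<close> makes these admissible variances, and with
      \<open>B 0 = 0\<close> they telescope to \<open>(B n)\<^sup>2\<close>.\<close>
    define \<beta> where "\<beta> j = (B j)\<^sup>2 - (B (j - 1))\<^sup>2" for j
    have B_ge: "B j \<ge> 0" for j using monoD[OF mono, of 0 j] B0 by simp
    have \<beta>: "\<beta> j \<ge> 0" for j
      unfolding \<beta>_def using power_mono[OF monoD[OF mono, of "j - 1" j] B_ge, of 2] by simp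
    have \<beta>_sum: "(\<Sum>j=1..n. \<beta> j) = (B n)\<^sup>2" for n by (induction n) (simp_all add: \<beta>_def B0)
    have S0: "S 0 \<omega> = 0" for \<omega> by (simp add: S centered_sum_def)
    have S_sum: "(\<Sum>j=1..n. S j \<omega> - S (j - 1) \<omega>) = S n \<omega>" for \<omega> n by (induction n) (simp_all add: S0)
    have "\<exists>\<gamma> \<in> couplings
      (distr P (\<Pi>\<^sub>M j\<in>{1..n}. borel) (\<lambda>\<omega>. \<lambda>j\<in>{1..n}. S j \<omega> - S (j - 1) \<omega>))
      (distr Q (\<Pi>\<^sub>M j\<in>{1..n}. borel) (\<lambda>\<omega>. \<lambda>j\<in>{1..n}. Z j \<omega>)).
        Lp_norm p \<gamma> (\<lambda>(s, z). (\<Sum>j=1..n. s j) - (\<Sum>j=1..n. z j)) \<le> ennreal (k powr (1 / p))" for n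
    proof -
      let ?B = "\<Pi>\<^sub>M j\<in>{1..n}. (borel :: real measure)"
      define U where "U = (\<lambda>\<omega>. \<lambda>j\<in>{1..n}. S j \<omega> - S (j - 1) \<omega>)"
      define \<mu> where "\<mu> = distr P ?B U"
      define \<nu> where "\<nu> = distr Q ?B (\<lambda>\<omega>. \<lambda>j\<in>{1..n}. Z j \<omega>)"
      have U[measurable]: "U \<in> P \<rightarrow>\<^sub>M ?B" unfolding U_def by (rule SV)
      have sets[measurable_cong]: "sets \<mu> = sets ?B" "sets \<nu> = sets ?B" by (simp_all add: \<mu>_def \<nu>_def)
      have \<mu>: "prob_space \<mu>" unfolding \<mu>_def by (rule prob_space_distr[OF U])
      have \<nu>: "prob_space \<nu>" unfolding \<nu>_def by (rule Q.prob_space_distr[OF ZV])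
      let ?h = "\<lambda>(s, z). (\<Sum>j=1..n. s j) - (\<Sum>j=1..n. z j) :: real"
      have h: "?h \<in> borel_measurable (\<mu> \<Otimes>\<^sub>M \<nu>)" unfolding case_prod_unfold by measurable
      have "\<exists>\<gamma>\<in>couplings \<mu> \<nu>. Lp_norm p \<gamma> ?h \<le> ennreal (k powr (1 / p))"
      proof (cases "n = 0")
        \<comment> \<open>\<open>Y n\<close> is available for \<open>n \<ge> 1\<close> only. For
          \<open>n = 0\<close> both sums are empty and the product coupling has error 0.\<close>
        case True
        interpret m: prob_space \<mu> by (rule \<mu>)
        interpret n: prob_space \<nu> by (rule \<nu>)
        interpret mn: pair_prob_space \<mu> \<nu> ..
        have "distr (\<mu> \<Otimes>\<^sub>M \<nu>) \<nu> snd = \<nu>"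
        proof (rule measure_eqI)
          fix E assume "E \<in> sets (distr (\<mu> \<Otimes>\<^sub>M \<nu>) \<nu> snd)"
          then have E: "E \<in> sets \<nu>" by simp
          then have "snd -` E \<inter> space (\<mu> \<Otimes>\<^sub>M \<nu>) = space \<mu> \<times> E"
            using sets.sets_into_space by (auto simp: space_pair_measure)
          then show "emeasure (distr (\<mu> \<Otimes>\<^sub>M \<nu>) \<nu> snd) E = emeasure \<nu> E"
            using E by (simp add: emeasure_distr n.emeasure_pair_measure_Times m.emeasure_space_1)
        qed simp
        note snd = this
        have "distr (\<mu> \<Otimes>\<^sub>M \<nu>) (\<mu> \<Otimes>\<^sub>M \<nu>) (\<lambda>x. (fst x, snd x)) \<in> couplings \<mu> \<nu>"
          by (rule distr_pair_in_couplings) (auto simp: n.distr_pair_fst snd intro: mn.prob_space_axioms)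
        moreover have "Lp_norm p (distr (\<mu> \<Otimes>\<^sub>M \<nu>) (\<mu> \<Otimes>\<^sub>M \<nu>) (\<lambda>x. (fst x, snd x))) ?h \<le> ennreal (k powr (1 / p))"
          by (rule Lp_norm_distr_le[OF h]) (use p True in \<open>auto simp: case_prod_unfold\<close>)
        ultimately show ?thesis by (rule bexI[rotated])
      next
        case False
        then have n: "n \<ge> 1" by simp
        note Y[OF n, measurable]
        obtain \<Phi> where \<Phi>[measurable]: "\<Phi> \<in> borel \<Otimes>\<^sub>M ?B \<rightarrow>\<^sub>M ?B"
          and \<Phi>_sum: "\<And>y x. (\<Sum>j=1..n. \<Phi> (y, x) j) = sqrt (\<Sum>j=1..n. \<beta> j) * y"
          and \<Phi>_law: "\<And>h. h \<in> borel_measurable ?B \<Longrightarrow>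
            (\<integral>\<^sup>+y. \<integral>\<^sup>+x. h (\<Phi> (y, x)) \<partial>(\<Pi>\<^sub>M j\<in>{1..n}. ?N) \<partial>?N) = (\<integral>\<^sup>+z. h z \<partial>(\<Pi>\<^sub>M j\<in>{1..n}. centered_normal (\<beta> j)))"
          by (rule normal_vector_with_given_sum[OF \<beta>, of n]) (rule that, assumption+)
        let ?G = "\<Pi>\<^sub>M j\<in>{1..n}. ?N"
        have G: "prob_space ?G" by (intro prob_space_PiM) (rule std_normal.prob_space_axioms)
        interpret G: prob_space ?G by (rule G)
        interpret W: pair_prob_space ?PN ?G ..
        have \<nu>_eq: "\<nu> = (\<Pi>\<^sub>M j\<in>{1..n}. centered_normal (\<beta> j))"
        proof -
          have "Q.indep_vars (\<lambda>_. borel) Z {1..n}" by (rule Q.indep_vars_subset[OF Z]) auto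
          then have "\<nu> = (\<Pi>\<^sub>M j\<in>{1..n}. distr Q borel (Z j))"
            unfolding \<nu>_def using n by (subst (asm) Q.indep_vars_iff_distr_eq_PiM') (auto intro: Z_meas)
          also have "\<dots> = (\<Pi>\<^sub>M j\<in>{1..n}. centered_normal (\<beta> j))"
            by (rule PiM_cong) (use Z_law in \<open>auto simp: \<beta>_def\<close>)
          finally show ?thesis .
        qed
        \<comment> \<open>The coupling of \<open>S n\<close> with \<open>Y n\<close> lives over
          \<open>P\<close>, so all increments of \<open>S\<close> come along. \<open>T\<close>
          splits \<open>B n * Y n\<close> into the required normal vector by means of auxiliary
          normals independent of everything else; its coordinates sum to \<open>B n * Y n\<close>,
          so the error of the sums is that of the single coupling.\<close>
        define T where "T = (\<lambda>x. \<Phi> (Y n (fst x), snd x))"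
        have T[measurable]: "T \<in> ?PN \<Otimes>\<^sub>M ?G \<rightarrow>\<^sub>M ?B" unfolding T_def by measurable
        have T_law: "distr (?PN \<Otimes>\<^sub>M ?G) ?B T = \<nu>"
        proof (rule measure_eqI)
          fix E assume "E \<in> sets (distr (?PN \<Otimes>\<^sub>M ?G) ?B T)"
          then have E[measurable]: "E \<in> sets ?B" by simp
          have "emeasure (distr (?PN \<Otimes>\<^sub>M ?G) ?B T) E = (\<integral>\<^sup>+z. indicator E z \<partial>distr (?PN \<Otimes>\<^sub>M ?G) ?B T)"
            by (rule nn_integral_indicator[symmetric]) simp
          also have "\<dots> = (\<integral>\<^sup>+x. indicator E (T x) \<partial>(?PN \<Otimes>\<^sub>M ?G))"
            by (rule nn_integral_distr) measurable
          also have "\<dots> = (\<integral>\<^sup>+x. \<integral>\<^sup>+g. indicator E (\<Phi> (Y n x, g)) \<partial>?G \<partial>?PN)"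
          proof -
            have "(\<integral>\<^sup>+x. \<integral>\<^sup>+g. indicator E (T (x, g)) \<partial>?G \<partial>?PN) = (\<integral>\<^sup>+x. indicator E (T x) \<partial>(?PN \<Otimes>\<^sub>M ?G))"
              by (rule G.nn_integral_fst) measurable
            then show ?thesis by (simp add: T_def)
          qed
          also have "\<dots> = (\<integral>\<^sup>+y. \<integral>\<^sup>+g. indicator E (\<Phi> (y, g)) \<partial>?G \<partial>distr ?PN borel (Y n))"
            by (rule nn_integral_distr[symmetric]) measurable
          also have "\<dots> = (\<integral>\<^sup>+z. indicator E z \<partial>\<nu>)"
            unfolding Y_law[OF n] \<nu>_eq by (rule \<Phi>_law) measurable
          also have "\<dots> = emeasure \<nu> E" by (rule nn_integral_indicator) simp
          finally show "emeasure (distr (?PN \<Otimes>\<^sub>M ?G) ?B T) E = emeasure \<nu> E" .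
        qed (simp add: sets)
        have U_law: "distr (?PN \<Otimes>\<^sub>M ?G) ?B (\<lambda>x. U (fst (fst x))) = \<mu>"
        proof -
          have "distr (?PN \<Otimes>\<^sub>M ?G) ?B (\<lambda>x. U (fst (fst x))) = distr (distr (?PN \<Otimes>\<^sub>M ?G) ?PN fst) ?B (\<lambda>x. U (fst x))"
            by (subst distr_distr) (measurable, simp add: comp_def)
          also have "\<dots> = \<mu>" unfolding G.distr_pair_fst \<mu>_def by (rule PN_fst[OF U])
          finally show ?thesis .
        qed
        let ?\<gamma> = "distr (?PN \<Otimes>\<^sub>M ?G) (\<mu> \<Otimes>\<^sub>M \<nu>) (\<lambda>x. (U (fst (fst x)), T x))"
        have "?\<gamma> \<in> couplings \<mu> \<nu>"
        proof (rule distr_pair_in_couplings)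
          show "prob_space (?PN \<Otimes>\<^sub>M ?G)" by unfold_locales
          show "distr (?PN \<Otimes>\<^sub>M ?G) \<mu> (\<lambda>x. U (fst (fst x))) = \<mu>" using U_law by (simp add: sets cong: distr_cong)
          show "distr (?PN \<Otimes>\<^sub>M ?G) \<nu> T = \<nu>" using T_law by (simp add: sets cong: distr_cong)
        qed measurable
        moreover have "Lp_norm p ?\<gamma> ?h \<le> ennreal (k powr (1 / p))"
        proof (rule Lp_norm_distr_le[OF h])
          have e: "?h (U (fst (fst x)), T x) = S n (fst (fst x)) - 0 - B n * Y n (fst x)" for x
          proof -
            have "(\<Sum>j=1..n. U (fst (fst x)) j) = S n (fst (fst x))" using S_sum[of "fst (fst x)"] by (simp add: U_def)
            then show ?thesis using B_ge[of n] by (simp add: T_def \<Phi>_sum \<beta>_sum)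
          qed
          have "(\<integral>\<^sup>+x. ennreal (\<bar>?h (U (fst (fst x)), T x)\<bar> powr p) \<partial>(?PN \<Otimes>\<^sub>M ?G))
            = (\<integral>\<^sup>+x. \<integral>\<^sup>+g. ennreal (\<bar>S n (fst x) - 0 - B n * Y n x\<bar> powr p) \<partial>?G \<partial>?PN)"
            unfolding e by (subst G.nn_integral_fst[symmetric]) auto
          also have "\<dots> \<le> ennreal k" using kn[OF n] by (simp add: G.emeasure_space_1)
          finally show "(\<integral>\<^sup>+x. ennreal (\<bar>?h (U (fst (fst x)), T x)\<bar> powr p) \<partial>(?PN \<Otimes>\<^sub>M ?G)) \<le> ennreal k" .
          show "0 < p" using p by simp
        qed measurable
        ultimately show ?thesis by (rule bexI[rotated])
      qed
      then show ?thesis unfolding \<mu>_def \<nu>_def U_def .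
    qed
    then show ?thesis unfolding p_def by blast
  qed
  ultimately show ?thesis by blast
qed

end
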